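(* Fix $r>0$ and let $f\in \mathbf{L}^2(\Omega)$, $g\in L^2(\Omega)$, $u_\Gamma\in\mathbf{H}^{1/2}(\Gamma)$, $r_\Gamma\in H^{-1/2}(\Gamma)$. Put $D:=\|g\|_{0,\Omega}+\|r_\Gamma\|_{-1/2,\Gamma}+\|u_\Gamma\|_{1/2,\Gamma}+\|f\|_{0,\Omega}$ and assume $$\kappa_2\,\tilde\gamma_1^*\,\tilde\gamma_1\,D\le\tfrac12,\qquad \frac{\tilde\gamma_1}{r}\max\{\tilde\gamma_1\kappa_2r,1\}\,D<1,\qquad \frac{\tilde\gamma_1^*}{r}\max\{\tilde\gamma_1^*\kappa_2r,1\}\,D<1 .$$ Let $((\underline{d},\sigma),\underline{u})\in(\widetilde{\mathbf{X}}\times\widetilde{\mathbf{Y}})\times\widetilde{\mathbf{Z}}$ and $((\underline{d}_h,\sigma_h),\underline{u}_h)\in(\widetilde{\mathbf{X}}_h\times\widetilde{\mathbf{Y}}_h)\times\widetilde{\mathbf{Z}}_h$ be the unique solutions of ($\widetilde{\mathrm P}$) with $\underline{d}\in\widetilde{\mathbf{W}}$ and of ($\widetilde{\mathrm P}_h$) with $\underline{d}_h\in\widetilde{\mathbf{W}}_h$, respectively. Then there exists $\widetilde C_{\text{Céa}}>0$ such that $$\|((\underline{d},\sigma),\underline{u})-((\underline{d}_h,\sigma_h),\underline{u}_h)\|\le \widetilde C_{\text{Céa}}\inf_{((\underline{e}_h,\tau_h),\underline{v}_h)\in(\widetilde{\mathbf{X}}_h\times\widetilde{\mathbf{Y}}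_h)\times\widetilde{\mathbf{Z}}_h}\|((\underline{d},\sigma),\underline{u})-((\underline{e}_h,\tau_h),\underline{v}_h)\|.$$
   Context: Setting. $\Omega\subset\mathbb{R}^n$, $n\in\{2,3\}$, is an open bounded domain with Lipschitz boundary $\Gamma$ and unit outward normal $\boldsymbol{n}$, such that $\overline\Omega$ admits a regular partition $\mathcal{T}_h$ into triangles ($n=2$) or tetrahedra ($n=3$) $K$ of diameter $h_K$, $h:=\max_K h_K$. Bold spaces $\mathbf{L}^2,\mathbf{H}^m$ are vector-valued, blackboard ones tensor-valued ($n\times n$); $\|\cdot\|_{m,\Omega}$ is the $H^m(\Omega)$ norm ($H^0=L^2$). $\mathbb{I}$ is the identity tensor; $\mathbf{div}$ of a tensor is the row-wise divergence; $\langle\cdot,\cdot\rangle_\Gamma$ is the duality between $H^{-1/2}(\Gamma)$ and $H^{1/2}(\Gamma)$ (also vector-valued). Parameters: constants $\lambda,\mu>0$, $0\le\alpha\le1$, $c_0>0$; $\mathcal{C}d:=\lambda(\operatorname{tr}d)\mathbb{I}+2\mu d$. Spaces: $\widetilde{\mathbf{X}}:=\mathbb{L}^2(\Omega)\times H^1(\Omega)$, $\widetilde{\mathbf{Y}}:=\mathbb{H}(\mathbf{div};\Omega)=\{\tau\in\mathbb{L}^2(\Omega):\mathbf{div}\,\tau\in\mathbf{L}^2(\Omega)\}$, $\widetilde{\mathbf{Z}}:=\mathbf{L}^2(\Omega)\times\mathbb{L}^2_{\rm skew}(\Omega)$, with $\mathbb{L}^2_{\rm skew}(\Omega)$ the skew-symmetric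 tensors in $\mathbb{L}^2(\Omega)$. Elements are written $\underline{d}=(d,p)$, $\underline{e}=(e,q)$, $\underline{w}=(w,s)\in\widetilde{\mathbf{X}}$ and $\underline{u}=(u,\gamma)$, $\underline{v}=(v,\eta)\in\widetilde{\mathbf{Z}}$. Norms: $\|\underline{e}\|_{\widetilde{\mathbf{X}}}^2=\|e\|_{0,\Omega}^2+\|q\|_{1,\Omega}^2$, $\|\tau\|_{\widetilde{\mathbf{Y}}}^2=\|\tau\|_{0,\Omega}^2+\|\mathbf{div}\,\tau\|_{0,\Omega}^2$, $\|\underline{v}\|_{\widetilde{\mathbf{Z}}}^2=\|v\|_{0,\Omega}^2+\|\eta\|_{0,\Omega}^2$; product spaces carry the Euclidean combination of norms, so $\|((\underline{e},\tau),\underline{v})\|^2=\|\underline{e}\|_{\widetilde{\mathbf{X}}}^2+\|\tau\|_{\widetilde{\mathbf{Y}}}^2+\|\underline{v}\|_{\widetilde{\mathbf{Z}}}^2$. Permeability: $\kappa$ assigns to each $(d,p)$ an $n\times n$ tensor $\kappa(d,p)\in\mathbb{L}^\infty(\Omega)$, and there are constants $\kappa_1,\kappa_2>0$ with $\kappa_1|v|^2\le v^{t}\kappa(\cdot,\cdot)v$ for all $v\in\mathbb{R}^n\setminus\{0\}$ (for all arguments, a.e. in $\Omega$) and $\|\kappa(\cdot,p_1)-\kappa(\cdot,p_2)\|_{\mathbb{L}^\infty(\Omega)}\le\kappa_2\|p_1-p_2\|_{1,\Omega}$ for all $p_1,p_2\in H^1(\Omega)$, where each dot stands for an arbitrary (possibly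 different) first argument. Forms: $$\tilde a(\underline{d},\underline{e}):=\int_\Omega\mathcal{C}d:e+\int_\Omega\kappa(\underline{d})\nabla p\cdot\nabla q+c_0\int_\Omega pq+\alpha\int_\Omega q\operatorname{tr}d-\alpha\int_\Omega p\operatorname{tr}e,$$ $\tilde b_1(\underline{e},\tau):=-\int_\Omega\tau:e$, $\tilde b_2((\underline{e},\tau),\underline{v}):=-\int_\Omega v\cdot\mathbf{div}\,\tau-\int_\Omega\tau:\eta$. Functionals: $\widetilde G(\underline{e}):=\int_\Omega gq+\langle r_\Gamma,q\rangle_\Gamma$, $\widetilde H(\tau):=-\langle\tau\boldsymbol{n},u_\Gamma\rangle_\Gamma$, $\widetilde F(\underline{v}):=\int_\Omega f\cdot v$. Problem ($\widetilde{\mathrm P}$): find $((\underline{d},\sigma),\underline{u})\in(\widetilde{\mathbf{X}}\times\widetilde{\mathbf{Y}})\times\widetilde{\mathbf{Z}}$ such that for all $((\underline{e},\tau),\underline{v})\in(\widetilde{\mathbf{X}}\times\widetilde{\mathbf{Y}})\times\widetilde{\mathbf{Z}}$: $\tilde a(\underline{d},\underline{e})+\tilde b_1(\underline{e},\sigma)=\widetilde G(\underline{e})$, $\;\tilde b_1(\underline{d},\tau)+\tilde b_2((\underline{e},\tau),\underline{u})=\widetilde H(\tau)$, $\;\tilde b_2((\underline{d},\sigma),\underline{v})=\widetilde F(\underline{v})$. Discrete spaces (PEERS-based), for an integer $k\ge0$ ($\mathrm{P}_\ell(K)$, $\mathbf{P}_\ell(K)$, $\mathbb{P}_\ell(K)$: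 scalar, vector, tensor polynomials of degree $\le\ell$ on $K$). $\mathbf{RT}_k(K):=\mathbf{P}_k(K)\oplus\mathrm{P}_k(K)\boldsymbol{x}$, and $\mathbb{RT}_k(K)$ are the tensors with rows in $\mathbf{RT}_k(K)$. $b_K$ is the (suitably normalised) polynomial bubble on $K$ vanishing on $\partial K$ (product of the barycentric coordinates); $\mathbf{B}_k(K):=\mathbf{curl}^{t}(b_K\mathrm{P}_k(K))$ if $n=2$, and $\nabla\times(b_K\mathbf{P}_k(K))$ if $n=3$; $[\mathbf{B}_k(K)]^n$ are the tensors with rows in $\mathbf{B}_k(K)$. $\widetilde{\mathbf{X}}_{1,h}:=\{e_h\in\mathbb{L}^2(\Omega):e_h|_K\in\mathbb{P}_k(K)\oplus[\mathbf{B}_k(K)]^n\ \forall K\in\mathcal{T}_h\}$; $\mathbf{X}_{2,h}:=\{q_h\in C(\overline\Omega):q_h|_K\in\mathrm{P}_{k+1}(K)\ \forall K\}$; $\widetilde{\mathbf{X}}_h:=\widetilde{\mathbf{X}}_{1,h}\times\mathbf{X}_{2,h}$; $\widetilde{\mathbf{Y}}_h:=\{\tau_h\in\mathbb{H}(\mathbf{div};\Omega):\tau_h|_K\in\mathbb{RT}_k(K)\oplus[\mathbf{B}_k(K)]^n\ \forall K\}$; $\widetilde{\mathbf{Z}}_{1,h}:=\{v_h\in\mathbf{L}^2(\Omega):v_h|_K\in\mathbf{P}_k(K)\ \forall K\}$; $\widetilde{\mathbf{Z}}_{2,h}:=\{\eta_h\in\mathbb{L}^2_{\rm skew}(\Omega):\eta_h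 \text{ continuous on }\overline\Omega,\ \eta_h|_K\in\mathbb{P}_{k+1}(K)\ \forall K\}$; $\widetilde{\mathbf{Z}}_h:=\widetilde{\mathbf{Z}}_{1,h}\times\widetilde{\mathbf{Z}}_{2,h}$. Problem ($\widetilde{\mathrm P}_h$): the same equations as ($\widetilde{\mathrm P}$), with solution and test functions in $(\widetilde{\mathbf{X}}_h\times\widetilde{\mathbf{Y}}_h)\times\widetilde{\mathbf{Z}}_h$. $\widetilde{\mathbf{W}}:=\{\underline{w}\in\widetilde{\mathbf{X}}:\|\underline{w}\|_{\widetilde{\mathbf{X}}}\le r\}$, $\widetilde{\mathbf{W}}_h:=\{\underline{w}_h\in\widetilde{\mathbf{X}}_h:\|\underline{w}_h\|_{\widetilde{\mathbf{X}}}\le r\}$. Constants: $\tilde\beta_2>0$ and $\tilde\beta_2^*>0$ are constants such that $\sup_{0\ne(\underline{e},\tau)\in\widetilde{\mathbf{X}}\times\widetilde{\mathbf{Y}}}\frac{\tilde b_2((\underline{e},\tau),\underline{v})}{\|(\underline{e},\tau)\|_{\widetilde{\mathbf{X}}\times\widetilde{\mathbf{Y}}}}\ge\tilde\beta_2\|\underline{v}\|_{\widetilde{\mathbf{Z}}}$ for all $\underline{v}\in\widetilde{\mathbf{Z}}$ and $\sup_{0\ne(\underline{e}_h,\tau_h)\in\widetilde{\mathbf{X}}_h\times\widetilde{\mathbf{Y}}_h}\frac{\tilde b_2((\underline{e}_h,\tau_h),\underline{v}_h)}{\|(\underline{e}_h,\tau_h)\|_{\widetilde{\mathbf{X}}\times\widetilde{\mathbf{Y}}}}\ge\tilde\beta_2^*\|\underline{v}_h\|_{\widetilde{\mathbf{Z}}}$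 for all $\underline{v}_h\in\widetilde{\mathbf{Z}}_h$; $C_a:=\max\{2\mu+n\lambda,c_0,n\alpha,\kappa_2r\}$, $c_a:=\min\{\kappa_1,2\mu,c_0\}$, $$\gamma_2:=\frac{(C_a+2)(c_a+1+C_a)}{c_a},\quad\tilde\gamma_1:=\frac{(C_a+1+\tilde\beta_2+\gamma_2)^2}{\tilde\beta_2^2\gamma_2},\quad\tilde\gamma_1^*:=\frac{(C_a+1+\tilde\beta_2^*+\gamma_2)^2}{(\tilde\beta_2^* )^2\gamma_2}.$$ *)

theory Defs
  imports "HOL-Analysis.Analysis" "HOL-Probability.Essential_Supremum"
begin

text \<open>Functions on \<open>\<Omega>\<close> are total functions on \<open>real^'n\<close> whose values outside \<open>\<Omega>\<close> (or its closure)
  are ignored. Elements of \<open>L\<^sup>2\<close>, \<open>H\<^sup>1\<close>, ... are represented by functions rather than by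
  almost-everywhere classes, so the norms below are seminorms on representatives, and equality in
  these spaces is equality almost everywhere, i.e. vanishing of the norm of the difference.
  Tensors are \<open>real^'n^'n\<close>: \<open>\<bullet>\<close> is then the Frobenius product, \<open>norm\<close> the Frobenius norm, and
  \<open>\<tau> x $ i\<close> the \<open>i\<close>-th row.\<close>


section \<open>Domains, Lebesgue and Sobolev spaces\<close>

text \<open>Near each boundary point the domain is, in a rotated orthonormal frame whose last axis
  is \<open>\<nu>\<close>, the region strictly below the graph of a Lipschitz function on the hyperplane
  orthogonal to \<open>\<nu>\<close>.\<close>

definition lipschitz_boundary :: "(real^'n) set \<Rightarrow> bool" where
  "lipschitz_boundary \<Omega> \<longleftrightarrow>
    (\<forall>x\<in>frontier \<Omega>. \<exists>U \<nu> \<phi> L. open U \<and> x \<in> U \<and> norm \<nu> = 1 \<and> L-lipschitz_on {z. z \<bullet> \<nu> = 0} \<phi> \<and>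
       \<Omega> \<inter> U = {y \<in> U. y \<bullet> \<nu> < \<phi> (y - (y \<bullet> \<nu>) *\<^sub>R \<nu>)})"

definition lipschitz_domain :: "(real^'n) set \<Rightarrow> bool" where
  "lipschitz_domain \<Omega> \<longleftrightarrow>
    open \<Omega> \<and> bounded \<Omega> \<and> connected \<Omega> \<and> \<Omega> \<noteq> {} \<and> lipschitz_boundary \<Omega>"

definition L2 :: "(real^'n) set \<Rightarrow> (real^'n \<Rightarrow> 'b::euclidean_space) set" where
  "L2 \<Omega> = {f. f \<in> borel_measurable (lebesgue_on \<Omega>) \<and>
              integrable (lebesgue_on \<Omega>) (\<lambda>x. (norm (f x))\<^sup>2)}"

definition L2_norm :: "(real^'n) set \<Rightarrow> (real^'n \<Rightarrow> 'b::euclidean_space) \<Rightarrow> real" where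
  "L2_norm \<Omega> f = sqrt (LINT x|lebesgue_on \<Omega>. (norm (f x))\<^sup>2)"

definition L2_skew :: "(real^'n) set \<Rightarrow> (real^'n \<Rightarrow> real^'n^'n) set" where
  "L2_skew \<Omega> = {\<eta> \<in> L2 \<Omega>. AE x in lebesgue_on \<Omega>. transpose (\<eta> x) = - \<eta> x}"

definition Linf_norm :: "(real^'n) set \<Rightarrow> (real^'n \<Rightarrow> 'b::euclidean_space) \<Rightarrow> ereal" where
  "Linf_norm \<Omega> K = esssup (lebesgue_on \<Omega>) (\<lambda>x. ereal (norm (K x)))"

definition Linf :: "(real^'n) set \<Rightarrow> (real^'n \<Rightarrow> 'b::euclidean_space) set" where
  "Linf \<Omega> = {K. K \<in> borel_measurable (lebesgue_on \<Omega>) \<and> Linf_norm \<Omega> K < \<infinity>}"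

definition partial_deriv :: "'n \<Rightarrow> (real^'n \<Rightarrow> real) \<Rightarrow> real^'n \<Rightarrow> real" where
  "partial_deriv i f x = frechet_derivative f (at x) (axis i 1)"

primrec C_k :: "nat \<Rightarrow> (real^'n \<Rightarrow> real) \<Rightarrow> bool" where
  "C_k 0 f \<longleftrightarrow> continuous_on UNIV f"
| "C_k (Suc m) f \<longleftrightarrow> (\<forall>x. f differentiable (at x)) \<and> (\<forall>i. C_k m (partial_deriv i f))"

definition test_functions :: "(real^'n) set \<Rightarrow> (real^'n \<Rightarrow> real) set" where
  "test_functions \<Omega> = {\<phi>. (\<forall>m. C_k m \<phi>) \<and> compact (closure {x. \<phi> x \<noteq> 0}) \<and>
                           closure {x. \<phi> x \<noteq> 0} \<subseteq> \<Omega>}"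

definition has_weak_grad ::
    "(real^'n) set \<Rightarrow> (real^'n \<Rightarrow> real) \<Rightarrow> (real^'n \<Rightarrow> real^'n) \<Rightarrow> bool" where
  "has_weak_grad \<Omega> p G \<longleftrightarrow> G \<in> L2 \<Omega> \<and>
    (\<forall>\<phi>\<in>test_functions \<Omega>. \<forall>i.
       (LINT x|lebesgue_on \<Omega>. p x * partial_deriv i \<phi> x) = - (LINT x|lebesgue_on \<Omega>. G x $ i * \<phi> x))"

definition weak_grad :: "(real^'n) set \<Rightarrow> (real^'n \<Rightarrow> real) \<Rightarrow> real^'n \<Rightarrow> real^'n" where
  "weak_grad \<Omega> p = (SOME G. has_weak_grad \<Omega> p G)"

definition H1 :: "(real^'n) set \<Rightarrow> (real^'n \<Rightarrow> real) set" where
  "H1 \<Omega> = {p \<in> L2 \<Omega>. \<exists>G. has_weak_grad \<Omega> p G}"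

definition H1_norm :: "(real^'n) set \<Rightarrow> (real^'n \<Rightarrow> real) \<Rightarrow> real" where
  "H1_norm \<Omega> p = sqrt ((L2_norm \<Omega> p)\<^sup>2 + (L2_norm \<Omega> (weak_grad \<Omega> p))\<^sup>2)"

definition has_weak_div ::
    "(real^'n) set \<Rightarrow> (real^'n \<Rightarrow> real^'n) \<Rightarrow> (real^'n \<Rightarrow> real) \<Rightarrow> bool" where
  "has_weak_div \<Omega> t g \<longleftrightarrow> g \<in> L2 \<Omega> \<and>
    (\<forall>\<phi>\<in>test_functions \<Omega>.
       (LINT x|lebesgue_on \<Omega>. t x \<bullet> (\<chi> i. partial_deriv i \<phi> x)) = - (LINT x|lebesgue_on \<Omega>. g x * \<phi> x))"

definition weak_div :: "(real^'n) set \<Rightarrow> (real^'n \<Rightarrow> real^'n) \<Rightarrow> real^'n \<Rightarrow> real" where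
  "weak_div \<Omega> t = (SOME g. has_weak_div \<Omega> t g)"

definition tensor_div :: "(real^'n) set \<Rightarrow> (real^'n \<Rightarrow> real^'n^'n) \<Rightarrow> real^'n \<Rightarrow> real^'n" where
  "tensor_div \<Omega> \<tau> x = (\<chi> i. weak_div \<Omega> (\<lambda>y. \<tau> y $ i) x)"

definition Hdiv :: "(real^'n) set \<Rightarrow> (real^'n \<Rightarrow> real^'n^'n) set" where
  "Hdiv \<Omega> = {\<tau> \<in> L2 \<Omega>. \<forall>i. \<exists>g. has_weak_div \<Omega> (\<lambda>x. \<tau> x $ i) g}"


section \<open>Trace spaces on the boundary\<close>

text \<open>\<open>H\<^sup>1\<^sup>/\<^sup>2(\<Gamma>)\<close> is the space of boundary values of \<open>H\<^sup>1(\<Omega>)\<close>, where two functions have the same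
  boundary values iff their difference lies in \<open>H\<^sup>1\<^sub>0(\<Omega>)\<close>, the kernel of the trace operator. A
  boundary value is represented by the set of its extensions to \<open>\<Omega>\<close>, and
  \<open>\<parallel>\<psi>\<parallel>\<^bsub>1/2,\<Gamma>\<^esub>\<close> is the infimum of the \<open>H\<^sup>1(\<Omega>)\<close> norms of these extensions.
  \<open>H\<^sup>-\<^sup>1\<^sup>/\<^sup>2(\<Gamma>)\<close> is its dual with the dual norm.\<close>

definition H10 :: "(real^'n) set \<Rightarrow> (real^'n \<Rightarrow> real) set" where
  "H10 \<Omega> = {w \<in> H1 \<Omega>. \<forall>\<epsilon>>0. \<exists>\<phi>\<in>test_functions \<Omega>. H1_norm \<Omega> (w - \<phi>) < \<epsilon>}"

definition bdry_trace :: "(real^'n) set \<Rightarrow> (real^'n \<Rightarrow> real) \<Rightarrow> (real^'n \<Rightarrow> real) set" where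
  "bdry_trace \<Omega> w = {w' \<in> H1 \<Omega>. w' - w \<in> H10 \<Omega>}"

definition Hhalf :: "(real^'n) set \<Rightarrow> (real^'n \<Rightarrow> real) set set" where
  "Hhalf \<Omega> = bdry_trace \<Omega> ` H1 \<Omega>"

definition Hhalf_norm :: "(real^'n) set \<Rightarrow> (real^'n \<Rightarrow> real) set \<Rightarrow> real" where
  "Hhalf_norm \<Omega> \<psi> = (INF w\<in>\<psi>. H1_norm \<Omega> w)"

definition Hhalf_vec :: "(real^'n) set \<Rightarrow> ((real^'n \<Rightarrow> real) set ^ 'n) set" where
  "Hhalf_vec \<Omega> = {u. \<forall>i. u $ i \<in> Hhalf \<Omega>}"

definition Hhalf_vec_norm :: "(real^'n) set \<Rightarrow> (real^'n \<Rightarrow> real) set ^ 'n \<Rightarrow> real" where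
  "Hhalf_vec_norm \<Omega> u = sqrt (\<Sum>i\<in>UNIV. (Hhalf_norm \<Omega> (u $ i))\<^sup>2)"

definition Hmhalf :: "(real^'n) set \<Rightarrow> ((real^'n \<Rightarrow> real) set \<Rightarrow> real) set" where
  "Hmhalf \<Omega> = {R.
     (\<forall>v\<in>H1 \<Omega>. \<forall>w\<in>H1 \<Omega>. R (bdry_trace \<Omega> (\<lambda>x. v x + w x)) = R (bdry_trace \<Omega> v) + R (bdry_trace \<Omega> w)) \<and>
     (\<forall>c. \<forall>w\<in>H1 \<Omega>. R (bdry_trace \<Omega> (\<lambda>x. c * w x)) = c * R (bdry_trace \<Omega> w)) \<and>
     (\<exists>C. \<forall>\<psi>\<in>Hhalf \<Omega>. \<bar>R \<psi>\<bar> \<le> C * Hhalf_norm \<Omega> \<psi>)}"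

definition Hmhalf_norm :: "(real^'n) set \<Rightarrow> ((real^'n \<Rightarrow> real) set \<Rightarrow> real) \<Rightarrow> real" where
  "Hmhalf_norm \<Omega> R = (SUP \<psi>\<in>{\<psi> \<in> Hhalf \<Omega>. Hhalf_norm \<Omega> \<psi> \<le> 1}. \<bar>R \<psi>\<bar>)"

text \<open>For \<open>t\<close> in \<open>H(div;\<Omega>)\<close> the normal trace \<open>t \<bullet> n\<close> has no pointwise values on \<open>\<Gamma>\<close>; it is the
  functional on \<open>H\<^sup>1\<^sup>/\<^sup>2(\<Gamma>)\<close> given by Green's formula,
  \<open>\<langle>t \<bullet> n, w|\<^sub>\<Gamma>\<rangle> = \<integral>\<^sub>\<Omega> t \<bullet> \<nabla>w + \<integral>\<^sub>\<Omega> w div t\<close>. By the density of test functions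
  in \<open>H\<^sup>1\<^sub>0(\<Omega>)\<close> the right-hand side does not depend on the extension \<open>w\<close> chosen.\<close>

definition normal_trace ::
    "(real^'n) set \<Rightarrow> (real^'n \<Rightarrow> real^'n) \<Rightarrow> (real^'n \<Rightarrow> real) set \<Rightarrow> real" where
  "normal_trace \<Omega> t \<psi> = (let w = (SOME w. w \<in> \<psi>) in
     (LINT x|lebesgue_on \<Omega>. t x \<bullet> weak_grad \<Omega> w x) + (LINT x|lebesgue_on \<Omega>. w x * weak_div \<Omega> t x))"

definition tensor_normal_pairing ::
    "(real^'n) set \<Rightarrow> (real^'n \<Rightarrow> real^'n^'n) \<Rightarrow> (real^'n \<Rightarrow> real) set ^ 'n \<Rightarrow> real" where
  "tensor_normal_pairing \<Omega> \<tau> u = (\<Sum>i\<in>UNIV. normal_trace \<Omega> (\<lambda>x. \<tau> x $ i) (u $ i))"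


section \<open>The continuous problem\<close>

type_synonym 'n xsp = "(real^'n \<Rightarrow> real^'n^'n) \<times> (real^'n \<Rightarrow> real)"
type_synonym 'n ysp = "real^'n \<Rightarrow> real^'n^'n"
type_synonym 'n zsp = "(real^'n \<Rightarrow> real^'n) \<times> (real^'n \<Rightarrow> real^'n^'n)"

definition X_space :: "(real^'n) set \<Rightarrow> 'n xsp set" where
  "X_space \<Omega> = L2 \<Omega> \<times> H1 \<Omega>"

definition Y_space :: "(real^'n) set \<Rightarrow> 'n ysp set" where
  "Y_space \<Omega> = Hdiv \<Omega>"

definition Z_space :: "(real^'n) set \<Rightarrow> 'n zsp set" where
  "Z_space \<Omega> = L2 \<Omega> \<times> L2_skew \<Omega>"

definition X_norm :: "(real^'n) set \<Rightarrow> 'n xsp \<Rightarrow> real" where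
  "X_norm \<Omega> = (\<lambda>(e, q). sqrt ((L2_norm \<Omega> e)\<^sup>2 + (H1_norm \<Omega> q)\<^sup>2))"

definition Y_norm :: "(real^'n) set \<Rightarrow> 'n ysp \<Rightarrow> real" where
  "Y_norm \<Omega> \<tau> = sqrt ((L2_norm \<Omega> \<tau>)\<^sup>2 + (L2_norm \<Omega> (tensor_div \<Omega> \<tau>))\<^sup>2)"

definition Z_norm :: "(real^'n) set \<Rightarrow> 'n zsp \<Rightarrow> real" where
  "Z_norm \<Omega> = (\<lambda>(v, \<eta>). sqrt ((L2_norm \<Omega> v)\<^sup>2 + (L2_norm \<Omega> \<eta>)\<^sup>2))"

definition XY_norm :: "(real^'n) set \<Rightarrow> 'n xsp \<times> 'n ysp \<Rightarrow> real" where
  "XY_norm \<Omega> = (\<lambda>(e, \<tau>). sqrt ((X_norm \<Omega> e)\<^sup>2 + (Y_norm \<Omega> \<tau>)\<^sup>2))"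

definition XYZ_norm :: "(real^'n) set \<Rightarrow> ('n xsp \<times> 'n ysp) \<times> 'n zsp \<Rightarrow> real" where
  "XYZ_norm \<Omega> = (\<lambda>((e, \<tau>), v). sqrt ((X_norm \<Omega> e)\<^sup>2 + (Y_norm \<Omega> \<tau>)\<^sup>2 + (Z_norm \<Omega> v)\<^sup>2))"

text \<open>The Lipschitz estimate is required with independent first arguments.\<close>

definition permeability ::
    "(real^'n) set \<Rightarrow> real \<Rightarrow> real \<Rightarrow> ('n xsp \<Rightarrow> real^'n \<Rightarrow> real^'n^'n) \<Rightarrow> bool" where
  "permeability \<Omega> \<kappa>1 \<kappa>2 \<kappa> \<longleftrightarrow> \<kappa>1 > 0 \<and> \<kappa>2 > 0 \<and>
    (\<forall>d\<in>X_space \<Omega>. \<kappa> d \<in> Linf \<Omega>) \<and>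
    (\<forall>d\<in>X_space \<Omega>. AE x in lebesgue_on \<Omega>. \<forall>v. v \<noteq> 0 \<longrightarrow> \<kappa>1 * (norm v)\<^sup>2 \<le> v \<bullet> (\<kappa> d x *v v)) \<and>
    (\<forall>d1\<in>L2 \<Omega>. \<forall>d2\<in>L2 \<Omega>. \<forall>p1\<in>H1 \<Omega>. \<forall>p2\<in>H1 \<Omega>.
       Linf_norm \<Omega> (\<kappa> (d1, p1) - \<kappa> (d2, p2)) \<le> ereal (\<kappa>2 * H1_norm \<Omega> (p1 - p2)))"

definition elasticity :: "real \<Rightarrow> real \<Rightarrow> real^'n^'n \<Rightarrow> real^'n^'n" where
  "elasticity lam \<mu> d = (lam * trace d) *\<^sub>R mat 1 + (2 * \<mu>) *\<^sub>R d"

definition form_a ::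
    "(real^'n) set \<Rightarrow> real \<Rightarrow> real \<Rightarrow> real \<Rightarrow> real \<Rightarrow> ('n xsp \<Rightarrow> real^'n \<Rightarrow> real^'n^'n) \<Rightarrow>
     'n xsp \<Rightarrow> 'n xsp \<Rightarrow> real" where
  "form_a \<Omega> lam \<mu> \<alpha> c0 \<kappa> = (\<lambda>(d, p) (e, q).
      (LINT x|lebesgue_on \<Omega>. elasticity lam \<mu> (d x) \<bullet> e x)
    + (LINT x|lebesgue_on \<Omega>. (\<kappa> (d, p) x *v weak_grad \<Omega> p x) \<bullet> weak_grad \<Omega> q x)
    + c0 * (LINT x|lebesgue_on \<Omega>. p x * q x)
    + \<alpha> * (LINT x|lebesgue_on \<Omega>. q x * trace (d x))
    - \<alpha> * (LINT x|lebesgue_on \<Omega>. p x * trace (e x)))"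

definition form_b1 :: "(real^'n) set \<Rightarrow> 'n xsp \<Rightarrow> 'n ysp \<Rightarrow> real" where
  "form_b1 \<Omega> = (\<lambda>(e, q) \<tau>. - (LINT x|lebesgue_on \<Omega>. \<tau> x \<bullet> e x))"

definition form_b2 :: "(real^'n) set \<Rightarrow> 'n xsp \<times> 'n ysp \<Rightarrow> 'n zsp \<Rightarrow> real" where
  "form_b2 \<Omega> = (\<lambda>(e, \<tau>) (v, \<eta>).
     - (LINT x|lebesgue_on \<Omega>. v x \<bullet> tensor_div \<Omega> \<tau> x) - (LINT x|lebesgue_on \<Omega>. \<tau> x \<bullet> \<eta> x))"

definition functional_G ::
    "(real^'n) set \<Rightarrow> (real^'n \<Rightarrow> real) \<Rightarrow> ((real^'n \<Rightarrow> real) set \<Rightarrow> real) \<Rightarrow> 'n xsp \<Rightarrow> real" where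
  "functional_G \<Omega> g r\<Gamma> = (\<lambda>(e, q). (LINT x|lebesgue_on \<Omega>. g x * q x) + r\<Gamma> (bdry_trace \<Omega> q))"

definition functional_H ::
    "(real^'n) set \<Rightarrow> (real^'n \<Rightarrow> real) set ^ 'n \<Rightarrow> 'n ysp \<Rightarrow> real" where
  "functional_H \<Omega> u\<Gamma> \<tau> = - tensor_normal_pairing \<Omega> \<tau> u\<Gamma>"

definition functional_F :: "(real^'n) set \<Rightarrow> (real^'n \<Rightarrow> real^'n) \<Rightarrow> 'n zsp \<Rightarrow> real" where
  "functional_F \<Omega> f = (\<lambda>(v, \<eta>). (LINT x|lebesgue_on \<Omega>. f x \<bullet> v x))"

text \<open>Solution and test functions both range over \<open>(XS \<times> YS) \<times> ZS\<close>; the continuous and the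
  discrete problem differ only in these spaces.\<close>

definition solves_problem ::
    "(real^'n) set \<Rightarrow> real \<Rightarrow> real \<Rightarrow> real \<Rightarrow> real \<Rightarrow> ('n xsp \<Rightarrow> real^'n \<Rightarrow> real^'n^'n) \<Rightarrow>
     (real^'n \<Rightarrow> real^'n) \<Rightarrow> (real^'n \<Rightarrow> real) \<Rightarrow> (real^'n \<Rightarrow> real) set ^ 'n \<Rightarrow>
     ((real^'n \<Rightarrow> real) set \<Rightarrow> real) \<Rightarrow>
     'n xsp set \<Rightarrow> 'n ysp set \<Rightarrow> 'n zsp set \<Rightarrow> ('n xsp \<times> 'n ysp) \<times> 'n zsp \<Rightarrow> bool" where
  "solves_problem \<Omega> lam \<mu> \<alpha> c0 \<kappa> f g u\<Gamma> r\<Gamma> XS YS ZS = (\<lambda>((d, \<sigma>), u).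
     d \<in> XS \<and> \<sigma> \<in> YS \<and> u \<in> ZS \<and>
     (\<forall>e\<in>XS. \<forall>\<tau>\<in>YS. \<forall>v\<in>ZS.
        form_a \<Omega> lam \<mu> \<alpha> c0 \<kappa> d e + form_b1 \<Omega> e \<sigma> = functional_G \<Omega> g r\<Gamma> e \<and>
        form_b1 \<Omega> d \<tau> + form_b2 \<Omega> (e, \<tau>) u = functional_H \<Omega> u\<Gamma> \<tau> \<and>
        form_b2 \<Omega> (d, \<sigma>) v = functional_F \<Omega> f v))"

text \<open>The quotients are bounded by 1, so the supremum over the reals is the mathematical one;
  "nonzero" means nonzero as an almost-everywhere class.\<close>

definition inf_sup_b2 ::
    "(real^'n) set \<Rightarrow> 'n xsp set \<Rightarrow> 'n ysp set \<Rightarrow> 'n zsp set \<Rightarrow> real \<Rightarrow> bool" where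
  "inf_sup_b2 \<Omega> XS YS ZS \<beta> \<longleftrightarrow>
    (\<forall>v\<in>ZS. (SUP x\<in>{x \<in> XS \<times> YS. XY_norm \<Omega> x \<noteq> 0}. form_b2 \<Omega> x v / XY_norm \<Omega> x) \<ge> \<beta> * Z_norm \<Omega> v)"


section \<open>The PEERS-based discrete problem\<close>

definition inball_diameter :: "(real^'n) set \<Rightarrow> real" where
  "inball_diameter K = Sup {2 * \<rho> |\<rho> c. 0 \<le> \<rho> \<and> cball c \<rho> \<subseteq> K}"

text \<open>Conforming and, with constant \<open>\<theta>\<close>, shape-regular.\<close>

definition regular_partition :: "(real^'n) set \<Rightarrow> real \<Rightarrow> (real^'n) set set \<Rightarrow> bool" where
  "regular_partition \<Omega> \<theta> T \<longleftrightarrow>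
    triangulation T \<and> (\<forall>K\<in>T. int CARD('n) simplex K) \<and> \<Union>T = closure \<Omega> \<and>
    (\<forall>K\<in>T. diameter K \<le> \<theta> * inball_diameter K)"

definition poly_deg :: "nat \<Rightarrow> (real^'n \<Rightarrow> real) set" where
  "poly_deg k = {p. \<exists>c :: ('n \<Rightarrow> nat) \<Rightarrow> real.
     \<forall>x. p x = (\<Sum>a | (\<Sum>i\<in>UNIV. a i) \<le> k. c a * (\<Prod>i\<in>UNIV. (x $ i) ^ a i))}"

definition poly_deg_vec :: "nat \<Rightarrow> (real^'n \<Rightarrow> real^'n) set" where
  "poly_deg_vec k = {v. \<forall>i. (\<lambda>x. v x $ i) \<in> poly_deg k}"

definition poly_deg_tensor :: "nat \<Rightarrow> (real^'n \<Rightarrow> real^'n^'n) set" where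
  "poly_deg_tensor k = {\<tau>. \<forall>i. (\<lambda>x. \<tau> x $ i) \<in> poly_deg_vec k}"

text \<open>Barycentric coordinates of an arbitrary point of \<open>\<real>\<^sup>n\<close> with respect to the \<open>n + 1\<close> vertices
  of a nondegenerate simplex.\<close>

definition barycentric :: "(real^'n) set \<Rightarrow> real^'n \<Rightarrow> real^'n \<Rightarrow> real" where
  "barycentric V x = (THE c. (\<forall>v. v \<notin> V \<longrightarrow> c v = 0) \<and> (\<Sum>v\<in>V. c v) = 1 \<and> (\<Sum>v\<in>V. c v *\<^sub>R v) = x)"

definition bubble :: "(real^'n) set \<Rightarrow> real^'n \<Rightarrow> real" where
  "bubble K x = (let V = {v. v extreme_point_of K} in \<Prod>v\<in>V. barycentric V x v)"

text \<open>The index type carries no order, so the coordinates are numbered by a fixed but arbitrary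
  enumeration \<open>coord 1, ..., coord n\<close>. Another enumeration changes the curls below at most by
  a sign, hence does not change \<open>bubble_curls\<close>.\<close>

definition coord :: "nat \<Rightarrow> 'n::finite" where
  "coord = (SOME h. bij_betw h {1..CARD('n)} (UNIV :: 'n set))"

definition curl2 :: "(real^'n \<Rightarrow> real) \<Rightarrow> real^'n \<Rightarrow> real^'n" where
  "curl2 \<phi> x = (\<chi> i. if i = coord 1 then partial_deriv (coord 2) \<phi> x
                     else - partial_deriv (coord 1) \<phi> x)"

definition curl3 :: "(real^'n \<Rightarrow> real^'n) \<Rightarrow> real^'n \<Rightarrow> real^'n" where
  "curl3 \<psi> x = (let D = (\<lambda>a b. partial_deriv (coord a) (\<lambda>y. \<psi> y $ coord b) x) in
     \<chi> i. if i = coord 1 then D 2 3 - D 3 2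
          else if i = coord 2 then D 3 1 - D 1 3
          else D 1 2 - D 2 1)"

definition bubble_curls :: "nat \<Rightarrow> (real^'n) set \<Rightarrow> (real^'n \<Rightarrow> real^'n) set" where
  "bubble_curls k K =
    (if CARD('n) = 2 then {curl2 (\<lambda>x. bubble K x * \<phi> x) |\<phi>. \<phi> \<in> poly_deg k}
     else {curl3 (\<lambda>x. bubble K x *\<^sub>R \<psi> x) |\<psi>. \<psi> \<in> poly_deg_vec k})"

definition bubble_curls_tensor :: "nat \<Rightarrow> (real^'n) set \<Rightarrow> (real^'n \<Rightarrow> real^'n^'n) set" where
  "bubble_curls_tensor k K = {\<beta>. \<forall>i. (\<lambda>x. \<beta> x $ i) \<in> bubble_curls k K}"

definition RT :: "nat \<Rightarrow> (real^'n \<Rightarrow> real^'n) set" where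
  "RT k = {\<lambda>x. a x + b x *\<^sub>R x |a b. a \<in> poly_deg_vec k \<and> b \<in> poly_deg k}"

definition RT_tensor :: "nat \<Rightarrow> (real^'n \<Rightarrow> real^'n^'n) set" where
  "RT_tensor k = {\<tau>. \<forall>i. (\<lambda>x. \<tau> x $ i) \<in> RT k}"

definition X1h :: "(real^'n) set \<Rightarrow> (real^'n) set set \<Rightarrow> nat \<Rightarrow> (real^'n \<Rightarrow> real^'n^'n) set" where
  "X1h \<Omega> T k = {e \<in> L2 \<Omega>. \<forall>K\<in>T. \<exists>a\<in>poly_deg_tensor k. \<exists>b\<in>bubble_curls_tensor k K.
                    AE x in lebesgue_on K. e x = a x + b x}"

definition X2h :: "(real^'n) set \<Rightarrow> (real^'n) set set \<Rightarrow> nat \<Rightarrow> (real^'n \<Rightarrow> real) set" where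
  "X2h \<Omega> T k = {q. continuous_on (closure \<Omega>) q \<and>
                    (\<forall>K\<in>T. \<exists>a\<in>poly_deg (k + 1). \<forall>x\<in>K. q x = a x)}"

definition Xh :: "(real^'n) set \<Rightarrow> (real^'n) set set \<Rightarrow> nat \<Rightarrow> 'n xsp set" where
  "Xh \<Omega> T k = X1h \<Omega> T k \<times> X2h \<Omega> T k"

definition Yh :: "(real^'n) set \<Rightarrow> (real^'n) set set \<Rightarrow> nat \<Rightarrow> 'n ysp set" where
  "Yh \<Omega> T k = {\<tau> \<in> Hdiv \<Omega>. \<forall>K\<in>T. \<exists>a\<in>RT_tensor k. \<exists>b\<in>bubble_curls_tensor k K.
                    AE x in lebesgue_on K. \<tau> x = a x + b x}"

definition Z1h :: "(real^'n) set \<Rightarrow> (real^'n) set set \<Rightarrow> nat \<Rightarrow> (real^'n \<Rightarrow> real^'n) set" where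
  "Z1h \<Omega> T k = {v \<in> L2 \<Omega>. \<forall>K\<in>T. \<exists>a\<in>poly_deg_vec k. AE x in lebesgue_on K. v x = a x}"

definition Z2h :: "(real^'n) set \<Rightarrow> (real^'n) set set \<Rightarrow> nat \<Rightarrow> (real^'n \<Rightarrow> real^'n^'n) set" where
  "Z2h \<Omega> T k = {\<eta> \<in> L2_skew \<Omega>. continuous_on (closure \<Omega>) \<eta> \<and>
                    (\<forall>K\<in>T. \<exists>a\<in>poly_deg_tensor (k + 1). \<forall>x\<in>K. \<eta> x = a x)}"

definition Zh :: "(real^'n) set \<Rightarrow> (real^'n) set set \<Rightarrow> nat \<Rightarrow> 'n zsp set" where
  "Zh \<Omega> T k = Z1h \<Omega> T k \<times> Z2h \<Omega> T k"


section \<open>Constants and data\<close>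

definition const_Ca :: "nat \<Rightarrow> real \<Rightarrow> real \<Rightarrow> real \<Rightarrow> real \<Rightarrow> real \<Rightarrow> real \<Rightarrow> real" where
  "const_Ca n lam \<mu> \<alpha> c0 \<kappa>2 r = Max {2 * \<mu> + real n * lam, c0, real n * \<alpha>, \<kappa>2 * r}"

definition const_ca :: "real \<Rightarrow> real \<Rightarrow> real \<Rightarrow> real" where
  "const_ca \<mu> c0 \<kappa>1 = Min {\<kappa>1, 2 * \<mu>, c0}"

definition const_gamma2 :: "real \<Rightarrow> real \<Rightarrow> real" where
  "const_gamma2 Ca ca = (Ca + 2) * (ca + 1 + Ca) / ca"

definition const_gamma1 :: "real \<Rightarrow> real \<Rightarrow> real \<Rightarrow> real" where
  "const_gamma1 Ca ca \<beta> =
    (Ca + 1 + \<beta> + const_gamma2 Ca ca)\<^sup>2 / (\<beta>\<^sup>2 * const_gamma2 Ca ca)"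

definition data_size ::
    "(real^'n) set \<Rightarrow> (real^'n \<Rightarrow> real^'n) \<Rightarrow> (real^'n \<Rightarrow> real) \<Rightarrow> (real^'n \<Rightarrow> real) set ^ 'n \<Rightarrow>
     ((real^'n \<Rightarrow> real) set \<Rightarrow> real) \<Rightarrow> real" where
  "data_size \<Omega> f g u\<Gamma> r\<Gamma> =
    L2_norm \<Omega> g + Hmhalf_norm \<Omega> r\<Gamma> + Hhalf_vec_norm \<Omega> u\<Gamma> + L2_norm \<Omega> f"

end

theory Submission
  imports Defs "HOL-Library.Function_Algebras"
begin

text \<open>The estimate is an energy argument in which the permeability is the only nonlinear term.

  First, the exact solution is small. Tested with itself, the problem gives
  \<open>a(d, d) = G(d) - H(\<sigma>) + F(u)\<close>. The left-hand side is coercive with the constant \<open>ca\<close>, whatever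
  the argument of the permeability. On the right, the stress is bounded by the strain and the pressure
  through the constitutive law, its divergence by the load, and the displacement by the inf-sup
  condition. This yields \<open>\<parallel>d\<parallel> \<le> \<gamma>1 * D\<close> (\<open>a_priori_bound\<close>). Since \<open>ca * \<gamma>1h \<ge> 2\<close>, the smallness
  of the data then becomes \<open>\<kappa>2 * \<parallel>d\<parallel> \<le> ca / 4\<close>.

  Secondly, the difference between the discrete solution and an arbitrary discrete competitor
  \<open>((e, \<tau>), v)\<close> satisfies linear discrete equations whose data are the approximation error and the
  term \<open>(\<kappa>(d) - \<kappa>(d\<^sub>h)) \<nabla>p\<close> (\<open>galerkin_error\<close>). This term is at most \<open>ca / 4\<close> times the pressure
  error, so coercivity absorbs it. The difference of the displacements is bounded by the discrete
  inf-sup condition. The difference of the stresses is split (\<open>discrete_split\<close>) into a part bounded by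
  the approximation error and a part in the discrete kernel of \<open>b\<^sub>2\<close>. The choice of the spaces decides
  what happens to the second part: the divergence of a discrete stress is a discrete displacement, so
  a kernel stress is divergence-free; a divergence-free Raviart-Thomas field of order \<open>k\<close> is
  polynomial of degree \<open>k\<close>, so the kernel stress, including its bubble curls, is an admissible strain
  (\<open>discrete_kernel\<close>), and the constitutive equation tested with it bounds its norm. The constants depend on the domain, the
  parameters, the permeability and the discrete inf-sup constant, but not on the mesh.

  Two facts connect the discrete with the continuous problem. Galerkin orthogonality requires the
  discrete spaces to be contained in the continuous ones, that is, continuous piecewise polynomials
  must have weak derivatives (\<open>X2h_H1\<close>); this is proved by an integration by parts for Lipschitz
  functions. And the weak divergence of a discrete stress must be computed element by element
  (\<open>Yh_divergence\<close>), which rests on the fundamental lemma of the calculus of variations.\<close>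

section \<open>Finite-dimensional semi-inner product spaces\<close>

text \<open>Pointwise scalar multiplication makes the function spaces of the problem real vector spaces, so that
  subspaces, spans and independence are available for them.\<close>

instantiation "fun" :: (type, scaleR) scaleR
begin
definition scaleR_fun_def: "c *\<^sub>R f = (\<lambda>x. c *\<^sub>R f x)"
instance ..
end

lemma scaleR_fun_apply [simp]: "(c *\<^sub>R f) x = c *\<^sub>R f x"
  by (simp add: scaleR_fun_def)

instance "fun" :: (type, real_vector) real_vector
  by standard (auto simp: fun_eq_iff scaleR_add_right scaleR_add_left)

lemma sum_fun_apply: "(\<Sum>i\<in>A. F i) x = (\<Sum>i\<in>A. F i x)"
  by (induction A rule: infinite_finite_induct) auto

text \<open>Only semidefinite, because fields are functions and not classes up to null sets.\<close>

locale semi_inner =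
  fixes V :: "'a::real_vector set" and ip :: "'a \<Rightarrow> 'a \<Rightarrow> real"
  assumes sub: "subspace V"
    and ip_sym: "\<lbrakk>x \<in> V; y \<in> V\<rbrakk> \<Longrightarrow> ip x y = ip y x"
    and ip_add: "\<lbrakk>x \<in> V; y \<in> V; z \<in> V\<rbrakk> \<Longrightarrow> ip (x + y) z = ip x z + ip y z"
    and ip_scale: "\<lbrakk>x \<in> V; z \<in> V\<rbrakk> \<Longrightarrow> ip (c *\<^sub>R x) z = c * ip x z"
    and ip_nonneg: "x \<in> V \<Longrightarrow> 0 \<le> ip x x"
begin

definition nrm :: "'a \<Rightarrow> real" where "nrm x = sqrt (ip x x)"

lemma zero_in [simp]: "0 \<in> V" and add_in: "\<lbrakk>x \<in> V; y \<in> V\<rbrakk> \<Longrightarrow> x + y \<in> V"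
  and scale_in: "x \<in> V \<Longrightarrow> c *\<^sub>R x \<in> V" and diff_in: "\<lbrakk>x \<in> V; y \<in> V\<rbrakk> \<Longrightarrow> x - y \<in> V"
  using sub by (auto simp: subspace_0 subspace_add subspace_scale subspace_diff)

lemma sum_in: "(\<And>i. i \<in> A \<Longrightarrow> F i \<in> V) \<Longrightarrow> (\<Sum>i\<in>A. F i) \<in> V"
  using sub by (rule subspace_sum)

lemma ip_zero: "z \<in> V \<Longrightarrow> ip 0 z = 0"
  using ip_scale[of 0 z 0] by simp

lemma ip_sum: "\<lbrakk>finite A; \<And>i. i \<in> A \<Longrightarrow> F i \<in> V; z \<in> V\<rbrakk> \<Longrightarrow> ip (\<Sum>i\<in>A. c i *\<^sub>R F i) z = (\<Sum>i\<in>A. c i * ip (F i) z)"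
  by (induction A rule: finite_induct) (auto simp: ip_zero ip_add scale_in sum_in ip_scale)

lemma ip_diff: "\<lbrakk>x \<in> V; y \<in> V; z \<in> V\<rbrakk> \<Longrightarrow> ip (x - y) z = ip x z - ip y z"
  using ip_add[of x "(-1) *\<^sub>R y" z] ip_scale[of y z "-1"] scale_in[of y "-1"] by simp

lemma ip_diff_right: "\<lbrakk>x \<in> V; y \<in> V; z \<in> V\<rbrakk> \<Longrightarrow> ip z (x - y) = ip z x - ip z y"
  by (metis ip_diff ip_sym diff_in)

lemma nrm_sq: "x \<in> V \<Longrightarrow> (nrm x)\<^sup>2 = ip x x"
  by (simp add: nrm_def ip_nonneg)

lemma nrm_nonneg: "x \<in> V \<Longrightarrow> 0 \<le> nrm x"
  by (simp add: nrm_def ip_nonneg)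

lemma Cauchy_Schwarz: assumes "x \<in> V" "y \<in> V" shows "ip x y \<le> nrm x * nrm y"
proof -
  have q: "0 \<le> ip x x - 2 * t * ip x y + t\<^sup>2 * ip y y" for t
  proof -
    have "0 \<le> ip (x - t *\<^sub>R y) (x - t *\<^sub>R y)" by (intro ip_nonneg diff_in scale_in assms)
    also have "\<dots> = ip x x - 2 * t * ip x y + t\<^sup>2 * ip y y"
    proof -
      have "ip x (t *\<^sub>R y) = t * ip x y" "ip y (t *\<^sub>R y) = t * ip y y"
        using ip_sym[of x "t *\<^sub>R y"] ip_sym[of y "t *\<^sub>R y"] ip_sym[of y x] assms
        by (simp_all add: scale_in ip_scale)
      then show ?thesis
        using assms ip_sym[of y x] by (simp add: ip_diff ip_diff_right diff_in scale_in ip_scale algebra_simps power2_eq_square)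
    qed
    finally show ?thesis .
  qed
  show ?thesis
  proof (cases "ip y y = 0")
    case True
    have "ip x y = 0"
    proof (rule ccontr)
      assume n: "ip x y \<noteq> 0"
      then show False using q[of "(ip x x + 1) / (2 * ip x y)"] True by (simp add: divide_simps)
    qed
    then show ?thesis using True by (simp add: nrm_def)
  next
    case False
    then have p: "ip y y > 0" using ip_nonneg[OF assms(2)] by simp
    have "0 \<le> ip x x - (ip x y)\<^sup>2 / ip y y"
      using q[of "ip x y / ip y y"] p by (simp add: power2_eq_square divide_simps)
    then have "(ip x y)\<^sup>2 \<le> ip x x * ip y y" using p by (simp add: divide_simps)
    then have "(ip x y)\<^sup>2 \<le> (nrm x * nrm y)\<^sup>2" using assms by (simp add: power_mult_distrib nrm_sq)
    then have "\<bar>ip x y\<bar> \<le> \<bar>nrm x * nrm y\<bar>" by (simp only: abs_le_square_iff)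
    then show ?thesis using nrm_nonneg assms by (simp add: abs_mult)
  qed
qed

lemma Cauchy_Schwarz_abs: assumes "x \<in> V" "y \<in> V" shows "\<bar>ip x y\<bar> \<le> nrm x * nrm y"
proof -
  have n: "ip (- x) y = - ip x y" "nrm (- x) = nrm x" "- x \<in> V"
    using ip_scale[of x y "-1"] ip_scale[of x "- x" "-1"] ip_scale[of x x "-1"]
      scale_in[of x "-1"] ip_sym[of x "- x"] assms by (simp_all add: nrm_def)
  show ?thesis using Cauchy_Schwarz[OF assms] Cauchy_Schwarz[OF n(3) assms(2)] n by simp
qed

lemma nrm_triangle: assumes "x \<in> V" "y \<in> V" shows "nrm (x + y) \<le> nrm x + nrm y"
proof (rule power2_le_imp_le)
  have "(nrm (x + y))\<^sup>2 = ip x x + 2 * ip x y + ip y y"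
    using assms ip_sym[of x "x + y"] ip_sym[of y "x + y"] ip_sym[of y x]
    by (simp add: nrm_sq add_in ip_add)
  also have "\<dots> \<le> (nrm x)\<^sup>2 + 2 * (nrm x * nrm y) + (nrm y)\<^sup>2"
    using Cauchy_Schwarz[OF assms] assms by (simp add: nrm_sq)
  finally show "(nrm (x + y))\<^sup>2 \<le> (nrm x + nrm y)\<^sup>2" by (simp add: power2_eq_square algebra_simps)
qed (use assms in \<open>simp add: nrm_nonneg\<close>)

lemma nrm_scale: assumes "x \<in> V" shows "nrm (c *\<^sub>R x) = \<bar>c\<bar> * nrm x"
proof -
  have "ip (c *\<^sub>R x) (c *\<^sub>R x) = c\<^sup>2 * ip x x"
    using assms ip_sym[of x "c *\<^sub>R x"] by (simp add: ip_scale scale_in power2_eq_square)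
  then show ?thesis by (simp add: nrm_def real_sqrt_mult)
qed

lemma nrm_diff: "\<lbrakk>x \<in> V; y \<in> V\<rbrakk> \<Longrightarrow> nrm (x - y) \<le> nrm x + nrm y"
  using nrm_triangle[of x "(-1) *\<^sub>R y"] nrm_scale[of y "-1"] scale_in[of y "-1"] by simp

definition orthonormal :: "'a set \<Rightarrow> bool" where
  "orthonormal B \<longleftrightarrow> finite B \<and> B \<subseteq> V \<and> (\<forall>x\<in>B. \<forall>y\<in>B. ip x y = (if x = y then 1 else 0))"

text \<open>An orthonormal set of maximal size is complete up to null vectors: the remainder of any further
  vector could be normalised and added.\<close>

lemma orthonormal_basis_exists:
  assumes fin: "\<And>B. orthonormal B \<Longrightarrow> card B \<le> N" and U: "subspace U" "U \<subseteq> V"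
  obtains B where "orthonormal B" "B \<subseteq> U"
    "\<And>x. x \<in> U \<Longrightarrow> nrm (x - (\<Sum>b\<in>B. ip x b *\<^sub>R b)) = 0"
proof -
  define P where "P n \<longleftrightarrow> (\<exists>B. orthonormal B \<and> B \<subseteq> U \<and> card B = n)" for n
  have "P 0" unfolding P_def orthonormal_def by (intro exI[of _ "{}"]) auto
  moreover have "\<forall>n. P n \<longrightarrow> n \<le> N" unfolding P_def using fin by auto
  ultimately obtain m where m: "P m" "\<And>n. P n \<Longrightarrow> n \<le> m" using ex_has_greatest_nat[of P 0 "\<lambda>n. n" "Suc N"] by (auto simp: less_Suc_eq_le)
  then obtain B where B: "orthonormal B" "B \<subseteq> U" "card B = m" unfolding P_def by blast
  have finB: "finite B" and BV: "B \<subseteq> V" and on: "\<And>x y. x \<in> B \<Longrightarrow> y \<in> B \<Longrightarrow> ip x y = (if x = y then 1 else 0)"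
    using B(1) unfolding orthonormal_def by auto
  have "nrm (x - (\<Sum>b\<in>B. ip x b *\<^sub>R b)) = 0" if x: "x \<in> U" for x
  proof (rule ccontr)
    define z where "z = x - (\<Sum>b\<in>B. ip x b *\<^sub>R b)"
    assume "nrm (x - (\<Sum>b\<in>B. ip x b *\<^sub>R b)) \<noteq> 0"
    have xV: "x \<in> V" using x U by auto
    have sV: "(\<Sum>b\<in>B. ip x b *\<^sub>R b) \<in> V" using BV by (intro sum_in scale_in) auto
    have zU: "z \<in> U" unfolding z_def using B(2) x U(1)
      by (intro subspace_diff subspace_sum subspace_scale) auto
    then have zV: "z \<in> V" using U by auto
    have nz: "nrm z > 0" using \<open>nrm _ \<noteq> 0\<close> nrm_nonneg[OF zV] z_def by simp
    have orth: "ip z y = 0" if y: "y \<in> B" for y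
    proof -
      have yV: "y \<in> V" using y BV by auto
      have "ip (\<Sum>b\<in>B. ip x b *\<^sub>R b) y = (\<Sum>b\<in>B. ip x b * ip b y)"
        using BV yV finB by (intro ip_sum) auto
      also have "\<dots> = (\<Sum>b\<in>B. if b = y then ip x b else 0)"
        using y by (intro sum.cong) (auto simp: on)
      also have "\<dots> = ip x y" using finB y by simp
      finally show ?thesis unfolding z_def using xV sV yV by (simp add: ip_diff)
    qed
    define w where "w = (1 / nrm z) *\<^sub>R z"
    have wV: "w \<in> V" and wU: "w \<in> U" unfolding w_def using zV zU U by (auto simp: scale_in subspace_scale)
    have ww: "ip w w = 1"
    proof -
      have "ip w w = (1 / nrm z) * ip z w" unfolding w_def using zV by (intro ip_scale) (auto simp: scale_in)
      also have "ip z w = (1 / nrm z) * ip z z"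
        using ip_sym[OF zV wV] zV unfolding w_def by (simp add: ip_scale)
      finally show ?thesis using nz nrm_sq[OF zV] by (auto simp: power2_eq_square divide_simps)
    qed
    have wy: "ip w y = 0" if "y \<in> B" for y
      using orth[OF that] that BV zV unfolding w_def by (simp add: ip_scale subset_iff)
    have yw: "ip y w = 0" if "y \<in> B" for y
      using ip_sym[of y w] wy[OF that] that BV wV by auto
    have wB: "w \<notin> B" using ww wy by force
    have "orthonormal (insert w B)"
      unfolding orthonormal_def using finB BV wV ww wy yw on wB by auto
    moreover have "insert w B \<subseteq> U" using wU B(2) by auto
    ultimately have "P (card (insert w B))" unfolding P_def by blast
    then show False using m(2) wB finB B(3) by fastforce
  qed
  then show ?thesis using that B by blast
qed

text \<open>In finite dimensions an inf-sup condition for a bilinear form \<open>b\<close> lets the part of \<open>x\<close> on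
  which \<open>b\<close> acts be split off with a bound. The split-off part is the orthogonal projection of
  \<open>x\<close> onto the space of the Riesz representers \<open>T v\<close> of the functionals \<open>b \<cdot> v\<close>: what is
  orthogonal to every \<open>T v\<close> is annihilated by every \<open>b \<cdot> v\<close>, and the norm of \<open>T v\<close>, which is the
  supremum in the inf-sup condition, dominates \<open>\<beta>\<close> times the norm of \<open>v\<close>.\<close>

lemma inf_sup_kernel_split:
  fixes b :: "'a \<Rightarrow> 'z::real_vector \<Rightarrow> real" and nZ :: "'z \<Rightarrow> real"
  assumes fin: "\<And>B. orthonormal B \<Longrightarrow> card B \<le> N" and Z: "subspace Z"
    and b_add: "\<And>x y v. \<lbrakk>x \<in> V; y \<in> V; v \<in> Z\<rbrakk> \<Longrightarrow> b (x + y) v = b x v + b y v"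
    and b_scale: "\<And>c x v. \<lbrakk>x \<in> V; v \<in> Z\<rbrakk> \<Longrightarrow> b (c *\<^sub>R x) v = c * b x v"
    and b_add2: "\<And>x v w. \<lbrakk>x \<in> V; v \<in> Z; w \<in> Z\<rbrakk> \<Longrightarrow> b x (v + w) = b x v + b x w"
    and b_scale2: "\<And>c x v. \<lbrakk>x \<in> V; v \<in> Z\<rbrakk> \<Longrightarrow> b x (c *\<^sub>R v) = c * b x v"
    and b_bound: "\<And>x v. \<lbrakk>x \<in> V; v \<in> Z\<rbrakk> \<Longrightarrow> \<bar>b x v\<bar> \<le> nrm x * nZ v"
    and infsup: "\<And>v S. \<lbrakk>v \<in> Z; 0 \<le> S; \<And>x. x \<in> V \<Longrightarrow> b x v \<le> S * nrm x\<rbrakk> \<Longrightarrow> \<beta> * nZ v \<le> S"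
    and \<beta>: "\<beta> > 0" and R: "0 \<le> R" and x: "x \<in> V" "\<And>v. v \<in> Z \<Longrightarrow> b x v \<le> R * nZ v"
  obtains x0 where "x0 \<in> V" "\<And>v. v \<in> Z \<Longrightarrow> b (x - x0) v = 0" "nrm x0 \<le> R / \<beta>"
proof -
  obtain B where B: "orthonormal B" and Bexp: "\<And>y. y \<in> V \<Longrightarrow> nrm (y - (\<Sum>e\<in>B. ip y e *\<^sub>R e)) = 0"
    by (rule orthonormal_basis_exists[OF fin sub order_refl]) blast+
  have finB: "finite B" and BV: "\<And>e. e \<in> B \<Longrightarrow> e \<in> V" using B unfolding orthonormal_def by auto
  define T where "T v = (\<Sum>e\<in>B. b e v *\<^sub>R e)" for v
  have TV: "T v \<in> V" for v unfolding T_def by (intro sum_in scale_in BV)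
  have b_diff: "b (y - z) v = b y v - b z v" if "y \<in> V" "z \<in> V" "v \<in> Z" for y z v
    using b_add[of y "(-1) *\<^sub>R z" v] b_scale[of z v "-1"] scale_in[of z "-1"] that by simp
  have b_zero: "b 0 v = 0" if "v \<in> Z" for v
    using b_scale[of 0 v 0] that by simp
  have b_sum: "b (\<Sum>e\<in>A. c e *\<^sub>R e) v = (\<Sum>e\<in>A. c e * b e v)"
    if "finite A" "A \<subseteq> V" "v \<in> Z" for A v and c :: "'a \<Rightarrow> real"
    using that by (induction A rule: finite_induct) (auto simp: b_zero b_add scale_in sum_in b_scale subset_iff)
  have riesz: "ip (T v) y = b y v" if y: "y \<in> V" and v: "v \<in> Z" for y v
  proof -
    have sV: "(\<Sum>e\<in>B. ip y e *\<^sub>R e) \<in> V" by (intro sum_in scale_in BV)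
    have "b (y - (\<Sum>e\<in>B. ip y e *\<^sub>R e)) v = 0"
      using b_bound[of "y - (\<Sum>e\<in>B. ip y e *\<^sub>R e)" v] Bexp[OF y] v y sV by (simp add: diff_in)
    then have "b y v = (\<Sum>e\<in>B. ip y e * b e v)"
      using b_diff[OF y sV v] b_sum[of B v "ip y"] finB BV v by auto
    also have "\<dots> = ip (T v) y"
    proof -
      have "ip (T v) y = (\<Sum>e\<in>B. b e v * ip e y)"
        unfolding T_def using finB BV y by (intro ip_sum) auto
      also have "\<dots> = (\<Sum>e\<in>B. ip y e * b e v)"
        using BV y by (intro sum.cong) (auto simp: ip_sym[OF y])
      finally show ?thesis by simp
    qed
    finally show ?thesis by simp
  qed
  have T_add: "T (v + w) = T v + T w" if "v \<in> Z" "w \<in> Z" for v w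
    unfolding T_def using that BV by (simp add: b_add2 scaleR_add_left sum.distrib cong: sum.cong)
  have T_scale: "T (c *\<^sub>R v) = c *\<^sub>R T v" if "v \<in> Z" for c v
    unfolding T_def using that BV by (simp add: b_scale2 scaleR_sum_right cong: sum.cong)
  have U: "subspace (T ` Z)"
    unfolding subspace_def
  proof (intro conjI ballI allI)
    have "T 0 = 0" using T_scale[of 0 0] Z by (simp add: subspace_0)
    then show "0 \<in> T ` Z" using subspace_0[OF Z] by (intro image_eqI[of _ _ 0]) auto
    fix y c assume "y \<in> T ` Z"
    then obtain v where v: "v \<in> Z" "y = T v" by auto
    then show "c *\<^sub>R y \<in> T ` Z"
      using T_scale[of v c] subspace_scale[OF Z v(1)] by (intro image_eqI[of _ _ "c *\<^sub>R v"]) auto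
    fix z assume "z \<in> T ` Z"
    then obtain w where w: "w \<in> Z" "z = T w" by auto
    then show "y + z \<in> T ` Z"
      using T_add[OF v(1) w(1)] subspace_add[OF Z v(1) w(1)] v by (intro image_eqI[of _ _ "v + w"]) auto
  qed
  have UV: "T ` Z \<subseteq> V" using TV by auto
  obtain C where C: "orthonormal C" "C \<subseteq> T ` Z"
    and Cexp: "\<And>y. y \<in> T ` Z \<Longrightarrow> nrm (y - (\<Sum>e\<in>C. ip y e *\<^sub>R e)) = 0"
    by (rule orthonormal_basis_exists[OF fin U UV]) blast+
  have finC: "finite C" and CV: "\<And>e. e \<in> C \<Longrightarrow> e \<in> V" using C unfolding orthonormal_def by auto
  have exp: "ip y z = (\<Sum>e\<in>C. ip y e * ip e z)" if y: "y \<in> T ` Z" and z: "z \<in> V" for y z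
  proof -
    have yV: "y \<in> V" using y UV by auto
    have sV: "(\<Sum>e\<in>C. ip y e *\<^sub>R e) \<in> V" by (intro sum_in scale_in CV)
    have "ip (y - (\<Sum>e\<in>C. ip y e *\<^sub>R e)) z \<le> 0"
      using Cauchy_Schwarz[of "y - (\<Sum>e\<in>C. ip y e *\<^sub>R e)" z] Cexp[OF y] z yV sV by (simp add: diff_in)
    moreover have "ip (y - (\<Sum>e\<in>C. ip y e *\<^sub>R e)) ((-1) *\<^sub>R z) \<le> 0"
      using Cauchy_Schwarz[of "y - (\<Sum>e\<in>C. ip y e *\<^sub>R e)" "(-1) *\<^sub>R z"] Cexp[OF y] scale_in[OF z, of "-1"] yV sV by (simp add: diff_in)
    moreover have "ip (y - (\<Sum>e\<in>C. ip y e *\<^sub>R e)) ((-1) *\<^sub>R z) = - ip (y - (\<Sum>e\<in>C. ip y e *\<^sub>R e)) z"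
      using ip_sym[OF diff_in[OF yV sV] scale_in[OF z, of "-1"]] ip_scale[OF z diff_in[OF yV sV], of "-1"]
        ip_sym[OF diff_in[OF yV sV] z] by simp
    ultimately have "ip (y - (\<Sum>e\<in>C. ip y e *\<^sub>R e)) z = 0" by linarith
    then show ?thesis using ip_diff[OF yV sV z] ip_sum[of C "\<lambda>e. e" z "ip y"] finC CV z by simp
  qed
  define x0 where "x0 = (\<Sum>e\<in>C. ip x e *\<^sub>R e)"
  have x0U: "x0 \<in> T ` Z" unfolding x0_def using C(2) U by (intro subspace_sum subspace_scale) auto
  have x0V: "x0 \<in> V" using x0U UV by auto
  have ipx0: "ip y x0 = ip y x" if y: "y \<in> T ` Z" for y
  proof -
    have yV: "y \<in> V" using y UV by auto
    have "ip y x0 = ip x0 y" using ip_sym x0V yV by auto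
    also have "\<dots> = (\<Sum>e\<in>C. ip x e * ip e y)" unfolding x0_def using finC CV yV by (intro ip_sum) auto
    also have "\<dots> = (\<Sum>e\<in>C. ip y e * ip e x)" using CV yV x(1) by (intro sum.cong) (auto simp: ip_sym[OF yV] ip_sym[OF x(1)])
    also have "\<dots> = ip y x" using exp[OF y x(1)] by simp
    finally show ?thesis .
  qed
  show thesis
  proof (rule that)
    show "x0 \<in> V" by fact
    show "b (x - x0) v = 0" if v: "v \<in> Z" for v
    proof -
      have "b (x - x0) v = ip (T v) (x - x0)" using riesz[OF diff_in[OF x(1) x0V] v] by simp
      also have "\<dots> = ip (T v) x - ip (T v) x0" by (rule ip_diff_right[OF x(1) x0V TV])
      also have "\<dots> = 0" using ipx0 v by simp
      finally show ?thesis .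
    qed
    obtain v0 where v0: "v0 \<in> Z" "x0 = T v0" using x0U by auto
    have nn: "0 \<le> nrm x0" using nrm_nonneg x0V by auto
    have "\<beta> * nZ v0 \<le> nrm x0"
    proof (rule infsup[OF v0(1) nn])
      fix y assume y: "y \<in> V"
      show "b y v0 \<le> nrm x0 * nrm y"
        using riesz[OF y v0(1)] Cauchy_Schwarz[OF x0V y] v0(2) by simp
    qed
    then have n0: "nZ v0 \<le> nrm x0 / \<beta>" using \<beta> by (simp add: field_simps)
    have "(nrm x0)\<^sup>2 = ip x0 x" using nrm_sq[OF x0V] ipx0[OF x0U] by simp
    also have "\<dots> = b x v0" using riesz[OF x(1) v0(1)] v0(2) by simp
    also have "\<dots> \<le> R * nZ v0" using x(2) v0 by simp
    also have "\<dots> \<le> R * (nrm x0 / \<beta>)" using n0 R by (rule mult_left_mono)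
    finally have "nrm x0 * nrm x0 \<le> (R / \<beta>) * nrm x0" by (simp add: power2_eq_square)
    note sq = this
    show "nrm x0 \<le> R / \<beta>"
    proof (cases "nrm x0 = 0")
      case True
      then show ?thesis using R \<beta> by (simp only: divide_nonneg_pos)
    next
      case False
      then have "0 < nrm x0" using nn by linarith
      with sq show ?thesis by (rule mult_right_le_imp_le)
    qed
  qed
qed

text \<open>A bound for the size of orthonormal sets follows from a linear image of the space in a
  finitely spanned space, provided that the kernel of the linear map consists of null vectors.\<close>

lemma orthonormal_card_bound:
  fixes W :: "'w::real_vector set" and S :: "'a \<Rightarrow> 'w \<Rightarrow> bool"
  assumes finW: "finite W"
    and ex: "\<And>x. x \<in> V \<Longrightarrow> \<exists>w\<in>span W. S x w"
    and lin: "\<And>A X F c. \<lbrakk>finite A; A \<subseteq> V; \<And>x. x \<in> A \<Longrightarrow> S x (F x); (\<Sum>x\<in>A. c x *\<^sub>R F x) = 0\<rbrakk>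
        \<Longrightarrow> nrm (\<Sum>x\<in>A. c x *\<^sub>R x) = 0"
    and B: "orthonormal B"
  shows "card B \<le> card W"
proof -
  have finB: "finite B" and BV: "B \<subseteq> V" and on: "\<And>x y. x \<in> B \<Longrightarrow> y \<in> B \<Longrightarrow> ip x y = (if x = y then 1 else 0)"
    using B unfolding orthonormal_def by auto
  obtain F where F: "\<And>x. x \<in> B \<Longrightarrow> F x \<in> span W \<and> S x (F x)"
    using ex BV by (metis subsetD)
  have zero: "\<forall>x\<in>B. c x = 0" if s: "(\<Sum>x\<in>B. c x *\<^sub>R F x) = 0" for c
  proof
    fix y assume y: "y \<in> B"
    have sV: "(\<Sum>x\<in>B. c x *\<^sub>R x) \<in> V" using BV by (intro sum_in scale_in) auto
    have n: "nrm (\<Sum>x\<in>B. c x *\<^sub>R x) = 0"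
      by (rule lin[OF finB BV _ s]) (use F in auto)
    have yV: "y \<in> V" using y BV by auto
    have e: "ip (\<Sum>x\<in>B. c x *\<^sub>R x) y = c y"
    proof -
      have "ip (\<Sum>x\<in>B. c x *\<^sub>R x) y = (\<Sum>x\<in>B. c x * ip x y)"
        using finB BV yV by (intro ip_sum) auto
      also have "\<dots> = (\<Sum>x\<in>B. if x = y then c x else 0)" using y by (intro sum.cong) (auto simp: on)
      finally show ?thesis using finB y by simp
    qed
    have "c y \<le> 0" using Cauchy_Schwarz[OF sV yV] n e by simp
    moreover have "- c y \<le> 0"
      using Cauchy_Schwarz[OF sV scale_in[OF yV, of "-1"]] n
        ip_sym[OF sV scale_in[OF yV, of "-1"]] ip_scale[OF yV sV, of "-1"] ip_sym[OF yV sV] e by simp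
    ultimately show "c y = 0" by linarith
  qed
  have inj: "inj_on F B"
  proof (rule inj_onI, rule ccontr)
    fix x y assume xy: "x \<in> B" "y \<in> B" "F x = F y" "x \<noteq> y"
    define c where "c z = (if z = x then 1 else if z = y then - 1 else (0::real))" for z
    have "(\<Sum>z\<in>B. c z *\<^sub>R F z) = (\<Sum>z\<in>{x, y}. c z *\<^sub>R F z)"
      using finB xy by (intro sum.mono_neutral_right) (auto simp: c_def)
    also have "\<dots> = 0" using xy by (simp add: c_def)
    finally have "c x = 0" using zero xy by blast
    then show False by (simp add: c_def)
  qed
  have "independent (F ` B)"
  proof (rule independent_if_scalars_zero)
    show "finite (F ` B)" using finB by simp
    fix f w assume "(\<Sum>w\<in>F ` B. f w *\<^sub>R w) = 0" and w: "w \<in> F ` B"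
    then have "(\<Sum>x\<in>B. f (F x) *\<^sub>R F x) = 0" using sum.reindex[OF inj, of "\<lambda>w. f w *\<^sub>R w"] by simp
    then show "f w = 0" using zero[of "\<lambda>x. f (F x)"] w by auto
  qed
  moreover have "F ` B \<subseteq> span W" using F by auto
  ultimately have "card (F ` B) \<le> card W" using independent_span_bound[OF finW] by blast
  then show ?thesis using card_image[OF inj] by simp
qed

end

section \<open>Calculus in \<open>L\<^sup>2\<close>\<close>

lemma L2_measurable: "f \<in> L2 \<Omega> \<Longrightarrow> f \<in> borel_measurable (lebesgue_on \<Omega>)"
  and L2_integrable_sq: "f \<in> L2 \<Omega> \<Longrightarrow> integrable (lebesgue_on \<Omega>) (\<lambda>x. (norm (f x))\<^sup>2)"
  by (auto simp: L2_def)

lemma L2_zero: "(\<lambda>x. 0) \<in> L2 \<Omega>"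
  by (simp add: L2_def)

lemma L2_bounded_linear:
  assumes h: "bounded_linear h" and f: "f \<in> L2 \<Omega>"
  shows "(\<lambda>x. h (f x)) \<in> L2 \<Omega>"
proof -
  obtain K where K: "\<And>x. norm (h x) \<le> norm x * K" "K > 0" using bounded_linear.pos_bounded[OF h] by blast
  have m: "(\<lambda>x. h (f x)) \<in> borel_measurable (lebesgue_on \<Omega>)"
    using borel_measurable_continuous_onI[OF linear_continuous_on[OF h]] L2_measurable[OF f] by measurable
  have "integrable (lebesgue_on \<Omega>) (\<lambda>x. (norm (h (f x)))\<^sup>2)"
  proof (rule Bochner_Integration.integrable_bound)
    show "integrable (lebesgue_on \<Omega>) (\<lambda>x. K\<^sup>2 * (norm (f x))\<^sup>2)" using L2_integrable_sq[OF f] by simp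
    show "(\<lambda>x. (norm (h (f x)))\<^sup>2) \<in> borel_measurable (lebesgue_on \<Omega>)" using m by measurable
    show "AE x in lebesgue_on \<Omega>. norm ((norm (h (f x)))\<^sup>2) \<le> norm (K\<^sup>2 * (norm (f x))\<^sup>2)"
    proof (intro AE_I2)
      fix x
      have "(norm (h (f x)))\<^sup>2 \<le> (norm (f x) * K)\<^sup>2" by (rule power_mono[OF K(1)]) simp
      then show "norm ((norm (h (f x)))\<^sup>2) \<le> norm (K\<^sup>2 * (norm (f x))\<^sup>2)" by (simp add: power_mult_distrib mult.commute)
    qed
  qed
  then show ?thesis using m by (simp add: L2_def)
qed

lemma L2_add: assumes "f \<in> L2 \<Omega>" "g \<in> L2 \<Omega>" shows "(\<lambda>x. f x + g x) \<in> L2 \<Omega>"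
proof -
  have [measurable]: "f \<in> borel_measurable (lebesgue_on \<Omega>)" "g \<in> borel_measurable (lebesgue_on \<Omega>)"
    using assms by (auto simp: L2_measurable)
  have "integrable (lebesgue_on \<Omega>) (\<lambda>x. (norm (f x + g x))\<^sup>2)"
  proof (rule Bochner_Integration.integrable_bound)
    show "integrable (lebesgue_on \<Omega>) (\<lambda>x. 2 * (norm (f x))\<^sup>2 + 2 * (norm (g x))\<^sup>2)"
      using assms by (simp add: L2_integrable_sq)
    show "AE x in lebesgue_on \<Omega>. norm ((norm (f x + g x))\<^sup>2) \<le> norm (2 * (norm (f x))\<^sup>2 + 2 * (norm (g x))\<^sup>2)"
    proof (intro AE_I2)
      fix x
      have "(norm (f x + g x))\<^sup>2 \<le> (norm (f x) + norm (g x))\<^sup>2"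
        by (intro power_mono norm_triangle_ineq) simp
      also have "\<dots> \<le> 2 * (norm (f x))\<^sup>2 + 2 * (norm (g x))\<^sup>2"
        using zero_le_power2[of "norm (f x) - norm (g x)"] by (simp add: power2_eq_square algebra_simps)
      finally show "norm ((norm (f x + g x))\<^sup>2) \<le> norm (2 * (norm (f x))\<^sup>2 + 2 * (norm (g x))\<^sup>2)" by simp
    qed
  qed measurable
  then show ?thesis by (simp add: L2_def)
qed

lemma L2_scale: "f \<in> L2 \<Omega> \<Longrightarrow> (\<lambda>x. c *\<^sub>R f x) \<in> L2 \<Omega>"
  by (rule L2_bounded_linear[OF bounded_linear_scaleR_right])

lemma L2_mult: "f \<in> L2 \<Omega> \<Longrightarrow> (\<lambda>x. c * f x) \<in> L2 \<Omega>" for f :: "real^'n \<Rightarrow> real"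
  using L2_scale[of f \<Omega> c] by simp

lemma L2_minus: "f \<in> L2 \<Omega> \<Longrightarrow> (\<lambda>x. - f x) \<in> L2 \<Omega>"
  using L2_scale[of f \<Omega> "-1"] by simp

lemma L2_diff: "f \<in> L2 \<Omega> \<Longrightarrow> g \<in> L2 \<Omega> \<Longrightarrow> (\<lambda>x. f x - g x) \<in> L2 \<Omega>"
  using L2_add[OF _ L2_minus, of f \<Omega> g] by simp

lemma L2_subspace: "subspace (L2 \<Omega>)"
  using L2_zero L2_add L2_scale by (auto simp: subspace_def zero_fun_def plus_fun_def scaleR_fun_def)

lemma L2_inner_integrable:
  assumes "f \<in> L2 \<Omega>" "g \<in> L2 \<Omega>"
  shows "integrable (lebesgue_on \<Omega>) (\<lambda>x. f x \<bullet> g x)"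
proof -
  have [measurable]: "f \<in> borel_measurable (lebesgue_on \<Omega>)" "g \<in> borel_measurable (lebesgue_on \<Omega>)"
    using assms by (auto simp: L2_measurable)
  show ?thesis
  proof (rule Bochner_Integration.integrable_bound)
    show "integrable (lebesgue_on \<Omega>) (\<lambda>x. (norm (f x))\<^sup>2 + (norm (g x))\<^sup>2)"
      using assms by (simp add: L2_integrable_sq)
    show "AE x in lebesgue_on \<Omega>. norm (f x \<bullet> g x) \<le> norm ((norm (f x))\<^sup>2 + (norm (g x))\<^sup>2)"
    proof (intro AE_I2)
      fix x
      have "\<bar>f x \<bullet> g x\<bar> \<le> norm (f x) * norm (g x)" by (rule Cauchy_Schwarz_ineq2)
      also have "\<dots> \<le> (norm (f x))\<^sup>2 + (norm (g x))\<^sup>2"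
        using zero_le_power2[of "norm (f x) - norm (g x)"] zero_le_power2[of "norm (f x)"] zero_le_power2[of "norm (g x)"]
        unfolding power2_diff by linarith
      finally show "norm (f x \<bullet> g x) \<le> norm ((norm (f x))\<^sup>2 + (norm (g x))\<^sup>2)" by simp
    qed
  qed measurable
qed

lemma L2_mult_integrable:
  fixes f g :: "real^'n \<Rightarrow> real"
  shows "f \<in> L2 \<Omega> \<Longrightarrow> g \<in> L2 \<Omega> \<Longrightarrow> integrable (lebesgue_on \<Omega>) (\<lambda>x. f x * g x)"
  using L2_inner_integrable[of f \<Omega> g] by simp

definition L2_inner :: "(real^'n) set \<Rightarrow> (real^'n \<Rightarrow> 'b::euclidean_space) \<Rightarrow> (real^'n \<Rightarrow> 'b) \<Rightarrow> real" where
  "L2_inner \<Omega> f g = (LINT x|lebesgue_on \<Omega>. f x \<bullet> g x)"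

interpretation L2: semi_inner "L2 \<Omega>" "L2_inner \<Omega>" for \<Omega> :: "(real^'n) set"
proof
  fix f g h :: "real^'n \<Rightarrow> 'b::euclidean_space" and c :: real
  show "subspace (L2 \<Omega> :: (real^'n \<Rightarrow> 'b) set)" by (rule L2_subspace)
  show "L2_inner \<Omega> f g = L2_inner \<Omega> g f" by (simp add: L2_inner_def inner_commute)
  show "L2_inner \<Omega> (f + g) h = L2_inner \<Omega> f h + L2_inner \<Omega> g h" if "f \<in> L2 \<Omega>" "g \<in> L2 \<Omega>" "h \<in> L2 \<Omega>"
    using that by (simp add: L2_inner_def inner_add_left L2_inner_integrable)
  show "L2_inner \<Omega> (c *\<^sub>R f) h = c * L2_inner \<Omega> f h" by (simp add: L2_inner_def)
  show "0 \<le> L2_inner \<Omega> f f" by (simp add: L2_inner_def)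
qed

lemma L2_nrm: "L2.nrm \<Omega> f = L2_norm \<Omega> f"
  by (simp add: L2.nrm_def L2_norm_def L2_inner_def power2_norm_eq_inner)

lemma L2_norm_sq_inner: "(L2_norm \<Omega> f)\<^sup>2 = L2_inner \<Omega> f f"
  by (simp add: L2_norm_def L2_inner_def power2_norm_eq_inner)

lemma L2_inner_cong:
  assumes "AE x in lebesgue_on \<Omega>. f x = f' x" "f \<in> L2 \<Omega>" "f' \<in> L2 \<Omega>" "g \<in> L2 \<Omega>"
  shows "L2_inner \<Omega> f g = L2_inner \<Omega> f' g"
  unfolding L2_inner_def
proof (rule integral_cong_AE)
  show "(\<lambda>x. f x \<bullet> g x) \<in> borel_measurable (lebesgue_on \<Omega>)" "(\<lambda>x. f' x \<bullet> g x) \<in> borel_measurable (lebesgue_on \<Omega>)"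
    using L2_inner_integrable assms borel_measurable_integrable by blast+
qed (use assms(1) in \<open>auto elim: eventually_mono\<close>)

lemma L2_norm_nonneg [simp]: "0 \<le> L2_norm \<Omega> f"
  by (simp add: L2_norm_def)

lemma L2_Cauchy_Schwarz: "\<lbrakk>f \<in> L2 \<Omega>; g \<in> L2 \<Omega>\<rbrakk> \<Longrightarrow> \<bar>L2_inner \<Omega> f g\<bar> \<le> L2_norm \<Omega> f * L2_norm \<Omega> g"
  using L2.Cauchy_Schwarz_abs[of f \<Omega> g] by (simp add: L2_nrm)

lemma L2_norm_cong_AE:
  assumes "AE x in lebesgue_on \<Omega>. f x = g x" "f \<in> L2 \<Omega>" "g \<in> L2 \<Omega>"
  shows "L2_norm \<Omega> f = L2_norm \<Omega> g"
proof -
  have "(LINT x|lebesgue_on \<Omega>. (norm (f x))\<^sup>2) = (LINT x|lebesgue_on \<Omega>. (norm (g x))\<^sup>2)"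
    using assms(1) L2_integrable_sq[OF assms(2)] L2_integrable_sq[OF assms(3)]
    by (intro integral_cong_AE) auto
  then show ?thesis by (simp add: L2_norm_def)
qed

lemma L2_norm_zero_AE:
  assumes "f \<in> L2 \<Omega>" "L2_norm \<Omega> f = 0"
  shows "AE x in lebesgue_on \<Omega>. f x = 0"
proof -
  have "(LINT x|lebesgue_on \<Omega>. (norm (f x))\<^sup>2) = 0" using assms(2) by (simp add: L2_norm_def)
  then have "AE x in lebesgue_on \<Omega>. (norm (f x))\<^sup>2 = 0"
    using integral_nonneg_eq_0_iff_AE[OF L2_integrable_sq[OF assms(1)]] by auto
  then show ?thesis by simp
qed

lemma L2_pair:
  assumes "f \<in> L2 \<Omega>" "g \<in> L2 \<Omega>"
  shows "(\<lambda>x. (f x, g x)) \<in> L2 \<Omega>"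
proof -
  have [measurable]: "f \<in> borel_measurable (lebesgue_on \<Omega>)" "g \<in> borel_measurable (lebesgue_on \<Omega>)"
    using assms by (auto simp: L2_measurable)
  show ?thesis using assms unfolding L2_def by (auto simp: norm_Pair)
qed

lemma L2_norm_pair:
  assumes "f \<in> L2 \<Omega>" "g \<in> L2 \<Omega>"
  shows "(L2_norm \<Omega> (\<lambda>x. (f x, g x)))\<^sup>2 = (L2_norm \<Omega> f)\<^sup>2 + (L2_norm \<Omega> g)\<^sup>2"
  using assms by (simp add: L2_norm_def norm_Pair L2_integrable_sq)

lemma L2_component: "f \<in> L2 \<Omega> \<Longrightarrow> (\<lambda>x. f x $ i) \<in> L2 \<Omega>"
  for f :: "real^'n \<Rightarrow> 'b::euclidean_space^'m"
  by (rule L2_bounded_linear[OF bounded_linear_vec_nth])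

lemma norm_sq_vec: "(norm x)\<^sup>2 = (\<Sum>i\<in>UNIV. (norm (x $ i))\<^sup>2)" for x :: "'b::real_normed_vector^'m"
  by (simp add: norm_vec_def L2_set_def sum_nonneg)

lemma L2_vec:
  fixes f :: "real^'n \<Rightarrow> 'b::euclidean_space^'m"
  assumes "\<And>i. (\<lambda>x. f x $ i) \<in> L2 \<Omega>"
  shows "f \<in> L2 \<Omega>"
proof -
  have "f \<in> borel_measurable (lebesgue_on \<Omega>)"
  proof (subst borel_measurable_euclidean_space, rule ballI)
    fix b :: "'b^'m" assume "b \<in> Basis"
    have [measurable]: "(\<lambda>x. f x $ i) \<in> borel_measurable (lebesgue_on \<Omega>)" for i using assms by (simp add: L2_measurable)
    show "(\<lambda>x. f x \<bullet> b) \<in> borel_measurable (lebesgue_on \<Omega>)" unfolding inner_vec_def by measurable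
  qed
  moreover have "integrable (lebesgue_on \<Omega>) (\<lambda>x. (norm (f x))\<^sup>2)"
    unfolding norm_sq_vec using assms by (intro Bochner_Integration.integrable_sum L2_integrable_sq)
  ultimately show ?thesis by (simp add: L2_def)
qed

lemma L2_norm_vec:
  fixes f :: "real^'n \<Rightarrow> 'b::euclidean_space^'m"
  assumes "f \<in> L2 \<Omega>"
  shows "(L2_norm \<Omega> f)\<^sup>2 = (\<Sum>i\<in>UNIV. (L2_norm \<Omega> (\<lambda>x. f x $ i))\<^sup>2)"
proof -
  have "(LINT x|lebesgue_on \<Omega>. (norm (f x))\<^sup>2) = (\<Sum>i\<in>UNIV. LINT x|lebesgue_on \<Omega>. (norm (f x $ i))\<^sup>2)"
    unfolding norm_sq_vec using assms by (intro Bochner_Integration.integral_sum L2_integrable_sq L2_component)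
  then show ?thesis by (simp add: L2_norm_def sum_nonneg)
qed

lemma L2_const_bounded: assumes "bounded \<Omega>" "\<Omega> \<in> sets lebesgue" shows "(\<lambda>x. c) \<in> L2 \<Omega>"
proof -
  have "finite_measure (lebesgue_on \<Omega>)"
    using bounded_set_imp_lmeasurable[OF assms] by (rule finite_measure_lebesgue_on)
  then show ?thesis by (simp add: L2_def finite_measure.integrable_const)
qed

lemma L2_bounded_function:
  assumes "bounded \<Omega>" "\<Omega> \<in> sets lebesgue" "f \<in> borel_measurable (lebesgue_on \<Omega>)"
    "\<And>x. x \<in> \<Omega> \<Longrightarrow> norm (f x) \<le> B"
  shows "f \<in> L2 \<Omega>"
proof -
  interpret finite_measure "lebesgue_on \<Omega>"
    using bounded_set_imp_lmeasurable[OF assms(1,2)] by (rule finite_measure_lebesgue_on)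
  have "integrable (lebesgue_on \<Omega>) (\<lambda>x. (norm (f x))\<^sup>2)"
  proof (rule integrable_const_bound)
    have "norm ((norm (f x))\<^sup>2) \<le> B\<^sup>2" if "x \<in> \<Omega>" for x using assms(4)[OF that] by (simp add: power_mono)
    then show "AE x in lebesgue_on \<Omega>. norm ((norm (f x))\<^sup>2) \<le> B\<^sup>2" by (intro AE_I2) simp
    show "(\<lambda>x. (norm (f x))\<^sup>2) \<in> borel_measurable (lebesgue_on \<Omega>)" using assms(3) by measurable
  qed
  then show ?thesis using assms(3) by (simp add: L2_def)
qed

lemma norm_matrix_vector_le: "norm (A *v x) \<le> norm A * norm x" for A :: "real^'n^'m"
proof (rule power2_le_imp_le)
  have "(norm (A *v x))\<^sup>2 = (\<Sum>i\<in>UNIV. (A $ i \<bullet> x)\<^sup>2)"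
    by (simp add: norm_sq_vec matrix_vector_mul_component)
  also have "\<dots> \<le> (\<Sum>i\<in>UNIV. (norm (A $ i) * norm x)\<^sup>2)"
    using Cauchy_Schwarz_ineq2 by (intro sum_mono) (simp add: abs_le_square_iff[symmetric])
  also have "\<dots> = (norm A * norm x)\<^sup>2"
    by (simp add: power_mult_distrib norm_sq_vec[of A] sum_distrib_right)
  finally show "(norm (A *v x))\<^sup>2 \<le> (norm A * norm x)\<^sup>2" .
qed simp

lemma L2_matrix_mult:
  fixes K :: "real^'n \<Rightarrow> real^'n^'n" and f :: "real^'n \<Rightarrow> real^'n"
  assumes K: "K \<in> borel_measurable (lebesgue_on \<Omega>)" and B: "AE x in lebesgue_on \<Omega>. norm (K x) \<le> B" "0 \<le> B"
    and f: "f \<in> L2 \<Omega>"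
  shows "(\<lambda>x. K x *v f x) \<in> L2 \<Omega>" and "L2_norm \<Omega> (\<lambda>x. K x *v f x) \<le> B * L2_norm \<Omega> f"
proof -
  have [measurable]: "f \<in> borel_measurable (lebesgue_on \<Omega>)" using f by (simp add: L2_measurable)
  have Ki: "(\<lambda>x. K x $ i) \<in> borel_measurable (lebesgue_on \<Omega>)" for i
    using measurable_compose[OF K borel_measurable_continuous_onI[OF linear_continuous_on[OF bounded_linear_vec_nth]], of i] by simp
  have m: "(\<lambda>x. K x *v f x) \<in> borel_measurable (lebesgue_on \<Omega>)"
  proof (subst borel_measurable_euclidean_space, rule ballI)
    fix b :: "real^'n" assume "b \<in> Basis"
    have [measurable]: "(\<lambda>x. K x $ i) \<in> borel_measurable (lebesgue_on \<Omega>)" for i by (rule Ki)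
    show "(\<lambda>x. (K x *v f x) \<bullet> b) \<in> borel_measurable (lebesgue_on \<Omega>)"
      unfolding inner_vec_def[where 'a=real and 'b='n, of _ b] matrix_vector_mul_component by measurable
  qed
  have b: "AE x in lebesgue_on \<Omega>. (norm (K x *v f x))\<^sup>2 \<le> B\<^sup>2 * (norm (f x))\<^sup>2"
    using B(1)
  proof eventually_elim
    fix x assume "norm (K x) \<le> B"
    then have "norm (K x *v f x) \<le> B * norm (f x)"
      by (meson norm_matrix_vector_le order_trans mult_right_mono norm_ge_zero)
    then show "(norm (K x *v f x))\<^sup>2 \<le> B\<^sup>2 * (norm (f x))\<^sup>2" by (metis norm_ge_zero power_mono power_mult_distrib)
  qed
  have i: "integrable (lebesgue_on \<Omega>) (\<lambda>x. (norm (K x *v f x))\<^sup>2)"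
  proof (rule Bochner_Integration.integrable_bound)
    show "integrable (lebesgue_on \<Omega>) (\<lambda>x. B\<^sup>2 * (norm (f x))\<^sup>2)" using L2_integrable_sq[OF f] by simp
    show "(\<lambda>x. (norm (K x *v f x))\<^sup>2) \<in> borel_measurable (lebesgue_on \<Omega>)" using m by measurable
    show "AE x in lebesgue_on \<Omega>. norm ((norm (K x *v f x))\<^sup>2) \<le> norm (B\<^sup>2 * (norm (f x))\<^sup>2)" using b by simp
  qed
  show "(\<lambda>x. K x *v f x) \<in> L2 \<Omega>" using i m by (simp add: L2_def)
  have "(LINT x|lebesgue_on \<Omega>. (norm (K x *v f x))\<^sup>2) \<le> (LINT x|lebesgue_on \<Omega>. B\<^sup>2 * (norm (f x))\<^sup>2)"
    by (rule integral_mono_AE[OF i _ b]) (use L2_integrable_sq[OF f] in simp)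
  then have "(L2_norm \<Omega> (\<lambda>x. K x *v f x))\<^sup>2 \<le> (B * L2_norm \<Omega> f)\<^sup>2"
    by (simp add: L2_norm_def power_mult_distrib)
  then show "L2_norm \<Omega> (\<lambda>x. K x *v f x) \<le> B * L2_norm \<Omega> f"
    by (rule power2_le_imp_le) (use B(2) in simp)
qed

lemma Linf_norm_bound: "Linf_norm \<Omega> K \<le> ereal c \<Longrightarrow> K \<in> borel_measurable (lebesgue_on \<Omega>) \<Longrightarrow>
    AE x in lebesgue_on \<Omega>. norm (K x) \<le> c"
  using esssup_AE[of "\<lambda>x. ereal (norm (K x))" "lebesgue_on \<Omega>"]
  unfolding Linf_norm_def by (auto elim!: eventually_mono dest: order_trans)

text \<open>Linearity of \<open>J\<close> almost everywhere is the right hypothesis because weak derivatives are determined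
  only up to null sets.\<close>

lemma semi_inner_pullback:
  fixes J :: "'v::real_vector \<Rightarrow> real^'n \<Rightarrow> 'b::euclidean_space"
  assumes V: "subspace V" and J: "\<And>x. x \<in> V \<Longrightarrow> J x \<in> L2 \<Omega>"
    and lin: "\<And>x y c. \<lbrakk>x \<in> V; y \<in> V\<rbrakk> \<Longrightarrow> AE t in lebesgue_on \<Omega>. J (c *\<^sub>R x + y) t = c *\<^sub>R J x t + J y t"
  shows "semi_inner V (\<lambda>x y. L2_inner \<Omega> (J x) (J y))"
proof
  have comb: "L2_inner \<Omega> (J (c *\<^sub>R x + y)) (J z) = c * L2_inner \<Omega> (J x) (J z) + L2_inner \<Omega> (J y) (J z)"
    if "x \<in> V" "y \<in> V" "z \<in> V" for x y z c
  proof -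
    have "L2_inner \<Omega> (J (c *\<^sub>R x + y)) (J z) = L2_inner \<Omega> (c *\<^sub>R J x + J y) (J z)"
      using that V J lin[OF that(1,2), of c]
      by (intro L2_inner_cong) (auto simp: subspace_add subspace_scale intro!: L2.add_in L2.scale_in)
    also have "\<dots> = c * L2_inner \<Omega> (J x) (J z) + L2_inner \<Omega> (J y) (J z)"
      using that J by (simp add: L2.ip_add L2.ip_scale L2.scale_in)
    finally show ?thesis .
  qed
  fix x y z and c :: real
  show "subspace V" by fact
  show "L2_inner \<Omega> (J x) (J y) = L2_inner \<Omega> (J y) (J x)" if "x \<in> V" "y \<in> V"
    using that J by (simp add: L2.ip_sym)
  show "L2_inner \<Omega> (J (x + y)) (J z) = L2_inner \<Omega> (J x) (J z) + L2_inner \<Omega> (J y) (J z)"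
    if "x \<in> V" "y \<in> V" "z \<in> V"
    using comb[of x y z 1] that by simp
  have "L2_inner \<Omega> (J 0) (J z) = 0" if "z \<in> V"
    using comb[of 0 0 z 1] that V by (simp add: subspace_0)
  then show "L2_inner \<Omega> (J (c *\<^sub>R x)) (J z) = c * L2_inner \<Omega> (J x) (J z)" if "x \<in> V" "z \<in> V"
    using comb[of x 0 z c] that V by (simp add: subspace_0)
  show "0 \<le> L2_inner \<Omega> (J x) (J x)" if "x \<in> V" using J[OF that] by (rule L2.ip_nonneg)
qed

section \<open>Test functions and the fundamental lemma of the calculus of variations\<close>

text \<open>\<open>bump 1\<close> is the standard smooth function vanishing on the negative half-line; the polynomial factors
  make the family closed under differentiation.\<close>

definition bump :: "real poly \<Rightarrow> real \<Rightarrow> real" where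
  "bump Q t = (if t > 0 then poly Q (1 / t) * exp (- (1 / t)) else 0)"

lemma poly_exp_tendsto_0: "((\<lambda>u. poly Q u * exp (- u)) \<longlongrightarrow> 0) at_top" for Q :: "real poly"
proof -
  have "((\<lambda>u. \<Sum>i\<le>degree Q. coeff Q i * (u ^ i / exp u)) \<longlongrightarrow> (\<Sum>i\<le>degree Q. coeff Q i * 0)) at_top"
    by (intro tendsto_intros tendsto_power_div_exp_0)
  then show ?thesis by (simp add: poly_altdef exp_minus sum_distrib_right divide_inverse mult.assoc)
qed

text \<open>The derivatives of \<open>exp (- 1 / t)\<close> are of the form \<open>Q (1 / t) * exp (- 1 / t)\<close> with polynomials
  \<open>Q\<close>, and these functions vanish at \<open>0\<close> faster than any power.\<close>

lemma bump_deriv: "(bump Q has_real_derivative bump ([:0, 0, 1:] * (Q - pderiv Q)) t) (at t)"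
proof -
  consider "t < 0" | "t = 0" | "t > 0" by linarith
  then show ?thesis
  proof cases
    case 1
    have "((\<lambda>_. 0) has_real_derivative 0) (at t)" by simp
    moreover have "eventually (\<lambda>s. bump Q s = 0) (nhds t)"
      using eventually_nhds_in_open[of "{..<0}" t] 1 by (auto elim!: eventually_mono simp: bump_def)
    ultimately have "(bump Q has_real_derivative 0) (at t)"
      using DERIV_cong_ev[of t t "bump Q" "\<lambda>_. 0" 0 0] by simp
    then show ?thesis using 1 by (simp add: bump_def)
  next
    case 3
    have "((\<lambda>s. poly Q (1 / s) * exp (- (1 / s))) has_real_derivative
        poly (pderiv Q) (1 / t) * (- (1 / t\<^sup>2)) * exp (- (1 / t)) + poly Q (1 / t) * (exp (- (1 / t)) * (1 / t\<^sup>2))) (at t)"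
      using 3 by (auto intro!: derivative_eq_intros DERIV_chain2[OF poly_DERIV] simp: power2_eq_square divide_simps)
    moreover have "poly (pderiv Q) (1 / t) * (- (1 / t\<^sup>2)) * exp (- (1 / t)) + poly Q (1 / t) * (exp (- (1 / t)) * (1 / t\<^sup>2))
      = bump ([:0, 0, 1:] * (Q - pderiv Q)) t"
      using 3 by (simp add: bump_def power2_eq_square field_simps)
    moreover have "eventually (\<lambda>s. bump Q s = poly Q (1 / s) * exp (- (1 / s))) (nhds t)"
      using eventually_nhds_in_open[of "{0<..}" t] 3 by (auto elim!: eventually_mono simp: bump_def)
    ultimately show ?thesis
      by (subst DERIV_cong_ev[OF refl _ refl]) auto
  next
    case 2
    have lim: "((\<lambda>s. bump Q s / s) \<longlongrightarrow> 0) (at 0)"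
    proof (rule filterlim_split_at)
      have "eventually (\<lambda>s. bump Q s / s = 0) (at_left 0)"
        by (auto simp: bump_def eventually_at_filter)
      then show "((\<lambda>s. bump Q s / s) \<longlongrightarrow> 0) (at_left 0)" by (rule tendsto_eventually)
      have "((\<lambda>s. poly ([:0, 1:] * Q) (inverse s) * exp (- inverse s)) \<longlongrightarrow> 0) (at_right (0::real))"
        by (rule filterlim_compose[OF poly_exp_tendsto_0 filterlim_inverse_at_top_right])
      moreover have "eventually (\<lambda>s. poly ([:0, 1:] * Q) (inverse s) * exp (- inverse s) = bump Q s / s) (at_right 0)"
        by (auto simp: bump_def eventually_at_filter divide_inverse)
      ultimately show "((\<lambda>s. bump Q s / s) \<longlongrightarrow> 0) (at_right 0)" by (rule Lim_transform_eventually)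
    qed
    have "bump Q 0 = 0" "bump ([:0, 0, 1:] * (Q - pderiv Q)) 0 = 0" by (simp_all add: bump_def)
    then show ?thesis using lim 2 by (simp add: has_field_derivative_iff)
  qed
qed

lemma frechet_derivative_at_eq: "(f has_derivative f') (at x) \<Longrightarrow> frechet_derivative f (at x) = f'"
  using frechet_derivative_at by metis

lemma partial_deriv_has_derivative:
  fixes f :: "real^'n \<Rightarrow> real"
  shows
  "(f has_derivative f') (at x) \<Longrightarrow> partial_deriv i f x = f' (axis i 1)"
  by (simp add: partial_deriv_def frechet_derivative_at_eq)

lemma has_derivative_partial_deriv:
  fixes f :: "real^'n \<Rightarrow> real"
  assumes "f differentiable (at x)"
  shows "(f has_derivative (\<lambda>h. \<Sum>i\<in>UNIV. h $ i * partial_deriv i f x)) (at x)"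
proof -
  let ?D = "frechet_derivative f (at x)"
  have D: "(f has_derivative ?D) (at x)" using assms frechet_derivative_works by blast
  then have lin: "linear ?D" using has_derivative_linear by blast
  have "?D h = (\<Sum>i\<in>UNIV. h $ i * partial_deriv i f x)" for h
  proof -
    have "?D h = ?D (\<Sum>i\<in>UNIV. h $ i *\<^sub>R axis i 1)" by (simp add: basis_expansion[of h, unfolded scalar_mult_eq_scaleR])
    also have "\<dots> = (\<Sum>i\<in>UNIV. h $ i * partial_deriv i f x)"
      using lin by (simp add: linear_sum linear_scale partial_deriv_def)
    finally show ?thesis .
  qed
  then show ?thesis using D by (metis (no_types, lifting) ext)
qed

lemma partial_deriv_plus:
  fixes f g :: "real^'n \<Rightarrow> real"
  assumes "\<And>x. f differentiable (at x)" "\<And>x. g differentiable (at x)"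
  shows "partial_deriv j (\<lambda>x. f x + g x) = (\<lambda>x. partial_deriv j f x + partial_deriv j g x)"
proof
  fix x
  show "partial_deriv j (\<lambda>x. f x + g x) x = partial_deriv j f x + partial_deriv j g x"
    using partial_deriv_has_derivative[OF has_derivative_add[OF frechet_derivative_works[THEN iffD1] frechet_derivative_works[THEN iffD1]], of f x g j] assms
    by (simp add: partial_deriv_def)
qed

lemma partial_deriv_times:
  fixes f g :: "real^'n \<Rightarrow> real"
  assumes "\<And>x. f differentiable (at x)" "\<And>x. g differentiable (at x)"
  shows "partial_deriv j (\<lambda>x. f x * g x) = (\<lambda>x. f x * partial_deriv j g x + partial_deriv j f x * g x)"
proof
  fix x
  show "partial_deriv j (\<lambda>x. f x * g x) x = f x * partial_deriv j g x + partial_deriv j f x * g x"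
    using partial_deriv_has_derivative[OF has_derivative_mult[OF frechet_derivative_works[THEN iffD1] frechet_derivative_works[THEN iffD1]], of f x g j] assms
    by (simp add: partial_deriv_def)
qed

lemma partial_deriv_const: "partial_deriv j (\<lambda>x::real^'n. c) = (\<lambda>x. 0)"
  by (rule ext) (simp add: partial_deriv_has_derivative[OF has_derivative_const])

text \<open>A class of functions that contains enough compactly supported functions and is closed under
  partial derivatives.\<close>

inductive bump_algebra :: "(real^'n \<Rightarrow> real) \<Rightarrow> bool" where
  base: "bump_algebra (\<lambda>x. bump Q (s * x $ i + d))"
| const: "bump_algebra (\<lambda>x. c)"
| add: "bump_algebra f \<Longrightarrow> bump_algebra g \<Longrightarrow> bump_algebra (\<lambda>x. f x + g x)"
| mult: "bump_algebra f \<Longrightarrow> bump_algebra g \<Longrightarrow> bump_algebra (\<lambda>x. f x * g x)"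

lemma bump_algebra_partial_deriv:
  fixes f :: "real^'n \<Rightarrow> real"
  shows
  "bump_algebra f \<Longrightarrow> (\<forall>x. f differentiable (at x)) \<and> (\<forall>j. bump_algebra (partial_deriv j f))"
proof (induction rule: bump_algebra.induct)
  case (base Q s i d)
  let ?R = "[:0, 0, 1:] * (Q - pderiv Q)"
  have D: "((\<lambda>x. bump Q (s * x $ i + d)) has_derivative (\<lambda>h. s * h $ i * bump ?R (s * x $ i + d))) (at x)" for x :: "real^'n"
  proof -
    have "((\<lambda>x. s * x $ i + d) has_derivative (\<lambda>h. s * h $ i)) (at x)"
      by (auto intro!: derivative_eq_intros bounded_linear.has_derivative[OF bounded_linear_vec_nth])
    from has_derivative_compose[OF this bump_deriv[unfolded has_field_derivative_def]]
    show ?thesis by (simp add: o_def mult.commute)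
  qed
  have "partial_deriv j (\<lambda>x. bump Q (s * x $ i + d)) = (\<lambda>x. (if i = j then s else 0) * bump ?R (s * x $ i + d))" for j :: 'n
    by (rule ext) (simp add: partial_deriv_has_derivative[OF D] axis_def)
  then show ?case
    using D bump_algebra.intros by (auto simp: differentiable_def simp del: mult_pCons_left intro: bump_algebra.mult[OF bump_algebra.const bump_algebra.base])
next
  case (const c)
  then show ?case by (auto intro: bump_algebra.const simp: partial_deriv_const)
next
  case (add f g)
  have "partial_deriv j (\<lambda>x. f x + g x) = (\<lambda>x. partial_deriv j f x + partial_deriv j g x)" for j
    using add by (intro partial_deriv_plus) auto
  then show ?case using add by (auto intro: bump_algebra.add)
next
  case (mult f g)
  have "partial_deriv j (\<lambda>x. f x * g x) = (\<lambda>x. f x * partial_deriv j g x + partial_deriv j f x * g x)" for j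
    using mult by (intro partial_deriv_times) auto
  then show ?case using mult by (auto intro!: bump_algebra.add intro: bump_algebra.mult)
qed

lemma bump_algebra_C_k: "bump_algebra f \<Longrightarrow> C_k m f"
proof (induction m arbitrary: f)
  case 0
  then have "\<forall>x. f differentiable (at x)" using bump_algebra_partial_deriv by blast
  then show ?case
    by (auto intro!: continuous_at_imp_continuous_on differentiable_imp_continuous_within)
next
  case (Suc m)
  then show ?case using bump_algebra_partial_deriv[of f] by auto
qed

lemma bump_algebra_prod: "finite I \<Longrightarrow> (\<And>i. i \<in> I \<Longrightarrow> bump_algebra (F i)) \<Longrightarrow> bump_algebra (\<lambda>x. \<Prod>i\<in>I. F i x)"
  by (induction I rule: finite_induct) (auto intro: bump_algebra.const bump_algebra.mult)

text \<open>Increasing the slopes of the factors makes these products converge to the indicator of the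
  box \<open>box a b\<close>.\<close>

definition box_bump :: "real^'n \<Rightarrow> real^'n \<Rightarrow> nat \<Rightarrow> real^'n \<Rightarrow> real" where
  "box_bump a b j x = (\<Prod>i\<in>UNIV. bump 1 (real j * (x $ i - a $ i)) * bump 1 (real j * (b $ i - x $ i)))"

lemma bump_1: "bump 1 t = (if t > 0 then exp (- (1 / t)) else 0)"
  by (simp add: bump_def)

lemma bump_1_range: "0 \<le> bump 1 t" "bump 1 t \<le> 1"
  by (auto simp: bump_1)

lemma box_bump_range: "0 \<le> box_bump a b j x" "box_bump a b j x \<le> 1"
  unfolding box_bump_def by (auto intro!: prod_nonneg prod_le_1 mult_nonneg_nonneg mult_le_one simp: bump_1_range)

lemma box_bump_outside:
  assumes "x \<notin> box a b" shows "box_bump a b j x = 0"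
proof -
  obtain i where "\<not> (a $ i < x $ i \<and> x $ i < b $ i)" using assms by (auto simp: mem_box_cart)
  then have "bump 1 (real j * (x $ i - a $ i)) * bump 1 (real j * (b $ i - x $ i)) = 0"
    by (auto simp: bump_1 zero_less_mult_iff)
  then show ?thesis unfolding box_bump_def by (metis (no_types, lifting) UNIV_I finite prod_zero)
qed

lemma box_bump_test_function:
  assumes "cbox a b \<subseteq> \<Omega>" shows "box_bump a b j \<in> test_functions \<Omega>"
proof -
  have "bump_algebra (\<lambda>x. bump 1 (real j * (x $ i - a $ i)))" for i
    using bump_algebra.base[of 1 "real j" i "- real j * a $ i"] by (simp add: algebra_simps)
  moreover have "bump_algebra (\<lambda>x. bump 1 (real j * (b $ i - x $ i)))" for i
    using bump_algebra.base[of 1 "- real j" i "real j * b $ i"] by (simp add: algebra_simps)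
  ultimately have "bump_algebra (\<lambda>x. box_bump a b j x)"
    unfolding box_bump_def by (intro bump_algebra_prod bump_algebra.mult) auto
  moreover have "closure {x. box_bump a b j x \<noteq> 0} \<subseteq> cbox a b"
    using box_bump_outside[of _ a b j] box_subset_cbox[of a b] by (intro closure_minimal) auto
  moreover have "compact (closure {x. box_bump a b j x \<noteq> 0})"
    using calculation(2) compact_cbox by (meson closed_closure compact_Int_closed compact_closure bounded_cbox bounded_subset closure_subset order_trans)
  ultimately show ?thesis using bump_algebra_C_k assms unfolding test_functions_def by blast
qed

lemma box_bump_tendsto: "(\<lambda>j. box_bump a b j x) \<longlonglongrightarrow> indicator (box a b) x"
proof (cases "x \<in> box a b")
  case False
  then show ?thesis by (simp add: box_bump_outside)
next
  case True
  have lim: "(\<lambda>j. bump 1 (real j * c)) \<longlonglongrightarrow> 1" if c: "c > 0" for c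
  proof -
    have "(\<lambda>j. exp (- ((1 / c) * (1 / real j)))) \<longlonglongrightarrow> exp (- ((1 / c) * 0))"
      by (intro tendsto_intros lim_1_over_n)
    moreover have "eventually (\<lambda>j. exp (- ((1 / c) * (1 / real j))) = bump 1 (real j * c)) sequentially"
      using eventually_gt_at_top[of 0] by eventually_elim (use c in \<open>simp add: bump_1 field_simps\<close>)
    ultimately show ?thesis by (simp add: Lim_transform_eventually)
  qed
  have "(\<lambda>j. box_bump a b j x) \<longlonglongrightarrow> (\<Prod>i\<in>(UNIV::'a set). 1 * 1)"
    unfolding box_bump_def using True by (intro tendsto_intros lim) (auto simp: mem_box_cart)
  then show ?thesis using True by simp
qed

text \<open>Boxes are stable under intersection and generate the Borel sets, so the integral of \<open>g\<close> over every
  Borel set vanishes, in particular over the sets where a Borel version \<open>g'\<close> of \<open>g\<close> is positive and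
  negative.\<close>

lemma AE_zero_if_box_integrals_zero:
  fixes g :: "real^'n \<Rightarrow> real"
  assumes g: "integrable lebesgue g" and tot: "integral\<^sup>L lebesgue g = 0"
    and box: "\<And>c d. (LINT x|lebesgue. indicator (box c d) x * g x) = 0"
  shows "AE x in lebesgue. g x = 0"
proof -
  obtain g' where g'm: "g' \<in> borel_measurable lborel" and ae: "AE x in lborel. g x = g' x"
    using completion_ex_borel_measurable_real[of g lborel] g by auto
  note [measurable] = g'm
  have ae': "AE x in lebesgue. g x = g' x" using ae by (rule AE_completion)
  have g'l: "integrable lebesgue g'"
    by (rule integrable_cong_AE_imp[OF g]) (use ae' g'm in \<open>auto simp: measurable_completion elim: eventually_mono\<close>)
  then have g'i: "integrable lborel g'" using integrable_completion[OF g'm] by simp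
  have bi: "(LINT x|lborel. indicator A x * g' x) = (LINT x|lebesgue. indicator A x * g x)" if "A \<in> sets borel" for A
  proof -
    have "(LINT x|lborel. indicator A x * g' x) = (LINT x|lebesgue. indicator A x * g' x)"
    proof (rule integral_completion[symmetric])
      have [measurable]: "A \<in> sets lborel" using that by simp
      show "(\<lambda>x. indicator A x * g' x) \<in> borel_measurable lborel" by measurable
    qed
    also have "\<dots> = (LINT x|lebesgue. indicator A x * g x)"
    proof (rule integral_cong_AE)
      have [measurable]: "A \<in> sets lebesgue" using that by simp
      have [measurable]: "g' \<in> borel_measurable lebesgue" "g \<in> borel_measurable lebesgue" using g'l g by auto
      show "(\<lambda>x. indicator A x * g' x) \<in> borel_measurable lebesgue" by measurable
      show "(\<lambda>x. indicator A x * g x) \<in> borel_measurable lebesgue" by measurable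
      show "AE x in lebesgue. indicator A x * g' x = indicator A x * g x" using ae' by (auto elim: eventually_mono)
    qed
    finally show ?thesis .
  qed
  have all: "(LINT x|lborel. indicator A x * g' x) = 0" if "A \<in> sets borel" for A
  proof -
    have As: "A \<in> sigma_sets UNIV (range (\<lambda>(a, b). box a b))" using that by (simp add: borel_eq_box)
    have st: "Int_stable (range (\<lambda>(a, b). box a b :: (real^'n) set))"
    proof (rule Int_stableI_image)
      fix p q :: "(real^'n) \<times> (real^'n)"
      obtain a b c d where pq: "p = (a, b)" "q = (c, d)" by (metis surj_pair)
      have "box a b \<inter> box c d = box (\<chi> i. max (a $ i) (c $ i)) (\<chi> i. min (b $ i) (d $ i))"
        by (auto simp: mem_box_cart)
      then show "\<exists>r\<in>UNIV. (case p of (a, b) \<Rightarrow> box a b) \<inter> (case q of (a, b) \<Rightarrow> box a b) = (case r of (a, b) \<Rightarrow> box a b)"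
        using pq by auto
    qed
    have "range (\<lambda>(a, b). box a b :: (real^'n) set) \<subseteq> Pow UNIV" by simp
    from st this As show ?thesis
    proof (induction rule: sigma_sets_induct_disjoint)
      case (basic A) then show ?case using bi box by auto
    next
      case empty then show ?case by simp
    next
      case (compl A)
      then have [measurable]: "A \<in> sets borel" by (simp add: borel_eq_box)
      have "(LINT x|lborel. indicator (UNIV - A) x * g' x) = (LINT x|lborel. g' x - indicator A x * g' x)"
        by (intro Bochner_Integration.integral_cong) (auto simp: indicator_def)
      also have "\<dots> = (LINT x|lborel. g' x) - (LINT x|lborel. indicator A x * g' x)"
        using g'i integrable_mult_indicator[of A lborel g'] by (intro Bochner_Integration.integral_diff) auto
      also have "(LINT x|lborel. g' x) = 0" using bi[of UNIV] tot by simp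
      finally show ?case using compl by simp
    next
      case (union A)
      then have A[measurable]: "A i \<in> sets borel" for i by (auto simp: borel_eq_box)
      have "(LINT x:(\<Union>i. A i)|lborel. g' x) = (\<Sum>i. LINT x:A i|lborel. g' x)"
      proof (rule lebesgue_integral_countable_add)
        show "A i \<inter> A j = {}" if "i \<noteq> j" for i j using union(1) that by (auto simp: disjoint_family_on_def)
        show "set_integrable lborel (\<Union>i. A i) g'"
          unfolding set_integrable_def using g'i by (intro integrable_mult_indicator) auto
      qed simp
      then show ?case using union(3) by (simp add: set_lebesgue_integral_def)
    qed
  qed
  define P where "P = {x. g' x > 0}"
  define M where "M = {x. g' x < 0}"
  have [measurable]: "P \<in> sets borel" "M \<in> sets borel" using g'm unfolding P_def M_def by measurable
  have int: "integrable lborel (\<lambda>x. indicator A x * g' x)" if "A \<in> sets borel" for A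
    using integrable_mult_indicator[of A lborel g'] g'i that by simp
  have "AE x in lborel. indicator P x * g' x = 0"
  proof (subst integral_nonneg_eq_0_iff_AE[symmetric, OF int])
    show "AE x in lborel. 0 \<le> indicator P x * g' x" by (intro AE_I2) (simp add: P_def indicator_def)
  qed (use all[of P] in simp_all)
  moreover have "AE x in lborel. - (indicator M x * g' x) = 0"
  proof (subst integral_nonneg_eq_0_iff_AE[symmetric])
    show "integrable lborel (\<lambda>x. - (indicator M x * g' x))" using int[of M] by simp
    show "AE x in lborel. 0 \<le> - (indicator M x * g' x)" by (intro AE_I2) (simp add: M_def indicator_def)
  qed (use all[of M] in simp_all)
  ultimately have "AE x in lborel. g' x = 0"
    by eventually_elim (auto simp: P_def M_def indicator_def split: if_splits)
  then have "AE x in lebesgue. g' x = 0" by (rule AE_completion)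
  with ae' show ?thesis by eventually_elim simp
qed

text \<open>Integrals over boxes inside the domain are limits of integrals against test functions, and the domain
  is a countable union of such boxes.\<close>

lemma fundamental_lemma:
  fixes G :: "real^'n \<Rightarrow> real"
  assumes \<Omega>: "open \<Omega>" and G: "G \<in> L2 \<Omega>"
    and test: "\<And>\<phi>. \<phi> \<in> test_functions \<Omega> \<Longrightarrow> (LINT x|lebesgue_on \<Omega>. G x * \<phi> x) = 0"
  shows "AE x in lebesgue_on \<Omega>. G x = 0"
proof -
  have [measurable]: "\<Omega> \<in> sets lebesgue" using \<Omega> by auto
  define g where "g = (\<lambda>x. indicator \<Omega> x * G x)"
  have gm [measurable]: "g \<in> borel_measurable lebesgue"
    using L2_measurable[OF G] by (simp add: borel_measurable_restrict_space_iff g_def)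
  have G1: "integrable lebesgue (\<lambda>x. indicator (cbox a b) x * g x)" if "cbox a b \<subseteq> \<Omega>" for a b
  proof -
    have "indicat_real (cbox a b) \<in> L2 \<Omega>"
    proof -
      have [measurable]: "cbox a b \<in> sets lebesgue" by simp
      have m: "indicat_real (cbox a b) \<in> borel_measurable lebesgue" by measurable
      have "integrable lebesgue (indicat_real (cbox a b))" by (simp add: fmeasurableD2 less_top[symmetric])
      moreover have "(\<lambda>x. indicator \<Omega> x *\<^sub>R (norm (indicat_real (cbox a b) x))\<^sup>2) = indicat_real (cbox a b)"
        using that by (auto simp: indicator_def fun_eq_iff)
      ultimately have "integrable (lebesgue_on \<Omega>) (\<lambda>x. (norm (indicat_real (cbox a b) x))\<^sup>2)"
        by (simp only: integrable_restrict_space sets.Int_space_eq2 \<open>\<Omega> \<in> sets lebesgue\<close>)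
      then show ?thesis
        unfolding L2_def using m by (auto intro!: measurable_restrict_space1)
    qed
    from L2_mult_integrable[OF this G] show ?thesis
      by (simp add: integrable_restrict_space g_def mult.left_commute)
  qed
  have box: "(LINT x|lebesgue. indicator (box a b) x * g x) = 0" if ab: "cbox a b \<subseteq> \<Omega>" for a b
  proof -
    have [measurable]: "box a b \<in> sets lebesgue" "g \<in> borel_measurable lebesgue" by (simp_all add: gm)
    have "(\<lambda>j. LINT x|lebesgue. box_bump a b j x * g x) \<longlonglongrightarrow> (LINT x|lebesgue. indicator (box a b) x * g x)"
    proof (rule integral_dominated_convergence)
      have "(\<lambda>x. box_bump a b j x) \<in> borel_measurable lebesgue" for j
      proof -
        have "C_k 0 (box_bump a b j)" using box_bump_test_function[OF ab, of j] unfolding test_functions_def by blast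
        then have "box_bump a b j \<in> borel_measurable borel" by (auto intro: borel_measurable_continuous_onI)
        then show ?thesis by (simp add: measurable_completion)
      qed
      then show "(\<lambda>x. box_bump a b j x * g x) \<in> borel_measurable lebesgue" for j by measurable
      show "integrable lebesgue (\<lambda>x. indicator (cbox a b) x * \<bar>g x\<bar>)"
        using integrable_norm[OF G1[OF ab]] by (simp add: abs_mult)
      show "AE x in lebesgue. (\<lambda>j. box_bump a b j x * g x) \<longlonglongrightarrow> indicator (box a b) x * g x"
        by (intro AE_I2 tendsto_mult box_bump_tendsto tendsto_const)
      show "AE x in lebesgue. norm (box_bump a b j x * g x) \<le> indicator (cbox a b) x * \<bar>g x\<bar>" for j
      proof (intro AE_I2)
        fix x
        show "norm (box_bump a b j x * g x) \<le> indicator (cbox a b) x * \<bar>g x\<bar>"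
        proof (cases "x \<in> cbox a b")
          case True
          then show ?thesis using box_bump_range[of a b j x] by (simp add: abs_mult mult_left_le_one_le)
        next
          case False
          then have "x \<notin> box a b" using box_subset_cbox[of a b] by blast
          then show ?thesis by (simp add: box_bump_outside)
        qed
      qed
    qed measurable
    moreover have "(LINT x|lebesgue. box_bump a b j x * g x) = 0" for j
      using test[OF box_bump_test_function[OF ab, of j]] by (simp add: integral_restrict_space g_def mult_ac)
    ultimately show ?thesis by (simp add: LIMSEQ_const_iff)
  qed
  have aeb: "AE x in lebesgue. x \<in> cbox a b \<longrightarrow> g x = 0" if ab: "cbox a b \<subseteq> \<Omega>" for a b
  proof -
    let ?h = "\<lambda>x. indicator (box a b) x * g x"
    have [measurable]: "box a b \<in> sets lebesgue" "g \<in> borel_measurable lebesgue" by (simp_all add: gm)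
    have "AE x in lebesgue. ?h x = 0"
    proof (rule AE_zero_if_box_integrals_zero)
      show "integrable lebesgue ?h"
      proof (rule Bochner_Integration.integrable_bound[OF G1[OF ab]])
        show "AE x in lebesgue. norm (?h x) \<le> norm (indicator (cbox a b) x * g x)"
          using box_subset_cbox[of a b] by (intro AE_I2) (auto simp: indicator_def)
      qed measurable
      show "integral\<^sup>L lebesgue ?h = 0" using box[OF ab] .
      fix c d
      let ?a = "\<chi> i. max (a $ i) (c $ i)" and ?b = "\<chi> i. min (b $ i) (d $ i)"
      have e: "box a b \<inter> box c d = box ?a ?b" by (auto simp: mem_box_cart)
      have "(LINT x|lebesgue. indicator (box c d) x * ?h x) = (LINT x|lebesgue. indicator (box ?a ?b) x * g x)"
        unfolding e[symmetric] by (intro Bochner_Integration.integral_cong) (auto simp: indicator_def)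
      also have "\<dots> = 0"
      proof (rule box)
        show "cbox ?a ?b \<subseteq> \<Omega>" using ab by (auto simp: mem_box_cart subset_iff)
      qed
      finally show "(LINT x|lebesgue. indicator (box c d) x * ?h x) = 0" .
    qed
    moreover have "AE x in lebesgue. x \<notin> cbox a b - box a b"
      using negligible_frontier_interval[of a b] by (intro AE_not_in) (simp add: negligible_iff_null_sets)
    ultimately show ?thesis by eventually_elim (auto simp: indicator_def split: if_splits)
  qed
  obtain D where D: "countable D" "D \<subseteq> Pow \<Omega>" "\<And>X. X \<in> D \<Longrightarrow> \<exists>a b. X = cbox a b" "\<Union>D = \<Omega>"
    using open_countable_Union_open_cbox[OF \<Omega>] by metis
  have "AE x in lebesgue. x \<in> X \<longrightarrow> g x = 0" if X: "X \<in> D" for X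
  proof -
    obtain a b where ab: "X = cbox a b" using D(3)[OF X] by blast
    then show ?thesis using aeb[of a b] D(2) X by auto
  qed
  then have "AE x in lebesgue. \<forall>X\<in>D. x \<in> X \<longrightarrow> g x = 0"
    unfolding AE_ball_countable[OF D(1)] by blast
  then have "AE x in lebesgue. x \<in> \<Omega> \<longrightarrow> G x = 0"
  proof eventually_elim
    fix x assume a: "\<forall>X\<in>D. x \<in> X \<longrightarrow> g x = 0"
    show "x \<in> \<Omega> \<longrightarrow> G x = 0"
    proof
      assume x: "x \<in> \<Omega>"
      then have "g x = 0" using a D(4) by blast
      then show "G x = 0" using x by (simp add: g_def)
    qed
  qed
  then show ?thesis by (simp add: AE_restrict_space_iff)
qed

section \<open>Weak derivatives\<close>

lemma integrable_lebesgue: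
  fixes f :: "'a::euclidean_space \<Rightarrow> 'b::{banach, second_countable_topology}"
  assumes "integrable lborel f" shows "integrable lebesgue f"
  using integrable_completion[OF borel_measurable_integrable[OF assms]] assms by (simp only:)

lemma partial_deriv_DERIV:
  fixes f :: "real^'n \<Rightarrow> real"
  assumes "f differentiable (at x)"
  shows "((\<lambda>s. f (x + s *\<^sub>R axis i 1)) has_real_derivative partial_deriv i f x) (at 0)"
proof -
  have f: "(f has_derivative (\<lambda>h. \<Sum>i\<in>UNIV. h $ i * partial_deriv i f x)) (at (x + 0 *\<^sub>R axis i 1))"
    using has_derivative_partial_deriv[OF assms] by simp
  have "((\<lambda>s. x + s *\<^sub>R axis i 1) has_derivative (\<lambda>s. s *\<^sub>R axis i (1::real))) (at 0)"
    by (auto intro!: derivative_eq_intros)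
  from has_derivative_compose[OF this f]
  have "((\<lambda>s. f (x + s *\<^sub>R axis i 1)) has_derivative (\<lambda>s. \<Sum>j\<in>UNIV. (s *\<^sub>R axis i 1) $ j * partial_deriv j f x)) (at 0)" .
  moreover have "(\<Sum>j\<in>UNIV. (s *\<^sub>R axis i 1) $ j * partial_deriv j f x) = partial_deriv i f x * s" for s
  proof -
    have "(\<Sum>j\<in>UNIV. (s *\<^sub>R axis i 1) $ j * partial_deriv j f x) = (\<Sum>j\<in>UNIV. if j = i then s * partial_deriv j f x else 0)"
      by (intro sum.cong) (auto simp: axis_def)
    then show ?thesis by simp
  qed
  ultimately show ?thesis by (simp add: has_field_derivative_def)
qed

text \<open>Difference quotients of an integrable function have mean zero by translation invariance, and
  the Lipschitz bound makes dominated convergence applicable.\<close>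

lemma integral_lipschitz_derivative_zero:
  fixes h g :: "real^'n \<Rightarrow> real"
  assumes h: "integrable lborel h" and S: "bounded S" "\<And>x. x \<notin> S \<Longrightarrow> h x = 0"
    and \<delta>: "\<delta> > 0" and lip: "\<And>x s. \<bar>s\<bar> < \<delta> \<Longrightarrow> \<bar>h (x + s *\<^sub>R e) - h x\<bar> \<le> L * \<bar>s\<bar>"
    and der: "AE x in lebesgue. ((\<lambda>s. h (x + s *\<^sub>R e)) has_real_derivative g x) (at 0)"
    and gm: "g \<in> borel_measurable lebesgue"
  shows "integrable lebesgue g" "integral\<^sup>L lebesgue g = 0"
proof -
  define s where "s n = \<delta> / real (n + 2)" for n
  have s: "0 < s n" "s n < \<delta>" for n using \<delta> by (auto simp: s_def field_simps intro: add_pos_nonneg)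
  have s0: "s \<longlonglongrightarrow> 0"
  proof -
    have "(\<lambda>n. \<delta> / real (n + 2)) \<longlonglongrightarrow> 0"
      using LIMSEQ_ignore_initial_segment[OF lim_const_over_n[of \<delta>], of 2] by simp
    then show ?thesis by (simp add: s_def[abs_def])
  qed
  define q where "q n x = (h (x + s n *\<^sub>R e) - h x) / s n" for n x
  have [measurable]: "h \<in> borel_measurable borel" using h by auto
  have tr: "integrable lborel (\<lambda>x. h (x + c))" "(LINT x|lborel. h (x + c)) = integral\<^sup>L lborel h" for c
  proof -
    have d: "distr lborel borel ((+) c) = lborel" by (rule lborel_distr_plus)
    show "integrable lborel (\<lambda>x. h (x + c))"
      using h by (subst (asm) d[symmetric]) (simp add: integrable_distr_eq add.commute)
    show "(LINT x|lborel. h (x + c)) = integral\<^sup>L lborel h"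
      by (subst (2) d[symmetric]) (simp add: integral_distr add.commute)
  qed
  have qi: "integrable lborel (q n)" "integral\<^sup>L lborel (q n) = 0" for n
    using h tr[of "s n *\<^sub>R e"] by (auto simp: q_def[abs_def])
  have qm: "q n \<in> borel_measurable borel" for n using qi(1)[of n] by auto
  have q_int0: "integral\<^sup>L lebesgue (q n) = 0" for n
    using qi(2)[of n] qm[of n] by (simp add: integral_completion)
  obtain R where R: "\<And>x. x \<in> S \<Longrightarrow> norm x \<le> R" using S(1) by (auto simp: bounded_iff)
  define B where "B = cball (0::real^'n) (R + \<delta> * norm e)"
  have w: "integrable lebesgue (\<lambda>x. \<bar>L\<bar> * indicat_real B x)"
  proof -
    have "integrable lborel (\<lambda>x. indicator B x *\<^sub>R (\<bar>L\<bar>::real))"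
      unfolding B_def by (rule borel_integrable_compact) auto
    then show ?thesis
      using integrable_completion[of "\<lambda>x. indicator B x *\<^sub>R (\<bar>L\<bar>::real)" lborel] by (auto simp: mult.commute B_def)
  qed
  have b: "norm (q n x) \<le> \<bar>L\<bar> * indicat_real B x" for n x
  proof (cases "x \<in> B")
    case True
    have "\<bar>h (x + s n *\<^sub>R e) - h x\<bar> \<le> \<bar>L\<bar> * s n"
      using lip[of "s n" x] s[of n] by (smt (verit) mult_right_mono)
    then show ?thesis using True s[of n] by (simp add: q_def field_simps)
  next
    case False
    have "x \<notin> S" using False R[of x] \<delta> by (smt (verit) B_def mem_cball_0 mult_nonneg_nonneg norm_ge_zero)
    moreover have "x + s n *\<^sub>R e \<notin> S"
    proof
      assume "x + s n *\<^sub>R e \<in> S"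
      then have "norm (x + s n *\<^sub>R e) \<le> R" by (rule R)
      moreover have "norm x \<le> norm (x + s n *\<^sub>R e) + norm (s n *\<^sub>R e)"
        by (metis add_diff_cancel_right' norm_triangle_ineq4)
      moreover have "norm (s n *\<^sub>R e) \<le> \<delta> * norm e" using s[of n] by (simp add: mult_right_mono)
      ultimately show False using False by (simp add: B_def)
    qed
    ultimately show ?thesis by (simp add: q_def S(2))
  qed
  have lim: "AE x in lebesgue. (\<lambda>n. q n x) \<longlonglongrightarrow> g x"
    using der
  proof eventually_elim
    fix x assume "((\<lambda>s. h (x + s *\<^sub>R e)) has_real_derivative g x) (at 0)"
    then have "((\<lambda>s. (h (x + s *\<^sub>R e) - h x) / s) \<longlongrightarrow> g x) (at 0)"
      by (simp add: has_field_derivative_iff)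
    then show "(\<lambda>n. q n x) \<longlonglongrightarrow> g x"
      unfolding q_def
    proof (rule filterlim_compose)
      show "filterlim s (at 0) sequentially"
        using s0 s(1) by (auto simp: filterlim_at intro!: always_eventually less_imp_neq[symmetric])
    qed
  qed
  show "integrable lebesgue g"
    by (rule integrable_dominated_convergence[OF gm _ w lim]) (use b qm in \<open>auto simp: measurable_completion\<close>)
  have "(\<lambda>n. integral\<^sup>L lebesgue (q n)) \<longlonglongrightarrow> integral\<^sup>L lebesgue g"
    by (rule integral_dominated_convergence[OF gm _ w lim]) (use b qm in \<open>auto simp: measurable_completion\<close>)
  then show "integral\<^sup>L lebesgue g = 0" by (simp add: q_int0 LIMSEQ_const_iff)
qed

lemma C1_lipschitz_on_segments:
  fixes f :: "real^'n \<Rightarrow> real"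
  assumes d: "\<And>x. f differentiable (at x)" and c: "\<And>i. continuous_on UNIV (partial_deriv i f)" and S: "compact S"
  shows "\<exists>L. \<forall>x y. closed_segment x y \<subseteq> S \<longrightarrow> \<bar>f x - f y\<bar> \<le> L * norm (x - y)"
proof -
  define D where "D x = (\<chi> i. partial_deriv i f x)" for x
  have "continuous_on S D" unfolding D_def
    by (intro continuous_on_vec_lambda continuous_on_subset[OF c]) auto
  then have "bounded (D ` S)" using S compact_continuous_image compact_imp_bounded by blast
  then obtain L where L: "\<And>x. x \<in> S \<Longrightarrow> norm (D x) \<le> L" by (auto simp: bounded_iff)
  have "\<bar>f x - f y\<bar> \<le> L * norm (x - y)" if xy: "closed_segment x y \<subseteq> S" for x y
  proof -
    have "norm (f x - f y) \<le> L * norm (x - y)"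
    proof (rule differentiable_bound[OF convex_closed_segment])
      fix z assume z: "z \<in> closed_segment x y"
      have eq: "(\<lambda>h. \<Sum>i\<in>UNIV. h $ i * partial_deriv i f z) = (\<lambda>h. h \<bullet> D z)"
        by (simp add: inner_vec_def D_def)
      show "(f has_derivative (\<lambda>h. h \<bullet> D z)) (at z within closed_segment x y)"
        using has_derivative_partial_deriv[OF d[of z]] by (simp add: eq has_derivative_at_withinI)
      show "onorm (\<lambda>h. h \<bullet> D z) \<le> L"
      proof (rule onorm_le)
        fix h
        have "norm (h \<bullet> D z) \<le> norm (D z) * norm h"
          using Cauchy_Schwarz_ineq2[of h "D z"] by (simp add: mult.commute)
        also have "\<dots> \<le> L * norm h" using L[of z] z xy by (intro mult_right_mono) auto
        finally show "norm (h \<bullet> D z) \<le> L * norm h" .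
      qed
    qed auto
    then show ?thesis by simp
  qed
  then show ?thesis by blast
qed

lemma test_function_C1:
  assumes "\<phi> \<in> test_functions \<Omega>"
  shows "\<phi> differentiable (at x)" "continuous_on UNIV \<phi>" "continuous_on UNIV (partial_deriv i \<phi>)"
proof -
  have "C_k 0 \<phi>" "C_k 1 \<phi>" using assms unfolding test_functions_def by blast+
  then show "\<phi> differentiable (at x)" "continuous_on UNIV \<phi>" "continuous_on UNIV (partial_deriv i \<phi>)" by auto
qed

lemma partial_deriv_outside_support:
  assumes "x \<notin> closure {x. \<phi> x \<noteq> 0}" shows "partial_deriv i \<phi> x = 0"
proof -
  have z: "\<phi> y = 0" if "y \<in> - closure {x. \<phi> x \<noteq> 0}" for y
    using that closure_subset[of "{x. \<phi> x \<noteq> 0}"] by blast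
  have "(\<phi> has_derivative (\<lambda>_. 0)) (at x)"
  proof (rule has_derivative_transform_within_open[OF has_derivative_const[of 0]])
    show "open (- closure {x. \<phi> x \<noteq> 0})" by (rule open_Compl) simp
    show "x \<in> - closure {x. \<phi> x \<noteq> 0}" using assms by simp
    show "0 = \<phi> y" if "y \<in> - closure {x. \<phi> x \<noteq> 0}" for y using z[OF that] by (rule sym)
  qed
  then show ?thesis by (simp add: partial_deriv_has_derivative)
qed

text \<open>The product \<open>q * \<phi>\<close>, extended by zero, is Lipschitz with compact support, so its derivative has
  integral zero. Lipschitz bounds along segments in compact subsets are what a continuous
  piecewise polynomial satisfies on a domain that is not convex.\<close>

lemma integration_by_parts_lipschitz:
  fixes q g :: "real^'n \<Rightarrow> real"
  assumes \<Omega>: "open \<Omega>" and \<phi>: "\<phi> \<in> test_functions \<Omega>" and q: "continuous_on \<Omega> q"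
    and lip: "\<And>S. compact S \<Longrightarrow> S \<subseteq> \<Omega> \<Longrightarrow> \<exists>L. \<forall>x y. closed_segment x y \<subseteq> S \<longrightarrow> \<bar>q x - q y\<bar> \<le> L * norm (x - y)"
    and der: "AE x in lebesgue_on \<Omega>. ((\<lambda>s. q (x + s *\<^sub>R axis i 1)) has_real_derivative g x) (at 0)"
    and gm: "g \<in> borel_measurable (lebesgue_on \<Omega>)"
  shows "(LINT x|lebesgue_on \<Omega>. q x * partial_deriv i \<phi> x) = - (LINT x|lebesgue_on \<Omega>. g x * \<phi> x)"
proof -
  define K where "K = closure {x. \<phi> x \<noteq> 0}"
  have K: "compact K" "K \<subseteq> \<Omega>" using \<phi> by (auto simp: test_functions_def K_def)
  have \<phi>0: "\<phi> x = 0" if "x \<notin> K" for x using that closure_subset[of "{x. \<phi> x \<noteq> 0}"] by (auto simp: K_def)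
  have d\<phi>0: "partial_deriv i \<phi> x = 0" if "x \<notin> K" for x using that unfolding K_def by (rule partial_deriv_outside_support)
  have [measurable]: "\<Omega> \<in> sets lebesgue" using \<Omega> by auto
  obtain \<epsilon> where \<epsilon>: "\<epsilon> > 0" "(\<Union>x\<in>K. cball x \<epsilon>) \<subseteq> \<Omega>"
    using compact_subset_open_imp_cball_epsilon_subset[OF K(1) \<Omega> K(2)] by blast
  \<comment> \<open>a compact neighbourhood of the support that contains all segments of length below \<open>\<epsilon>\<close> meeting \<open>K\<close>\<close>
  define S where "S = {x + y |x y. x \<in> K \<and> y \<in> cball 0 \<epsilon>}"
  have S: "compact S" unfolding S_def by (intro compact_sums K compact_cball)
  have S_iff: "z \<in> S \<longleftrightarrow> (\<exists>x\<in>K. dist x z \<le> \<epsilon>)" for z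
  proof
    assume "z \<in> S"
    then obtain x y where "x \<in> K" "norm y \<le> \<epsilon>" "z = x + y" unfolding S_def by auto
    then show "\<exists>x\<in>K. dist x z \<le> \<epsilon>" by (intro bexI[of _ x]) (auto simp: dist_norm)
  next
    assume "\<exists>x\<in>K. dist x z \<le> \<epsilon>"
    then obtain x where "x \<in> K" "dist x z \<le> \<epsilon>" by blast
    then have "z = x + (z - x) \<and> x \<in> K \<and> z - x \<in> cball 0 \<epsilon>"
      by (simp add: dist_norm norm_minus_commute)
    then show "z \<in> S" unfolding S_def by blast
  qed
  have S\<Omega>: "S \<subseteq> \<Omega>" using \<epsilon> by (auto simp: S_iff)
  have KS: "K \<subseteq> S"
  proof
    fix x assume "x \<in> K"
    moreover have "dist x x \<le> \<epsilon>" using \<epsilon>(1) by simp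
    ultimately show "x \<in> S" unfolding S_iff by blast
  qed
  obtain Lq where Lq: "\<And>x y. closed_segment x y \<subseteq> S \<Longrightarrow> \<bar>q x - q y\<bar> \<le> Lq * norm (x - y)"
    using lip[OF S S\<Omega>] by blast
  obtain Lp where Lp: "\<And>x y. closed_segment x y \<subseteq> S \<Longrightarrow> \<bar>\<phi> x - \<phi> y\<bar> \<le> Lp * norm (x - y)"
    using C1_lipschitz_on_segments[OF test_function_C1(1)[OF \<phi>] test_function_C1(3)[OF \<phi>] S] by blast
  have qS: "continuous_on S q" using q S\<Omega> continuous_on_subset by blast
  have \<phi>S: "continuous_on S \<phi>" using test_function_C1(2)[OF \<phi>] continuous_on_subset by blast
  have bdd: "bounded (q ` S)" "bounded (\<phi> ` S)"
    by (rule compact_imp_bounded[OF compact_continuous_image[OF qS S]])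
      (rule compact_imp_bounded[OF compact_continuous_image[OF \<phi>S S]])
  obtain Bq where Bq: "\<And>x. x \<in> S \<Longrightarrow> \<bar>q x\<bar> \<le> Bq" using bdd(1) by (auto simp: bounded_iff)
  obtain Bp where Bp: "\<And>x. x \<in> S \<Longrightarrow> \<bar>\<phi> x\<bar> \<le> Bp" using bdd(2) by (auto simp: bounded_iff)
  note B = Bq Bp
  define h where "h x = indicator S x *\<^sub>R (q x * \<phi> x)" for x
  have hi: "integrable lborel h" unfolding h_def
    by (rule borel_integrable_compact[OF S]) (intro continuous_intros qS \<phi>S)
  have h0: "h x = 0" if "x \<notin> K" for x using \<phi>0[OF that] by (simp add: h_def)
  have hO: "h x = q x * \<phi> x" if "x \<in> \<Omega>" for x
    using \<phi>0[of x] KS by (auto simp: h_def indicator_def)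
  define G where "G x = indicator \<Omega> x * (q x * partial_deriv i \<phi> x + g x * \<phi> x)" for x
  define L where "L = \<bar>Bq\<bar> * \<bar>Lp\<bar> + \<bar>Bp\<bar> * \<bar>Lq\<bar>"
  let ?e = "axis i (1::real)"
  have qm: "q \<in> borel_measurable (lebesgue_on \<Omega>)"
    using q by (intro continuous_imp_measurable_on_sets_lebesgue) auto
  have \<phi>m: "\<phi> \<in> borel_measurable (lebesgue_on \<Omega>)" "partial_deriv i \<phi> \<in> borel_measurable (lebesgue_on \<Omega>)"
    using test_function_C1[OF \<phi>] by (auto intro!: continuous_imp_measurable_on_sets_lebesgue intro: continuous_on_subset)
  have Gint: "integral\<^sup>L lebesgue G = 0" and Gi: "integrable lebesgue G"
  proof -
    have bK: "bounded K" using K compact_imp_bounded by blast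
    have lipb: "\<bar>h (x + s *\<^sub>R ?e) - h x\<bar> \<le> L * \<bar>s\<bar>" if s: "\<bar>s\<bar> < \<epsilon>" for x s
    proof (cases "x \<in> K \<or> x + s *\<^sub>R ?e \<in> K")
      case False
      then show ?thesis by (simp add: h0 L_def)
    next
      case True
      have dd: "dist x (x + s *\<^sub>R ?e) \<le> \<epsilon>" using s by (simp add: dist_norm norm_axis_1)
      have seg: "closed_segment (x + s *\<^sub>R ?e) x \<subseteq> S"
      proof
        fix z assume z: "z \<in> closed_segment (x + s *\<^sub>R ?e) x"
        show "z \<in> S"
        proof -
          have "dist x z \<le> \<epsilon>" "dist (x + s *\<^sub>R ?e) z \<le> \<epsilon>"
            using dist_in_closed_segment[OF z] dd by (simp_all add: dist_commute)
          then show ?thesis using True unfolding S_iff by blast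
        qed
      qed
      then have xS: "x \<in> S" "x + s *\<^sub>R ?e \<in> S" by auto
      let ?y = "x + s *\<^sub>R ?e"
      have "h ?y - h x = q ?y * (\<phi> ?y - \<phi> x) + \<phi> x * (q ?y - q x)"
        using xS by (simp add: h_def algebra_simps)
      also have "\<bar>\<dots>\<bar> \<le> \<bar>q ?y\<bar> * \<bar>\<phi> ?y - \<phi> x\<bar> + \<bar>\<phi> x\<bar> * \<bar>q ?y - q x\<bar>"
        by (metis abs_mult abs_triangle_ineq)
      also have "\<dots> \<le> \<bar>Bq\<bar> * (\<bar>Lp\<bar> * \<bar>s\<bar>) + \<bar>Bp\<bar> * (\<bar>Lq\<bar> * \<bar>s\<bar>)"
      proof (intro add_mono mult_mono)
        have n: "norm (?y - x) = \<bar>s\<bar>" by (simp add: norm_axis_1)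
        show "\<bar>\<phi> ?y - \<phi> x\<bar> \<le> \<bar>Lp\<bar> * \<bar>s\<bar>" using Lp[OF seg] n by (smt (verit) mult_right_mono)
        show "\<bar>q ?y - q x\<bar> \<le> \<bar>Lq\<bar> * \<bar>s\<bar>" using Lq[OF seg] n by (smt (verit) mult_right_mono)
        show "\<bar>q ?y\<bar> \<le> \<bar>Bq\<bar>" "\<bar>\<phi> x\<bar> \<le> \<bar>Bp\<bar>" using B xS by (meson abs_ge_self order_trans)+
      qed auto
      also have "\<dots> = L * \<bar>s\<bar>" by (simp add: L_def algebra_simps)
      finally show ?thesis .
    qed
    have derb: "AE x in lebesgue. ((\<lambda>s. h (x + s *\<^sub>R ?e)) has_real_derivative G x) (at 0)"
    proof -
      have "AE x in lebesgue. x \<in> \<Omega> \<longrightarrow> ((\<lambda>s. q (x + s *\<^sub>R ?e)) has_real_derivative g x) (at 0)"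
        using der by (simp add: AE_restrict_space_iff)
      then show ?thesis
      proof eventually_elim
        fix x assume a: "x \<in> \<Omega> \<longrightarrow> ((\<lambda>s. q (x + s *\<^sub>R ?e)) has_real_derivative g x) (at 0)"
        have tend: "((\<lambda>s. x + s *\<^sub>R ?e) \<longlongrightarrow> x) (nhds 0)"
          by (rule tendsto_eq_intros filterlim_ident refl | simp)+
        show "((\<lambda>s. h (x + s *\<^sub>R ?e)) has_real_derivative G x) (at 0)"
        proof (cases "x \<in> \<Omega>")
          case True
          have D: "((\<lambda>s. q (x + s *\<^sub>R ?e) * \<phi> (x + s *\<^sub>R ?e)) has_real_derivative G x) (at 0)"
            using DERIV_mult[OF a[rule_format, OF True] partial_deriv_DERIV[OF test_function_C1(1)[OF \<phi>], of x i]] True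
            by (simp add: G_def algebra_simps)
          have "eventually (\<lambda>s. h (x + s *\<^sub>R ?e) = q (x + s *\<^sub>R ?e) * \<phi> (x + s *\<^sub>R ?e)) (nhds 0)"
            using topological_tendstoD[OF tend \<Omega> True] by eventually_elim (rule hO)
          with D show ?thesis by (subst DERIV_cong_ev[OF refl _ refl])
        next
          case False
          then have "x \<in> - K" "open (- K)" using K by (auto simp: compact_imp_closed)
          then have "eventually (\<lambda>s. x + s *\<^sub>R ?e \<in> - K) (nhds 0)"
            using topological_tendstoD[OF tend] by blast
          then have "eventually (\<lambda>s. h (x + s *\<^sub>R ?e) = 0) (nhds 0)"
            by eventually_elim (simp add: h0)
          moreover have "((\<lambda>s::real. 0) has_real_derivative G x) (at 0)" using False by (simp add: G_def)
          ultimately show ?thesis by (subst DERIV_cong_ev[OF refl _ refl])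
        qed
      qed
    qed
    have Gm: "G \<in> borel_measurable lebesgue"
    proof -
      have "(\<lambda>x. q x * partial_deriv i \<phi> x + g x * \<phi> x) \<in> borel_measurable (lebesgue_on \<Omega>)"
        using qm \<phi>m gm by measurable
      then show ?thesis by (simp add: borel_measurable_restrict_space_iff G_def[abs_def])
    qed
    show "integrable lebesgue G"
      by (rule integral_lipschitz_derivative_zero(1)[OF hi bK h0 \<epsilon>(1) lipb derb Gm])
    show "integral\<^sup>L lebesgue G = 0"
      by (rule integral_lipschitz_derivative_zero(2)[OF hi bK h0 \<epsilon>(1) lipb derb Gm])
  qed
  have i1: "integrable (lebesgue_on \<Omega>) (\<lambda>x. q x * partial_deriv i \<phi> x)"
  proof -
    have "integrable lborel (\<lambda>x. indicator S x *\<^sub>R (q x * partial_deriv i \<phi> x))"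
      by (rule borel_integrable_compact[OF S])
        (intro continuous_intros qS continuous_on_subset[OF test_function_C1(3)[OF \<phi>]] subset_UNIV)
    then have "integrable lebesgue (\<lambda>x. indicator S x *\<^sub>R (q x * partial_deriv i \<phi> x))"
      by (rule integrable_lebesgue)
    moreover have "(\<lambda>x. indicator S x *\<^sub>R (q x * partial_deriv i \<phi> x)) = (\<lambda>x. indicator \<Omega> x *\<^sub>R (q x * partial_deriv i \<phi> x))"
    proof
      fix x show "indicator S x *\<^sub>R (q x * partial_deriv i \<phi> x) = indicator \<Omega> x *\<^sub>R (q x * partial_deriv i \<phi> x)"
        using d\<phi>0[of x] KS S\<Omega> by (cases "x \<in> K") (auto simp: indicator_def)
    qed
    ultimately show ?thesis by (simp add: integrable_restrict_space)
  qed
  have G': "integrable (lebesgue_on \<Omega>) (\<lambda>x. q x * partial_deriv i \<phi> x + g x * \<phi> x)"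
    using Gi by (simp add: integrable_restrict_space G_def[abs_def])
  have i2: "integrable (lebesgue_on \<Omega>) (\<lambda>x. g x * \<phi> x)"
    using Bochner_Integration.integrable_diff[OF G' i1] by simp
  have "0 = (LINT x|lebesgue_on \<Omega>. q x * partial_deriv i \<phi> x + g x * \<phi> x)"
    using Gint by (simp add: integral_restrict_space G_def[abs_def])
  also have "\<dots> = (LINT x|lebesgue_on \<Omega>. q x * partial_deriv i \<phi> x) + (LINT x|lebesgue_on \<Omega>. g x * \<phi> x)"
    by (rule Bochner_Integration.integral_add[OF i1 i2])
  finally show ?thesis by simp
qed

lemma integration_by_parts_C1:
  fixes q :: "real^'n \<Rightarrow> real"
  assumes \<Omega>: "open \<Omega>" and \<phi>: "\<phi> \<in> test_functions \<Omega>"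
    and q: "\<And>x. q differentiable (at x)" "\<And>j. continuous_on UNIV (partial_deriv j q)"
  shows "(LINT x|lebesgue_on \<Omega>. q x * partial_deriv i \<phi> x) = - (LINT x|lebesgue_on \<Omega>. partial_deriv i q x * \<phi> x)"
proof (rule integration_by_parts_lipschitz[OF \<Omega> \<phi>])
  show "continuous_on \<Omega> q"
    using q(1) by (intro continuous_at_imp_continuous_on ballI differentiable_imp_continuous_within)
  show "\<exists>L. \<forall>x y. closed_segment x y \<subseteq> S \<longrightarrow> \<bar>q x - q y\<bar> \<le> L * norm (x - y)" if "compact S" for S
    by (rule C1_lipschitz_on_segments[OF q that])
  show "AE x in lebesgue_on \<Omega>. ((\<lambda>s. q (x + s *\<^sub>R axis i 1)) has_real_derivative partial_deriv i q x) (at 0)"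
    by (intro AE_I2 partial_deriv_DERIV q)
  show "partial_deriv i q \<in> borel_measurable (lebesgue_on \<Omega>)"
    using \<Omega> by (intro continuous_imp_measurable_on_sets_lebesgue continuous_on_subset[OF q(2)]) auto
qed

lemma zero_test_function: "(\<lambda>x. 0) \<in> test_functions (\<Omega> :: (real^'n) set)"
proof -
  have "C_k m (\<lambda>x::real^'n. 0)" for m by (rule bump_algebra_C_k[OF bump_algebra.const])
  then show ?thesis by (simp add: test_functions_def)
qed

lemma L2_norm_pair_sqrt:
  assumes "f \<in> L2 \<Omega>" "g \<in> L2 \<Omega>"
  shows "L2_norm \<Omega> (\<lambda>x. (f x, g x)) = sqrt ((L2_norm \<Omega> f)\<^sup>2 + (L2_norm \<Omega> g)\<^sup>2)"
  using L2_norm_pair[OF assms] by (metis L2_norm_nonneg real_sqrt_unique)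

locale bounded_open =
  fixes \<Omega> :: "(real^'n) set"
  assumes open_dom: "open \<Omega>" and bounded_dom: "bounded \<Omega>"
begin

lemma dom_sets [simp]: "\<Omega> \<in> sets lebesgue"
  using open_dom by auto

lemma continuous_L2:
  fixes f :: "real^'n \<Rightarrow> 'b::euclidean_space"
  assumes "continuous_on (closure \<Omega>) f" shows "f \<in> L2 \<Omega>"
proof -
  have "bounded (f ` closure \<Omega>)"
    using compact_imp_bounded[OF compact_continuous_image[OF assms]] bounded_dom by (simp add: compact_closure)
  then obtain B where B: "\<And>x. x \<in> closure \<Omega> \<Longrightarrow> norm (f x) \<le> B" by (auto simp: bounded_iff)
  have "continuous_on \<Omega> f" using assms closure_subset continuous_on_subset by blast
  then have "f \<in> borel_measurable (lebesgue_on \<Omega>)" by (rule continuous_imp_measurable_on_sets_lebesgue) simp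
  then show ?thesis using B closure_subset[of \<Omega>] bounded_dom by (intro L2_bounded_function[of \<Omega> f B]) auto
qed

lemma continuous_UNIV_L2: "continuous_on UNIV f \<Longrightarrow> f \<in> L2 \<Omega>"
  for f :: "real^'n \<Rightarrow> 'b::euclidean_space"
  by (rule continuous_L2) (rule continuous_on_subset, auto)

lemma test_function_L2: "\<phi> \<in> test_functions \<Omega> \<Longrightarrow> \<phi> \<in> L2 \<Omega>"
  and test_function_deriv_L2: "\<phi> \<in> test_functions \<Omega> \<Longrightarrow> partial_deriv i \<phi> \<in> L2 \<Omega>"
  using test_function_C1 continuous_UNIV_L2 by blast+

lemma test_function_grad_L2: "\<phi> \<in> test_functions \<Omega> \<Longrightarrow> (\<lambda>x. \<chi> i. partial_deriv i \<phi> x) \<in> L2 \<Omega>"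
  by (rule L2_vec) (simp add: test_function_deriv_L2)

lemma fundamental_lemma_eq:
  fixes G H :: "real^'n \<Rightarrow> real"
  assumes "G \<in> L2 \<Omega>" "H \<in> L2 \<Omega>"
    "\<And>\<phi>. \<phi> \<in> test_functions \<Omega> \<Longrightarrow> (LINT x|lebesgue_on \<Omega>. G x * \<phi> x) = (LINT x|lebesgue_on \<Omega>. H x * \<phi> x)"
  shows "AE x in lebesgue_on \<Omega>. G x = H x"
proof -
  have "AE x in lebesgue_on \<Omega>. G x - H x = 0"
    by (rule fundamental_lemma[OF open_dom L2_diff[OF assms(1,2)]])
      (use assms test_function_L2 in \<open>simp add: left_diff_distrib L2_mult_integrable\<close>)
  then show ?thesis by simp
qed

lemma has_weak_grad_unique:
  assumes "has_weak_grad \<Omega> p G" "has_weak_grad \<Omega> p H"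
  shows "AE x in lebesgue_on \<Omega>. G x = H x"
proof -
  have "AE x in lebesgue_on \<Omega>. G x $ i = H x $ i" for i
  proof (rule fundamental_lemma_eq)
    show "(\<lambda>x. G x $ i) \<in> L2 \<Omega>" "(\<lambda>x. H x $ i) \<in> L2 \<Omega>"
      using assms by (auto simp: has_weak_grad_def intro: L2_component)
    fix \<phi> assume \<phi>: "\<phi> \<in> test_functions \<Omega>"
    have "(LINT x|lebesgue_on \<Omega>. p x * partial_deriv i \<phi> x) = - (LINT x|lebesgue_on \<Omega>. G x $ i * \<phi> x)"
      using assms(1) \<phi> unfolding has_weak_grad_def by blast
    moreover have "(LINT x|lebesgue_on \<Omega>. p x * partial_deriv i \<phi> x) = - (LINT x|lebesgue_on \<Omega>. H x $ i * \<phi> x)"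
      using assms(2) \<phi> unfolding has_weak_grad_def by blast
    ultimately show "(LINT x|lebesgue_on \<Omega>. G x $ i * \<phi> x) = (LINT x|lebesgue_on \<Omega>. H x $ i * \<phi> x)" by linarith
  qed
  then show ?thesis by (simp add: vec_eq_iff AE_all_countable)
qed

lemma has_weak_div_unique:
  assumes "has_weak_div \<Omega> t g" "has_weak_div \<Omega> t h"
  shows "AE x in lebesgue_on \<Omega>. g x = h x"
proof (rule fundamental_lemma_eq)
  show "g \<in> L2 \<Omega>" "h \<in> L2 \<Omega>" using assms by (auto simp: has_weak_div_def)
  fix \<phi> assume \<phi>: "\<phi> \<in> test_functions \<Omega>"
  let ?I = "LINT x|lebesgue_on \<Omega>. t x \<bullet> (\<chi> i. partial_deriv i \<phi> x)"
  have "?I = - (LINT x|lebesgue_on \<Omega>. g x * \<phi> x)" using assms(1) \<phi> unfolding has_weak_div_def by blast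
  moreover have "?I = - (LINT x|lebesgue_on \<Omega>. h x * \<phi> x)" using assms(2) \<phi> unfolding has_weak_div_def by blast
  ultimately show "(LINT x|lebesgue_on \<Omega>. g x * \<phi> x) = (LINT x|lebesgue_on \<Omega>. h x * \<phi> x)" by linarith
qed

lemma has_weak_grad_weak_grad: "has_weak_grad \<Omega> p G \<Longrightarrow> has_weak_grad \<Omega> p (weak_grad \<Omega> p)"
  unfolding weak_grad_def by (rule someI[of "has_weak_grad \<Omega> p"])

lemma has_weak_div_weak_div: "has_weak_div \<Omega> t g \<Longrightarrow> has_weak_div \<Omega> t (weak_div \<Omega> t)"
  unfolding weak_div_def by (rule someI[of "has_weak_div \<Omega> t"])

lemma weak_grad_AE: "has_weak_grad \<Omega> p G \<Longrightarrow> AE x in lebesgue_on \<Omega>. weak_grad \<Omega> p x = G x"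
  using has_weak_grad_unique has_weak_grad_weak_grad by blast

lemma weak_div_AE: "has_weak_div \<Omega> t g \<Longrightarrow> AE x in lebesgue_on \<Omega>. weak_div \<Omega> t x = g x"
  using has_weak_div_unique has_weak_div_weak_div by blast

lemma has_weak_grad_lincomb:
  assumes "p \<in> L2 \<Omega>" "q \<in> L2 \<Omega>" "has_weak_grad \<Omega> p G" "has_weak_grad \<Omega> q H"
  shows "has_weak_grad \<Omega> (\<lambda>x. c * p x + q x) (\<lambda>x. c *\<^sub>R G x + H x)"
  unfolding has_weak_grad_def
proof (intro conjI ballI allI)
  have GH: "G \<in> L2 \<Omega>" "H \<in> L2 \<Omega>" using assms by (auto simp: has_weak_grad_def)
  then show "(\<lambda>x. c *\<^sub>R G x + H x) \<in> L2 \<Omega>" by (intro L2_add L2_scale)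
  fix \<phi> i assume \<phi>: "\<phi> \<in> test_functions \<Omega>"
  note L = test_function_L2[OF \<phi>] test_function_deriv_L2[OF \<phi>, of i] assms(1,2) L2_component[OF GH(1), of i] L2_component[OF GH(2), of i]
  have "(LINT x|lebesgue_on \<Omega>. (c * p x + q x) * partial_deriv i \<phi> x)
    = c * (LINT x|lebesgue_on \<Omega>. p x * partial_deriv i \<phi> x) + (LINT x|lebesgue_on \<Omega>. q x * partial_deriv i \<phi> x)"
    using L by (simp add: distrib_right mult.assoc L2_mult_integrable)
  also have "\<dots> = - (c * (LINT x|lebesgue_on \<Omega>. G x $ i * \<phi> x) + (LINT x|lebesgue_on \<Omega>. H x $ i * \<phi> x))"
    using assms \<phi> by (simp add: has_weak_grad_def)
  also have "\<dots> = - (LINT x|lebesgue_on \<Omega>. (c *\<^sub>R G x + H x) $ i * \<phi> x)"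
    using L by (simp add: distrib_right mult.assoc L2_mult_integrable)
  finally show "(LINT x|lebesgue_on \<Omega>. (c * p x + q x) * partial_deriv i \<phi> x)
    = - (LINT x|lebesgue_on \<Omega>. (c *\<^sub>R G x + H x) $ i * \<phi> x)" .
qed

lemma has_weak_div_lincomb:
  assumes "t \<in> L2 \<Omega>" "s \<in> L2 \<Omega>" "has_weak_div \<Omega> t g" "has_weak_div \<Omega> s h"
  shows "has_weak_div \<Omega> (\<lambda>x. c *\<^sub>R t x + s x) (\<lambda>x. c * g x + h x)"
  unfolding has_weak_div_def
proof (intro conjI ballI)
  have gh: "g \<in> L2 \<Omega>" "h \<in> L2 \<Omega>" using assms by (auto simp: has_weak_div_def)
  then show "(\<lambda>x. c * g x + h x) \<in> L2 \<Omega>" by (intro L2_add L2_mult)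
  fix \<phi> assume \<phi>: "\<phi> \<in> test_functions \<Omega>"
  let ?D = "\<lambda>x. \<chi> i. partial_deriv i \<phi> x"
  note L = test_function_L2[OF \<phi>] test_function_grad_L2[OF \<phi>] assms(1,2) gh
  have "(LINT x|lebesgue_on \<Omega>. (c *\<^sub>R t x + s x) \<bullet> ?D x)
    = c * (LINT x|lebesgue_on \<Omega>. t x \<bullet> ?D x) + (LINT x|lebesgue_on \<Omega>. s x \<bullet> ?D x)"
    using L by (simp add: inner_add_left L2_inner_integrable)
  also have "\<dots> = - (c * (LINT x|lebesgue_on \<Omega>. g x * \<phi> x) + (LINT x|lebesgue_on \<Omega>. h x * \<phi> x))"
    using assms \<phi> by (simp add: has_weak_div_def)
  also have "\<dots> = - (LINT x|lebesgue_on \<Omega>. (c * g x + h x) * \<phi> x)"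
    using L by (simp add: distrib_right mult.assoc L2_mult_integrable)
  finally show "(LINT x|lebesgue_on \<Omega>. (c *\<^sub>R t x + s x) \<bullet> ?D x) = - (LINT x|lebesgue_on \<Omega>. (c * g x + h x) * \<phi> x)" .
qed

lemma has_weak_grad_C1:
  fixes q :: "real^'n \<Rightarrow> real"
  assumes q: "\<And>x. q differentiable (at x)" "\<And>j. continuous_on UNIV (partial_deriv j q)"
  shows "has_weak_grad \<Omega> q (\<lambda>x. \<chi> i. partial_deriv i q x)"
  unfolding has_weak_grad_def
proof (intro conjI ballI allI)
  show "(\<lambda>x. \<chi> i. partial_deriv i q x) \<in> L2 \<Omega>" by (rule L2_vec) (simp add: continuous_UNIV_L2 q)
  fix \<phi> i assume \<phi>: "\<phi> \<in> test_functions \<Omega>"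
  show "(LINT x|lebesgue_on \<Omega>. q x * partial_deriv i \<phi> x) = - (LINT x|lebesgue_on \<Omega>. (\<chi> i. partial_deriv i q x) $ i * \<phi> x)"
    using integration_by_parts_C1[OF open_dom \<phi> q] by simp
qed

lemma H1_L2: "p \<in> H1 \<Omega> \<Longrightarrow> p \<in> L2 \<Omega>"
  and H1_has_weak_grad: "p \<in> H1 \<Omega> \<Longrightarrow> has_weak_grad \<Omega> p (weak_grad \<Omega> p)"
  by (auto simp: H1_def intro: has_weak_grad_weak_grad)

lemma weak_grad_L2: "p \<in> H1 \<Omega> \<Longrightarrow> weak_grad \<Omega> p \<in> L2 \<Omega>"
  using H1_has_weak_grad by (auto simp: has_weak_grad_def)

lemma test_function_H1: "\<phi> \<in> test_functions \<Omega> \<Longrightarrow> \<phi> \<in> H1 \<Omega>"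
  unfolding H1_def using has_weak_grad_C1[of \<phi>] test_function_C1 test_function_L2 by blast

lemma H1_lincomb: "\<lbrakk>p \<in> H1 \<Omega>; q \<in> H1 \<Omega>\<rbrakk> \<Longrightarrow> (\<lambda>x. c * p x + q x) \<in> H1 \<Omega>"
  using has_weak_grad_lincomb[of p q _ _ c] unfolding H1_def by (auto intro!: L2_add L2_mult)

lemma weak_grad_lincomb:
  "\<lbrakk>p \<in> H1 \<Omega>; q \<in> H1 \<Omega>\<rbrakk> \<Longrightarrow>
    AE x in lebesgue_on \<Omega>. weak_grad \<Omega> (\<lambda>x. c * p x + q x) x = c *\<^sub>R weak_grad \<Omega> p x + weak_grad \<Omega> q x"
  by (intro weak_grad_AE has_weak_grad_lincomb H1_L2 H1_has_weak_grad)

lemma subspaceI_lincomb: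
  assumes "0 \<in> V" "\<And>x y c. x \<in> V \<Longrightarrow> y \<in> V \<Longrightarrow> c *\<^sub>R x + y \<in> V" shows "subspace V"
  unfolding subspace_def
proof (intro conjI ballI allI)
  fix x y c assume "x \<in> V"
  then show "c *\<^sub>R x \<in> V" using assms(2)[of x 0 c] assms(1) by simp
  assume "y \<in> V" then show "x + y \<in> V" using assms(2)[of x y 1] \<open>x \<in> V\<close> by simp
qed (rule assms)

lemma H1_subspace: "subspace (H1 \<Omega>)"
proof (rule subspaceI_lincomb)
  show "0 \<in> H1 \<Omega>" using test_function_H1[OF zero_test_function] by (simp add: zero_fun_def)
  show "c *\<^sub>R p + q \<in> H1 \<Omega>" if "p \<in> H1 \<Omega>" "q \<in> H1 \<Omega>" for p q c
    using H1_lincomb[OF that, of c] by (simp add: plus_fun_def scaleR_fun_def)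
qed

lemma Hdiv_L2: "\<tau> \<in> Hdiv \<Omega> \<Longrightarrow> \<tau> \<in> L2 \<Omega>"
  and Hdiv_has_weak_div: "\<tau> \<in> Hdiv \<Omega> \<Longrightarrow> has_weak_div \<Omega> (\<lambda>x. \<tau> x $ i) (\<lambda>x. tensor_div \<Omega> \<tau> x $ i)"
  by (auto simp: Hdiv_def tensor_div_def intro: has_weak_div_weak_div)

lemma tensor_div_L2: "\<tau> \<in> Hdiv \<Omega> \<Longrightarrow> tensor_div \<Omega> \<tau> \<in> L2 \<Omega>"
  using Hdiv_has_weak_div by (intro L2_vec) (auto simp: has_weak_div_def)

lemma tensor_div_lincomb:
  assumes "\<tau> \<in> Hdiv \<Omega>" "\<rho> \<in> Hdiv \<Omega>"
  shows "c *\<^sub>R \<tau> + \<rho> \<in> Hdiv \<Omega>"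
    and "AE x in lebesgue_on \<Omega>. tensor_div \<Omega> (c *\<^sub>R \<tau> + \<rho>) x = c *\<^sub>R tensor_div \<Omega> \<tau> x + tensor_div \<Omega> \<rho> x"
proof -
  have d: "has_weak_div \<Omega> (\<lambda>x. (c *\<^sub>R \<tau> + \<rho>) x $ i) (\<lambda>x. c * tensor_div \<Omega> \<tau> x $ i + tensor_div \<Omega> \<rho> x $ i)" for i
    using has_weak_div_lincomb[OF L2_component[OF Hdiv_L2[OF assms(1)]] L2_component[OF Hdiv_L2[OF assms(2)]]
        Hdiv_has_weak_div[OF assms(1), of i] Hdiv_has_weak_div[OF assms(2), of i], of c] by simp
  then show "c *\<^sub>R \<tau> + \<rho> \<in> Hdiv \<Omega>"
    using Hdiv_L2[OF assms(1)] Hdiv_L2[OF assms(2)] unfolding Hdiv_def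
    by (auto simp: subspace_add subspace_scale L2_subspace)
  have "AE x in lebesgue_on \<Omega>. tensor_div \<Omega> (c *\<^sub>R \<tau> + \<rho>) x $ i = (c *\<^sub>R tensor_div \<Omega> \<tau> x + tensor_div \<Omega> \<rho> x) $ i" for i
    using weak_div_AE[OF d[of i]] by (simp add: tensor_div_def)
  then show "AE x in lebesgue_on \<Omega>. tensor_div \<Omega> (c *\<^sub>R \<tau> + \<rho>) x = c *\<^sub>R tensor_div \<Omega> \<tau> x + tensor_div \<Omega> \<rho> x"
    by (simp add: vec_eq_iff AE_all_countable)
qed

lemma Hdiv_subspace: "subspace (Hdiv \<Omega>)"
proof (rule subspaceI_lincomb)
  have "has_weak_div \<Omega> (\<lambda>x. 0 :: real^'n) (\<lambda>x. 0)" by (simp add: has_weak_div_def L2_zero)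
  then have "\<forall>i. \<exists>g. has_weak_div \<Omega> (\<lambda>x. (0 :: real^'n \<Rightarrow> real^'n^'n) x $ i) g" by (simp add: exI[of _ "\<lambda>x. 0"])
  then show "0 \<in> Hdiv \<Omega>" unfolding Hdiv_def by (simp add: L2.zero_in)
qed (rule tensor_div_lincomb)

lemma L2_skew_subspace: "subspace (L2_skew \<Omega>)"
proof (rule subspaceI_lincomb)
  show "0 \<in> L2_skew \<Omega>" using L2_zero by (auto simp: L2_skew_def zero_fun_def transpose_def vec_eq_iff)
  fix \<eta> \<zeta> c assume a: "\<eta> \<in> L2_skew \<Omega>" "\<zeta> \<in> L2_skew \<Omega>"
  have "AE x in lebesgue_on \<Omega>. transpose (\<eta> x) = - \<eta> x" "AE x in lebesgue_on \<Omega>. transpose (\<zeta> x) = - \<zeta> x"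
    using a by (auto simp: L2_skew_def)
  then have "AE x in lebesgue_on \<Omega>. transpose ((c *\<^sub>R \<eta> + \<zeta>) x) = - (c *\<^sub>R \<eta> + \<zeta>) x"
  proof eventually_elim
    case (elim x)
    have "transpose (c *\<^sub>R \<eta> x + \<zeta> x) = c *\<^sub>R transpose (\<eta> x) + transpose (\<zeta> x)"
      by (simp add: transpose_def vec_eq_iff)
    then show ?case using elim by simp
  qed
  then show "c *\<^sub>R \<eta> + \<zeta> \<in> L2_skew \<Omega>"
    using a by (auto simp: L2_skew_def subspace_add subspace_scale L2_subspace)
qed

end

section \<open>The product spaces\<close>

text \<open>Each norm of the problem is the \<open>L\<^sup>2\<close> norm of one function into a product space, which
  collects the unknowns and their weak derivatives.\<close>

definition X_tuple :: "(real^'n) set \<Rightarrow> 'n xsp \<Rightarrow> real^'n \<Rightarrow> (real^'n^'n) \<times> real \<times> (real^'n)" where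
  "X_tuple \<Omega> d x = (fst d x, snd d x, weak_grad \<Omega> (snd d) x)"

definition Y_tuple :: "(real^'n) set \<Rightarrow> 'n ysp \<Rightarrow> real^'n \<Rightarrow> (real^'n^'n) \<times> (real^'n)" where
  "Y_tuple \<Omega> \<tau> x = (\<tau> x, tensor_div \<Omega> \<tau> x)"

definition Z_tuple :: "'n zsp \<Rightarrow> real^'n \<Rightarrow> (real^'n) \<times> (real^'n^'n)" where
  "Z_tuple v x = (fst v x, snd v x)"

context bounded_open
begin

lemma X_tuple_L2: "d \<in> X_space \<Omega> \<Longrightarrow> X_tuple \<Omega> d \<in> L2 \<Omega>"
  unfolding X_tuple_def[abs_def] X_space_def by (intro L2_pair) (auto simp: H1_L2 weak_grad_L2)

lemma Y_tuple_L2: "\<tau> \<in> Y_space \<Omega> \<Longrightarrow> Y_tuple \<Omega> \<tau> \<in> L2 \<Omega>"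
  unfolding Y_tuple_def[abs_def] Y_space_def by (intro L2_pair) (auto simp: Hdiv_L2 tensor_div_L2)

lemma Z_tuple_L2: "v \<in> Z_space \<Omega> \<Longrightarrow> Z_tuple v \<in> L2 \<Omega>"
  unfolding Z_tuple_def[abs_def] Z_space_def by (intro L2_pair) (auto simp: L2_skew_def)

lemma X_space_subspace: "subspace (X_space \<Omega>)"
  and Y_space_subspace: "subspace (Y_space \<Omega>)"
  and Z_space_subspace: "subspace (Z_space \<Omega>)"
  unfolding X_space_def Y_space_def Z_space_def
  by (intro subspace_Times L2_subspace H1_subspace Hdiv_subspace L2_skew_subspace)+

lemma X_tuple_lincomb:
  assumes "d \<in> X_space \<Omega>" "e \<in> X_space \<Omega>"
  shows "AE x in lebesgue_on \<Omega>. X_tuple \<Omega> (c *\<^sub>R d + e) x = c *\<^sub>R X_tuple \<Omega> d x + X_tuple \<Omega> e x"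
  using weak_grad_lincomb[of "snd d" "snd e" c] assms
  by (auto simp: X_tuple_def X_space_def plus_fun_def scaleR_fun_def elim!: eventually_mono)

sublocale X: semi_inner "X_space \<Omega>" "\<lambda>d e. L2_inner \<Omega> (X_tuple \<Omega> d) (X_tuple \<Omega> e)"
  by (rule semi_inner_pullback) (auto intro: X_space_subspace X_tuple_L2 X_tuple_lincomb)

sublocale Y: semi_inner "Y_space \<Omega>" "\<lambda>d e. L2_inner \<Omega> (Y_tuple \<Omega> d) (Y_tuple \<Omega> e)"
proof (rule semi_inner_pullback)
  show "AE x in lebesgue_on \<Omega>. Y_tuple \<Omega> (c *\<^sub>R \<tau> + \<rho>) x = c *\<^sub>R Y_tuple \<Omega> \<tau> x + Y_tuple \<Omega> \<rho> x"
    if "\<tau> \<in> Y_space \<Omega>" "\<rho> \<in> Y_space \<Omega>" for \<tau> \<rho> c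
    using tensor_div_lincomb(2)[of \<tau> \<rho> c] that by (auto simp: Y_tuple_def Y_space_def elim!: eventually_mono)
qed (auto intro: Y_space_subspace Y_tuple_L2)

sublocale Z: semi_inner "Z_space \<Omega>" "\<lambda>d e. L2_inner \<Omega> (Z_tuple d) (Z_tuple e)"
  by (rule semi_inner_pullback) (auto intro: Z_space_subspace Z_tuple_L2 simp: Z_tuple_def)

lemma X_norm_sq: "d \<in> X_space \<Omega> \<Longrightarrow> (X_norm \<Omega> d)\<^sup>2 = (L2_norm \<Omega> (fst d))\<^sup>2 + (L2_norm \<Omega> (snd d))\<^sup>2 + (L2_norm \<Omega> (weak_grad \<Omega> (snd d)))\<^sup>2"
  by (simp add: X_norm_def H1_norm_def split: prod.split)

lemma X_norm_eq: "d \<in> X_space \<Omega> \<Longrightarrow> X_norm \<Omega> d = L2_norm \<Omega> (X_tuple \<Omega> d)"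
  unfolding X_tuple_def[abs_def]
  by (cases d) (auto simp: X_norm_def H1_norm_def L2_norm_pair_sqrt L2_norm_pair L2_pair X_space_def H1_L2 weak_grad_L2)

lemma Y_norm_eq: "\<tau> \<in> Y_space \<Omega> \<Longrightarrow> Y_norm \<Omega> \<tau> = L2_norm \<Omega> (Y_tuple \<Omega> \<tau>)"
  unfolding Y_tuple_def[abs_def]
  by (auto simp: Y_norm_def L2_norm_pair_sqrt Y_space_def Hdiv_L2 tensor_div_L2)

lemma Z_norm_eq: "v \<in> Z_space \<Omega> \<Longrightarrow> Z_norm \<Omega> v = L2_norm \<Omega> (Z_tuple v)"
  unfolding Z_tuple_def[abs_def]
  by (cases v) (auto simp: Z_norm_def L2_norm_pair_sqrt Z_space_def L2_skew_def)

lemma X_nrm: "d \<in> X_space \<Omega> \<Longrightarrow> X.nrm d = X_norm \<Omega> d"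
  and Y_nrm: "\<tau> \<in> Y_space \<Omega> \<Longrightarrow> Y.nrm \<tau> = Y_norm \<Omega> \<tau>"
  and Z_nrm: "v \<in> Z_space \<Omega> \<Longrightarrow> Z.nrm v = Z_norm \<Omega> v"
  by (simp_all add: X.nrm_def Y.nrm_def Z.nrm_def X_norm_eq Y_norm_eq Z_norm_eq L2_norm_sq_inner[symmetric])

lemma XYZ_nonneg [simp]: "0 \<le> X_norm \<Omega> d" "0 \<le> Y_norm \<Omega> \<tau>" "0 \<le> Z_norm \<Omega> v" "0 \<le> H1_norm \<Omega> p"
  by (auto simp: X_norm_def Y_norm_def Z_norm_def H1_norm_def split: prod.split)

lemma tuple_norms_sq:
  "(X_norm \<Omega> (e, q))\<^sup>2 = (L2_norm \<Omega> e)\<^sup>2 + (H1_norm \<Omega> q)\<^sup>2"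
  "(H1_norm \<Omega> q)\<^sup>2 = (L2_norm \<Omega> q)\<^sup>2 + (L2_norm \<Omega> (weak_grad \<Omega> q))\<^sup>2"
  "(Y_norm \<Omega> \<tau>)\<^sup>2 = (L2_norm \<Omega> \<tau>)\<^sup>2 + (L2_norm \<Omega> (tensor_div \<Omega> \<tau>))\<^sup>2"
  "(Z_norm \<Omega> (v, \<eta>))\<^sup>2 = (L2_norm \<Omega> v)\<^sup>2 + (L2_norm \<Omega> \<eta>)\<^sup>2"
  by (simp_all add: X_norm_def H1_norm_def Y_norm_def Z_norm_def)

end

section \<open>Boundary data\<close>

context bounded_open
begin

lemma zero_H10: "(\<lambda>x. 0) \<in> H10 \<Omega>"
proof -
  have "H1_norm \<Omega> 0 = 0"
  proof -
    have "AE x in lebesgue_on \<Omega>. weak_grad \<Omega> 0 x = 0"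
      using weak_grad_AE[of 0 "\<lambda>x. 0"] by (simp add: has_weak_grad_def L2_zero)
    then have "L2_norm \<Omega> (weak_grad \<Omega> 0) = L2_norm \<Omega> (\<lambda>x. 0 :: real^'n)"
      using H1_subspace by (intro L2_norm_cong_AE weak_grad_L2 L2_zero) (auto simp: subspace_0)
    then show ?thesis by (simp add: H1_norm_def L2_norm_def)
  qed
  then have "H1_norm \<Omega> ((\<lambda>x. 0) - (\<lambda>x. 0)) < \<epsilon>" if "\<epsilon> > 0" for \<epsilon>
    using that by (simp add: fun_diff_def zero_fun_def)
  then show ?thesis unfolding H10_def using zero_test_function test_function_H1 by blast
qed

lemma trace_refl: "w \<in> H1 \<Omega> \<Longrightarrow> w \<in> bdry_trace \<Omega> w"
  using zero_H10 by (simp add: bdry_trace_def fun_diff_def)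

lemma Hhalf_norm_le: "w \<in> \<psi> \<Longrightarrow> Hhalf_norm \<Omega> \<psi> \<le> H1_norm \<Omega> w"
  unfolding Hhalf_norm_def by (rule cINF_lower) (auto intro!: bdd_belowI[of _ 0])

lemma Hhalf_norm_nonneg: "\<psi> \<in> Hhalf \<Omega> \<Longrightarrow> 0 \<le> Hhalf_norm \<Omega> \<psi>"
  unfolding Hhalf_norm_def using trace_refl by (intro cINF_greatest) (auto simp: Hhalf_def)

lemma H1_norm_scale: "w \<in> H1 \<Omega> \<Longrightarrow> H1_norm \<Omega> (\<lambda>x. c * w x) = \<bar>c\<bar> * H1_norm \<Omega> w"
proof -
  assume w: "w \<in> H1 \<Omega>"
  have d: "((0, w) :: 'n xsp) \<in> X_space \<Omega>" using w by (simp add: X_space_def L2.zero_in)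
  have "H1_norm \<Omega> q = X_norm \<Omega> (0, q)" for q by (simp add: X_norm_def L2_norm_def)
  then show ?thesis using X.nrm_scale[OF d, of c] X_nrm[OF d] X_nrm[OF X.scale_in[OF d, of c]]
    by (simp add: scaleR_fun_def zero_fun_def)
qed

lemma Hmhalf_norm_bdd:
  assumes "R \<in> Hmhalf \<Omega>"
  shows "bdd_above ((\<lambda>\<psi>. \<bar>R \<psi>\<bar>) ` {\<psi> \<in> Hhalf \<Omega>. Hhalf_norm \<Omega> \<psi> \<le> 1})"
proof -
  obtain C where C: "\<And>\<psi>. \<psi> \<in> Hhalf \<Omega> \<Longrightarrow> \<bar>R \<psi>\<bar> \<le> C * Hhalf_norm \<Omega> \<psi>"
    using assms unfolding Hmhalf_def by blast
  have "\<bar>R \<psi>\<bar> \<le> \<bar>C\<bar>" if "\<psi> \<in> Hhalf \<Omega>" "Hhalf_norm \<Omega> \<psi> \<le> 1" for \<psi>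
  proof -
    have "C * Hhalf_norm \<Omega> \<psi> \<le> \<bar>C\<bar> * 1"
      using that Hhalf_norm_nonneg[OF that(1)] by (intro mult_mono) auto
    then show ?thesis using C[OF that(1)] by simp
  qed
  then show ?thesis by (auto intro!: bdd_aboveI[of _ "\<bar>C\<bar>"])
qed

text \<open>The dual norm is a supremum over the unit ball, so for a null function \<open>w\<close> the bound comes from the
  continuity of \<open>R\<close> instead.\<close>

lemma Hmhalf_bound:
  assumes R: "R \<in> Hmhalf \<Omega>" and w: "w \<in> H1 \<Omega>"
  shows "\<bar>R (bdry_trace \<Omega> w)\<bar> \<le> Hmhalf_norm \<Omega> R * H1_norm \<Omega> w"
proof (cases "H1_norm \<Omega> w = 0")
  case True
  obtain C where C: "\<And>\<psi>. \<psi> \<in> Hhalf \<Omega> \<Longrightarrow> \<bar>R \<psi>\<bar> \<le> C * Hhalf_norm \<Omega> \<psi>"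
    using R unfolding Hmhalf_def by blast
  have t: "bdry_trace \<Omega> w \<in> Hhalf \<Omega>" using w by (simp add: Hhalf_def)
  have "Hhalf_norm \<Omega> (bdry_trace \<Omega> w) = 0"
    using Hhalf_norm_le[OF trace_refl[OF w]] Hhalf_norm_nonneg[OF t] True by simp
  then show ?thesis using C[OF t] True by simp
next
  case False
  define N where "N = H1_norm \<Omega> w"
  have N: "N > 0" using False by (simp add: N_def less_le)
  let ?w = "\<lambda>x. (1 / N) * w x"
  have w': "?w \<in> H1 \<Omega>" using subspace_scale[OF H1_subspace w, of "1 / N"] by (simp add: scaleR_fun_def)
  have t: "bdry_trace \<Omega> ?w \<in> Hhalf \<Omega>" using w' by (simp add: Hhalf_def)
  have "H1_norm \<Omega> ?w = 1" using H1_norm_scale[OF w, of "1 / N"] N by (simp add: N_def)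
  then have "Hhalf_norm \<Omega> (bdry_trace \<Omega> ?w) \<le> 1" using Hhalf_norm_le[OF trace_refl[OF w']] by simp
  then have "\<bar>R (bdry_trace \<Omega> ?w)\<bar> \<le> Hmhalf_norm \<Omega> R"
    unfolding Hmhalf_norm_def using t by (intro cSUP_upper Hmhalf_norm_bdd[OF R]) auto
  moreover have "R (bdry_trace \<Omega> ?w) = (1 / N) * R (bdry_trace \<Omega> w)"
    using R w unfolding Hmhalf_def by blast
  ultimately have "\<bar>(1 / N) * R (bdry_trace \<Omega> w)\<bar> \<le> Hmhalf_norm \<Omega> R" by (simp only:)
  then show ?thesis using N by (simp add: N_def[symmetric] abs_mult pos_divide_le_eq)
qed

lemma Hmhalf_norm_nonneg: "R \<in> Hmhalf \<Omega> \<Longrightarrow> 0 \<le> Hmhalf_norm \<Omega> R"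
proof -
  assume R: "R \<in> Hmhalf \<Omega>"
  have z: "(\<lambda>x. 0) \<in> H1 \<Omega>" by (rule test_function_H1[OF zero_test_function])
  have "H1_norm \<Omega> (\<lambda>x. 0) = 0" using H1_norm_scale[OF z, of 0] by simp
  then have "bdry_trace \<Omega> (\<lambda>x. 0) \<in> {\<psi> \<in> Hhalf \<Omega>. Hhalf_norm \<Omega> \<psi> \<le> 1}"
    using Hhalf_norm_le[OF trace_refl[OF z]] z by (auto simp: Hhalf_def)
  from cSUP_upper[OF this Hmhalf_norm_bdd[OF R]] show ?thesis unfolding Hmhalf_norm_def by linarith
qed

text \<open>The right-hand side of Green's formula. As the inner product of \<open>(div t, t)\<close> and \<open>(w, \<nabla>w)\<close> it is bounded
  by the product of the norms in \<open>H(div)\<close> and \<open>H\<^sup>1\<close>.\<close>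

definition green :: "(real^'n \<Rightarrow> real^'n) \<Rightarrow> (real^'n \<Rightarrow> real) \<Rightarrow> real" where
  "green t w = L2_inner \<Omega> (\<lambda>x. (weak_div \<Omega> t x, t x)) (\<lambda>x. (w x, weak_grad \<Omega> w x))"

lemma green_eq:
  assumes "t \<in> L2 \<Omega>" "has_weak_div \<Omega> t g" "w \<in> H1 \<Omega>"
  shows "green t w = (LINT x|lebesgue_on \<Omega>. t x \<bullet> weak_grad \<Omega> w x) + (LINT x|lebesgue_on \<Omega>. w x * weak_div \<Omega> t x)"
proof -
  have "weak_div \<Omega> t \<in> L2 \<Omega>" using has_weak_div_weak_div[OF assms(2)] by (simp add: has_weak_div_def)
  then show ?thesis
    using assms by (simp add: green_def L2_inner_def L2_inner_integrable weak_grad_L2 L2_mult_integrable H1_L2 mult.commute)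
qed

lemma green_bound:
  assumes "t \<in> L2 \<Omega>" "has_weak_div \<Omega> t g" "w \<in> H1 \<Omega>"
  shows "\<bar>green t w\<bar> \<le> sqrt ((L2_norm \<Omega> t)\<^sup>2 + (L2_norm \<Omega> (weak_div \<Omega> t))\<^sup>2) * H1_norm \<Omega> w"
proof -
  have L: "weak_div \<Omega> t \<in> L2 \<Omega>" using has_weak_div_weak_div[OF assms(2)] by (simp add: has_weak_div_def)
  have "\<bar>green t w\<bar> \<le> L2_norm \<Omega> (\<lambda>x. (weak_div \<Omega> t x, t x)) * L2_norm \<Omega> (\<lambda>x. (w x, weak_grad \<Omega> w x))"
    unfolding green_def by (intro L2_Cauchy_Schwarz L2_pair L assms H1_L2 weak_grad_L2)
  also have "L2_norm \<Omega> (\<lambda>x. (weak_div \<Omega> t x, t x)) = sqrt ((L2_norm \<Omega> t)\<^sup>2 + (L2_norm \<Omega> (weak_div \<Omega> t))\<^sup>2)"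
    using L assms by (simp add: L2_norm_pair_sqrt add.commute)
  also have "L2_norm \<Omega> (\<lambda>x. (w x, weak_grad \<Omega> w x)) = H1_norm \<Omega> w"
    using assms by (simp add: L2_norm_pair_sqrt H1_norm_def H1_L2 weak_grad_L2)
  finally show ?thesis .
qed

lemma green_diff:
  assumes t: "t \<in> L2 \<Omega>" "has_weak_div \<Omega> t g" and w: "v \<in> H1 \<Omega>" "w \<in> H1 \<Omega>"
  shows "green t (v - w) = green t v - green t w"
proof -
  have L: "weak_div \<Omega> t \<in> L2 \<Omega>" using has_weak_div_weak_div[OF t(2)] by (simp add: has_weak_div_def)
  have e: "v - w = (\<lambda>x. (-1) * w x + v x)" by (auto simp: fun_diff_def)
  have vw: "v - w \<in> H1 \<Omega>" using subspace_diff[OF H1_subspace w] .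
  let ?f = "\<lambda>x. (weak_div \<Omega> t x, t x)"
  let ?J = "\<lambda>w x. (w x, weak_grad \<Omega> w x)"
  have f: "?f \<in> L2 \<Omega>" by (intro L2_pair L t)
  have J: "?J w \<in> L2 \<Omega>" if "w \<in> H1 \<Omega>" for w using that by (intro L2_pair H1_L2 weak_grad_L2)
  have "green t (v - w) = (LINT x|lebesgue_on \<Omega>. ?f x \<bullet> (?J v x - ?J w x))"
    unfolding green_def L2_inner_def
  proof (rule integral_cong_AE)
    show "(\<lambda>x. ?f x \<bullet> ?J (v - w) x) \<in> borel_measurable (lebesgue_on \<Omega>)"
      "(\<lambda>x. ?f x \<bullet> (?J v x - ?J w x)) \<in> borel_measurable (lebesgue_on \<Omega>)"
      using L2_inner_integrable[OF f J[OF vw]] L2_inner_integrable[OF f L2_diff[OF J[OF w(1)] J[OF w(2)]]]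
      by (auto dest: borel_measurable_integrable)
    show "AE x in lebesgue_on \<Omega>. ?f x \<bullet> ?J (v - w) x = ?f x \<bullet> (?J v x - ?J w x)"
      using weak_grad_lincomb[OF w(2,1), of "-1"] unfolding e[symmetric]
      by eventually_elim simp
  qed
  also have "\<dots> = green t v - green t w"
    unfolding inner_diff_right green_def L2_inner_def
    by (rule Bochner_Integration.integral_diff) (intro L2_inner_integrable f J w)+
  finally show ?thesis .
qed

lemma green_test_function:
  assumes t: "t \<in> L2 \<Omega>" "has_weak_div \<Omega> t g" and \<phi>: "\<phi> \<in> test_functions \<Omega>"
  shows "green t \<phi> = 0"
proof -
  let ?D = "\<lambda>x. \<chi> i. partial_deriv i \<phi> x"
  have g: "AE x in lebesgue_on \<Omega>. weak_grad \<Omega> \<phi> x = ?D x"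
    by (intro weak_grad_AE has_weak_grad_C1 test_function_C1[OF \<phi>])
  have "(LINT x|lebesgue_on \<Omega>. t x \<bullet> weak_grad \<Omega> \<phi> x) = (LINT x|lebesgue_on \<Omega>. t x \<bullet> ?D x)"
  proof (rule integral_cong_AE)
    show "(\<lambda>x. t x \<bullet> weak_grad \<Omega> \<phi> x) \<in> borel_measurable (lebesgue_on \<Omega>)"
      "(\<lambda>x. t x \<bullet> ?D x) \<in> borel_measurable (lebesgue_on \<Omega>)"
      using L2_inner_integrable[OF t(1) weak_grad_L2[OF test_function_H1[OF \<phi>]]]
        L2_inner_integrable[OF t(1) test_function_grad_L2[OF \<phi>]] by (auto dest: borel_measurable_integrable)
  qed (use g in \<open>auto elim: eventually_mono\<close>)
  also have "\<dots> = - (LINT x|lebesgue_on \<Omega>. weak_div \<Omega> t x * \<phi> x)"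
    using has_weak_div_weak_div[OF t(2)] \<phi> by (simp add: has_weak_div_def)
  finally show ?thesis
    by (simp add: green_eq[OF t test_function_H1[OF \<phi>]] mult.commute)
qed

text \<open>\<open>green t\<close> vanishes on test functions by definition of the weak divergence, hence on their closure.\<close>

lemma green_H10:
  assumes t: "t \<in> L2 \<Omega>" "has_weak_div \<Omega> t g" and z: "z \<in> H10 \<Omega>"
  shows "green t z = 0"
proof (rule ccontr)
  assume n: "green t z \<noteq> 0"
  define N where "N = sqrt ((L2_norm \<Omega> t)\<^sup>2 + (L2_norm \<Omega> (weak_div \<Omega> t))\<^sup>2)"
  have N: "N \<ge> 0" by (simp add: N_def)
  have zH: "z \<in> H1 \<Omega>" using z by (simp add: H10_def)
  have "\<bar>green t z\<bar> / (N + 1) > 0" using n N by simp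
  then obtain \<phi> where \<phi>: "\<phi> \<in> test_functions \<Omega>" "H1_norm \<Omega> (z - \<phi>) < \<bar>green t z\<bar> / (N + 1)"
    using z unfolding H10_def by blast
  have \<phi>H: "\<phi> \<in> H1 \<Omega>" by (rule test_function_H1[OF \<phi>(1)])
  have "green t z = green t (z - \<phi>)" using green_diff[OF t zH \<phi>H] green_test_function[OF t \<phi>(1)] by simp
  then have "\<bar>green t z\<bar> \<le> N * H1_norm \<Omega> (z - \<phi>)"
    using green_bound[OF t subspace_diff[OF H1_subspace zH \<phi>H]] by (simp add: N_def)
  also have "\<dots> \<le> (N + 1) * H1_norm \<Omega> (z - \<phi>)" by (rule mult_right_mono) auto
  also have "\<dots> < (N + 1) * (\<bar>green t z\<bar> / (N + 1))" using \<phi>(2) N by (intro mult_strict_left_mono) auto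
  also have "\<dots> = \<bar>green t z\<bar>" using N by simp
  finally show False by simp
qed

text \<open>All extensions of a boundary value give the same value of \<open>green\<close>, so the bound passes to
  the infimum over the extensions.\<close>

lemma normal_trace_bound:
  assumes t: "t \<in> L2 \<Omega>" "has_weak_div \<Omega> t g" and \<psi>: "\<psi> \<in> Hhalf \<Omega>"
  shows "\<bar>normal_trace \<Omega> t \<psi>\<bar> \<le> sqrt ((L2_norm \<Omega> t)\<^sup>2 + (L2_norm \<Omega> (weak_div \<Omega> t))\<^sup>2) * Hhalf_norm \<Omega> \<psi>"
    (is "_ \<le> ?N * _")
proof -
  obtain w0 where w0: "w0 \<in> H1 \<Omega>" "\<psi> = bdry_trace \<Omega> w0" using \<psi> by (auto simp: Hhalf_def)
  have ind: "green t w = green t w0" if "w \<in> \<psi>" for w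
  proof -
    have "w \<in> H1 \<Omega>" "w - w0 \<in> H10 \<Omega>" using that w0 by (auto simp: bdry_trace_def)
    then show ?thesis using green_diff[OF t \<open>w \<in> H1 \<Omega>\<close> w0(1)] green_H10[OF t] by simp
  qed
  have w1: "(SOME w. w \<in> \<psi>) \<in> \<psi>" using trace_refl[OF w0(1)] w0(2) by (metis someI)
  then have w1H: "(SOME w. w \<in> \<psi>) \<in> H1 \<Omega>" using w0 by (auto simp: bdry_trace_def)
  have nt: "normal_trace \<Omega> t \<psi> = green t w0"
    unfolding normal_trace_def Let_def using green_eq[OF t w1H] ind[OF w1] by simp
  have le: "\<bar>green t w0\<bar> \<le> ?N * H1_norm \<Omega> w" if "w \<in> \<psi>" for w
    using green_bound[OF t, of w] ind[OF that] that w0 by (auto simp: bdry_trace_def)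
  show ?thesis
  proof (cases "?N = 0")
    case True
    then show ?thesis using le[OF w1] nt by simp
  next
    case False
    then have N: "?N > 0" by (smt (verit) real_sqrt_ge_zero sum_power2_ge_zero)
    have "\<bar>green t w0\<bar> / ?N \<le> Hhalf_norm \<Omega> \<psi>"
      unfolding Hhalf_norm_def using w1 le N by (intro cINF_greatest) (auto simp: field_simps)
    then show ?thesis using N nt by (simp add: field_simps)
  qed
qed

lemma functional_H_bound:
  assumes \<tau>: "\<tau> \<in> Y_space \<Omega>" and u: "u\<Gamma> \<in> Hhalf_vec \<Omega>"
  shows "\<bar>functional_H \<Omega> u\<Gamma> \<tau>\<bar> \<le> Hhalf_vec_norm \<Omega> u\<Gamma> * Y_norm \<Omega> \<tau>"
proof -
  have \<tau>': "\<tau> \<in> Hdiv \<Omega>" using \<tau> by (simp add: Y_space_def)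
  define n where "n i = sqrt ((L2_norm \<Omega> (\<lambda>x. \<tau> x $ i))\<^sup>2 + (L2_norm \<Omega> (\<lambda>x. tensor_div \<Omega> \<tau> x $ i))\<^sup>2)" for i
  have u': "u\<Gamma> $ i \<in> Hhalf \<Omega>" for i using u by (simp add: Hhalf_vec_def)
  have td: "(\<lambda>x. tensor_div \<Omega> \<tau> x $ i) = weak_div \<Omega> (\<lambda>x. \<tau> x $ i)" for i by (simp add: tensor_div_def)
  have b: "\<bar>normal_trace \<Omega> (\<lambda>x. \<tau> x $ i) (u\<Gamma> $ i)\<bar> \<le> \<bar>n i\<bar> * \<bar>Hhalf_norm \<Omega> (u\<Gamma> $ i)\<bar>" for i
    using normal_trace_bound[OF L2_component[OF Hdiv_L2[OF \<tau>']] Hdiv_has_weak_div[OF \<tau>'] u', of i i]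
      Hhalf_norm_nonneg[OF u', of i] by (simp add: n_def td)
  have "\<bar>functional_H \<Omega> u\<Gamma> \<tau>\<bar> \<le> (\<Sum>i\<in>UNIV. \<bar>normal_trace \<Omega> (\<lambda>x. \<tau> x $ i) (u\<Gamma> $ i)\<bar>)"
    by (simp add: functional_H_def tensor_normal_pairing_def)
  also have "\<dots> \<le> (\<Sum>i\<in>UNIV. \<bar>n i\<bar> * \<bar>Hhalf_norm \<Omega> (u\<Gamma> $ i)\<bar>)" by (intro sum_mono b)
  also have "\<dots> \<le> L2_set n UNIV * L2_set (\<lambda>i. Hhalf_norm \<Omega> (u\<Gamma> $ i)) UNIV" by (rule L2_set_mult_ineq)
  also have "L2_set (\<lambda>i. Hhalf_norm \<Omega> (u\<Gamma> $ i)) UNIV = Hhalf_vec_norm \<Omega> u\<Gamma>" by (simp add: L2_set_def Hhalf_vec_norm_def)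
  also have "L2_set n UNIV = Y_norm \<Omega> \<tau>"
    unfolding L2_set_def Y_norm_def L2_norm_vec[OF Hdiv_L2[OF \<tau>']] L2_norm_vec[OF tensor_div_L2[OF \<tau>']]
    by (simp add: n_def sum.distrib)
  finally show ?thesis by (simp add: mult.commute)
qed

lemma L2_norm_le_norms:
  "L2_norm \<Omega> q \<le> H1_norm \<Omega> q" "L2_norm \<Omega> (weak_grad \<Omega> q) \<le> H1_norm \<Omega> q" "H1_norm \<Omega> q \<le> X_norm \<Omega> (e, q)"
  "L2_norm \<Omega> e \<le> X_norm \<Omega> (e, q)" "L2_norm \<Omega> \<tau> \<le> Y_norm \<Omega> \<tau>" "L2_norm \<Omega> (tensor_div \<Omega> \<tau>) \<le> Y_norm \<Omega> \<tau>"
  "L2_norm \<Omega> v \<le> Z_norm \<Omega> (v, \<eta>)" "L2_norm \<Omega> \<eta> \<le> Z_norm \<Omega> (v, \<eta>)"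
  by (rule power2_le_imp_le, simp add: tuple_norms_sq, simp)+

lemma functional_G_bound:
  assumes g: "g \<in> L2 \<Omega>" and R: "R \<in> Hmhalf \<Omega>" and e: "e \<in> X_space \<Omega>"
  shows "\<bar>functional_G \<Omega> g R e\<bar> \<le> (L2_norm \<Omega> g + Hmhalf_norm \<Omega> R) * X_norm \<Omega> e"
proof -
  obtain e1 q where eq: "e = (e1, q)" and q: "q \<in> H1 \<Omega>" using e by (cases e) (auto simp: X_space_def)
  have "\<bar>LINT x|lebesgue_on \<Omega>. g x * q x\<bar> \<le> L2_norm \<Omega> g * L2_norm \<Omega> q"
    using L2_Cauchy_Schwarz[OF g H1_L2[OF q]] by (simp add: L2_inner_def)
  also have "\<dots> \<le> L2_norm \<Omega> g * X_norm \<Omega> e"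
    unfolding eq using L2_norm_le_norms(1)[of q] L2_norm_le_norms(3)[of q e1] by (intro mult_left_mono) auto
  finally have 1: "\<bar>LINT x|lebesgue_on \<Omega>. g x * q x\<bar> \<le> L2_norm \<Omega> g * X_norm \<Omega> e" .
  have "\<bar>R (bdry_trace \<Omega> q)\<bar> \<le> Hmhalf_norm \<Omega> R * H1_norm \<Omega> q" by (rule Hmhalf_bound[OF R q])
  also have "\<dots> \<le> Hmhalf_norm \<Omega> R * X_norm \<Omega> e"
    unfolding eq using L2_norm_le_norms(3)[of q e1] Hmhalf_norm_nonneg[OF R] by (rule mult_left_mono)
  finally show ?thesis using 1 by (simp add: eq functional_G_def distrib_right)
qed

lemma functional_F_bound:
  assumes f: "f \<in> L2 \<Omega>" and v: "v \<in> Z_space \<Omega>"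
  shows "\<bar>functional_F \<Omega> f v\<bar> \<le> L2_norm \<Omega> f * Z_norm \<Omega> v"
proof -
  obtain w \<eta> where eq: "v = (w, \<eta>)" and w: "w \<in> L2 \<Omega>" using v by (cases v) (auto simp: Z_space_def)
  have "\<bar>functional_F \<Omega> f v\<bar> \<le> L2_norm \<Omega> f * L2_norm \<Omega> w"
    using L2_Cauchy_Schwarz[OF f w] by (simp add: eq functional_F_def L2_inner_def)
  also have "\<dots> \<le> L2_norm \<Omega> f * Z_norm \<Omega> v" unfolding eq by (intro mult_left_mono L2_norm_le_norms) simp
  finally show ?thesis .
qed

lemma data_nonneg:
  assumes "R \<in> Hmhalf \<Omega>"
  shows "0 \<le> L2_norm \<Omega> g + Hmhalf_norm \<Omega> R" "0 \<le> Hhalf_vec_norm \<Omega> u\<Gamma>"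
  using Hmhalf_norm_nonneg[OF assms] by (auto simp: Hhalf_vec_norm_def sum_nonneg)

end

section \<open>Polynomials\<close>

definition monomial :: "('n \<Rightarrow> nat) \<Rightarrow> real^'n \<Rightarrow> real" where
  "monomial a x = (\<Prod>i\<in>UNIV. (x $ i) ^ a i)"

text \<open>Indexing by a strict degree bound makes the zero space the case \<open>m = 0\<close>, so differentiation
  lowers the index in all cases.\<close>

definition polys :: "nat \<Rightarrow> (real^'n \<Rightarrow> real) set" where
  "polys m = span (monomial ` {a. (\<Sum>i\<in>UNIV. a i) < m})"

lemma finite_exponents: "finite {a :: 'n::finite \<Rightarrow> nat. (\<Sum>i\<in>UNIV. a i) < m}"
proof (rule finite_subset)
  show "finite (PiE (UNIV :: 'n set) (\<lambda>_. {..m}))" by (intro finite_PiE) auto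
  show "{a :: 'n \<Rightarrow> nat. (\<Sum>i\<in>UNIV. a i) < m} \<subseteq> PiE UNIV (\<lambda>_. {..m})"
  proof
    fix a :: "'n \<Rightarrow> nat" assume a: "a \<in> {a. (\<Sum>i\<in>UNIV. a i) < m}"
    have "a i \<le> m" for i
    proof -
      have "a i \<le> (\<Sum>i\<in>UNIV. a i)" by (rule member_le_sum) simp_all
      also have "\<dots> \<le> m" using a by simp
      finally show ?thesis .
    qed
    then show "a \<in> PiE UNIV (\<lambda>_. {..m})" by (simp add: PiE_def Pi_def extensional_def)
  qed
qed

lemma polys_subspace: "subspace (polys m)"
  unfolding polys_def by (rule subspace_span)

lemma monomial_polys: "(\<Sum>i\<in>UNIV. a i) < m \<Longrightarrow> monomial a \<in> polys m"
  unfolding polys_def by (intro span_base imageI) simp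

lemma sum_monomials_polys:
  "(\<lambda>x. \<Sum>a | (\<Sum>i\<in>UNIV. a i) < m. c a * monomial a x) \<in> polys m"
proof -
  have "(\<Sum>a | (\<Sum>i\<in>UNIV. a i) < m. c a *\<^sub>R monomial a) \<in> polys m"
    by (intro subspace_sum subspace_scale polys_subspace monomial_polys) auto
  then show ?thesis by (simp add: sum_fun_apply[abs_def])
qed

lemma polys_induct [consumes 1, case_names zero add]:
  assumes "p \<in> polys m" "P 0"
    "\<And>c a q. \<lbrakk>(\<Sum>i\<in>UNIV. a i) < m; q \<in> polys m; P q\<rbrakk> \<Longrightarrow> P (c *\<^sub>R monomial a + q)"
  shows "P p"
proof -
  have "p \<in> span (monomial ` {a. (\<Sum>i\<in>UNIV. a i) < m})" using assms(1) by (simp add: polys_def)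
  then have "p \<in> polys m \<and> P p"
  proof (induction rule: span_induct_alt)
    case base
    show ?case by (intro conjI subspace_0[OF polys_subspace] assms(2))
  next
    case (step c x y)
    then obtain a where "x = monomial a" "(\<Sum>i\<in>UNIV. a i) < m" by auto
    then show ?case using step assms(3)[of a y c] monomial_polys[of a m] subspace_add[OF polys_subspace] subspace_scale[OF polys_subspace]
      by (intro conjI) blast+
  qed
  then show ?thesis by simp
qed

lemma polys_expansion:
  assumes "p \<in> polys m"
  shows "\<exists>c. \<forall>x. p x = (\<Sum>a | (\<Sum>i\<in>UNIV. a i) < m. c a * monomial a x)"
  using assms
proof (induction rule: polys_induct)
  case zero
  then show ?case by (intro exI[of _ "\<lambda>_. 0"]) simp
next
  case (add c a q)
  then obtain d where d: "\<And>x. q x = (\<Sum>a | (\<Sum>i\<in>UNIV. a i) < m. d a * monomial a x)" by blast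
  have "(\<Sum>b | (\<Sum>i\<in>UNIV. b i) < m. (if b = a then c else 0) * monomial b x) = c * monomial a x" for x
  proof -
    have "(\<Sum>b | (\<Sum>i\<in>UNIV. b i) < m. (if b = a then c else 0) * monomial b x)
      = (\<Sum>b | (\<Sum>i\<in>UNIV. b i) < m. if b = a then c * monomial b x else 0)"
      by (intro sum.cong) auto
    then show ?thesis using add(1) finite_exponents[where 'n='a, of m] by simp
  qed
  then have "(c *\<^sub>R monomial a + q) x = (\<Sum>b | (\<Sum>i\<in>UNIV. b i) < m. ((if b = a then c else 0) + d b) * monomial b x)" for x
    by (simp add: d distrib_right sum.distrib)
  then show ?case by (intro exI[of _ "\<lambda>b. (if b = a then c else 0) + d b"] allI)
qed

lemma poly_deg_polys: "poly_deg k = polys (Suc k)"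
proof (intro set_eqI iffI)
  fix p :: "real^'n \<Rightarrow> real"
  assume "p \<in> poly_deg k"
  then obtain c where "\<And>x. p x = (\<Sum>a | (\<Sum>i\<in>UNIV. a i) < Suc k. c a * monomial a x)"
    unfolding poly_deg_def monomial_def less_Suc_eq_le by blast
  then have "p = (\<lambda>x. \<Sum>a | (\<Sum>i\<in>UNIV. a i) < Suc k. c a * monomial a x)" by auto
  then show "p \<in> polys (Suc k)" using sum_monomials_polys by simp
next
  fix p :: "real^'n \<Rightarrow> real"
  assume "p \<in> polys (Suc k)"
  from polys_expansion[OF this] show "p \<in> poly_deg k"
    unfolding poly_deg_def monomial_def less_Suc_eq_le by blast
qed

lemma polys_mono: "m \<le> l \<Longrightarrow> polys m \<subseteq> polys l"
  unfolding polys_def by (intro span_mono image_mono) auto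

lemma const_polys: "(\<lambda>x. c) \<in> polys (Suc m)"
proof -
  have "c *\<^sub>R monomial (\<lambda>_. 0) \<in> polys (Suc m)"
    by (intro subspace_scale polys_subspace monomial_polys) simp
  then show ?thesis by (simp add: monomial_def scaleR_fun_def)
qed

lemma polynomial_monomial: "real_polynomial_function (monomial a)"
proof -
  have "real_polynomial_function (\<lambda>x::real^'a. x $ i)" for i
    by (rule real_polynomial_function.intros(1)) (rule bounded_linear_vec_nth)
  then show ?thesis unfolding monomial_def[abs_def]
    by (intro real_polynomial_function_prod real_polynomial_function_power) auto
qed

lemma polynomial_polys: "p \<in> polys m \<Longrightarrow> real_polynomial_function p"
  by (induction rule: polys_induct)
    (auto simp: plus_fun_def scaleR_fun_def zero_fun_def
      intro!: real_polynomial_function.intros(2-4) polynomial_monomial)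

lemma polynomial_differentiable:
  fixes f :: "real^'n \<Rightarrow> real"
  assumes "real_polynomial_function f"
  shows "f differentiable (at x)" and "real_polynomial_function (partial_deriv i f)"
    and "partial_deriv i (partial_deriv j f) = partial_deriv j (partial_deriv i f)"
proof -
  have "(\<forall>x. f differentiable (at x)) \<and> (\<forall>i. real_polynomial_function (partial_deriv i f)) \<and>
    (\<forall>i x. partial_deriv i f differentiable (at x)) \<and>
    (\<forall>i j. partial_deriv i (partial_deriv j f) = partial_deriv j (partial_deriv i f))"
    using assms
  proof (induction rule: real_polynomial_function.induct)
    case (linear f)
    have "partial_deriv i f = (\<lambda>x. f (axis i 1))" for i
      by (rule ext) (simp add: partial_deriv_has_derivative[OF bounded_linear_imp_has_derivative[OF linear]])
    then show ?case using bounded_linear_imp_differentiable[OF linear]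
      by (auto simp: partial_deriv_const)
  next
    case (const c)
    then show ?case by (auto simp: partial_deriv_const)
  next
    case (add f g)
    then show ?case by (auto simp: partial_deriv_plus)
  next
    case (mult f g)
    then show ?case
      by (auto simp: partial_deriv_times partial_deriv_plus algebra_simps
          intro!: real_polynomial_function.intros(3) intro: real_polynomial_function.intros(4))
  qed
  then show "f differentiable (at x)" "real_polynomial_function (partial_deriv i f)"
    "partial_deriv i (partial_deriv j f) = partial_deriv j (partial_deriv i f)" by auto
qed

lemma partial_deriv_sum:
  assumes "finite A" "\<And>a. a \<in> A \<Longrightarrow> real_polynomial_function (F a)"
  shows "partial_deriv i (\<lambda>x. \<Sum>a\<in>A. F a x) = (\<lambda>x. \<Sum>a\<in>A. partial_deriv i (F a) x)"
  using assms
proof (induction A rule: finite_induct)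
  case empty
  then show ?case by (simp add: partial_deriv_const)
next
  case (insert a A)
  have "real_polynomial_function (\<lambda>x. \<Sum>a\<in>A. F a x)" using insert by (intro real_polynomial_function_sum) auto
  then have "partial_deriv i (\<lambda>x. F a x + (\<Sum>a\<in>A. F a x)) = (\<lambda>x. partial_deriv i (F a) x + partial_deriv i (\<lambda>x. \<Sum>a\<in>A. F a x) x)"
    using insert by (intro partial_deriv_plus polynomial_differentiable(1)) auto
  then show ?case using insert by simp
qed

lemma polynomial_continuous: "real_polynomial_function f \<Longrightarrow> continuous_on S f"
  for f :: "real^'n \<Rightarrow> real"
  by (simp add: continuous_on_polymonial_function real_polynomial_function_eq)

lemma partial_deriv_diff_lincomb:
  assumes "real_polynomial_function f" "real_polynomial_function g"
  shows "partial_deriv j (c *\<^sub>R f + g) = c *\<^sub>R partial_deriv j f + partial_deriv j g"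
proof -
  have "partial_deriv j (\<lambda>x. c * f x) = (\<lambda>x. c * partial_deriv j f x)"
    using polynomial_differentiable(1)[OF assms(1)] by (subst partial_deriv_times) (auto simp: partial_deriv_const)
  then have "partial_deriv j (\<lambda>x. c * f x + g x) = (\<lambda>x. c * partial_deriv j f x + partial_deriv j g x)"
    using polynomial_differentiable(1)[OF assms(1)] polynomial_differentiable(1)[OF assms(2)]
    by (subst partial_deriv_plus) auto
  then show ?thesis by (simp add: plus_fun_def scaleR_fun_def)
qed

lemma monomial_split: "monomial a x = (x $ i) ^ a i * (\<Prod>l\<in>UNIV - {i}. (x $ l) ^ a l)"
  unfolding monomial_def by (rule prod.remove) auto

lemma monomial_times_coordinate: "x $ i * monomial a x = monomial (a(i := Suc (a i))) x"
proof -
  have "(\<Prod>l\<in>UNIV - {i}. (x $ l) ^ a l) = (\<Prod>l\<in>UNIV - {i}. (x $ l) ^ (a(i := Suc (a i))) l)"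
    by (intro prod.cong) auto
  then show ?thesis by (simp add: monomial_split[of _ x i])
qed

lemma sum_fun_upd: "(\<Sum>l\<in>UNIV. (a(i := v)) l) + a i = (\<Sum>l\<in>UNIV. a l) + v" for a :: "'n::finite \<Rightarrow> nat"
proof -
  have "(\<Sum>l\<in>UNIV. (a(i := v)) l) = v + (\<Sum>l\<in>UNIV - {i}. (a(i := v)) l)" by (subst sum.remove[of _ i]) auto
  also have "(\<Sum>l\<in>UNIV - {i}. (a(i := v)) l) = (\<Sum>l\<in>UNIV - {i}. a l)" by (intro sum.cong) auto
  finally show ?thesis by (simp add: sum.remove[of UNIV i a])
qed

lemma partial_deriv_monomial:
  "partial_deriv i (monomial a) x = real (a i) * monomial (a(i := a i - 1)) x"
proof -
  have d: "((\<lambda>s. monomial a (x + s *\<^sub>R axis i 1)) has_real_derivative partial_deriv i (monomial a) x) (at 0)"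
    by (intro partial_deriv_DERIV polynomial_differentiable polynomial_monomial)
  let ?C = "\<Prod>l\<in>UNIV - {i}. (x $ l) ^ a l"
  have eq: "monomial a (x + s *\<^sub>R axis i 1) = (x $ i + s) ^ a i * ?C" for s
    unfolding monomial_split[of a _ i] by (auto simp: axis_def intro!: prod.cong)
  have "((\<lambda>s. (x $ i + s) ^ a i * ?C) has_real_derivative (real (a i) * (x $ i) ^ (a i - 1)) * ?C) (at 0)"
    by (auto intro!: derivative_eq_intros)
  with d have "partial_deriv i (monomial a) x = (real (a i) * (x $ i) ^ (a i - 1)) * ?C"
    unfolding eq using DERIV_unique by blast
  also have "?C = (\<Prod>l\<in>UNIV - {i}. (x $ l) ^ (a(i := a i - 1)) l)" by (intro prod.cong) auto
  finally show ?thesis by (simp add: monomial_split[of _ x i])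
qed

lemma partial_deriv_polys:
  assumes "p \<in> polys (Suc m)" shows "partial_deriv i p \<in> polys m"
  using assms
proof (induction rule: polys_induct)
  case zero
  have "partial_deriv i 0 = (0 :: real^'a \<Rightarrow> real)" by (simp add: zero_fun_def partial_deriv_const)
  then show ?case using subspace_0[OF polys_subspace] by (simp only:)
next
  case (add c a q)
  have "partial_deriv i (monomial a) \<in> polys m"
  proof (cases "a i = 0")
    case True
    then have "partial_deriv i (monomial a) = 0" by (auto simp: partial_deriv_monomial fun_eq_iff)
    then show ?thesis by (simp only: subspace_0[OF polys_subspace])
  next
    case False
    have "partial_deriv i (monomial a) = real (a i) *\<^sub>R monomial (a(i := a i - 1))"
      by (auto simp: partial_deriv_monomial fun_eq_iff)
    moreover have "(\<Sum>l\<in>UNIV. (a(i := a i - 1)) l) < m"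
      using sum_fun_upd[of a i "a i - 1"] False add(1) by linarith
    ultimately show ?thesis by (simp add: subspace_scale polys_subspace monomial_polys)
  qed
  then have "c *\<^sub>R partial_deriv i (monomial a) + partial_deriv i q \<in> polys m"
    using add by (intro subspace_add subspace_scale polys_subspace)
  then show ?case
    using partial_deriv_diff_lincomb[OF polynomial_monomial polynomial_polys[OF add(2)], of i c a] by (simp only:)
qed

lemma coordinate_times_polys:
  assumes "p \<in> polys m" shows "(\<lambda>x. x $ i * p x) \<in> polys (Suc m)"
  using assms
proof (induction rule: polys_induct)
  case zero
  then show ?case using subspace_0[OF polys_subspace] by (simp add: zero_fun_def)
next
  case (add c a q)
  have "monomial (a(i := Suc (a i))) \<in> polys (Suc m)"
    using sum_fun_upd[of a i "Suc (a i)"] add(1) by (intro monomial_polys) linarith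
  then have "c *\<^sub>R monomial (a(i := Suc (a i))) + (\<lambda>x. x $ i * q x) \<in> polys (Suc m)"
    using add by (intro subspace_add subspace_scale polys_subspace) auto
  moreover have "c *\<^sub>R monomial (a(i := Suc (a i))) + (\<lambda>x. x $ i * q x) = (\<lambda>x. x $ i * (c *\<^sub>R monomial a + q) x)"
    by (auto simp: fun_eq_iff monomial_times_coordinate[symmetric] algebra_simps)
  ultimately show ?case by simp
qed

text \<open>The factor \<open>t\<close> on the left expresses a growth of order \<open>m - 1\<close> without a subtraction.\<close>

lemma polys_growth:
  assumes "p \<in> polys m"
  shows "\<exists>C. \<forall>t\<ge>1. \<bar>p (t *\<^sub>R x)\<bar> * t \<le> C * t ^ m"
  using assms
proof (induction rule: polys_induct)
  case zero
  then show ?case by (intro exI[of _ 0]) simp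
next
  case (add c a q)
  then obtain C where C: "\<And>t. t \<ge> 1 \<Longrightarrow> \<bar>q (t *\<^sub>R x)\<bar> * t \<le> C * t ^ m" by blast
  have "\<bar>(c *\<^sub>R monomial a + q) (t *\<^sub>R x)\<bar> * t \<le> (\<bar>c * monomial a x\<bar> + C) * t ^ m" if t: "t \<ge> 1" for t
  proof -
    have mt: "monomial a (t *\<^sub>R x) = t ^ (\<Sum>i\<in>UNIV. a i) * monomial a x"
      by (simp add: monomial_def power_mult_distrib prod.distrib power_sum)
    have "\<bar>(c *\<^sub>R monomial a + q) (t *\<^sub>R x)\<bar> * t \<le> (\<bar>c * monomial a (t *\<^sub>R x)\<bar> + \<bar>q (t *\<^sub>R x)\<bar>) * t"
      using t by (intro mult_right_mono) auto
    also have "\<bar>c * monomial a (t *\<^sub>R x)\<bar> * t = \<bar>c * monomial a x\<bar> * t ^ Suc (\<Sum>i\<in>UNIV. a i)"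
      using t by (simp add: mt abs_mult)
    then have "(\<bar>c * monomial a (t *\<^sub>R x)\<bar> + \<bar>q (t *\<^sub>R x)\<bar>) * t \<le> \<bar>c * monomial a x\<bar> * t ^ m + C * t ^ m"
      unfolding distrib_right using C[OF t] t add(1) by (intro add_mono) (auto intro!: mult_left_mono power_increasing simp del: power_Suc)
    finally show ?thesis by (simp add: distrib_right)
  qed
  then show ?case by blast
qed

text \<open>A divergence-free Raviart-Thomas field has no radial part: for homogeneous \<open>Q\<close> of degree \<open>k\<close>,
  Euler's identity gives \<open>div (Q x) = (n + k) Q\<close>, and this is the only contribution of degree \<open>k\<close>
  to the divergence of the field.\<close>

lemma divergence_free_RT_polys:
  fixes p :: "real^'n \<Rightarrow> real^'n" and q :: "real^'n \<Rightarrow> real"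
  assumes p: "\<And>i. (\<lambda>x. p x $ i) \<in> polys (Suc k)" and q: "q \<in> polys (Suc k)"
    and div: "\<And>x. (\<Sum>i\<in>UNIV. partial_deriv i (\<lambda>x. (p x + q x *\<^sub>R x) $ i) x) = 0"
  shows "(\<lambda>x. (p x + q x *\<^sub>R x) $ i) \<in> polys (Suc k)"
proof -
  obtain c where c: "\<And>x. q x = (\<Sum>a | (\<Sum>i\<in>UNIV. a i) < Suc k. c a * monomial a x)"
    using polys_expansion[OF q] by blast
  define Q where "Q x = (\<Sum>a | (\<Sum>i\<in>UNIV. a i) = k. c a * monomial a x)" for x :: "real^'n"
  define q' where "q' x = (\<Sum>a | (\<Sum>i\<in>UNIV. a i) < k. c a * monomial a x)" for x :: "real^'n"
  have fin: "finite {a :: 'n \<Rightarrow> nat. (\<Sum>i\<in>UNIV. a i) = k}"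
    by (rule finite_subset[OF _ finite_exponents[of "Suc k"]]) auto
  have qQ: "q = (\<lambda>x. Q x + q' x)"
  proof
    fix x :: "real^'n"
    have "{a :: 'n \<Rightarrow> nat. (\<Sum>i\<in>UNIV. a i) < Suc k} = {a. (\<Sum>i\<in>UNIV. a i) = k} \<union> {a. (\<Sum>i\<in>UNIV. a i) < k}" by auto
    then show "q x = Q x + q' x" unfolding c Q_def q'_def
      using fin finite_exponents[where 'n='n, of k] by (simp add: sum.union_disjoint[symmetric] disjoint_iff)
  qed
  have q': "q' \<in> polys k" unfolding q'_def[abs_def] by (rule sum_monomials_polys)
  have Qsum: "Q = (\<Sum>a | (\<Sum>i\<in>UNIV. a i) = k. c a *\<^sub>R monomial a)" by (auto simp: Q_def sum_fun_apply fun_eq_iff)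
  have Qp: "Q \<in> polys (Suc k)" unfolding Qsum
    by (intro subspace_sum subspace_scale polys_subspace monomial_polys) auto
  have poly: "real_polynomial_function Q" "real_polynomial_function q'" "real_polynomial_function (\<lambda>x. p x $ i)" for i
    using Qp q' p polynomial_polys by blast+
  have x: "real_polynomial_function (\<lambda>x::real^'n. x $ i)" for i
    by (rule real_polynomial_function.intros(1)) (rule bounded_linear_vec_nth)
  have dx: "partial_deriv i (\<lambda>x::real^'n. x $ i) = (\<lambda>x. 1)" for i
    by (rule ext) (simp add: partial_deriv_has_derivative[OF bounded_linear_imp_has_derivative[OF bounded_linear_vec_nth]] axis_def)
  note dif = polynomial_differentiable(1)
  have euler: "(\<Sum>i\<in>UNIV. x $ i * partial_deriv i Q x) = real k * Q x" for x
  proof -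
    have dQ: "partial_deriv i Q x = (\<Sum>a | (\<Sum>i\<in>UNIV. a i) = k. c a * partial_deriv i (monomial a) x)" for i
    proof -
      have cm: "partial_deriv i (\<lambda>x. c a * monomial a x) = (\<lambda>x. c a * partial_deriv i (monomial a) x)" for a
        using polynomial_differentiable(1)[OF polynomial_monomial]
        by (subst partial_deriv_times) (auto simp: partial_deriv_const)
      have "partial_deriv i Q x = (\<Sum>a | (\<Sum>i\<in>UNIV. a i) = k. partial_deriv i (\<lambda>x. c a * monomial a x) x)"
        unfolding Q_def[abs_def] using fin
        by (subst partial_deriv_sum) (auto intro!: real_polynomial_function.intros(2,4) polynomial_monomial)
      then show ?thesis by (simp add: cm)
    qed
    have "(\<Sum>i\<in>UNIV. x $ i * partial_deriv i Q x)
      = (\<Sum>i\<in>UNIV. \<Sum>a | (\<Sum>i\<in>UNIV. a i) = k. c a * (real (a i) * monomial a x))"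
    proof -
      have m: "x $ i * (c a * partial_deriv i (monomial a) x) = c a * (real (a i) * monomial a x)" for i a
      proof (cases "a i = 0")
        case True then show ?thesis by (simp add: partial_deriv_monomial)
      next
        case False
        have "x $ i * monomial (a(i := a i - 1)) x = monomial a x"
          using False by (subst monomial_times_coordinate) (simp add: fun_upd_idem)
        then show ?thesis by (simp add: partial_deriv_monomial mult.left_commute)
      qed
      show ?thesis by (intro sum.cong refl) (simp add: dQ sum_distrib_left m)
    qed
    also have "\<dots> = (\<Sum>a | (\<Sum>i\<in>UNIV. a i) = k. \<Sum>i\<in>UNIV. c a * (real (a i) * monomial a x))" by (rule sum.swap)
    also have "\<dots> = (\<Sum>a | (\<Sum>i\<in>UNIV. a i) = k. real k * (c a * monomial a x))"
    proof (rule sum.cong[OF refl])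
      fix a :: "'n \<Rightarrow> nat" assume a: "a \<in> {a. (\<Sum>i\<in>UNIV. a i) = k}"
      have "(\<Sum>i\<in>UNIV. c a * (real (a i) * monomial a x)) = c a * (real (\<Sum>i\<in>UNIV. a i) * monomial a x)"
        by (simp add: sum_distrib_left sum_distrib_right)
      moreover have "(\<Sum>i\<in>UNIV. a i) = k" using a by simp
      ultimately show "(\<Sum>i\<in>UNIV. c a * (real (a i) * monomial a x)) = real k * (c a * monomial a x)"
        by (simp only: mult.left_commute)
    qed
    also have "\<dots> = real k * Q x" by (simp add: Q_def sum_distrib_left)
    finally show ?thesis .
  qed
  define s where "s x = - (\<Sum>i\<in>UNIV. partial_deriv i (\<lambda>x. p x $ i) x + partial_deriv i (\<lambda>x. x $ i * q' x) x)" for x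
  have s: "s \<in> polys k"
  proof -
    have "- (\<Sum>i\<in>UNIV. partial_deriv i (\<lambda>x. p x $ i) + partial_deriv i (\<lambda>x. x $ i * q' x)) \<in> polys k"
      by (intro subspace_neg subspace_sum subspace_add polys_subspace partial_deriv_polys p coordinate_times_polys q')
    moreover have "- (\<Sum>i\<in>UNIV. partial_deriv i (\<lambda>x. p x $ i) + partial_deriv i (\<lambda>x. x $ i * q' x)) = s"
      by (auto simp: s_def fun_eq_iff sum_fun_apply)
    ultimately show ?thesis by simp
  qed
  have Qs: "(real CARD('n) + real k) * Q x = s x" for x
  proof -
    have xq: "real_polynomial_function (\<lambda>x. x $ i * q' x)" "real_polynomial_function (\<lambda>x. x $ i * Q x)" for i
      using x poly by (auto intro: real_polynomial_function.intros(4))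
    have "partial_deriv i (\<lambda>x. (p x + q x *\<^sub>R x) $ i) x
      = partial_deriv i (\<lambda>x. p x $ i) x + partial_deriv i (\<lambda>x. x $ i * q' x) x + (Q x + x $ i * partial_deriv i Q x)" for i
    proof -
      have "(\<lambda>x. (p x + q x *\<^sub>R x) $ i) = (\<lambda>x. (p x $ i + x $ i * q' x) + x $ i * Q x)"
        by (auto simp: qQ algebra_simps)
      then show ?thesis
        using dif[OF poly(3)] dif[OF xq(1)] dif[OF xq(2)] dif[OF poly(1)] dif[OF x]
          dif[OF real_polynomial_function.intros(3)[OF poly(3) xq(1)]]
        by (simp add: partial_deriv_plus partial_deriv_times dx)
    qed
    then show ?thesis using div[of x] euler[of x] by (simp add: sum.distrib s_def algebra_simps)
  qed
  \<comment> \<open>\<open>(n + k) Q\<close> is homogeneous of degree \<open>k\<close> and equals \<open>s\<close>, which grows more slowly on the ray through \<open>x\<close>\<close>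
  have "Q x = 0" for x
  proof (rule ccontr)
    assume n: "Q x \<noteq> 0"
    obtain C where C: "\<And>t. t \<ge> 1 \<Longrightarrow> \<bar>s (t *\<^sub>R x)\<bar> * t \<le> C * t ^ k" using polys_growth[OF s, of x] by blast
    let ?N = "real CARD('n) + real k"
    have N: "?N > 0" by (simp add: add_pos_nonneg)
    have hom: "Q (t *\<^sub>R x) = t ^ k * Q x" for t
    proof -
      have "monomial a (t *\<^sub>R x) = t ^ (\<Sum>i\<in>UNIV. a i) * monomial a x" for a
        by (simp add: monomial_def power_mult_distrib prod.distrib power_sum)
      then show ?thesis by (simp add: Q_def sum_distrib_left mult_ac)
    qed
    have b: "?N * \<bar>Q x\<bar> * t \<le> C" if t: "t \<ge> 1" for t
    proof -
      have "\<bar>s (t *\<^sub>R x)\<bar> = ?N * (t ^ k * \<bar>Q x\<bar>)" using N t by (simp add: Qs[symmetric] hom abs_mult)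
      then have "t ^ k * (?N * \<bar>Q x\<bar> * t) \<le> t ^ k * C" using C[OF t] by (simp add: mult_ac)
      then show ?thesis using t by (simp add: mult_le_cancel_left_pos)
    qed
    have P: "?N * \<bar>Q x\<bar> > 0" using N n by simp
    have "?N * \<bar>Q x\<bar> * (max 1 ((C + 1) / (?N * \<bar>Q x\<bar>))) \<le> C" by (rule b) simp
    moreover have "?N * \<bar>Q x\<bar> * ((C + 1) / (?N * \<bar>Q x\<bar>)) \<le> ?N * \<bar>Q x\<bar> * (max 1 ((C + 1) / (?N * \<bar>Q x\<bar>)))"
      using P by (intro mult_left_mono) auto
    moreover have "?N * \<bar>Q x\<bar> * ((C + 1) / (?N * \<bar>Q x\<bar>)) = C + 1" using P by (metis less_irrefl nonzero_mult_div_cancel_left times_divide_eq_right)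
    ultimately show False by linarith
  qed
  then have "(\<lambda>x. (p x + q x *\<^sub>R x) $ i) = (\<lambda>x. p x $ i) + (\<lambda>x. x $ i * q' x)"
    by (auto simp: qQ fun_eq_iff)
  then show ?thesis using p coordinate_times_polys[OF q'] by (simp add: subspace_add polys_subspace)
qed

text \<open>On the line through \<open>c\<close> and \<open>y\<close> the polynomial has infinitely many zeros.\<close>

lemma polynomial_zero_on_open:
  fixes f :: "real^'n \<Rightarrow> real"
  assumes f: "real_polynomial_function f" and U: "open U" "c \<in> U" and z: "\<And>x. x \<in> U \<Longrightarrow> f x = 0"
  shows "f y = 0"
proof -
  define h where "h t = c + t *\<^sub>R (y - c)" for t :: real
  have ph: "polynomial_function h" unfolding h_def[abs_def]
    by (intro polynomial_function_add polynomial_function_const polynomial_function_bounded_linear bounded_linear_scaleR_left)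
  have "real_polynomial_function (f \<circ> h)" by (rule real_polynomial_function_compose[OF ph f])
  then obtain a n where an: "(f \<circ> h) = (\<lambda>t. \<Sum>i\<le>n. a i * t ^ i)" using real_polynomial_function_iff_sum by blast
  have ch: "continuous_on UNIV h" unfolding h_def by (intro continuous_intros)
  have op: "open (h -` U)" using U(1) ch by (simp add: continuous_on_open_vimage)
  moreover have "0 \<in> h -` U" using U(2) by (simp add: h_def)
  ultimately have "infinite (h -` U)" using finite_imp_not_open by blast
  then have "\<not> finite {t. (\<Sum>i\<le>n. a i * t ^ i) = 0}"
  proof (rule infinite_super[rotated])
    show "h -` U \<subseteq> {t. (\<Sum>i\<le>n. a i * t ^ i) = 0}"
    proof
      fix t assume "t \<in> h -` U"
      then have "(f \<circ> h) t = 0" using z by simp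
      then show "t \<in> {t. (\<Sum>i\<le>n. a i * t ^ i) = 0}" by (simp add: an)
    qed
  qed
  then have "\<forall>i\<le>n. a i = 0" using polyfun_finite_roots[of a n] by auto
  then have "(f \<circ> h) 1 = 0" by (simp add: an)
  then show ?thesis by (simp add: h_def)
qed

section \<open>The local spaces\<close>

definition finite_dim :: "'a::real_vector set \<Rightarrow> bool" where
  "finite_dim S \<longleftrightarrow> (\<exists>M. finite M \<and> S \<subseteq> span M)"

lemma finite_dim_basis:
  assumes "subspace S" "finite_dim S"
  obtains M where "finite M" "M \<subseteq> S" "S \<subseteq> span M"
proof -
  obtain W where W: "finite W" "S \<subseteq> span W" using assms(2) by (auto simp: finite_dim_def)
  obtain B where B: "B \<subseteq> S" "independent B" "S \<subseteq> span B" by (rule maximal_independent_subset)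
  then have "finite B" using independent_span_bound[OF W(1) B(2)] W(2) by blast
  then show ?thesis using that B by blast
qed

lemma subspace_image_on:
  assumes S: "subspace S" and F: "\<And>x y c. \<lbrakk>x \<in> S; y \<in> S\<rbrakk> \<Longrightarrow> F (c *\<^sub>R x + y) = c *\<^sub>R F x + F y"
  shows "subspace (F ` S)"
proof -
  have F0: "F 0 = 0" using F[of 0 0 1] S by (simp add: subspace_0)
  show ?thesis
    unfolding subspace_def
  proof (intro conjI ballI allI)
    show "0 \<in> F ` S" using F0 subspace_0[OF S] by (intro image_eqI[of _ _ 0]) auto
    fix a c assume "a \<in> F ` S"
    then obtain x where x: "x \<in> S" "a = F x" by auto
    then show "c *\<^sub>R a \<in> F ` S"
      using F[OF x(1) subspace_0[OF S], of c] F0 subspace_scale[OF S x(1), of c]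
      by (intro image_eqI[of _ _ "c *\<^sub>R x"]) auto
    fix b assume "b \<in> F ` S"
    then obtain y where y: "y \<in> S" "b = F y" by auto
    then show "a + b \<in> F ` S"
      using F[OF x(1) y(1), of 1] x subspace_add[OF S x(1) y(1)] by (intro image_eqI[of _ _ "x + y"]) auto
  qed
qed

lemma finite_dim_image_on:
  assumes S: "subspace S" "finite_dim S" and F: "\<And>x y c. \<lbrakk>x \<in> S; y \<in> S\<rbrakk> \<Longrightarrow> F (c *\<^sub>R x + y) = c *\<^sub>R F x + F y"
  shows "finite_dim (F ` S)"
proof -
  obtain M where M: "finite M" "M \<subseteq> S" "S \<subseteq> span M" by (rule finite_dim_basis[OF S])
  have F0: "F 0 = 0" using F[of 0 0 1] S(1) by (simp add: subspace_0)
  have "x \<in> S \<and> F x \<in> span (F ` M)" if "x \<in> span M" for x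
    using that
  proof (induction rule: span_induct_alt)
    case base
    show ?case unfolding F0 by (intro conjI subspace_0[OF S(1)] span_zero)
  next
    case (step c x y)
    have xS: "x \<in> S" using step M(2) by blast
    have "c *\<^sub>R x + y \<in> S" using xS step(2) by (intro subspace_add subspace_scale S(1)) auto
    moreover have "F (c *\<^sub>R x + y) \<in> span (F ` M)"
      unfolding F[OF xS conjunct1[OF step(2)]] using step(1) conjunct2[OF step(2)]
      by (intro span_add span_scale) (auto intro: span_base)
    ultimately show ?case by blast
  qed
  then have "F ` S \<subseteq> span (F ` M)" using M(3) by blast
  then show ?thesis unfolding finite_dim_def using M(1) by blast
qed

lemma finite_dim_plus:
  assumes "finite_dim S" "finite_dim T" shows "finite_dim {a + b |a b. a \<in> S \<and> b \<in> T}"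
proof -
  obtain M N where M: "finite M" "S \<subseteq> span M" and N: "finite N" "T \<subseteq> span N"
    using assms unfolding finite_dim_def by blast
  have "span M \<subseteq> span (M \<union> N)" "span N \<subseteq> span (M \<union> N)" by (intro span_mono; blast)+
  then have "{a + b |a b. a \<in> S \<and> b \<in> T} \<subseteq> span (M \<union> N)" using M N by (auto intro!: span_add)
  then show ?thesis unfolding finite_dim_def using M N by blast
qed

text \<open>Vector and tensor spaces are built from scalar spaces in this way, so they inherit finite dimension.\<close>

definition with_rows_in :: "('x \<Rightarrow> 'b) set \<Rightarrow> ('x \<Rightarrow> 'b^'m) set" where
  "with_rows_in S = {\<tau>. \<forall>i. (\<lambda>x. \<tau> x $ i) \<in> S}"

lemma with_rows_in_subspace:
  fixes S :: "('x \<Rightarrow> 'b::real_vector) set"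
  assumes "subspace S" shows "subspace (with_rows_in S :: ('x \<Rightarrow> 'b^'m) set)"
  unfolding subspace_def
proof (intro conjI ballI allI)
  have "(\<lambda>x. (0 :: 'x \<Rightarrow> 'b^'m) x $ i) = (0 :: 'x \<Rightarrow> 'b)" for i by auto
  then show "(0 :: 'x \<Rightarrow> 'b^'m) \<in> with_rows_in S" using subspace_0[OF assms] unfolding with_rows_in_def by (simp only: mem_Collect_eq simp_thms)
  fix x y :: "'x \<Rightarrow> 'b^'m" and c :: real assume x: "x \<in> with_rows_in S"
  have "(\<lambda>t. (c *\<^sub>R x) t $ i) = c *\<^sub>R (\<lambda>t. x t $ i)" for i by auto
  then show "c *\<^sub>R x \<in> with_rows_in S" using x subspace_scale[OF assms] unfolding with_rows_in_def by (simp only: mem_Collect_eq simp_thms)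
  assume y: "y \<in> with_rows_in S"
  have "(\<lambda>t. (x + y) t $ i) = (\<lambda>t. x t $ i) + (\<lambda>t. y t $ i)" for i by auto
  then show "x + y \<in> with_rows_in S" using x y subspace_add[OF assms] unfolding with_rows_in_def by (simp only: mem_Collect_eq simp_thms)
qed

lemma finite_dim_with_rows_in:
  fixes S :: "('x \<Rightarrow> 'b::real_vector) set"
  assumes "finite_dim S" shows "finite_dim (with_rows_in S :: ('x \<Rightarrow> 'b^'m) set)"
proof -
  obtain M where M: "finite M" "S \<subseteq> span M" using assms by (auto simp: finite_dim_def)
  define E where "E i f = (\<lambda>x. axis i (f x))" for i :: 'm and f :: "'x \<Rightarrow> 'b"
  have lin: "linear (E i)" for i by (rule linearI) (auto simp: E_def axis_def vec_eq_iff fun_eq_iff)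
  have "with_rows_in S \<subseteq> span (\<Union>i\<in>UNIV. E i ` M)"
  proof
    fix \<tau> :: "'x \<Rightarrow> 'b^'m" assume t: "\<tau> \<in> with_rows_in S"
    have "E i (\<lambda>x. \<tau> x $ i) \<in> span (\<Union>i\<in>UNIV. E i ` M)" for i
    proof -
      have "(\<lambda>x. \<tau> x $ i) \<in> span M" using t M(2) by (auto simp: with_rows_in_def)
      then have "E i (\<lambda>x. \<tau> x $ i) \<in> span (E i ` M)" using linear_span_image[OF lin] by blast
      then show ?thesis using span_mono[of "E i ` M" "\<Union>i\<in>UNIV. E i ` M"] by blast
    qed
    then have "(\<Sum>i\<in>UNIV. E i (\<lambda>x. \<tau> x $ i)) \<in> span (\<Union>i\<in>UNIV. E i ` M)" by (intro span_sum)
    moreover have "(\<Sum>i\<in>UNIV. E i (\<lambda>x. \<tau> x $ i)) = \<tau>"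
    proof
      fix x
      have "(\<Sum>i\<in>UNIV. axis i (\<tau> x $ i)) $ j = \<tau> x $ j" for j
      proof -
        have "(\<Sum>i\<in>UNIV. axis i (\<tau> x $ i)) $ j = (\<Sum>i\<in>UNIV. if i = j then \<tau> x $ i else 0)"
          by (auto simp: axis_def intro!: sum.cong)
        then show ?thesis by simp
      qed
      then show "(\<Sum>i\<in>UNIV. E i (\<lambda>x. \<tau> x $ i)) x = \<tau> x" by (simp add: sum_fun_apply E_def vec_eq_iff)
    qed
    ultimately show "\<tau> \<in> span (\<Union>i\<in>UNIV. E i ` M)" by simp
  qed
  moreover have "finite (\<Union>i\<in>UNIV. E i ` M)" using M(1) by simp
  ultimately show ?thesis unfolding finite_dim_def by (intro exI conjI)
qed

lemma local_spaces_rows: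
  "poly_deg_vec k = with_rows_in (poly_deg k)" "poly_deg_tensor k = with_rows_in (poly_deg_vec k)"
  "RT_tensor k = with_rows_in (RT k)" "bubble_curls_tensor k K = with_rows_in (bubble_curls k K)"
  by (auto simp: poly_deg_vec_def poly_deg_tensor_def RT_tensor_def bubble_curls_tensor_def with_rows_in_def)

lemma poly_deg_subspace: "subspace (poly_deg k)" and poly_deg_finite_dim: "finite_dim (poly_deg k)"
proof -
  show "subspace (poly_deg k)" by (simp add: poly_deg_polys polys_subspace)
  show "finite_dim (poly_deg k)"
    unfolding finite_dim_def poly_deg_polys polys_def using finite_exponents by blast
qed

lemma poly_deg_vec_subspace: "subspace (poly_deg_vec k)" and poly_deg_vec_finite_dim: "finite_dim (poly_deg_vec k)"
  unfolding local_spaces_rows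
  by (rule with_rows_in_subspace poly_deg_subspace finite_dim_with_rows_in poly_deg_finite_dim)+

lemma poly_deg_tensor_subspace: "subspace (poly_deg_tensor k)"
  unfolding local_spaces_rows(2) by (rule with_rows_in_subspace[OF poly_deg_vec_subspace])

lemma RT_sum: "RT k = {a + b |a b. a \<in> poly_deg_vec k \<and> b \<in> (\<lambda>b x. b x *\<^sub>R x) ` poly_deg k}"
  unfolding RT_def by (fastforce simp: plus_fun_def)

lemma RT_subspace: "subspace (RT k :: (real^'n \<Rightarrow> real^'n) set)"
  and RT_finite_dim: "finite_dim (RT k :: (real^'n \<Rightarrow> real^'n) set)"
proof -
  define R where "R = (\<lambda>(b :: real^'n \<Rightarrow> real) x. b x *\<^sub>R x)"
  have e: "RT k = {a + b |a b. a \<in> poly_deg_vec k \<and> b \<in> R ` poly_deg k}" by (simp add: RT_sum R_def)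
  have lin: "R (c *\<^sub>R p + q) = c *\<^sub>R R p + R q" for c p q by (auto simp: R_def algebra_simps)
  show "subspace (RT k :: (real^'n \<Rightarrow> real^'n) set)"
    unfolding e by (intro subspace_sums poly_deg_vec_subspace subspace_image_on poly_deg_subspace lin)
  show "finite_dim (RT k :: (real^'n \<Rightarrow> real^'n) set)"
    unfolding e by (intro finite_dim_plus poly_deg_vec_finite_dim finite_dim_image_on poly_deg_subspace poly_deg_finite_dim lin)
qed

subsection \<open>Bubble functions\<close>

lemma simplex_vertices:
  fixes K :: "(real^'n) set"
  assumes "int CARD('n) simplex K"
  obtains C where "finite C" "\<not> affine_dependent C" "affine hull C = UNIV" "K = convex hull C"
    "{v. v extreme_point_of K} = C"
proof -
  obtain C where C: "\<not> affine_dependent C" "int (card C) = int CARD('n) + 1" "K = convex hull C"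
    using assms unfolding simplex_def by blast
  have "aff_dim C = int CARD('n)" using aff_dim_affine_independent[OF C(1)] C(2) by simp
  then have "affine hull C = UNIV" using aff_dim_eq_full[of C] by simp
  moreover have "{v. v extreme_point_of K} = C"
    using extreme_point_of_convex_hull_affine_independent[OF C(1)] C(3) by auto
  ultimately show ?thesis using that C aff_independent_finite[OF C(1)] by blast
qed

definition is_barycentric :: "(real^'n) set \<Rightarrow> real^'n \<Rightarrow> (real^'n \<Rightarrow> real) \<Rightarrow> bool" where
  "is_barycentric V x c \<longleftrightarrow> (\<forall>v. v \<notin> V \<longrightarrow> c v = 0) \<and> (\<Sum>v\<in>V. c v) = 1 \<and> (\<Sum>v\<in>V. c v *\<^sub>R v) = x"

context
  fixes V :: "(real^'n) set"
  assumes V: "finite V" "\<not> affine_dependent V" "affine hull V = UNIV"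
begin

lemma is_barycentric_unique:
  assumes "is_barycentric V x c" "is_barycentric V x d" shows "c = d"
proof
  fix v
  have "(\<Sum>v\<in>V. c v - d v) = 0" "(\<Sum>v\<in>V. (c v - d v) *\<^sub>R v) = 0"
    using assms by (auto simp: is_barycentric_def sum_subtractf scaleR_diff_left)
  then have "\<forall>v\<in>V. c v - d v = 0" using V(2) affine_dependent_explicit_finite[OF V(1)] by blast
  then show "c v = d v" using assms by (cases "v \<in> V") (auto simp: is_barycentric_def)
qed

lemma is_barycentric_barycentric: "is_barycentric V x (barycentric V x)"
proof -
  have "x \<in> affine hull V" using V by simp
  then obtain u where u: "sum u V = 1" "(\<Sum>v\<in>V. u v *\<^sub>R v) = x" unfolding affine_hull_finite[OF V(1)] by blast
  have "is_barycentric V x (\<lambda>v. if v \<in> V then u v else 0)"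
    using u by (simp add: is_barycentric_def if_distrib[of "\<lambda>t. t *\<^sub>R _"] cong: if_cong)
  then have "is_barycentric V x (THE c. is_barycentric V x c)"
    using is_barycentric_unique by (metis (no_types, lifting) theI)
  then show ?thesis by (simp add: barycentric_def is_barycentric_def)
qed

text \<open>By uniqueness the barycentric coordinates are affine functions of the point.\<close>

lemma barycentric_polynomial: "real_polynomial_function (\<lambda>x. barycentric V x v)"
proof -
  define L where "L x = barycentric V x v - barycentric V 0 v" for x
  have comb: "barycentric V (c *\<^sub>R x + y) v = c * barycentric V x v + barycentric V y v - c * barycentric V 0 v" for x y c
  proof -
    have "is_barycentric V (c *\<^sub>R x + y) (\<lambda>v. c * barycentric V x v + barycentric V y v - c * barycentric V 0 v)"
      using is_barycentric_barycentric[of x] is_barycentric_barycentric[of y] is_barycentric_barycentric[of 0]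
      by (simp add: is_barycentric_def sum_subtractf sum.distrib sum_distrib_left[symmetric] scaleR_diff_left scaleR_add_left
          scaleR_scaleR[symmetric] scaleR_sum_right[symmetric] del: scaleR_scaleR)
    from is_barycentric_unique[OF is_barycentric_barycentric this] show ?thesis by metis
  qed
  have "linear L"
  proof (rule linearI)
    show "L (x + y) = L x + L y" for x y using comb[of 1 x y] by (simp add: L_def)
    show "L (c *\<^sub>R x) = c *\<^sub>R L x" for c x using comb[of c x 0] by (simp add: L_def algebra_simps)
  qed
  then have "real_polynomial_function L"
    by (intro real_polynomial_function.intros(1)) (simp add: linear_conv_bounded_linear)
  then have "real_polynomial_function (\<lambda>x. L x + barycentric V 0 v)"
    by (intro real_polynomial_function.intros(3) real_polynomial_function.intros(2))
  then show ?thesis by (simp add: L_def)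
qed

end

lemma bubble_polynomial:
  fixes K :: "(real^'n) set"
  assumes "int CARD('n) simplex K" shows "real_polynomial_function (bubble K)"
proof -
  obtain C where C: "finite C" "\<not> affine_dependent C" "affine hull C = UNIV" "{v. v extreme_point_of K} = C"
    using simplex_vertices[OF assms] by blast
  show ?thesis unfolding bubble_def[abs_def] Let_def C(4)
    using C by (intro real_polynomial_function_prod barycentric_polynomial)
qed

lemma coord_bij: "bij_betw (coord :: nat \<Rightarrow> 'n::finite) {1..CARD('n)} UNIV"
proof -
  have "\<exists>h. bij_betw h {1..CARD('n)} (UNIV :: 'n set)"
    by (rule finite_same_card_bij) auto
  then show ?thesis unfolding coord_def by (rule someI_ex)
qed

lemma coord_sum_2:
  assumes "CARD('n::finite) = 2"
  shows "(\<Sum>i\<in>UNIV. f i) = f (coord 1 :: 'n) + f (coord 2)" and "(coord 2 :: 'n) \<noteq> coord 1"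
proof -
  have b: "bij_betw (coord :: nat \<Rightarrow> 'n) {1..2} UNIV" using coord_bij[where 'n='n] assms by simp
  have s: "{1..2} = {1, 2::nat}" by auto
  show "(\<Sum>i\<in>UNIV. f i) = f (coord 1 :: 'n) + f (coord 2)"
    using sum.reindex_bij_betw[OF b, of f] unfolding s by simp
  show "(coord 2 :: 'n) \<noteq> coord 1" using b unfolding bij_betw_def inj_on_def s by auto
qed

lemma coord_sum_3:
  assumes "CARD('n::finite) = 3"
  shows "(\<Sum>i\<in>UNIV. f i) = f (coord 1 :: 'n) + f (coord 2) + f (coord 3)"
    and "(coord 2 :: 'n) \<noteq> coord 1" "(coord 3 :: 'n) \<noteq> coord 1" "(coord 3 :: 'n) \<noteq> coord 2"
proof -
  have b: "bij_betw (coord :: nat \<Rightarrow> 'n) {1..3} UNIV" using coord_bij[where 'n='n] assms by simp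
  have s: "{1..3} = {1, 2, 3::nat}" by auto
  show "(\<Sum>i\<in>UNIV. f i) = f (coord 1 :: 'n) + f (coord 2) + f (coord 3)"
    using sum.reindex_bij_betw[OF b, of f] unfolding s by (simp add: add.assoc)
  show "(coord 2 :: 'n) \<noteq> coord 1" "(coord 3 :: 'n) \<noteq> coord 1" "(coord 3 :: 'n) \<noteq> coord 2"
    using b unfolding bij_betw_def inj_on_def s by auto
qed

lemma partial_deriv_minus:
  assumes "real_polynomial_function f"
  shows "partial_deriv i (\<lambda>x. - f x) = (\<lambda>x. - partial_deriv i f x)"
  using partial_deriv_times[of "\<lambda>_. -1" f i] polynomial_differentiable(1)[OF assms]
  by (auto simp: partial_deriv_const)

lemma partial_deriv_minus_diff:
  assumes "real_polynomial_function f" "real_polynomial_function g"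
  shows "partial_deriv i (\<lambda>x. f x - g x) = (\<lambda>x. partial_deriv i f x - partial_deriv i g x)"
  using partial_deriv_plus[of f "\<lambda>x. - g x" i] polynomial_differentiable(1)[OF assms(1)]
    polynomial_differentiable(1)[OF real_polynomial_function_minus[OF assms(2)]]
  by (auto simp: partial_deriv_minus[OF assms(2)])

text \<open>Second derivatives commute.\<close>

lemma curl2_divergence_free:
  fixes \<phi> :: "real^'n \<Rightarrow> real"
  assumes n: "CARD('n) = 2" and \<phi>: "real_polynomial_function \<phi>"
  shows "real_polynomial_function (\<lambda>x. curl2 \<phi> x $ i)" "(\<Sum>i\<in>UNIV. partial_deriv i (\<lambda>x. curl2 \<phi> x $ i) x) = 0"
proof -
  note p = polynomial_differentiable(2)[OF \<phi>]
  have c: "(\<lambda>x. curl2 \<phi> x $ coord 1) = partial_deriv (coord 2) \<phi>"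
    "(\<lambda>x. curl2 \<phi> x $ coord 2) = (\<lambda>x. - partial_deriv (coord 1) \<phi> x)"
    using coord_sum_2(2)[OF n] by (auto simp: curl2_def)
  have "i = coord 1 \<or> (\<lambda>x. curl2 \<phi> x $ i) = (\<lambda>x. - partial_deriv (coord 1) \<phi> x)" by (auto simp: curl2_def)
  then show "real_polynomial_function (\<lambda>x. curl2 \<phi> x $ i)"
    using c(1) p real_polynomial_function_minus[OF p] by auto
  show "(\<Sum>i\<in>UNIV. partial_deriv i (\<lambda>x. curl2 \<phi> x $ i) x) = 0"
    unfolding coord_sum_2(1)[OF n] c partial_deriv_minus[OF p]
    using polynomial_differentiable(3)[OF \<phi>, of "coord 1" "coord 2"] by simp
qed

lemma curl3_divergence_free:
  fixes \<psi> :: "real^'n \<Rightarrow> real^'n"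
  assumes n: "CARD('n) = 3" and \<psi>: "\<And>j. real_polynomial_function (\<lambda>x. \<psi> x $ j)"
  shows "real_polynomial_function (\<lambda>x. curl3 \<psi> x $ i)" "(\<Sum>i\<in>UNIV. partial_deriv i (\<lambda>x. curl3 \<psi> x $ i) x) = 0"
proof -
  define D where "D a b = partial_deriv (coord a) (\<lambda>y. \<psi> y $ coord b)" for a b
  have p: "real_polynomial_function (D a b)" for a b unfolding D_def by (rule polynomial_differentiable(2)[OF \<psi>])
  have c: "(\<lambda>x. curl3 \<psi> x $ coord 1) = (\<lambda>x. D 2 3 x - D 3 2 x)"
    "(\<lambda>x. curl3 \<psi> x $ coord 2) = (\<lambda>x. D 3 1 x - D 1 3 x)"
    "(\<lambda>x. curl3 \<psi> x $ coord 3) = (\<lambda>x. D 1 2 x - D 2 1 x)"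
    using coord_sum_3(2-4)[OF n] by (auto simp: curl3_def D_def Let_def)
  have "i = coord 1 \<or> i = coord 2 \<or> (\<lambda>x. curl3 \<psi> x $ i) = (\<lambda>x. D 1 2 x - D 2 1 x)"
    by (auto simp: curl3_def D_def Let_def)
  then show "real_polynomial_function (\<lambda>x. curl3 \<psi> x $ i)"
    using c real_polynomial_function_diff[OF p p] by metis
  have sym: "partial_deriv (coord a) (D b m) = partial_deriv (coord b) (D a m)" for a b m
    unfolding D_def by (rule polynomial_differentiable(3)[OF \<psi>])
  show "(\<Sum>i\<in>UNIV. partial_deriv i (\<lambda>x. curl3 \<psi> x $ i) x) = 0"
    unfolding coord_sum_3(1)[OF n] c partial_deriv_minus_diff[OF p p]
    using sym[of 1 2 3] sym[of 1 3 2] sym[of 2 3 1] by simp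
qed

lemma curl2_lincomb:
  assumes "real_polynomial_function f" "real_polynomial_function g"
  shows "curl2 (c *\<^sub>R f + g) = c *\<^sub>R curl2 f + curl2 g"
  by (rule ext) (simp add: curl2_def partial_deriv_diff_lincomb[OF assms] vec_eq_iff)

lemma curl3_lincomb:
  assumes "\<And>j. real_polynomial_function (\<lambda>x. f x $ j)" "\<And>j. real_polynomial_function (\<lambda>x. g x $ j)"
  shows "curl3 (c *\<^sub>R f + g) = c *\<^sub>R curl3 f + curl3 g"
proof -
  have "partial_deriv i (\<lambda>x. (c *\<^sub>R f + g) x $ j) x
      = c * partial_deriv i (\<lambda>x. f x $ j) x + partial_deriv i (\<lambda>x. g x $ j) x" for i j x
  proof -
    have "(\<lambda>x. (c *\<^sub>R f + g) x $ j) = c *\<^sub>R (\<lambda>x. f x $ j) + (\<lambda>x. g x $ j)" by auto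
    then show ?thesis by (simp only: partial_deriv_diff_lincomb[OF assms]) simp
  qed
  then show ?thesis by (intro ext) (simp add: curl3_def Let_def vec_eq_iff algebra_simps)
qed

lemma bubble_curls_spaces:
  fixes K :: "(real^'n) set"
  assumes n: "CARD('n) \<in> {2, 3}" and K: "int CARD('n) simplex K"
  shows "subspace (bubble_curls k K)" "finite_dim (bubble_curls k K)"
    "\<And>b i. b \<in> bubble_curls k K \<Longrightarrow> real_polynomial_function (\<lambda>x. b x $ i)"
    "\<And>b x. b \<in> bubble_curls k K \<Longrightarrow> (\<Sum>i\<in>UNIV. partial_deriv i (\<lambda>x. b x $ i) x) = 0"
proof -
  note B = bubble_polynomial[OF K]
  have poly: "real_polynomial_function \<phi>" if "\<phi> \<in> poly_deg k" for \<phi> :: "real^'n \<Rightarrow> real"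
    using that polynomial_polys by (auto simp: poly_deg_polys)
  have polyv: "real_polynomial_function (\<lambda>x. \<psi> x $ j)" if "\<psi> \<in> poly_deg_vec k" for \<psi> :: "real^'n \<Rightarrow> real^'n" and j
    using that poly by (auto simp: poly_deg_vec_def)
  have "subspace (bubble_curls k K) \<and> finite_dim (bubble_curls k K) \<and>
    (\<forall>b\<in>bubble_curls k K. (\<forall>i. real_polynomial_function (\<lambda>x. b x $ i)) \<and>
       (\<forall>x. (\<Sum>i\<in>UNIV. partial_deriv i (\<lambda>x. b x $ i) x) = 0))"
  proof (cases "CARD('n) = 2")
    case True
    define F where "F \<phi> = curl2 (\<lambda>x. bubble K x * \<phi> x)" for \<phi>
    have e: "bubble_curls k K = F ` poly_deg k" using True by (auto simp: bubble_curls_def F_def)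
    have pb: "real_polynomial_function (\<lambda>x. bubble K x * \<phi> x)" if "\<phi> \<in> poly_deg k" for \<phi>
      using B poly[OF that] by (rule real_polynomial_function.intros(4))
    have lin: "F (c *\<^sub>R \<phi> + \<psi>) = c *\<^sub>R F \<phi> + F \<psi>" if "\<phi> \<in> poly_deg k" "\<psi> \<in> poly_deg k" for c \<phi> \<psi>
    proof -
      have "(\<lambda>x. bubble K x * (c *\<^sub>R \<phi> + \<psi>) x) = c *\<^sub>R (\<lambda>x. bubble K x * \<phi> x) + (\<lambda>x. bubble K x * \<psi> x)"
        by (auto simp: algebra_simps)
      then show ?thesis unfolding F_def by (simp only: curl2_lincomb[OF pb[OF that(1)] pb[OF that(2)]])
    qed
    show ?thesis unfolding e
      using subspace_image_on[of "poly_deg k" F, OF poly_deg_subspace lin]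
        finite_dim_image_on[of "poly_deg k" F, OF poly_deg_subspace poly_deg_finite_dim lin]
        curl2_divergence_free[OF True pb] by (auto simp: F_def)
  next
    case False
    then have n3: "CARD('n) = 3" using n by auto
    define F where "F \<psi> = curl3 (\<lambda>x. bubble K x *\<^sub>R \<psi> x)" for \<psi>
    have e: "bubble_curls k K = F ` poly_deg_vec k" using False by (auto simp: bubble_curls_def F_def)
    have pb: "real_polynomial_function (\<lambda>x. (bubble K x *\<^sub>R \<psi> x) $ j)" if "\<psi> \<in> poly_deg_vec k" for \<psi> j
      using real_polynomial_function.intros(4)[OF B polyv[OF that]] by simp
    have lin: "F (c *\<^sub>R \<phi> + \<psi>) = c *\<^sub>R F \<phi> + F \<psi>" if "\<phi> \<in> poly_deg_vec k" "\<psi> \<in> poly_deg_vec k" for c \<phi> \<psi>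
    proof -
      have "(\<lambda>x. bubble K x *\<^sub>R (c *\<^sub>R \<phi> + \<psi>) x) = c *\<^sub>R (\<lambda>x. bubble K x *\<^sub>R \<phi> x) + (\<lambda>x. bubble K x *\<^sub>R \<psi> x)"
        by (auto simp: algebra_simps)
      then show ?thesis unfolding F_def by (simp only: curl3_lincomb[OF pb[OF that(1)] pb[OF that(2)]])
    qed
    show ?thesis unfolding e
      using subspace_image_on[of "poly_deg_vec k" F, OF poly_deg_vec_subspace lin]
        finite_dim_image_on[of "poly_deg_vec k" F, OF poly_deg_vec_subspace poly_deg_vec_finite_dim lin]
        curl3_divergence_free[OF n3 pb] by (auto simp: F_def)
  qed
  then show "subspace (bubble_curls k K)" "finite_dim (bubble_curls k K)"
    "\<And>b i. b \<in> bubble_curls k K \<Longrightarrow> real_polynomial_function (\<lambda>x. b x $ i)"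
    "\<And>b x. b \<in> bubble_curls k K \<Longrightarrow> (\<Sum>i\<in>UNIV. partial_deriv i (\<lambda>x. b x $ i) x) = 0" by auto
qed

lemma simplex_interior:
  fixes K :: "(real^'n) set"
  assumes "int CARD('n) simplex K"
  shows "compact K" "convex K" "interior K \<noteq> {}"
proof -
  obtain C where C: "finite C" "affine hull C = UNIV" "K = convex hull C"
    using simplex_vertices[OF assms] by blast
  show "compact K" "convex K" using C by (auto simp: finite_imp_compact_convex_hull)
  have "affine hull K = UNIV" using C by (simp add: affine_hull_convex_hull)
  moreover have "K \<noteq> {}" using calculation by force
  ultimately show "interior K \<noteq> {}"
    using \<open>convex K\<close> rel_interior_interior[of K] rel_interior_eq_empty[of K] by simp
qed

section \<open>The discrete spaces\<close>

lemma semi_inner_subspace: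
  assumes "semi_inner V ip" "subspace U" "U \<subseteq> V" shows "semi_inner U ip"
proof -
  interpret semi_inner V ip by fact
  show ?thesis
    by unfold_locales (use assms(2,3) ip_sym ip_add ip_scale ip_nonneg in \<open>auto simp: subset_iff\<close>)
qed

text \<open>A Lipschitz boundary has the complement of the closure on its other side, so the closure has no
  interior points outside the domain.\<close>

lemma lipschitz_boundary_interior_closure:
  fixes \<Omega> :: "(real^'n) set"
  assumes op: "open \<Omega>" and lb: "lipschitz_boundary \<Omega>"
  shows "interior (closure \<Omega>) \<subseteq> \<Omega>"
proof
  fix x assume x: "x \<in> interior (closure \<Omega>)"
  show "x \<in> \<Omega>"
  proof (rule ccontr)
    assume xn: "x \<notin> \<Omega>"
    have "x \<in> frontier \<Omega>" using xn x op interior_subset[of "closure \<Omega>"] by (auto simp: frontier_def interior_open)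
    obtain U \<nu> \<phi> L where U: "open U" "x \<in> U" "norm \<nu> = 1" "L-lipschitz_on {z. z \<bullet> \<nu> = 0} \<phi>"
      "\<Omega> \<inter> U = {y \<in> U. y \<bullet> \<nu> < \<phi> (y - (y \<bullet> \<nu>) *\<^sub>R \<nu>)}"
      using lb[unfolded lipschitz_boundary_def, rule_format, OF \<open>x \<in> frontier \<Omega>\<close>] by (elim exE conjE)
    have nn: "\<nu> \<bullet> \<nu> = 1" using U(3) by (simp add: norm_eq_1)
    define P where "P y = y - (y \<bullet> \<nu>) *\<^sub>R \<nu>" for y
    have P: "P y \<in> {z. z \<bullet> \<nu> = 0}" for y by (simp add: P_def inner_diff_left nn)
    have cP: "continuous_on UNIV P" unfolding P_def by (intro continuous_intros)
    have c: "continuous_on UNIV (\<lambda>y. \<phi> (P y))"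
      by (rule continuous_on_compose2[OF lipschitz_on_continuous_on[OF U(4)] cP]) (use P in auto)
    define V where "V = U \<inter> {y. \<phi> (P y) < y \<bullet> \<nu>}"
    have oV: "open V" unfolding V_def
      by (intro open_Int U(1) open_Collect_less c continuous_intros)
    have "V \<inter> \<Omega> = {}"
    proof -
      have "y \<notin> \<Omega>" if "y \<in> V" for y
      proof
        assume "y \<in> \<Omega>"
        then have "y \<in> \<Omega> \<inter> U" using that by (simp add: V_def)
        then have "y \<bullet> \<nu> < \<phi> (P y)" unfolding U(5) P_def by blast
        then show False using that by (simp add: V_def)
      qed
      then show ?thesis by blast
    qed
    then have dis: "V \<inter> closure \<Omega> = {}" using open_Int_closure_eq_empty[OF oV] by blast
    have xge: "\<phi> (P x) \<le> x \<bullet> \<nu>"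
    proof (rule ccontr)
      assume "\<not> \<phi> (P x) \<le> x \<bullet> \<nu>"
      then have "x \<in> \<Omega> \<inter> U" unfolding U(5) using U(2) by (simp add: P_def)
      then show False using xn by simp
    qed
    have "open (U \<inter> interior (closure \<Omega>))" using U(1) by blast
    then obtain e where e: "e > 0" "ball x e \<subseteq> U \<inter> interior (closure \<Omega>)"
      using x U(2) open_contains_ball by blast
    define y where "y = x + (e / 2) *\<^sub>R \<nu>"
    have yb: "y \<in> ball x e" using e U(3) by (simp add: y_def dist_norm)
    have "P y = P x" by (simp add: P_def y_def inner_add_left nn algebra_simps)
    then have "\<phi> (P y) < y \<bullet> \<nu>" using xge e(1) by (simp add: y_def inner_add_left nn)
    then have "y \<in> V" using yb e by (auto simp: V_def)
    then show False using dis yb e interior_subset[of "closure \<Omega>"] by blast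
  qed
qed

locale peers = bounded_open \<Omega> for \<Omega> :: "(real^'n) set" +
  fixes T :: "(real^'n) set set" and k :: nat and \<theta> :: real
  assumes dimension: "CARD('n) \<in> {2, 3}" and lipschitz: "lipschitz_boundary \<Omega>"
    and partition: "regular_partition \<Omega> \<theta> T"
begin

lemma finite_T: "finite T" and simplex_T: "K \<in> T \<Longrightarrow> int CARD('n) simplex K" and Union_T: "\<Union>T = closure \<Omega>"
  using partition by (auto simp: regular_partition_def triangulation_def)

lemma compact_T: "K \<in> T \<Longrightarrow> compact K" and convex_T: "K \<in> T \<Longrightarrow> convex K" and interior_T: "K \<in> T \<Longrightarrow> interior K \<noteq> {}"
  using simplex_interior[OF simplex_T[of K]] by simp_all

lemma sets_T [simp]: "K \<in> T \<Longrightarrow> K \<in> sets lebesgue"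
  by (intro lmeasurable_compact[THEN fmeasurableD] compact_T)

lemma interior_sub: "K \<in> T \<Longrightarrow> interior K \<subseteq> \<Omega>"
proof -
  assume "K \<in> T"
  then have "interior K \<subseteq> interior (closure \<Omega>)" using Union_T by (intro interior_mono) auto
  then show ?thesis using lipschitz_boundary_interior_closure[OF open_dom lipschitz] by (rule order_trans)
qed

lemma AE_boundary: "K \<in> T \<Longrightarrow> AE x in lebesgue. x \<in> K \<longrightarrow> x \<in> interior K"
proof -
  assume K: "K \<in> T"
  have "negligible (frontier K)" by (rule negligible_convex_frontier[OF convex_T[OF K]])
  then have "AE x in lebesgue. x \<notin> frontier K" by (intro AE_not_in) (simp add: negligible_iff_null_sets)
  then show ?thesis
    by eventually_elim (use closure_subset[of K] in \<open>auto simp: frontier_def\<close>)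
qed

lemma AE_restrict_T: "K \<in> T \<Longrightarrow> (AE x in lebesgue_on K. P x) \<longleftrightarrow> (AE x in lebesgue. x \<in> K \<longrightarrow> P x)"
  by (rule AE_restrict_space_iff) simp

lemma AE_restrict_dom: "(AE x in lebesgue_on \<Omega>. P x) \<longleftrightarrow> (AE x in lebesgue. x \<in> \<Omega> \<longrightarrow> P x)"
  by (rule AE_restrict_space_iff) simp

lemma AE_dom_if_AE_T:
  assumes "\<And>K. K \<in> T \<Longrightarrow> AE x in lebesgue_on K. P x" shows "AE x in lebesgue_on \<Omega>. P x"
proof -
  have "AE x in lebesgue. x \<in> K \<longrightarrow> P x" if "K \<in> T" for K
    using assms[OF that] AE_restrict_T[OF that] by simp
  then have "AE x in lebesgue. \<forall>K\<in>T. x \<in> K \<longrightarrow> P x" unfolding AE_finite_all[OF finite_T] by blast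
  moreover have "\<exists>K\<in>T. x \<in> K" if "x \<in> \<Omega>" for x using that Union_T closure_subset[of \<Omega>] by blast
  ultimately have "AE x in lebesgue. x \<in> \<Omega> \<longrightarrow> P x"
  proof eventually_elim
    case (elim x)
    then show ?case using \<open>\<And>x. x \<in> \<Omega> \<Longrightarrow> \<exists>K\<in>T. x \<in> K\<close> by blast
  qed
  then show ?thesis by (simp add: AE_restrict_dom)
qed

lemma AE_T_if_AE_dom:
  assumes "AE x in lebesgue_on \<Omega>. P x" "K \<in> T" shows "AE x in lebesgue_on K. P x"
proof -
  have "AE x in lebesgue. x \<in> \<Omega> \<longrightarrow> P x" using assms(1) by (simp add: AE_restrict_dom)
  then have "AE x in lebesgue. x \<in> K \<longrightarrow> P x"
    using AE_boundary[OF assms(2)]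
  proof eventually_elim
    case (elim x)
    then show ?case using interior_sub[OF assms(2)] by blast
  qed
  then show ?thesis using AE_restrict_T[OF assms(2)] by simp
qed

definition piecewise :: "((real^'n) set \<Rightarrow> (real^'n \<Rightarrow> 'b) set) \<Rightarrow> (real^'n \<Rightarrow> 'b) set" where
  "piecewise S = {e. \<forall>K\<in>T. \<exists>a\<in>S K. AE x in lebesgue_on K. e x = a x}"

lemma piecewise_subspace:
  fixes S :: "(real^'n) set \<Rightarrow> (real^'n \<Rightarrow> 'b::real_vector) set"
  assumes S: "\<And>K. K \<in> T \<Longrightarrow> subspace (S K)" shows "subspace (piecewise S)"
proof (rule subspaceI_lincomb)
  show "0 \<in> piecewise S" using subspace_0[OF S] by (auto simp: piecewise_def intro!: bexI[of _ 0])
  fix e f c assume ef: "e \<in> piecewise S" "f \<in> piecewise S"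
  show "c *\<^sub>R e + f \<in> piecewise S"
    unfolding piecewise_def
  proof (intro CollectI ballI)
    fix K assume K: "K \<in> T"
    obtain a b where a: "a \<in> S K" "AE x in lebesgue_on K. e x = a x" and b: "b \<in> S K" "AE x in lebesgue_on K. f x = b x"
      using ef K unfolding piecewise_def by blast
    have "AE x in lebesgue_on K. (c *\<^sub>R e + f) x = (c *\<^sub>R a + b) x" using a(2) b(2) by eventually_elim simp
    then show "\<exists>a\<in>S K. AE x in lebesgue_on K. (c *\<^sub>R e + f) x = a x"
      using subspace_add[OF S[OF K] subspace_scale[OF S[OF K] a(1), of c] b(1)] by blast
  qed
qed

definition local_Y :: "(real^'n) set \<Rightarrow> (real^'n \<Rightarrow> real^'n^'n) set" where
  "local_Y K = {a + b |a b. a \<in> RT_tensor k \<and> b \<in> bubble_curls_tensor k K}"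

definition local_X :: "(real^'n) set \<Rightarrow> (real^'n \<Rightarrow> real^'n^'n) set" where
  "local_X K = {a + b |a b. a \<in> poly_deg_tensor k \<and> b \<in> bubble_curls_tensor k K}"

lemma Yh_eq: "Yh \<Omega> T k = Hdiv \<Omega> \<inter> piecewise local_Y"
  and X1h_eq: "X1h \<Omega> T k = L2 \<Omega> \<inter> piecewise local_X"
  and Z1h_eq: "Z1h \<Omega> T k = L2 \<Omega> \<inter> piecewise (\<lambda>K. poly_deg_vec k)"
  unfolding Yh_def X1h_def Z1h_def piecewise_def local_Y_def local_X_def by fastforce+

lemma bubble_tensor_subspace: "K \<in> T \<Longrightarrow> subspace (bubble_curls_tensor k K)"
  and bubble_tensor_finite_dim: "K \<in> T \<Longrightarrow> finite_dim (bubble_curls_tensor k K)"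
  unfolding local_spaces_rows
  by (intro with_rows_in_subspace finite_dim_with_rows_in bubble_curls_spaces dimension simplex_T; assumption)+

lemma local_Y_subspace: "K \<in> T \<Longrightarrow> subspace (local_Y K)"
  unfolding local_Y_def local_spaces_rows(3)
  by (intro subspace_sums with_rows_in_subspace RT_subspace bubble_tensor_subspace)

lemma local_Y_finite_dim: "K \<in> T \<Longrightarrow> finite_dim (local_Y K)"
  unfolding local_Y_def local_spaces_rows(3)
  by (intro finite_dim_plus finite_dim_with_rows_in RT_finite_dim bubble_tensor_finite_dim)

lemma local_X_subspace: "K \<in> T \<Longrightarrow> subspace (local_X K)"
  unfolding local_X_def by (intro subspace_sums poly_deg_tensor_subspace bubble_tensor_subspace)

lemma Yh_subspace: "subspace (Yh \<Omega> T k)"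
  unfolding Yh_eq by (intro subspace_inter Hdiv_subspace piecewise_subspace local_Y_subspace)

lemma X1h_subspace: "subspace (X1h \<Omega> T k)"
  unfolding X1h_eq by (intro subspace_inter L2_subspace piecewise_subspace local_X_subspace)

lemma Z1h_subspace: "subspace (Z1h \<Omega> T k)"
  unfolding Z1h_eq by (intro subspace_inter L2_subspace piecewise_subspace poly_deg_vec_subspace)

lemma continuous_piecewise_subspace:
  fixes S :: "(real^'n \<Rightarrow> 'b::real_normed_vector) set"
  assumes S: "subspace S"
  shows "subspace {q. continuous_on (closure \<Omega>) q \<and> (\<forall>K\<in>T. \<exists>a\<in>S. \<forall>x\<in>K. q x = a x)}" (is "subspace ?V")
proof (rule subspaceI_lincomb)
  show "0 \<in> ?V" using subspace_0[OF S] by (auto intro!: bexI[of _ 0] simp: zero_fun_def)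
  fix p q c assume pq: "p \<in> ?V" "q \<in> ?V"
  have "continuous_on (closure \<Omega>) (\<lambda>x. c *\<^sub>R p x + q x)" using pq by (auto intro!: continuous_intros)
  moreover have "\<exists>a\<in>S. \<forall>x\<in>K. (c *\<^sub>R p + q) x = a x" if K: "K \<in> T" for K
  proof -
    obtain a b where "a \<in> S" "\<forall>x\<in>K. p x = a x" "b \<in> S" "\<forall>x\<in>K. q x = b x" using pq K by blast
    then show ?thesis using subspace_add[OF S subspace_scale[OF S, of a c], of b] by (intro bexI[of _ "c *\<^sub>R a + b"]) auto
  qed
  ultimately show "c *\<^sub>R p + q \<in> ?V" by (simp add: plus_fun_def scaleR_fun_def)
qed

lemma X2h_subspace: "subspace (X2h \<Omega> T k)"
  unfolding X2h_def by (rule continuous_piecewise_subspace[OF poly_deg_subspace])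

lemma Z2h_subspace: "subspace (Z2h \<Omega> T k)"
proof -
  have "Z2h \<Omega> T k = L2_skew \<Omega> \<inter> {q. continuous_on (closure \<Omega>) q \<and> (\<forall>K\<in>T. \<exists>a\<in>poly_deg_tensor (k + 1). \<forall>x\<in>K. q x = a x)}"
    by (auto simp: Z2h_def)
  then show ?thesis
    using subspace_inter[OF L2_skew_subspace continuous_piecewise_subspace[OF poly_deg_tensor_subspace]] by simp
qed

lemma Xh_subspace: "subspace (Xh \<Omega> T k)" and Zh_subspace: "subspace (Zh \<Omega> T k)"
  unfolding Xh_def Zh_def by (intro subspace_Times X1h_subspace X2h_subspace Z1h_subspace Z2h_subspace)+

lemma poly_deg_polynomial: "p \<in> poly_deg m \<Longrightarrow> real_polynomial_function p"
  using polynomial_polys by (auto simp: poly_deg_polys)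

text \<open>Continuous piecewise polynomials are Lipschitz along segments, with one constant for all
  elements, and differentiable off the null set of element boundaries.\<close>

lemma X2h_H1: "X2h \<Omega> T k \<subseteq> H1 \<Omega>"
proof
  fix q assume "q \<in> X2h \<Omega> T k"
  then have qc: "continuous_on (closure \<Omega>) q" and "\<forall>K\<in>T. \<exists>a\<in>poly_deg (k + 1). \<forall>x\<in>K. q x = a x"
    by (auto simp: X2h_def)
  then obtain a where a: "\<And>K. K \<in> T \<Longrightarrow> a K \<in> poly_deg (k + 1)" "\<And>K x. K \<in> T \<Longrightarrow> x \<in> K \<Longrightarrow> q x = a K x"
    by metis
  have ap: "real_polynomial_function (a K)" if "K \<in> T" for K by (rule poly_deg_polynomial[OF a(1)[OF that]])
  have "\<exists>L. \<forall>x y. closed_segment x y \<subseteq> K \<longrightarrow> \<bar>a K x - a K y\<bar> \<le> L * norm (x - y)" if "K \<in> T" for K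
    by (intro C1_lipschitz_on_segments compact_T that polynomial_differentiable(1) ap polynomial_continuous polynomial_differentiable(2))
  then obtain L where L: "\<And>K x y. K \<in> T \<Longrightarrow> closed_segment x y \<subseteq> K \<Longrightarrow> \<bar>a K x - a K y\<bar> \<le> L K * norm (x - y)"
    by metis
  define M where "M = (\<Sum>K\<in>T. \<bar>L K\<bar>)"
  have LM: "L K \<le> M" if "K \<in> T" for K
    using member_le_sum[of K T "\<lambda>K. \<bar>L K\<bar>"] that finite_T by (auto simp: M_def)
  have M0: "M \<ge> 0" by (simp add: M_def sum_nonneg)
  have lip: "\<bar>q x - q y\<bar> \<le> M * norm (x - y)" if seg: "closed_segment x y \<subseteq> \<Omega>" for x y
  proof -
    define h where "h t = x + t *\<^sub>R (y - x)" for t :: real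
    have ch: "continuous_on UNIV h" unfolding h_def by (intro continuous_intros)
    \<comment> \<open>the finitely many closed elements cut the segment into pieces with a common Lipschitz constant\<close>
    have "(M * norm (y - x))-lipschitz_on {0..1} (\<lambda>t. q (h t))"
    proof (rule lipschitz_on_closed_Union)
      show "finite T" by (rule finite_T)
      show "0 \<le> M * norm (y - x)" using M0 by simp
      fix K assume K: "K \<in> T"
      show "closed (h -` K)"
        using continuous_closed_vimage[of K h] compact_imp_closed[OF compact_T[OF K]] ch continuous_on_eq_continuous_at[of UNIV h] by auto
      show "(M * norm (y - x))-lipschitz_on (h -` K) (\<lambda>t. q (h t))"
      proof (rule lipschitz_onI)
        fix s t assume st: "s \<in> h -` K" "t \<in> h -` K"
        then have "closed_segment (h s) (h t) \<subseteq> K" using convex_T[OF K] by (simp add: closed_segment_subset)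
        then have "\<bar>q (h s) - q (h t)\<bar> \<le> L K * norm (h s - h t)" using L[OF K] a(2)[OF K] st by simp
        also have "\<dots> \<le> M * norm (h s - h t)" using LM[OF K] by (rule mult_right_mono) simp
        also have "h s - h t = (s - t) *\<^sub>R (y - x)" by (simp add: h_def algebra_simps)
        finally show "dist (q (h s)) (q (h t)) \<le> M * norm (y - x) * dist s t"
          by (simp add: dist_real_def mult_ac)
      qed (use M0 in simp)
    next
      have "h t \<in> closed_segment x y" if "t \<in> {0..1}" for t
        using that by (auto simp: in_segment h_def algebra_simps intro!: exI[of _ t])
      then have "h t \<in> \<Union>T" if "t \<in> {0..1}" for t
        using that seg closure_subset[of \<Omega>] unfolding Union_T by (meson subsetD)
      then show "{0..1} \<subseteq> (\<Union>K\<in>T. h -` K)" by auto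
    qed
    then have "dist (q (h 0)) (q (h 1)) \<le> M * norm (y - x) * dist 0 (1::real)" by (rule lipschitz_onD) auto
    then show ?thesis by (simp add: h_def dist_real_def norm_minus_commute)
  qed
  define U where "U = (\<Union>K\<in>T. interior K)"
  have oU: "open U" by (auto simp: U_def)
  have U\<Omega>: "U \<subseteq> \<Omega>" using interior_sub by (auto simp: U_def)
  define g where "g i x = indicator U x * partial_deriv i q x" for i x
  have loc: "(q has_derivative (\<lambda>h. \<Sum>i\<in>UNIV. h $ i * partial_deriv i (a K) x)) (at x)" if K: "K \<in> T" and x: "x \<in> interior K" for K x
  proof (rule has_derivative_transform_within_open)
    show "(a K has_derivative (\<lambda>h. \<Sum>i\<in>UNIV. h $ i * partial_deriv i (a K) x)) (at x)"
      by (rule has_derivative_partial_deriv[OF polynomial_differentiable(1)[OF ap[OF K]]])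
    show "a K y = q y" if "y \<in> interior K" for y
      using a(2)[OF K subsetD[OF interior_subset that]] by simp
  qed (use x in auto)
  have dq: "q differentiable (at x)" and dqa: "partial_deriv i q x = partial_deriv i (a K) x"
    if K: "K \<in> T" and x: "x \<in> interior K" for K x i
  proof -
    show "q differentiable (at x)" using loc[OF K x] by (auto simp: differentiable_def)
    have "partial_deriv i q x = (\<Sum>j\<in>UNIV. axis i 1 $ j * partial_deriv j (a K) x)"
      by (rule partial_deriv_has_derivative[OF loc[OF K x]])
    also have "\<dots> = (\<Sum>j\<in>UNIV. if j = i then partial_deriv j (a K) x else 0)"
      by (intro sum.cong) (auto simp: axis_def)
    finally show "partial_deriv i q x = partial_deriv i (a K) x" by simp
  qed
  have gm: "g i \<in> borel_measurable lebesgue" for i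
  proof -
    have "continuous_on U (partial_deriv i q)"
    proof (subst continuous_on_eq_continuous_at[OF oU], intro ballI)
      fix x assume "x \<in> U"
      then obtain K where K: "K \<in> T" "x \<in> interior K" by (auto simp: U_def)
      have "isCont (partial_deriv i (a K)) x"
        using polynomial_continuous[OF polynomial_differentiable(2)[OF ap[OF K(1)]], of UNIV i] by (simp add: continuous_on_eq_continuous_at)
      moreover have "eventually (\<lambda>y. partial_deriv i (a K) y = partial_deriv i q y) (nhds x)"
        using eventually_nhds_in_open[OF open_interior K(2)] by eventually_elim (simp add: dqa[OF K(1)])
      ultimately show "isCont (partial_deriv i q) x" using isCont_cong by blast
    qed
    then have "(\<lambda>x. indicator U x *\<^sub>R partial_deriv i q x) \<in> borel_measurable borel"
      using oU by (intro borel_measurable_continuous_on_indicator) auto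
    then have "g i \<in> borel_measurable lborel" by (simp add: g_def[abs_def])
    then show ?thesis by (rule measurable_completion)
  qed
  have gL2: "g i \<in> L2 \<Omega>" for i
  proof -
    have "\<exists>B. \<forall>x\<in>K. \<bar>partial_deriv i (a K) x\<bar> \<le> B" if K: "K \<in> T" for K
      using compact_imp_bounded[OF compact_continuous_image[OF polynomial_continuous[OF polynomial_differentiable(2)[OF ap[OF K]]] compact_T[OF K]], of i]
      by (auto simp: bounded_iff)
    then obtain B where B: "\<And>K x. K \<in> T \<Longrightarrow> x \<in> K \<Longrightarrow> \<bar>partial_deriv i (a K) x\<bar> \<le> B K" by metis
    have "norm (g i x) \<le> (\<Sum>K\<in>T. \<bar>B K\<bar>)" for x
    proof (cases "x \<in> U")
      case True
      then obtain K where K: "K \<in> T" "x \<in> interior K" by (auto simp: U_def)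
      have "\<bar>partial_deriv i q x\<bar> \<le> \<bar>B K\<bar>" using B[OF K(1)] dqa[OF K] K(2) interior_subset by fastforce
      also have "\<dots> \<le> (\<Sum>K\<in>T. \<bar>B K\<bar>)" using K(1) finite_T by (intro member_le_sum) auto
      finally show ?thesis using True by (simp add: g_def)
    qed (simp add: g_def sum_nonneg)
    then show ?thesis
      by (intro L2_bounded_function[OF bounded_dom dom_sets measurable_restrict_space1[OF gm]])
  qed
  have "has_weak_grad \<Omega> q (\<lambda>x. \<chi> i. g i x)"
    unfolding has_weak_grad_def
  proof (intro conjI ballI allI)
    show "(\<lambda>x. \<chi> i. g i x) \<in> L2 \<Omega>" by (rule L2_vec) (simp add: gL2)
    fix \<phi> i assume \<phi>: "\<phi> \<in> test_functions \<Omega>"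
    have "(LINT x|lebesgue_on \<Omega>. q x * partial_deriv i \<phi> x) = - (LINT x|lebesgue_on \<Omega>. g i x * \<phi> x)"
    proof (rule integration_by_parts_lipschitz[OF open_dom \<phi>])
      show "continuous_on \<Omega> q" using qc closure_subset continuous_on_subset by blast
      show "\<exists>L. \<forall>x y. closed_segment x y \<subseteq> S \<longrightarrow> \<bar>q x - q y\<bar> \<le> L * norm (x - y)" if "S \<subseteq> \<Omega>" for S
        using lip that by (intro exI[of _ M]) blast
      show "g i \<in> borel_measurable (lebesgue_on \<Omega>)" by (rule measurable_restrict_space1[OF gm])
      show "AE x in lebesgue_on \<Omega>. ((\<lambda>s. q (x + s *\<^sub>R axis i 1)) has_real_derivative g i x) (at 0)"
      proof (rule AE_dom_if_AE_T)
        fix K assume K: "K \<in> T"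
        have "AE x in lebesgue. x \<in> K \<longrightarrow> ((\<lambda>s. q (x + s *\<^sub>R axis i 1)) has_real_derivative g i x) (at 0)"
          using AE_boundary[OF K]
        proof eventually_elim
          case (elim x)
          show ?case
          proof
            assume "x \<in> K"
            then have x: "x \<in> interior K" using elim by blast
            then have "x \<in> U" using K by (auto simp: U_def)
            then show "((\<lambda>s. q (x + s *\<^sub>R axis i 1)) has_real_derivative g i x) (at 0)"
              using partial_deriv_DERIV[OF dq[OF K x], of i] by (simp add: g_def)
          qed
        qed
        then show "AE x in lebesgue_on K. ((\<lambda>s. q (x + s *\<^sub>R axis i 1)) has_real_derivative g i x) (at 0)"
          by (simp add: AE_restrict_T[OF K])
      qed
    qed
    then show "(LINT x|lebesgue_on \<Omega>. q x * partial_deriv i \<phi> x) = - (LINT x|lebesgue_on \<Omega>. (\<chi> i. g i x) $ i * \<phi> x)" by simp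
  qed
  then show "q \<in> H1 \<Omega>" unfolding H1_def using continuous_L2[OF qc] by blast
qed

lemma Xh_X: "Xh \<Omega> T k \<subseteq> X_space \<Omega>"
  unfolding Xh_def X_space_def using X2h_H1 by (auto simp: X1h_def)

lemma Yh_Y: "Yh \<Omega> T k \<subseteq> Y_space \<Omega>"
  unfolding Yh_def Y_space_def by auto

lemma Zh_Z: "Zh \<Omega> T k \<subseteq> Z_space \<Omega>"
  unfolding Zh_def Z_space_def by (auto simp: Z1h_def Z2h_def)

lemma const_X1h: "(\<lambda>x. c) \<in> X1h \<Omega> T k" and const_Z1h: "(\<lambda>x. d) \<in> Z1h \<Omega> T k"
proof -
  have m: "bounded \<Omega>" "\<Omega> \<in> sets lebesgue" by (simp_all add: bounded_dom)
  have pc: "(\<lambda>x::real^'n. r) \<in> poly_deg k" for r by (simp add: poly_deg_polys const_polys)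
  have "(\<lambda>x. c) \<in> poly_deg_tensor k" using pc by (simp add: poly_deg_tensor_def poly_deg_vec_def)
  then show "(\<lambda>x. c) \<in> X1h \<Omega> T k"
    unfolding X1h_def
  proof (intro CollectI conjI ballI)
    show "(\<lambda>x. c) \<in> L2 \<Omega>" by (rule L2_const_bounded[OF m])
    fix K assume K: "K \<in> T"
    show "\<exists>a\<in>poly_deg_tensor k. \<exists>b\<in>bubble_curls_tensor k K. AE x in lebesgue_on K. c = a x + b x"
      using subspace_0[OF bubble_tensor_subspace[OF K]] \<open>(\<lambda>x. c) \<in> poly_deg_tensor k\<close>
      by (intro bexI[of _ "\<lambda>x. c"] bexI[of _ 0]) auto
  qed
  have "(\<lambda>x. d) \<in> poly_deg_vec k" using pc by (simp add: poly_deg_vec_def)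
  then show "(\<lambda>x. d) \<in> Z1h \<Omega> T k" unfolding Z1h_def using L2_const_bounded[OF m] by auto
qed

end

lemma L2_subset: "f \<in> L2 \<Omega> \<Longrightarrow> S \<subseteq> \<Omega> \<Longrightarrow> S \<in> sets lebesgue \<Longrightarrow> \<Omega> \<in> sets lebesgue \<Longrightarrow> f \<in> L2 S"
  unfolding L2_def
proof (elim CollectE conjE, intro CollectI conjI)
  assume S: "S \<subseteq> \<Omega>" "S \<in> sets lebesgue" "\<Omega> \<in> sets lebesgue"
  assume f: "f \<in> borel_measurable (lebesgue_on \<Omega>)" and i: "integrable (lebesgue_on \<Omega>) (\<lambda>x. (norm (f x))\<^sup>2)"
  have e: "lebesgue_on S = restrict_space (lebesgue_on \<Omega>) S"
    using S by (simp add: restrict_restrict_space Int_absorb1)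
  have S': "S \<inter> space (lebesgue_on \<Omega>) \<in> sets (lebesgue_on \<Omega>)"
    using S by (simp add: sets_restrict_space_iff Int_absorb2)
  show "f \<in> borel_measurable (lebesgue_on S)" unfolding e by (rule measurable_restrict_space1[OF f])
  show "integrable (lebesgue_on S) (\<lambda>x. (norm (f x))\<^sup>2)"
    unfolding e integrable_restrict_space[OF S'] using S' i S
    by (intro integrable_mult_indicator) (simp_all add: Int_absorb2)
qed

lemma integral_restrict_subset:
  fixes f :: "real^'n \<Rightarrow> real"
  assumes "S \<subseteq> \<Omega>" "S \<in> sets lebesgue" "\<Omega> \<in> sets lebesgue" "\<And>x. x \<notin> S \<Longrightarrow> f x = 0"
  shows "(LINT x|lebesgue_on \<Omega>. f x) = (LINT x|lebesgue_on S. f x)"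
proof -
  have "(\<lambda>x. indicator \<Omega> x *\<^sub>R f x) = (\<lambda>x. indicator S x *\<^sub>R f x)"
    using assms(1,4) by (auto simp: indicator_def fun_eq_iff)
  then show ?thesis using assms(2,3) by (simp add: integral_restrict_space)
qed

definition divergence :: "(real^'n \<Rightarrow> real^'n) \<Rightarrow> real^'n \<Rightarrow> real" where
  "divergence t x = (\<Sum>j\<in>UNIV. partial_deriv j (\<lambda>x. t x $ j) x)"

lemma divergence_add:
  assumes "\<And>j. real_polynomial_function (\<lambda>x. s x $ j)" "\<And>j. real_polynomial_function (\<lambda>x. t x $ j)"
  shows "divergence (\<lambda>x. s x + t x) x = divergence s x + divergence t x"
  using assms by (simp add: divergence_def partial_deriv_plus polynomial_differentiable(1) sum.distrib)

lemma RT_divergence: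
  assumes "a \<in> RT k"
  shows "real_polynomial_function (\<lambda>x. a x $ j)" "divergence a \<in> poly_deg k"
    "(\<And>x. divergence a x = 0) \<Longrightarrow> a \<in> poly_deg_vec k"
proof -
  obtain p q where a: "a = (\<lambda>x. p x + q x *\<^sub>R x)" and p': "p \<in> poly_deg_vec k" and q': "q \<in> poly_deg k"
    using assms by (auto simp: RT_def)
  have p: "(\<lambda>x. p x $ i) \<in> polys (Suc k)" for i using p' by (simp add: poly_deg_vec_def poly_deg_polys)
  have q: "q \<in> polys (Suc k)" using q' by (simp add: poly_deg_polys)
  have xq: "(\<lambda>x. x $ i * q x) \<in> polys (Suc (Suc k))" for i by (rule coordinate_times_polys[OF q])
  have e: "(\<lambda>x. a x $ i) = (\<lambda>x. p x $ i + x $ i * q x)" for i by (auto simp: a)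
  have poly: "real_polynomial_function (\<lambda>x. p x $ i)" "real_polynomial_function (\<lambda>x. x $ i * q x)" for i
    using p xq polynomial_polys by blast+
  show "real_polynomial_function (\<lambda>x. a x $ j)" unfolding e by (rule real_polynomial_function.intros(3)[OF poly])
  have "divergence a = (\<Sum>i\<in>UNIV. partial_deriv i (\<lambda>x. p x $ i) + partial_deriv i (\<lambda>x. x $ i * q x))"
    by (rule ext) (simp add: divergence_def e partial_deriv_plus polynomial_differentiable(1) poly sum_fun_apply)
  also have "\<dots> \<in> polys (Suc k)"
  proof (intro subspace_sum subspace_add polys_subspace)
    show "partial_deriv i (\<lambda>x. p x $ i) \<in> polys (Suc k)" for i
      using partial_deriv_polys[OF p] polys_mono[of k "Suc k"] by auto
    show "partial_deriv i (\<lambda>x. x $ i * q x) \<in> polys (Suc k)" for i by (rule partial_deriv_polys[OF xq])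
  qed
  finally show "divergence a \<in> poly_deg k" by (simp add: poly_deg_polys)
  assume "\<And>x. divergence a x = 0"
  then have "(\<Sum>i\<in>UNIV. partial_deriv i (\<lambda>x. (p x + q x *\<^sub>R x) $ i) x) = 0" for x
    unfolding divergence_def a by blast
  from divergence_free_RT_polys[OF p q this] show "a \<in> poly_deg_vec k"
    unfolding poly_deg_vec_def poly_deg_polys a by blast
qed

context peers
begin

sublocale Yh: semi_inner "Yh \<Omega> T k" "\<lambda>d e. L2_inner \<Omega> (Y_tuple \<Omega> d) (Y_tuple \<Omega> e)"
  by (rule semi_inner_subspace[OF Y.semi_inner_axioms Yh_subspace Yh_Y])

lemma Yh_nrm: "\<tau> \<in> Yh \<Omega> T k \<Longrightarrow> Yh.nrm \<tau> = Y_norm \<Omega> \<tau>"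
  using Yh_Y Y_nrm by blast

lemma Y_norm_AE_zero:
  assumes z: "z \<in> Hdiv \<Omega>" and ae: "AE x in lebesgue_on \<Omega>. z x = 0"
  shows "Y_norm \<Omega> z = 0"
proof -
  have "has_weak_div \<Omega> (\<lambda>x. z x $ i) (\<lambda>x. 0)" for i
    unfolding has_weak_div_def
  proof (intro conjI ballI)
    fix \<phi> :: "real^'n \<Rightarrow> real" assume "\<phi> \<in> test_functions \<Omega>"
    have "(LINT x|lebesgue_on \<Omega>. z x $ i \<bullet> (\<chi> i. partial_deriv i \<phi> x)) = 0"
      by (rule integral_eq_zero_AE) (use ae in \<open>auto elim: eventually_mono\<close>)
    then show "(LINT x|lebesgue_on \<Omega>. z x $ i \<bullet> (\<chi> i. partial_deriv i \<phi> x)) = - (LINT x|lebesgue_on \<Omega>. 0 * \<phi> x)" by simp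
  qed (rule L2_zero)
  then have "AE x in lebesgue_on \<Omega>. weak_div \<Omega> (\<lambda>x. z x $ i) x = 0" for i by (rule weak_div_AE)
  then have "AE x in lebesgue_on \<Omega>. \<forall>i. weak_div \<Omega> (\<lambda>x. z x $ i) x = 0" by (simp add: AE_all_countable)
  then have d: "AE x in lebesgue_on \<Omega>. tensor_div \<Omega> z x = 0"
    by eventually_elim (simp add: tensor_div_def vec_eq_iff)
  have "L2_norm \<Omega> z = L2_norm \<Omega> (\<lambda>x. 0 :: real^'n^'n)"
    using ae by (intro L2_norm_cong_AE Hdiv_L2 z L2_zero)
  moreover have "L2_norm \<Omega> (tensor_div \<Omega> z) = L2_norm \<Omega> (\<lambda>x. 0 :: real^'n)"
    using d by (intro L2_norm_cong_AE tensor_div_L2 z L2_zero)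
  ultimately show ?thesis by (simp add: Y_norm_def L2_norm_def)
qed

text \<open>Up to null sets a discrete stress is determined by its polynomials on the finitely many elements, which
  range over a finite-dimensional space.\<close>

lemma Yh_orthonormal_bound: "\<exists>N. \<forall>B. Yh.orthonormal B \<longrightarrow> card B \<le> N"
proof -
  have "\<exists>M. finite M \<and> local_Y K \<subseteq> span M" if "K \<in> T" for K
    using local_Y_finite_dim[OF that] by (simp add: finite_dim_def)
  then obtain M where M: "\<And>K. K \<in> T \<Longrightarrow> finite (M K)" "\<And>K. K \<in> T \<Longrightarrow> local_Y K \<subseteq> span (M K)" by metis
  define E where "E K f = (\<lambda>K'. if K' = K then f else 0)" for K :: "(real^'n) set" and f :: "real^'n \<Rightarrow> real^'n^'n"
  have lin: "linear (E K)" for K by (rule linearI) (auto simp: E_def fun_eq_iff)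
  define W where "W = (\<Union>K\<in>T. E K ` M K)"
  have finW: "finite W" using finite_T M(1) by (auto simp: W_def)
  define S where "S y w \<longleftrightarrow> (\<forall>K\<in>T. AE x in lebesgue_on K. y x = w K x)" for y :: "real^'n \<Rightarrow> real^'n^'n" and w
  have ex: "\<exists>w\<in>span W. S y w" if y: "y \<in> Yh \<Omega> T k" for y
  proof -
    have "\<exists>a\<in>local_Y K. AE x in lebesgue_on K. y x = a x" if "K \<in> T" for K
      using y that unfolding Yh_eq piecewise_def by blast
    then obtain a where a: "\<And>K. K \<in> T \<Longrightarrow> a K \<in> local_Y K" "\<And>K. K \<in> T \<Longrightarrow> AE x in lebesgue_on K. y x = a K x" by metis
    have "E K (a K) \<in> span W" if K: "K \<in> T" for K
    proof -
      have "E K (a K) \<in> E K ` span (M K)" using a(1)[OF K] M(2)[OF K] by blast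
      then have "E K (a K) \<in> span (E K ` M K)" using linear_span_image[OF lin] by blast
      moreover have "span (E K ` M K) \<subseteq> span W" using K by (intro span_mono) (auto simp: W_def)
      ultimately show ?thesis by blast
    qed
    then have "(\<Sum>K\<in>T. E K (a K)) \<in> span W" by (intro span_sum)
    moreover have "(\<Sum>K\<in>T. E K (a K)) K' = a K'" if "K' \<in> T" for K'
      using that finite_T by (simp add: sum_fun_apply E_def sum.delta')
    ultimately show ?thesis using a(2) by (intro bexI[of _ "\<Sum>K\<in>T. E K (a K)"]) (auto simp: S_def)
  qed
  have "card B \<le> card W" if "Yh.orthonormal B" for B
  proof (rule Yh.orthonormal_card_bound[OF finW ex _ that])
    fix A and F :: "(real^'n \<Rightarrow> real^'n^'n) \<Rightarrow> (real^'n) set \<Rightarrow> real^'n \<Rightarrow> real^'n^'n" and c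
    assume A: "finite A" "A \<subseteq> Yh \<Omega> T k" and F: "\<And>x. x \<in> A \<Longrightarrow> S x (F x)" and z: "(\<Sum>x\<in>A. c x *\<^sub>R F x) = 0"
    have sY: "(\<Sum>x\<in>A. c x *\<^sub>R x) \<in> Yh \<Omega> T k" using A by (intro Yh.sum_in Yh.scale_in) auto
    have "AE t in lebesgue_on \<Omega>. (\<Sum>x\<in>A. c x *\<^sub>R x) t = 0"
    proof (rule AE_dom_if_AE_T)
      fix K assume K: "K \<in> T"
      have "\<forall>x\<in>A. AE t in lebesgue_on K. x t = F x K t" using F K by (auto simp: S_def)
      then have "AE t in lebesgue_on K. \<forall>x\<in>A. x t = F x K t" unfolding AE_finite_all[OF A(1)] .
      then show "AE t in lebesgue_on K. (\<Sum>x\<in>A. c x *\<^sub>R x) t = 0"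
      proof eventually_elim
        case (elim t)
        have "(\<Sum>x\<in>A. c x *\<^sub>R x) t = (\<Sum>x\<in>A. c x *\<^sub>R F x K t)"
          using elim by (auto simp: sum_fun_apply intro!: sum.cong)
        also have "\<dots> = (\<Sum>x\<in>A. c x *\<^sub>R F x) K t" by (simp add: sum_fun_apply)
        finally show ?case by (simp add: z)
      qed
    qed
    then show "Yh.nrm (\<Sum>x\<in>A. c x *\<^sub>R x) = 0"
      using Y_norm_AE_zero sY Yh_nrm by (simp add: Yh_def)
  qed
  then show ?thesis by blast
qed

text \<open>On each element the weak divergence is the classical one, to which the curls do not contribute.\<close>

lemma Yh_divergence:
  assumes \<tau>: "\<tau> \<in> Yh \<Omega> T k" and K: "K \<in> T"
    and a: "a \<in> RT_tensor k" and b: "b \<in> bubble_curls_tensor k K" and ae: "AE x in lebesgue_on K. \<tau> x = a x + b x"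
  shows "AE x in lebesgue_on K. tensor_div \<Omega> \<tau> x = (\<chi> i. divergence (\<lambda>x. a x $ i) x)"
proof -
  interpret I: bounded_open "interior K"
    by unfold_locales (rule open_interior, rule bounded_subset[OF bounded_dom interior_sub[OF K]])
  have IS: "interior K \<subseteq> \<Omega>" "interior K \<in> sets lebesgue" "\<Omega> \<in> sets lebesgue" using interior_sub[OF K] by auto
  have \<tau>d: "\<tau> \<in> Hdiv \<Omega>" using \<tau> by (simp add: Yh_def)
  have "AE x in lebesgue_on (interior K). weak_div \<Omega> (\<lambda>x. \<tau> x $ i) x = divergence (\<lambda>x. a x $ i) x" for i
  proof -
    have ai: "(\<lambda>x. a x $ i) \<in> RT k" and bi: "(\<lambda>x. b x $ i) \<in> bubble_curls k K"
      using a b by (auto simp: RT_tensor_def bubble_curls_tensor_def)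
    have pa: "real_polynomial_function (\<lambda>x. a x $ i $ j)" for j using RT_divergence(1)[OF ai] by simp
    have pb: "real_polynomial_function (\<lambda>x. b x $ i $ j)" for j
      using bubble_curls_spaces(3)[OF dimension simplex_T[OF K] bi] by simp
    define c where "c x = a x $ i + b x $ i" for x
    have pc: "real_polynomial_function (\<lambda>x. c x $ j)" for j
      using real_polynomial_function.intros(3)[OF pa pb] by (simp add: c_def)
    have divc: "divergence c x = divergence (\<lambda>x. a x $ i) x" for x
    proof -
      have "divergence (\<lambda>x. b x $ i) x = 0"
        unfolding divergence_def by (rule bubble_curls_spaces(4)[OF dimension simplex_T[OF K] bi])
      then show ?thesis unfolding c_def[abs_def] by (subst divergence_add[OF pa pb]) simp
    qed
    have "continuous_on UNIV (\<lambda>x. \<chi> j. c x $ j)" by (intro continuous_on_vec_lambda polynomial_continuous pc)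
    then have cc: "continuous_on UNIV c" by simp
    have wd: "has_weak_div \<Omega> (\<lambda>x. \<tau> x $ i) (weak_div \<Omega> (\<lambda>x. \<tau> x $ i))"
      using Hdiv_has_weak_div[OF \<tau>d] has_weak_div_weak_div by blast
    have wdL: "weak_div \<Omega> (\<lambda>x. \<tau> x $ i) \<in> L2 \<Omega>" using wd by (simp add: has_weak_div_def)
    have dcont: "continuous_on UNIV (divergence c)"
      unfolding divergence_def by (intro continuous_on_sum polynomial_continuous polynomial_differentiable(2) pc)
    have aei: "AE x in lebesgue_on (interior K). \<tau> x $ i = c x"
    proof -
      have "AE x in lebesgue. x \<in> K \<longrightarrow> \<tau> x = a x + b x" using ae AE_restrict_T[OF K] by simp
      then have "AE x in lebesgue. x \<in> interior K \<longrightarrow> \<tau> x $ i = c x"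
        by eventually_elim (use interior_subset[of K] in \<open>auto simp: c_def\<close>)
      then show ?thesis using IS by (simp add: AE_restrict_space_iff)
    qed
    have "AE x in lebesgue_on (interior K). weak_div \<Omega> (\<lambda>x. \<tau> x $ i) x = divergence c x"
    proof (rule I.fundamental_lemma_eq)
      show "weak_div \<Omega> (\<lambda>x. \<tau> x $ i) \<in> L2 (interior K)" by (rule L2_subset[OF wdL IS])
      show "divergence c \<in> L2 (interior K)" by (rule I.continuous_UNIV_L2[OF dcont])
      fix \<phi> assume \<phi>: "\<phi> \<in> test_functions (interior K)"
      have \<phi>\<Omega>: "\<phi> \<in> test_functions \<Omega>" using \<phi> IS(1) by (auto simp: test_functions_def)
      let ?D = "\<lambda>x. \<chi> j. partial_deriv j \<phi> x"
      have out: "x \<notin> closure {x. \<phi> x \<noteq> 0}" if "x \<notin> interior K" for x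
        using \<phi> that by (auto simp: test_functions_def)
      have \<phi>0: "\<phi> x = 0" if "x \<notin> interior K" for x using out[OF that] closure_subset[of "{x. \<phi> x \<noteq> 0}"] by blast
      have D0: "?D x = 0" if "x \<notin> interior K" for x
        using partial_deriv_outside_support[OF out[OF that]] by (simp add: vec_eq_iff)
      have "(LINT x|lebesgue_on (interior K). weak_div \<Omega> (\<lambda>x. \<tau> x $ i) x * \<phi> x)
          = (LINT x|lebesgue_on \<Omega>. weak_div \<Omega> (\<lambda>x. \<tau> x $ i) x * \<phi> x)"
        by (rule integral_restrict_subset[OF IS, symmetric]) (simp add: \<phi>0)
      also have "\<dots> = - (LINT x|lebesgue_on \<Omega>. \<tau> x $ i \<bullet> ?D x)"
        using wd \<phi>\<Omega> by (simp add: has_weak_div_def)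
      also have "(LINT x|lebesgue_on \<Omega>. \<tau> x $ i \<bullet> ?D x) = (LINT x|lebesgue_on (interior K). \<tau> x $ i \<bullet> ?D x)"
        by (rule integral_restrict_subset[OF IS]) (simp add: D0)
      also have "\<dots> = (LINT x|lebesgue_on (interior K). c x \<bullet> ?D x)"
      proof (rule integral_cong_AE)
        show "(\<lambda>x. \<tau> x $ i \<bullet> ?D x) \<in> borel_measurable (lebesgue_on (interior K))"
          by (rule borel_measurable_integrable)
            (intro L2_inner_integrable I.test_function_grad_L2 \<phi> L2_subset[OF L2_component[OF Hdiv_L2[OF \<tau>d]] IS])
        show "(\<lambda>x. c x \<bullet> ?D x) \<in> borel_measurable (lebesgue_on (interior K))"
          by (rule borel_measurable_integrable) (intro L2_inner_integrable I.test_function_grad_L2 \<phi> I.continuous_UNIV_L2 cc)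
      qed (use aei in \<open>auto elim: eventually_mono\<close>)
      also have "\<dots> = (\<Sum>j\<in>UNIV. LINT x|lebesgue_on (interior K). c x $ j * partial_deriv j \<phi> x)"
        unfolding inner_vec_def
        by (subst Bochner_Integration.integral_sum)
          (simp_all add: L2_mult_integrable[OF I.continuous_UNIV_L2[OF polynomial_continuous[OF pc]] I.test_function_deriv_L2[OF \<phi>]])
      also have "\<dots> = (\<Sum>j\<in>UNIV. - (LINT x|lebesgue_on (interior K). partial_deriv j (\<lambda>x. c x $ j) x * \<phi> x))"
        by (intro sum.cong refl integration_by_parts_C1 open_interior \<phi> polynomial_differentiable(1) pc
            polynomial_continuous polynomial_differentiable(2))
      also have "\<dots> = - (LINT x|lebesgue_on (interior K). divergence c x * \<phi> x)"
        unfolding divergence_def sum_distrib_right sum_negf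
        by (subst Bochner_Integration.integral_sum)
          (simp_all add: L2_mult_integrable[OF I.continuous_UNIV_L2[OF polynomial_continuous[OF polynomial_differentiable(2)[OF pc]]] I.test_function_L2[OF \<phi>]])
      finally show "(LINT x|lebesgue_on (interior K). weak_div \<Omega> (\<lambda>x. \<tau> x $ i) x * \<phi> x)
          = (LINT x|lebesgue_on (interior K). divergence c x * \<phi> x)" by simp
    qed
    then show ?thesis by (simp add: divc)
  qed
  then have "AE x in lebesgue_on (interior K). \<forall>i. weak_div \<Omega> (\<lambda>x. \<tau> x $ i) x = divergence (\<lambda>x. a x $ i) x"
    by (simp add: AE_all_countable)
  then have "AE x in lebesgue. x \<in> interior K \<longrightarrow> tensor_div \<Omega> \<tau> x = (\<chi> i. divergence (\<lambda>x. a x $ i) x)"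
    using IS by (simp add: AE_restrict_space_iff tensor_div_def vec_eq_iff)
  then have "AE x in lebesgue. x \<in> K \<longrightarrow> tensor_div \<Omega> \<tau> x = (\<chi> i. divergence (\<lambda>x. a x $ i) x)"
    using AE_boundary[OF K] by eventually_elim blast
  then show ?thesis by (simp add: AE_restrict_T[OF K])
qed

lemma Yh_local:
  assumes "\<tau> \<in> Yh \<Omega> T k" "K \<in> T"
  obtains a b where "a \<in> RT_tensor k" "b \<in> bubble_curls_tensor k K" "AE x in lebesgue_on K. \<tau> x = a x + b x"
    "AE x in lebesgue_on K. tensor_div \<Omega> \<tau> x = (\<chi> i. divergence (\<lambda>x. a x $ i) x)"
proof -
  obtain a b where ab: "a \<in> RT_tensor k" "b \<in> bubble_curls_tensor k K" "AE x in lebesgue_on K. \<tau> x = a x + b x"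
    using assms unfolding Yh_def by blast
  show ?thesis by (rule that[OF ab Yh_divergence[OF assms ab]])
qed

lemma Yh_tensor_div_Z1h:
  assumes \<tau>: "\<tau> \<in> Yh \<Omega> T k" shows "tensor_div \<Omega> \<tau> \<in> Z1h \<Omega> T k"
  unfolding Z1h_def
proof (intro CollectI conjI ballI)
  show "tensor_div \<Omega> \<tau> \<in> L2 \<Omega>" using \<tau> by (intro tensor_div_L2) (simp add: Yh_def)
  fix K assume K: "K \<in> T"
  obtain a b where ab: "a \<in> RT_tensor k" "AE x in lebesgue_on K. tensor_div \<Omega> \<tau> x = (\<chi> i. divergence (\<lambda>x. a x $ i) x)"
    by (rule Yh_local[OF \<tau> K])
  have d: "(\<lambda>x. \<chi> i. divergence (\<lambda>x. a x $ i) x) \<in> poly_deg_vec k"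
    using ab(1) RT_divergence(2) by (auto simp: poly_deg_vec_def RT_tensor_def)
  show "\<exists>a\<in>poly_deg_vec k. AE x in lebesgue_on K. tensor_div \<Omega> \<tau> x = a x" using ab(2) by (rule bexI[OF _ d])
qed

text \<open>The divergence of a discrete stress is itself a discrete displacement, so a stress in the
  discrete kernel of \<open>b\<^sub>2\<close> has zero divergence; its Raviart-Thomas part is then a polynomial of
  degree \<open>k\<close>, which makes the stress an admissible strain.\<close>

lemma discrete_kernel:
  assumes \<tau>: "\<tau> \<in> Yh \<Omega> T k" and ker: "\<And>v. v \<in> Zh \<Omega> T k \<Longrightarrow> form_b2 \<Omega> (e, \<tau>) v = 0"
  shows "L2_norm \<Omega> (tensor_div \<Omega> \<tau>) = 0" "\<tau> \<in> X1h \<Omega> T k"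
proof -
  have \<tau>d: "\<tau> \<in> Hdiv \<Omega>" using \<tau> by (simp add: Yh_def)
  have "(tensor_div \<Omega> \<tau>, 0) \<in> Zh \<Omega> T k"
    unfolding Zh_def using Yh_tensor_div_Z1h[OF \<tau>] subspace_0[OF Z2h_subspace] by simp
  from ker[OF this] have "(LINT x|lebesgue_on \<Omega>. tensor_div \<Omega> \<tau> x \<bullet> tensor_div \<Omega> \<tau> x) = 0"
    by (simp add: form_b2_def)
  then show d0: "L2_norm \<Omega> (tensor_div \<Omega> \<tau>) = 0" by (simp add: L2_norm_def power2_norm_eq_inner)
  have z: "AE x in lebesgue_on \<Omega>. tensor_div \<Omega> \<tau> x = 0" by (rule L2_norm_zero_AE[OF tensor_div_L2[OF \<tau>d] d0])
  show "\<tau> \<in> X1h \<Omega> T k"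
    unfolding X1h_def
  proof (intro CollectI conjI ballI)
    show "\<tau> \<in> L2 \<Omega>" by (rule Hdiv_L2[OF \<tau>d])
    fix K assume K: "K \<in> T"
    obtain a b where ab: "a \<in> RT_tensor k" "b \<in> bubble_curls_tensor k K" "AE x in lebesgue_on K. \<tau> x = a x + b x"
      "AE x in lebesgue_on K. tensor_div \<Omega> \<tau> x = (\<chi> i. divergence (\<lambda>x. a x $ i) x)"
      by (rule Yh_local[OF \<tau> K])
    have "AE x in lebesgue_on K. (\<chi> i. divergence (\<lambda>x. a x $ i) x) = 0"
      using ab(4) AE_T_if_AE_dom[OF z K] by eventually_elim simp
    then have zK: "AE x in lebesgue. x \<in> K \<longrightarrow> (\<chi> i. divergence (\<lambda>x. a x $ i) x) = 0" by (simp add: AE_restrict_T[OF K])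
    have "(\<lambda>x. a x $ i) \<in> poly_deg_vec k" for i
    proof -
      have ai: "(\<lambda>x. a x $ i) \<in> RT k" using ab(1) by (simp add: RT_tensor_def)
      let ?d = "divergence (\<lambda>x. a x $ i)"
      have pd: "real_polynomial_function ?d" by (rule poly_deg_polynomial[OF RT_divergence(2)[OF ai]])
      \<comment> \<open>a polynomial that vanishes almost everywhere on \<open>K\<close> vanishes identically\<close>
      have op: "open (interior K \<inter> ?d -` (- {0}))"
        by (intro continuous_open_preimage polynomial_continuous pd) auto
      have "AE x in lebesgue. x \<notin> interior K \<inter> ?d -` (- {0})"
        using zK
      proof eventually_elim
        case (elim x)
        then show ?case using interior_subset[of K] by (auto simp: vec_eq_iff)
      qed
      then have "interior K \<inter> ?d -` (- {0}) \<in> null_sets lebesgue"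
        using op by (subst AE_iff_null_sets) auto
      then have "negligible (interior K \<inter> ?d -` (- {0}))" by (simp add: negligible_iff_null_sets)
      then have "interior K \<inter> ?d -` (- {0}) = {}" using op open_not_negligible by blast
      then have zi: "\<And>x. x \<in> interior K \<Longrightarrow> ?d x = 0" by auto
      obtain x0 where "x0 \<in> interior K" using interior_T[OF K] by blast
      then have "?d x = 0" for x using polynomial_zero_on_open[OF pd open_interior _ zi] by blast
      then show ?thesis by (rule RT_divergence(3)[OF ai])
    qed
    then have "a \<in> poly_deg_tensor k" by (simp add: poly_deg_tensor_def)
    then show "\<exists>a\<in>poly_deg_tensor k. \<exists>b\<in>bubble_curls_tensor k K. AE x in lebesgue_on K. \<tau> x = a x + b x"
      using ab(2,3) by (intro bexI)
  qed
qed

end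

section \<open>The forms and the a priori bound\<close>

definition trace_fun :: "(real^'n \<Rightarrow> real^'n^'n) \<Rightarrow> real^'n \<Rightarrow> real" where
  "trace_fun d x = trace (d x)"

lemma trace_inner: "trace A = mat 1 \<bullet> A" for A :: "real^'n^'n"
proof -
  have "mat 1 \<bullet> A = (\<Sum>i\<in>UNIV. \<Sum>j\<in>UNIV. if j = i then A $ i $ j else 0)"
    unfolding inner_vec_def by (intro sum.cong refl) (auto simp: mat_def)
  then show ?thesis by (simp add: trace_def)
qed

lemma trace_bound: "\<bar>trace A\<bar> \<le> sqrt (real CARD('n)) * norm A" for A :: "real^'n^'n"
proof -
  have "norm (mat 1 :: real^'n^'n) = sqrt (real CARD('n))"
  proof -
    have "trace (mat 1 :: real^'n^'n) = real CARD('n)" by (simp add: trace_def mat_def)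
    then show ?thesis unfolding trace_inner norm_eq_sqrt_inner by (simp only:)
  qed
  then show ?thesis unfolding trace_inner using Cauchy_Schwarz_ineq2[of "mat 1" A] by simp
qed

lemma trace_fun_L2: "d \<in> L2 \<Omega> \<Longrightarrow> trace_fun d \<in> L2 \<Omega>"
  unfolding trace_fun_def[abs_def] trace_inner by (rule L2_bounded_linear[OF bounded_linear_inner_right])

lemma trace_fun_diff: "trace_fun (d - e) = trace_fun d - trace_fun e"
  by (auto simp: trace_fun_def trace_inner inner_diff_right)

lemma trace_fun_norm:
  fixes d :: "real^'n \<Rightarrow> real^'n^'n"
  assumes "d \<in> L2 \<Omega>" shows "L2_norm \<Omega> (trace_fun d) \<le> sqrt (real CARD('n)) * L2_norm \<Omega> d"
proof (rule power2_le_imp_le)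
  have "(LINT x|lebesgue_on \<Omega>. (norm (trace_fun d x))\<^sup>2) \<le> (LINT x|lebesgue_on \<Omega>. real CARD('n) * (norm (d x))\<^sup>2)"
  proof (rule integral_mono)
    show "integrable (lebesgue_on \<Omega>) (\<lambda>x. (norm (trace_fun d x))\<^sup>2)" by (rule L2_integrable_sq[OF trace_fun_L2[OF assms]])
    show "integrable (lebesgue_on \<Omega>) (\<lambda>x. real CARD('n) * (norm (d x))\<^sup>2)" using L2_integrable_sq[OF assms] by simp
    fix x
    have "(norm (trace_fun d x))\<^sup>2 \<le> (sqrt (real CARD('n)) * norm (d x))\<^sup>2"
      using trace_bound[of "d x"] by (intro power_mono) (auto simp: trace_fun_def)
    then show "(norm (trace_fun d x))\<^sup>2 \<le> real CARD('n) * (norm (d x))\<^sup>2" by (simp add: power_mult_distrib)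
  qed
  then show "(L2_norm \<Omega> (trace_fun d))\<^sup>2 \<le> (sqrt (real CARD('n)) * L2_norm \<Omega> d)\<^sup>2"
    by (simp add: L2_norm_def power_mult_distrib)
qed simp

text \<open>Separating the field \<open>M\<close> from the pressure makes the permeability term linear in all three arguments.\<close>

definition flux_form :: "(real^'n) set \<Rightarrow> (real^'n \<Rightarrow> real^'n^'n) \<Rightarrow> (real^'n \<Rightarrow> real) \<Rightarrow> (real^'n \<Rightarrow> real) \<Rightarrow> real" where
  "flux_form \<Omega> M p q = L2_inner \<Omega> (\<lambda>x. M x *v weak_grad \<Omega> p x) (weak_grad \<Omega> q)"

definition bounded_field :: "(real^'n) set \<Rightarrow> (real^'n \<Rightarrow> real^'n^'n) \<Rightarrow> real \<Rightarrow> bool" where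
  "bounded_field \<Omega> M B \<longleftrightarrow> M \<in> borel_measurable (lebesgue_on \<Omega>) \<and> (AE x in lebesgue_on \<Omega>. norm (M x) \<le> B) \<and> 0 \<le> B"

context bounded_open
begin

lemma flux_L2: "bounded_field \<Omega> M B \<Longrightarrow> p \<in> H1 \<Omega> \<Longrightarrow> (\<lambda>x. M x *v weak_grad \<Omega> p x) \<in> L2 \<Omega>"
  unfolding bounded_field_def by (intro L2_matrix_mult(1)[where B = B] weak_grad_L2) auto

lemma flux_form_bound:
  assumes M: "bounded_field \<Omega> M B" and pq: "p \<in> H1 \<Omega>" "q \<in> H1 \<Omega>"
  shows "\<bar>flux_form \<Omega> M p q\<bar> \<le> B * H1_norm \<Omega> p * H1_norm \<Omega> q"
proof -
  have "\<bar>flux_form \<Omega> M p q\<bar> \<le> L2_norm \<Omega> (\<lambda>x. M x *v weak_grad \<Omega> p x) * L2_norm \<Omega> (weak_grad \<Omega> q)"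
    unfolding flux_form_def by (rule L2_Cauchy_Schwarz[OF flux_L2[OF M pq(1)] weak_grad_L2[OF pq(2)]])
  also have "\<dots> \<le> (B * H1_norm \<Omega> p) * H1_norm \<Omega> q"
  proof (intro mult_mono)
    have "L2_norm \<Omega> (\<lambda>x. M x *v weak_grad \<Omega> p x) \<le> B * L2_norm \<Omega> (weak_grad \<Omega> p)"
      using M by (intro L2_matrix_mult(2) weak_grad_L2 pq) (auto simp: bounded_field_def)
    also have "\<dots> \<le> B * H1_norm \<Omega> p" using M L2_norm_le_norms(2)[of p] by (intro mult_left_mono) (auto simp: bounded_field_def)
    finally show "L2_norm \<Omega> (\<lambda>x. M x *v weak_grad \<Omega> p x) \<le> B * H1_norm \<Omega> p" .
    show "0 \<le> B * H1_norm \<Omega> p" using M by (simp add: bounded_field_def)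
  qed (use L2_norm_le_norms(2)[of q] in auto)
  finally show ?thesis .
qed

lemma flux_form_diff:
  assumes M: "bounded_field \<Omega> M B" and pq: "p \<in> H1 \<Omega>" "p' \<in> H1 \<Omega>" "q \<in> H1 \<Omega>"
  shows "flux_form \<Omega> M (p - p') q = flux_form \<Omega> M p q - flux_form \<Omega> M p' q"
proof -
  have e: "p - p' = (\<lambda>x. (-1) * p' x + p x)" by auto
  have "flux_form \<Omega> M (p - p') q = L2_inner \<Omega> ((\<lambda>x. M x *v weak_grad \<Omega> p x) - (\<lambda>x. M x *v weak_grad \<Omega> p' x)) (weak_grad \<Omega> q)"
    unfolding flux_form_def
  proof (rule L2_inner_cong)
    show "AE x in lebesgue_on \<Omega>. M x *v weak_grad \<Omega> (p - p') x
        = ((\<lambda>x. M x *v weak_grad \<Omega> p x) - (\<lambda>x. M x *v weak_grad \<Omega> p' x)) x"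
      using weak_grad_lincomb[OF pq(2,1), of "-1"] unfolding e[symmetric]
      by eventually_elim (simp add: matrix_vector_mult_diff_distrib[symmetric])
  qed (intro flux_L2[OF M] subspace_diff[OF H1_subspace] weak_grad_L2 L2.diff_in pq)+
  also have "\<dots> = flux_form \<Omega> M p q - flux_form \<Omega> M p' q"
    unfolding flux_form_def by (intro L2.ip_diff flux_L2[OF M] weak_grad_L2 pq)
  finally show ?thesis .
qed

lemma flux_form_diff_field:
  assumes M: "bounded_field \<Omega> M B" "bounded_field \<Omega> M' B'" and pq: "p \<in> H1 \<Omega>" "q \<in> H1 \<Omega>"
  shows "flux_form \<Omega> (M - M') p q = flux_form \<Omega> M p q - flux_form \<Omega> M' p q"
proof -
  have "(\<lambda>x. (M - M') x *v weak_grad \<Omega> p x) = (\<lambda>x. M x *v weak_grad \<Omega> p x) - (\<lambda>x. M' x *v weak_grad \<Omega> p x)"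
    by (auto simp: matrix_vector_mult_diff_rdistrib)
  then show ?thesis unfolding flux_form_def
    by (simp only: L2.ip_diff[OF flux_L2[OF M(1) pq(1)] flux_L2[OF M(2) pq(1)] weak_grad_L2[OF pq(2)]])
qed

lemma form_b1_inner: "form_b1 \<Omega> e \<tau> = - L2_inner \<Omega> \<tau> (fst e)"
  by (simp add: form_b1_def L2_inner_def split: prod.split)

lemma form_b1_bound:
  assumes "e \<in> X_space \<Omega>" "\<tau> \<in> Y_space \<Omega>"
  shows "\<bar>form_b1 \<Omega> e \<tau>\<bar> \<le> X_norm \<Omega> e * Y_norm \<Omega> \<tau>"
proof -
  have "\<bar>form_b1 \<Omega> e \<tau>\<bar> \<le> L2_norm \<Omega> \<tau> * L2_norm \<Omega> (fst e)"
    unfolding form_b1_inner abs_minus_cancel using assms by (intro L2_Cauchy_Schwarz) (auto simp: X_space_def Y_space_def Hdiv_L2)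
  also have "\<dots> \<le> Y_norm \<Omega> \<tau> * X_norm \<Omega> e"
    using L2_norm_le_norms(4)[of "fst e" "snd e"] L2_norm_le_norms(5)[of \<tau>] by (intro mult_mono) auto
  finally show ?thesis by (simp add: mult.commute)
qed

lemma form_b1_diff:
  "\<lbrakk>d \<in> X_space \<Omega>; e \<in> X_space \<Omega>; \<tau> \<in> Y_space \<Omega>\<rbrakk> \<Longrightarrow> form_b1 \<Omega> (d - e) \<tau> = form_b1 \<Omega> d \<tau> - form_b1 \<Omega> e \<tau>"
  "\<lbrakk>e \<in> X_space \<Omega>; \<sigma> \<in> Y_space \<Omega>; \<tau> \<in> Y_space \<Omega>\<rbrakk> \<Longrightarrow> form_b1 \<Omega> e (\<sigma> - \<tau>) = form_b1 \<Omega> e \<sigma> - form_b1 \<Omega> e \<tau>"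
  by (auto simp: form_b1_inner X_space_def Y_space_def Hdiv_L2 L2.ip_diff L2.ip_diff_right)

text \<open>The strain does not enter \<open>form_b2\<close>. The components of \<open>v\<close> are swapped because the rotation faces the
  stress and the displacement faces its divergence.\<close>

definition b2 :: "'n ysp \<Rightarrow> 'n zsp \<Rightarrow> real" where
  "b2 \<tau> v = - L2_inner \<Omega> (Y_tuple \<Omega> \<tau>) (\<lambda>x. (snd v x, fst v x))"

lemma Z_swap_L2: "v \<in> Z_space \<Omega> \<Longrightarrow> (\<lambda>x. (snd v x, fst v x)) \<in> L2 \<Omega>"
  by (intro L2_pair) (auto simp: Z_space_def L2_skew_def)

lemma form_b2_b2:
  assumes "\<tau> \<in> Y_space \<Omega>" "v \<in> Z_space \<Omega>" shows "form_b2 \<Omega> (e, \<tau>) v = b2 \<tau> v"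
proof -
  obtain w \<eta> where v: "v = (w, \<eta>)" "w \<in> L2 \<Omega>" "\<eta> \<in> L2 \<Omega>" using assms(2) by (cases v) (auto simp: Z_space_def L2_skew_def)
  have "\<tau> \<in> L2 \<Omega>" "tensor_div \<Omega> \<tau> \<in> L2 \<Omega>" using assms(1) by (auto simp: Y_space_def Hdiv_L2 tensor_div_L2)
  then show ?thesis using v
    by (simp add: b2_def form_b2_def L2_inner_def Y_tuple_def L2_inner_integrable inner_commute[of "w _"])
qed

lemma b2_bound:
  assumes "\<tau> \<in> Y_space \<Omega>" "v \<in> Z_space \<Omega>" shows "\<bar>b2 \<tau> v\<bar> \<le> Y_norm \<Omega> \<tau> * Z_norm \<Omega> v"
proof -
  have "\<bar>b2 \<tau> v\<bar> \<le> L2_norm \<Omega> (Y_tuple \<Omega> \<tau>) * L2_norm \<Omega> (\<lambda>x. (snd v x, fst v x))"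
    unfolding b2_def abs_minus_cancel by (rule L2_Cauchy_Schwarz[OF Y_tuple_L2[OF assms(1)] Z_swap_L2[OF assms(2)]])
  moreover have "L2_norm \<Omega> (\<lambda>x. (snd v x, fst v x)) = Z_norm \<Omega> v"
    using assms(2) by (cases v) (simp add: L2_norm_pair_sqrt Z_space_def L2_skew_def Z_norm_def add.commute)
  ultimately show ?thesis by (simp add: Y_norm_eq[OF assms(1)])
qed

lemma b2_lincomb_left:
  assumes "\<tau> \<in> Y_space \<Omega>" "\<rho> \<in> Y_space \<Omega>" "v \<in> Z_space \<Omega>"
  shows "b2 (c *\<^sub>R \<tau> + \<rho>) v = c * b2 \<tau> v + b2 \<rho> v"
proof -
  have "L2_inner \<Omega> (Y_tuple \<Omega> (c *\<^sub>R \<tau> + \<rho>)) (\<lambda>x. (snd v x, fst v x))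
    = L2_inner \<Omega> (c *\<^sub>R Y_tuple \<Omega> \<tau> + Y_tuple \<Omega> \<rho>) (\<lambda>x. (snd v x, fst v x))"
  proof (rule L2_inner_cong)
    show "AE x in lebesgue_on \<Omega>. Y_tuple \<Omega> (c *\<^sub>R \<tau> + \<rho>) x = (c *\<^sub>R Y_tuple \<Omega> \<tau> + Y_tuple \<Omega> \<rho>) x"
      using tensor_div_lincomb(2)[of \<tau> \<rho> c] assms by (auto simp: Y_tuple_def Y_space_def elim!: eventually_mono)
  qed (intro Y_tuple_L2 Y.add_in Y.scale_in L2.add_in L2.scale_in assms Z_swap_L2)+
  then show ?thesis
    by (simp add: b2_def L2.ip_add[OF L2.scale_in[OF Y_tuple_L2[OF assms(1)]] Y_tuple_L2[OF assms(2)] Z_swap_L2[OF assms(3)]]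
        L2.ip_scale[OF Y_tuple_L2[OF assms(1)] Z_swap_L2[OF assms(3)]])
qed

lemma b2_lincomb_right:
  assumes "\<tau> \<in> Y_space \<Omega>" "v \<in> Z_space \<Omega>" "w \<in> Z_space \<Omega>"
  shows "b2 \<tau> (c *\<^sub>R v + w) = c * b2 \<tau> v + b2 \<tau> w"
proof -
  let ?s = "\<lambda>v x. (snd v x, fst v x)"
  have e: "?s (c *\<^sub>R v + w) = c *\<^sub>R ?s v + ?s w" by auto
  have "L2_inner \<Omega> (Y_tuple \<Omega> \<tau>) (?s (c *\<^sub>R v + w)) = L2_inner \<Omega> (c *\<^sub>R ?s v + ?s w) (Y_tuple \<Omega> \<tau>)"
    unfolding e by (intro L2.ip_sym L2.add_in L2.scale_in Y_tuple_L2 Z_swap_L2 assms)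
  also have "\<dots> = c * L2_inner \<Omega> (?s v) (Y_tuple \<Omega> \<tau>) + L2_inner \<Omega> (?s w) (Y_tuple \<Omega> \<tau>)"
    by (simp only: L2.ip_add[OF L2.scale_in[OF Z_swap_L2[OF assms(2)]] Z_swap_L2[OF assms(3)] Y_tuple_L2[OF assms(1)]]
        L2.ip_scale[OF Z_swap_L2[OF assms(2)] Y_tuple_L2[OF assms(1)]])
  finally show ?thesis
    by (simp add: b2_def L2.ip_sym[OF Z_swap_L2[OF assms(2)] Y_tuple_L2[OF assms(1)]]
        L2.ip_sym[OF Z_swap_L2[OF assms(3)] Y_tuple_L2[OF assms(1)]])
qed

lemma b2_diff:
  "\<lbrakk>\<tau> \<in> Y_space \<Omega>; \<rho> \<in> Y_space \<Omega>; v \<in> Z_space \<Omega>\<rbrakk> \<Longrightarrow> b2 (\<tau> - \<rho>) v = b2 \<tau> v - b2 \<rho> v"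
  "\<lbrakk>\<tau> \<in> Y_space \<Omega>; v \<in> Z_space \<Omega>; w \<in> Z_space \<Omega>\<rbrakk> \<Longrightarrow> b2 \<tau> (v - w) = b2 \<tau> v - b2 \<tau> w"
  using b2_lincomb_left[of \<rho> \<tau> v "-1"] b2_lincomb_right[of \<tau> w v "-1"] by simp_all

lemma L2_norm_const_pos:
  fixes c :: "'b::euclidean_space"
  assumes "\<Omega> \<noteq> {}" "c \<noteq> 0" shows "L2_norm \<Omega> (\<lambda>x. c) > 0"
proof (rule ccontr)
  assume "\<not> L2_norm \<Omega> (\<lambda>x. c) > 0"
  then have "L2_norm \<Omega> (\<lambda>x. c) = 0" using L2_norm_nonneg[of \<Omega> "\<lambda>x. c"] by linarith
  then have "AE x in lebesgue_on \<Omega>. c = 0"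
    by (rule L2_norm_zero_AE[OF L2_const_bounded[OF bounded_dom dom_sets]])
  then have "AE x in lebesgue. x \<notin> \<Omega>" using assms(2) by (simp add: AE_restrict_space_iff)
  then have "\<Omega> \<in> null_sets lebesgue" by (simp add: AE_iff_null_sets)
  then show False using open_not_negligible[OF open_dom assms(1)] by (simp add: negligible_iff_null_sets)
qed

text \<open>The supremum runs over pairs of nonzero norm. The identity strain shows that there are such pairs, and
  omitting the strain from a pair decreases only the denominator.\<close>

lemma inf_supD:
  assumes infsup: "inf_sup_b2 \<Omega> XS YS ZS \<beta>" and sub: "YS \<subseteq> Y_space \<Omega>" "ZS \<subseteq> Z_space \<Omega>"
    and X: "((\<lambda>x. mat 1), 0) \<in> XS" "0 \<in> YS" and ne: "\<Omega> \<noteq> {}"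
    and v: "v \<in> ZS" and S: "0 \<le> S" "\<And>\<tau>. \<tau> \<in> YS \<Longrightarrow> b2 \<tau> v \<le> S * Y_norm \<Omega> \<tau>"
  shows "\<beta> * Z_norm \<Omega> v \<le> S"
proof -
  let ?A = "{x \<in> XS \<times> YS. XY_norm \<Omega> x \<noteq> 0}"
  have "\<beta> * Z_norm \<Omega> v \<le> (SUP x\<in>?A. form_b2 \<Omega> x v / XY_norm \<Omega> x)"
    using infsup v unfolding inf_sup_b2_def by blast
  also have "\<dots> \<le> S"
  proof (rule cSUP_least)
    have "mat 1 \<noteq> (0 :: real^'n^'n)" by (auto simp: mat_def vec_eq_iff)
    then have "L2_norm \<Omega> (\<lambda>x. mat 1 :: real^'n^'n) > 0" by (rule L2_norm_const_pos[OF ne])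
    then have "X_norm \<Omega> ((\<lambda>x. mat 1), 0) > 0"
      using L2_norm_le_norms(4)[of "\<lambda>x. mat 1" 0] by linarith
    then have "XY_norm \<Omega> (((\<lambda>x. mat 1), 0), 0) \<noteq> 0" by (simp add: XY_norm_def)
    then have "(((\<lambda>x. mat 1), 0), 0) \<in> ?A" using X by blast
    then show "?A \<noteq> {}" by blast
    fix x assume "x \<in> ?A"
    then obtain e \<tau> where x: "x = (e, \<tau>)" "e \<in> XS" "\<tau> \<in> YS" "XY_norm \<Omega> (e, \<tau>) \<noteq> 0" by (cases x) auto
    have le: "Y_norm \<Omega> \<tau> \<le> XY_norm \<Omega> (e, \<tau>)" by (simp add: XY_norm_def real_le_rsqrt)
    then have pos: "XY_norm \<Omega> (e, \<tau>) > 0" using x(4) XYZ_nonneg(2)[of \<tau>] by linarith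
    have "form_b2 \<Omega> x v = b2 \<tau> v" unfolding x(1) using x(3) v sub by (intro form_b2_b2) auto
    also have "\<dots> \<le> S * Y_norm \<Omega> \<tau>" by (rule S(2)[OF x(3)])
    also have "\<dots> \<le> S * XY_norm \<Omega> (e, \<tau>)" using le S(1) by (rule mult_left_mono)
    finally show "form_b2 \<Omega> x v / XY_norm \<Omega> x \<le> S" using pos by (simp add: x(1) pos_divide_le_eq)
  qed
  finally show ?thesis .
qed

text \<open>Since \<open>b\<^sub>2\<close> is bounded by the product of the norms, any nonzero \<open>v\<close> shows this; the constant displacement
  belongs to all spaces considered.\<close>

lemma inf_sup_le_1:
  assumes infsup: "inf_sup_b2 \<Omega> XS YS ZS \<beta>" and sub: "YS \<subseteq> Y_space \<Omega>" "ZS \<subseteq> Z_space \<Omega>"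
    and X: "((\<lambda>x. mat 1), 0) \<in> XS" "0 \<in> YS" and ne: "\<Omega> \<noteq> {}"
    and v: "((\<lambda>x. vec 1), 0) \<in> ZS"
  shows "\<beta> \<le> 1"
proof -
  let ?v = "((\<lambda>x. vec 1), 0) :: 'n zsp"
  have "vec 1 \<noteq> (0 :: real^'n)" by (simp add: vec_eq_iff)
  then have "L2_norm \<Omega> (\<lambda>x. vec 1 :: real^'n) > 0" by (rule L2_norm_const_pos[OF ne])
  then have pos: "Z_norm \<Omega> ?v > 0" using L2_norm_le_norms(7)[of "\<lambda>x. vec 1" 0] by linarith
  have "\<beta> * Z_norm \<Omega> ?v \<le> Z_norm \<Omega> ?v"
  proof (rule inf_supD[OF infsup sub X ne v XYZ_nonneg(3)])
    fix \<tau> assume "\<tau> \<in> YS"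
    then have "\<bar>b2 \<tau> ?v\<bar> \<le> Y_norm \<Omega> \<tau> * Z_norm \<Omega> ?v" using sub v by (intro b2_bound) blast+
    then show "b2 \<tau> ?v \<le> Z_norm \<Omega> ?v * Y_norm \<Omega> \<tau>" unfolding mult.commute[of "Y_norm \<Omega> \<tau>"] by linarith
  qed
  then show ?thesis using pos by simp
qed

end

text \<open>\<open>\<beta>\<^sup>2 \<gamma>1\<close> is of the form \<open>(c + \<gamma>2)\<^sup>2 / \<gamma>2\<close> with \<open>c \<ge> 0\<close>, hence at least \<open>\<gamma>2\<close>, and
  \<open>ca * \<gamma>2 = (Ca + 2) * (ca + 1 + Ca)\<close>.\<close>

lemma gamma1_bounds:
  assumes "Ca > 0" "ca > 0" "0 < \<beta>" "\<beta> \<le> 1"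
  shows "(Ca + 1) * (Ca + 2) \<le> \<beta>\<^sup>2 * (ca * const_gamma1 Ca ca \<beta>)" "2 \<le> const_gamma1 Ca ca \<beta>" "2 \<le> ca * const_gamma1 Ca ca \<beta>"
proof -
  define g where "g = const_gamma2 Ca ca"
  have cag: "ca * g = (Ca + 2) * (ca + 1 + Ca)" using assms by (simp add: g_def const_gamma2_def)
  have g: "g \<ge> Ca + 2"
  proof -
    have "ca * (Ca + 2) \<le> ca * g" unfolding cag using assms by (simp add: algebra_simps)
    then show ?thesis using assms by simp
  qed
  have gpos: "g > 0" using g assms by linarith
  have eq: "\<beta>\<^sup>2 * const_gamma1 Ca ca \<beta> = (Ca + 1 + \<beta> + g)\<^sup>2 / g"
    using assms by (simp add: const_gamma1_def g_def)
  have "g\<^sup>2 \<le> (Ca + 1 + \<beta> + g)\<^sup>2" using assms gpos by (intro power_mono) auto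
  then have "g \<le> (Ca + 1 + \<beta> + g)\<^sup>2 / g" using gpos by (simp add: pos_le_divide_eq power2_eq_square)
  then have lo: "g \<le> \<beta>\<^sup>2 * const_gamma1 Ca ca \<beta>" using eq by simp
  have b1: "\<beta>\<^sup>2 \<le> 1" "\<beta>\<^sup>2 > 0" using assms by (auto simp: power_le_one)
  have p: "const_gamma1 Ca ca \<beta> > 0" using lo gpos b1 by (metis less_le_trans zero_less_mult_pos)
  have le: "\<beta>\<^sup>2 * const_gamma1 Ca ca \<beta> \<le> const_gamma1 Ca ca \<beta>" using b1 p by (simp add: mult_left_le_one_le)
  show "2 \<le> const_gamma1 Ca ca \<beta>" using lo le g assms by linarith
  have "(Ca + 1) * (Ca + 2) \<le> ca * g" unfolding cag using assms by (simp add: algebra_simps)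
  also have "\<dots> \<le> ca * (\<beta>\<^sup>2 * const_gamma1 Ca ca \<beta>)" using lo assms by simp
  finally show 1: "(Ca + 1) * (Ca + 2) \<le> \<beta>\<^sup>2 * (ca * const_gamma1 Ca ca \<beta>)" by (simp add: mult.left_commute)
  have "\<beta>\<^sup>2 * (ca * const_gamma1 Ca ca \<beta>) \<le> ca * const_gamma1 Ca ca \<beta>" using b1 p assms by (simp add: mult_left_le_one_le)
  moreover have "2 \<le> (Ca + 1) * (Ca + 2)" using assms by (simp add: algebra_simps)
  ultimately show "2 \<le> ca * const_gamma1 Ca ca \<beta>" using 1 by linarith
qed

text \<open>Here \<open>x\<close>, \<open>s\<close>, \<open>u\<close> stand for the norms of strain and pressure, of the stress and of the displacement,
  and \<open>G\<close>, \<open>H\<close>, \<open>F\<close> for those of the functionals. Once \<open>s\<close> and \<open>u\<close> are replaced by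
  their bounds, the energy inequality \<open>en\<close> is quadratic in \<open>x\<close> on the left and linear in \<open>x\<close> on the
  right, so it bounds \<open>x\<close> by a multiple of the data; \<open>\<gamma>1\<close> is at least that multiple.\<close>

lemma energy_bound_gamma1:
  assumes pos: "Ca > 0" "ca > 0" "0 < \<beta>" "\<beta> \<le> 1"
    and nn: "0 \<le> G" "0 \<le> H" "0 \<le> F" "0 \<le> x"
    and en: "ca * x\<^sup>2 \<le> G * x + H * s + F * u" and s: "s \<le> 3 / 2 * Ca * x + F" and u: "\<beta> * u \<le> x + H"
  shows "x \<le> const_gamma1 Ca ca \<beta> * (G + H + F)"
proof (rule ccontr)
  define \<gamma> where "\<gamma> = const_gamma1 Ca ca \<beta>"
  define D where "D = G + H + F"
  note gb = gamma1_bounds[OF pos, folded \<gamma>_def]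
  assume "\<not> x \<le> const_gamma1 Ca ca \<beta> * (G + H + F)"
  then have xD: "\<gamma> * D < x" by (simp add: \<gamma>_def D_def)
  have D0: "D \<ge> 0" using nn by (simp add: D_def)
  have x0: "x > 0" using xD D0 gb(2) by (smt (verit) mult_nonneg_nonneg)
  have Dx: "\<gamma> * D \<le> x" using xD by simp
  have "\<beta> * (ca * x\<^sup>2) \<le> \<beta> * (G * x + H * s + F * u)" using en pos by simp
  also have "\<dots> = \<beta> * (G * x) + \<beta> * (H * s) + F * (\<beta> * u)" by (simp add: algebra_simps)
  also have "\<dots> \<le> 1 * (G * x) + 1 * (H * (3 / 2 * Ca * x + F)) + F * (x + H)"
  proof (intro add_mono)
    show "\<beta> * (G * x) \<le> 1 * (G * x)" using pos nn by (intro mult_right_mono) auto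
    have "\<beta> * (H * s) \<le> \<beta> * (H * (3 / 2 * Ca * x + F))" using s nn pos by (simp add: mult_left_mono)
    also have "\<dots> \<le> 1 * (H * (3 / 2 * Ca * x + F))" using pos nn by (intro mult_right_mono) auto
    finally show "\<beta> * (H * s) \<le> 1 * (H * (3 / 2 * Ca * x + F))" .
    show "F * (\<beta> * u) \<le> F * (x + H)" using u nn by (intro mult_left_mono) auto
  qed
  also have "\<dots> = x * (G + 3 / 2 * Ca * H + F) + 2 * (H * F)" by (simp add: algebra_simps)
  also have "\<dots> \<le> x * ((1 + 3 / 2 * Ca) * D) + D * D"
  proof (intro add_mono mult_left_mono)
    show "G + 3 / 2 * Ca * H + F \<le> (1 + 3 / 2 * Ca) * D"
    proof -
      have "0 \<le> Ca * G" "0 \<le> Ca * F" using nn pos by simp_all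
      moreover have "(1 + 3 / 2 * Ca) * D = G + 3 / 2 * Ca * H + F + (H + 3 / 2 * (Ca * G) + 3 / 2 * (Ca * F))"
        by (simp add: D_def field_simps)
      ultimately show ?thesis using nn by linarith
    qed
    have "0 \<le> G * G + H * H + F * F + 2 * (G * H) + 2 * (G * F)" using nn by simp
    then show "2 * (H * F) \<le> D * D" by (simp add: D_def algebra_simps)
  qed (use nn in auto)
  finally have main: "\<beta> * (ca * x\<^sup>2) \<le> x * ((1 + 3 / 2 * Ca) * D) + D * D" .
  \<comment> \<open>multiplication by \<open>\<gamma>\<close> turns every \<open>D\<close> into at most \<open>x\<close>\<close>
  have "\<gamma> * (\<beta> * (ca * x\<^sup>2)) \<le> x * ((1 + 3 / 2 * Ca) * (\<gamma> * D)) + D * (\<gamma> * D)"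
    using mult_left_mono[OF main, of \<gamma>] gb(2) by (simp add: algebra_simps)
  also have "\<dots> \<le> x * ((1 + 3 / 2 * Ca) * x) + D * x"
    using Dx x0 D0 pos by (intro add_mono mult_left_mono) (simp_all add: mult_left_mono)
  also have "D * x < x * x"
  proof -
    have "2 * D \<le> \<gamma> * D" using gb(2) D0 by (rule mult_right_mono)
    then have "D < x" using x0 Dx by linarith
    then show ?thesis using x0 by simp
  qed
  then have "x * ((1 + 3 / 2 * Ca) * x) + D * x < (1 + 3 / 2 * Ca) * (x * x) + x * x" by (simp add: mult_ac)
  finally have "\<gamma> * (\<beta> * (ca * x\<^sup>2)) < (2 + 3 / 2 * Ca) * (x * x)" by (simp add: algebra_simps)
  then have "\<gamma> * \<beta> * ca < 2 + 3 / 2 * Ca" using x0 by (simp add: power2_eq_square mult.assoc[symmetric])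
  moreover have "2 + 3 / 2 * Ca \<le> \<gamma> * \<beta> * ca"
  proof -
    have "2 + 3 / 2 * Ca \<le> (Ca + 1) * (Ca + 2)" using pos by (simp add: algebra_simps)
    also have "\<dots> \<le> \<beta> * (\<beta> * (ca * \<gamma>))" using gb(1) by (simp add: power2_eq_square)
    also have "\<dots> \<le> 1 * (\<beta> * (ca * \<gamma>))" using pos gb(2) by (intro mult_right_mono) auto
    finally show ?thesis by (simp add: mult_ac)
  qed
  ultimately show False by linarith
qed

lemma solves_problemD:
  assumes "solves_problem \<Omega> lam \<mu> \<alpha> c0 \<kappa> f g u\<Gamma> r\<Gamma> XS YS ZS ((d, \<sigma>), u)" "0 \<in> XS" "0 \<in> YS" "0 \<in> ZS"
  shows "d \<in> XS" "\<sigma> \<in> YS" "u \<in> ZS"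
    "e \<in> XS \<Longrightarrow> form_a \<Omega> lam \<mu> \<alpha> c0 \<kappa> d e + form_b1 \<Omega> e \<sigma> = functional_G \<Omega> g r\<Gamma> e"
    "\<tau> \<in> YS \<Longrightarrow> form_b1 \<Omega> d \<tau> + form_b2 \<Omega> (0, \<tau>) u = functional_H \<Omega> u\<Gamma> \<tau>"
    "v \<in> ZS \<Longrightarrow> form_b2 \<Omega> (0, \<sigma>) v = functional_F \<Omega> f v"
proof -
  have "form_b2 \<Omega> (d, \<sigma>) v = form_b2 \<Omega> (0, \<sigma>) v" for v by (simp add: form_b2_def split: prod.split)
  then show "d \<in> XS" "\<sigma> \<in> YS" "u \<in> ZS"
    "e \<in> XS \<Longrightarrow> form_a \<Omega> lam \<mu> \<alpha> c0 \<kappa> d e + form_b1 \<Omega> e \<sigma> = functional_G \<Omega> g r\<Gamma> e"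
    "\<tau> \<in> YS \<Longrightarrow> form_b1 \<Omega> d \<tau> + form_b2 \<Omega> (0, \<tau>) u = functional_H \<Omega> u\<Gamma> \<tau>"
    "v \<in> ZS \<Longrightarrow> form_b2 \<Omega> (0, \<sigma>) v = functional_F \<Omega> f v"
    using assms unfolding solves_problem_def by auto
qed

locale poroelastic = bounded_open \<Omega> for \<Omega> :: "(real^'n) set" +
  fixes lam \<mu> \<alpha> c0 \<kappa>1 \<kappa>2 r :: real and \<kappa> :: "'n xsp \<Rightarrow> real^'n \<Rightarrow> real^'n^'n"
  assumes nonempty: "\<Omega> \<noteq> {}" and params: "lam > 0" "\<mu> > 0" "0 \<le> \<alpha>" "c0 > 0"
    and perm: "permeability \<Omega> \<kappa>1 \<kappa>2 \<kappa>" and r: "r > 0"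
begin

definition Ca :: real where "Ca = const_Ca CARD('n) lam \<mu> \<alpha> c0 \<kappa>2 r"
definition ca :: real where "ca = const_ca \<mu> c0 \<kappa>1"

lemma Ca_ge: "2 * \<mu> + real CARD('n) * lam \<le> Ca" "real CARD('n) * \<alpha> \<le> Ca" "Ca > 0"
proof -
  show "2 * \<mu> + real CARD('n) * lam \<le> Ca" "real CARD('n) * \<alpha> \<le> Ca" by (auto simp: Ca_def const_Ca_def)
  then show "Ca > 0" using params by (smt (verit) mult_nonneg_nonneg of_nat_0_le_iff)
qed

lemma ca_le: "ca \<le> \<kappa>1" "ca \<le> 2 * \<mu>" "ca \<le> c0" "ca > 0"
  using params perm by (auto simp: ca_def const_ca_def permeability_def)

lemma kappa_pos: "\<kappa>1 > 0" "\<kappa>2 > 0"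
  using perm by (auto simp: permeability_def)

lemma kappa_Linf: "d \<in> X_space \<Omega> \<Longrightarrow> \<kappa> d \<in> Linf \<Omega>"
  using perm by (auto simp: permeability_def)

lemma bounded_field_Linf: "M \<in> Linf \<Omega> \<Longrightarrow> \<exists>B. bounded_field \<Omega> M B"
proof -
  assume M: "M \<in> Linf \<Omega>"
  then have m: "M \<in> borel_measurable (lebesgue_on \<Omega>)" and n: "Linf_norm \<Omega> M < \<infinity>" by (auto simp: Linf_def)
  obtain B where "Linf_norm \<Omega> M \<le> ereal B" using n by (cases "Linf_norm \<Omega> M") auto
  then have "Linf_norm \<Omega> M \<le> ereal \<bar>B\<bar>" by (smt (verit) ereal_less_eq(3) order_trans)
  then show ?thesis using Linf_norm_bound[OF _ m] m unfolding bounded_field_def by (intro exI[of _ "\<bar>B\<bar>"]) auto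
qed

lemma bounded_fieldI:
  "\<lbrakk>M \<in> borel_measurable (lebesgue_on \<Omega>); Linf_norm \<Omega> M \<le> ereal B; 0 \<le> B\<rbrakk> \<Longrightarrow> bounded_field \<Omega> M B"
  by (simp add: bounded_field_def Linf_norm_bound)

lemma kappa_diff_bounded:
  assumes "d \<in> X_space \<Omega>" "e \<in> X_space \<Omega>"
  shows "bounded_field \<Omega> (\<kappa> d - \<kappa> e) (\<kappa>2 * H1_norm \<Omega> (snd d - snd e))"
proof -
  have m: "\<kappa> d - \<kappa> e \<in> borel_measurable (lebesgue_on \<Omega>)"
    using kappa_Linf[OF assms(1)] kappa_Linf[OF assms(2)] by (auto simp: Linf_def fun_diff_def)
  have "Linf_norm \<Omega> (\<kappa> d - \<kappa> e) \<le> ereal (\<kappa>2 * H1_norm \<Omega> (snd d - snd e))"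
    using perm assms by (cases d; cases e) (auto simp: permeability_def X_space_def)
  with m show ?thesis by (rule bounded_fieldI) (use kappa_pos in simp)
qed

text \<open>The Lipschitz condition compares with the permeability at \<open>0\<close>, which gives one bound for the whole ball.\<close>

lemma kappa_bounded:
  "\<exists>B. \<forall>d\<in>X_space \<Omega>. X_norm \<Omega> d \<le> r \<longrightarrow> bounded_field \<Omega> (\<kappa> d) B"
proof -
  obtain K0 where K0: "bounded_field \<Omega> (\<kappa> 0) K0" using bounded_field_Linf[OF kappa_Linf[OF X.zero_in]] by blast
  have "bounded_field \<Omega> (\<kappa> d) (K0 + \<kappa>2 * r)" if d: "d \<in> X_space \<Omega>" "X_norm \<Omega> d \<le> r" for d
  proof -
    have H: "H1_norm \<Omega> (snd d - snd (0 :: 'n xsp)) \<le> r"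
      using L2_norm_le_norms(3)[of "snd d" "fst d"] d(2) by simp
    have "AE x in lebesgue_on \<Omega>. norm ((\<kappa> d - \<kappa> 0) x) \<le> \<kappa>2 * H1_norm \<Omega> (snd d - snd (0 :: 'n xsp))"
      using kappa_diff_bounded[OF d(1) X.zero_in] by (simp add: bounded_field_def)
    moreover have "AE x in lebesgue_on \<Omega>. norm (\<kappa> 0 x) \<le> K0" using K0 by (simp add: bounded_field_def)
    ultimately have "AE x in lebesgue_on \<Omega>. norm (\<kappa> d x) \<le> K0 + \<kappa>2 * r"
    proof eventually_elim
      case (elim x)
      have "\<kappa>2 * H1_norm \<Omega> (snd d - snd (0 :: 'n xsp)) \<le> \<kappa>2 * r" using H kappa_pos by simp
      then show ?case using elim norm_triangle_sub[of "\<kappa> d x" "\<kappa> 0 x"] by simp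
    qed
    then show ?thesis using K0 kappa_pos r kappa_Linf[OF d(1)] by (auto simp: bounded_field_def Linf_def)
  qed
  then show ?thesis by blast
qed

text \<open>Without the permeability the form \<open>a\<close> is bilinear.\<close>

definition a0 :: "'n xsp \<Rightarrow> 'n xsp \<Rightarrow> real" where
  "a0 d e = lam * L2_inner \<Omega> (trace_fun (fst d)) (trace_fun (fst e)) + 2 * \<mu> * L2_inner \<Omega> (fst d) (fst e)
    + c0 * L2_inner \<Omega> (snd d) (snd e) + \<alpha> * L2_inner \<Omega> (trace_fun (fst d)) (snd e)
    - \<alpha> * L2_inner \<Omega> (snd d) (trace_fun (fst e))"

lemma form_a_split:
  assumes "d \<in> X_space \<Omega>" "e \<in> X_space \<Omega>"
  shows "form_a \<Omega> lam \<mu> \<alpha> c0 \<kappa> d e = a0 d e + flux_form \<Omega> (\<kappa> d) (snd d) (snd e)"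
proof -
  obtain E p E' q where eq: "d = (E, p)" "e = (E', q)" and L: "E \<in> L2 \<Omega>" "p \<in> H1 \<Omega>" "E' \<in> L2 \<Omega>" "q \<in> H1 \<Omega>"
    using assms by (cases d; cases e) (auto simp: X_space_def)
  have "elasticity lam \<mu> (E x) \<bullet> E' x = lam * (trace_fun E x \<bullet> trace_fun E' x) + 2 * \<mu> * (E x \<bullet> E' x)" for x
    by (simp add: elasticity_def inner_add_left trace_fun_def trace_inner)
  then have "(LINT x|lebesgue_on \<Omega>. elasticity lam \<mu> (E x) \<bullet> E' x) = lam * L2_inner \<Omega> (trace_fun E) (trace_fun E') + 2 * \<mu> * L2_inner \<Omega> E E'"
    unfolding L2_inner_def using L2_inner_integrable[OF trace_fun_L2[OF L(1)] trace_fun_L2[OF L(3)]] L2_inner_integrable[OF L(1,3)]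
    by simp
  then show ?thesis by (simp add: form_a_def eq a0_def flux_form_def L2_inner_def trace_fun_def mult.commute[of _ "q _"])
qed

lemma a0_diff:
  assumes "d \<in> X_space \<Omega>" "d' \<in> X_space \<Omega>" "e \<in> X_space \<Omega>"
  shows "a0 (d - d') e = a0 d e - a0 d' e"
  using assms
  by (auto simp: a0_def X_space_def trace_fun_diff L2.ip_diff trace_fun_L2 H1_L2 algebra_simps)

lemma X_parts:
  assumes "d \<in> X_space \<Omega>"
  shows "fst d \<in> L2 \<Omega>" "snd d \<in> H1 \<Omega>" "trace_fun (fst d) \<in> L2 \<Omega>" "snd d \<in> L2 \<Omega>"
    "L2_norm \<Omega> (fst d) \<le> X_norm \<Omega> d" "H1_norm \<Omega> (snd d) \<le> X_norm \<Omega> d" "L2_norm \<Omega> (snd d) \<le> X_norm \<Omega> d"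
    "L2_norm \<Omega> (trace_fun (fst d)) \<le> sqrt (real CARD('n)) * X_norm \<Omega> d"
proof -
  show 1: "fst d \<in> L2 \<Omega>" "snd d \<in> H1 \<Omega>" using assms by (auto simp: X_space_def)
  then show "trace_fun (fst d) \<in> L2 \<Omega>" "snd d \<in> L2 \<Omega>" by (auto simp: trace_fun_L2 H1_L2)
  show 2: "L2_norm \<Omega> (fst d) \<le> X_norm \<Omega> d" using L2_norm_le_norms(4)[of "fst d" "snd d"] by simp
  show 3: "H1_norm \<Omega> (snd d) \<le> X_norm \<Omega> d" using L2_norm_le_norms(3)[of "snd d" "fst d"] by simp
  then show "L2_norm \<Omega> (snd d) \<le> X_norm \<Omega> d" using L2_norm_le_norms(1)[of "snd d"] by linarith
  have "L2_norm \<Omega> (trace_fun (fst d)) \<le> sqrt (real CARD('n)) * L2_norm \<Omega> (fst d)" by (rule trace_fun_norm[OF 1(1)])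
  also have "\<dots> \<le> sqrt (real CARD('n)) * X_norm \<Omega> d" using 2 by (rule mult_left_mono) simp
  finally show "L2_norm \<Omega> (trace_fun (fst d)) \<le> sqrt (real CARD('n)) * X_norm \<Omega> d" .
qed

lemma L2_inner_le:
  assumes "f \<in> L2 \<Omega>" "h \<in> L2 \<Omega>" "L2_norm \<Omega> f \<le> a" "L2_norm \<Omega> h \<le> b"
  shows "\<bar>L2_inner \<Omega> f h\<bar> \<le> a * b"
proof -
  have "\<bar>L2_inner \<Omega> f h\<bar> \<le> L2_norm \<Omega> f * L2_norm \<Omega> h" by (rule L2_Cauchy_Schwarz[OF assms(1,2)])
  also have "\<dots> \<le> a * b" using assms(3,4) order_trans[OF L2_norm_nonneg assms(3)] by (intro mult_mono) simp_all
  finally show ?thesis .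
qed

lemma sqrt_card_le: "sqrt (real CARD('n)) \<le> real CARD('n)"
proof -
  have "1 \<le> real CARD('n)" using zero_less_card_finite[where 'a='n] by linarith
  then have "real CARD('n) \<le> (real CARD('n))\<^sup>2" by (simp add: power2_eq_square)
  then show ?thesis by (simp add: real_le_lsqrt)
qed

text \<open>Continuity constant of \<open>a0\<close>.\<close>

definition C0 :: real where "C0 = lam * real CARD('n) + 2 * \<mu> + c0 + 2 * (\<alpha> * real CARD('n))"

lemma C0_nonneg: "C0 \<ge> 0" using params by (simp add: C0_def)

lemma a0_bound:
  assumes d: "d \<in> X_space \<Omega>" and e: "e \<in> X_space \<Omega>"
  shows "\<bar>a0 d e\<bar> \<le> C0 * X_norm \<Omega> d * X_norm \<Omega> e"
proof -
  note D = X_parts[OF d] and E = X_parts[OF e]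
  let ?x = "X_norm \<Omega> d" and ?y = "X_norm \<Omega> e" and ?n = "real CARD('n)"
  have nn: "0 \<le> ?x * ?y" by simp
  have s: "sqrt ?n * (?x * ?y) \<le> ?n * (?x * ?y)" using sqrt_card_le nn by (rule mult_right_mono)
  have 1: "\<bar>L2_inner \<Omega> (trace_fun (fst d)) (trace_fun (fst e))\<bar> \<le> ?n * (?x * ?y)"
    using L2_inner_le[OF D(3) E(3) D(8) E(8)] by (simp add: mult_ac)
  have 2: "\<bar>L2_inner \<Omega> (fst d) (fst e)\<bar> \<le> ?x * ?y" by (rule L2_inner_le[OF D(1) E(1) D(5) E(5)])
  have 3: "\<bar>L2_inner \<Omega> (snd d) (snd e)\<bar> \<le> ?x * ?y" by (rule L2_inner_le[OF D(4) E(4) D(7) E(7)])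
  have 4: "\<bar>L2_inner \<Omega> (trace_fun (fst d)) (snd e)\<bar> \<le> ?n * (?x * ?y)"
    using L2_inner_le[OF D(3) E(4) D(8) E(7)] s by (simp add: mult_ac)
  have 5: "\<bar>L2_inner \<Omega> (snd d) (trace_fun (fst e))\<bar> \<le> ?n * (?x * ?y)"
    using L2_inner_le[OF D(4) E(3) D(7) E(8)] s by (simp add: mult_ac)
  have "\<bar>a0 d e\<bar> \<le> \<bar>lam * L2_inner \<Omega> (trace_fun (fst d)) (trace_fun (fst e))\<bar> + \<bar>2 * \<mu> * L2_inner \<Omega> (fst d) (fst e)\<bar>
    + \<bar>c0 * L2_inner \<Omega> (snd d) (snd e)\<bar> + \<bar>\<alpha> * L2_inner \<Omega> (trace_fun (fst d)) (snd e)\<bar>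
    + \<bar>\<alpha> * L2_inner \<Omega> (snd d) (trace_fun (fst e))\<bar>" unfolding a0_def by linarith
  also have "\<dots> \<le> lam * (?n * (?x * ?y)) + 2 * \<mu> * (?x * ?y) + c0 * (?x * ?y) + \<alpha> * (?n * (?x * ?y)) + \<alpha> * (?n * (?x * ?y))"
    unfolding abs_mult using 1 2 3 4 5 params by (intro add_mono mult_mono) auto
  also have "\<dots> = C0 * ?x * ?y" by (simp add: C0_def algebra_simps)
  finally show ?thesis .
qed

lemma strain_test: "E \<in> L2 \<Omega> \<Longrightarrow> (E, 0) \<in> X_space \<Omega>" and X_norm_strain: "X_norm \<Omega> (E, 0) = L2_norm \<Omega> E"
  and H1_norm_0: "H1_norm \<Omega> 0 = 0"
proof -
  have z: "(0 :: real^'n \<Rightarrow> real) \<in> H1 \<Omega>" using H1_subspace by (rule subspace_0)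
  show h: "H1_norm \<Omega> 0 = 0" using H1_norm_scale[OF z, of 0] by (simp add: zero_fun_def)
  show "E \<in> L2 \<Omega> \<Longrightarrow> (E, 0) \<in> X_space \<Omega>" using z by (simp add: X_space_def)
  show "X_norm \<Omega> (E, 0) = L2_norm \<Omega> E" by (simp add: X_norm_def h)
qed

text \<open>Against a pure strain only the elastic terms and one coupling term remain, each bounded by \<open>Ca\<close>; the
  factor \<open>3 / 2\<close> exceeds the \<open>\<surd>2\<close> from adding the norms of strain and pressure.\<close>

lemma a0_strain_bound:
  assumes d: "d \<in> X_space \<Omega>" and E: "E \<in> L2 \<Omega>"
  shows "a0 d (E, 0) \<le> 3 / 2 * Ca * X_norm \<Omega> d * L2_norm \<Omega> E"
proof -
  note D = X_parts[OF d]
  let ?n = "real CARD('n)" and ?a = "L2_norm \<Omega> (fst d)" and ?b = "L2_norm \<Omega> (snd d)" and ?e = "L2_norm \<Omega> E"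
  note tE = trace_fun_L2[OF E] trace_fun_norm[OF E]
  have z: "L2_inner \<Omega> f 0 = 0" for f :: "real^'n \<Rightarrow> real" by (simp add: L2_inner_def)
  have 1: "\<bar>L2_inner \<Omega> (trace_fun (fst d)) (trace_fun E)\<bar> \<le> ?n * (?a * ?e)"
    using L2_inner_le[OF D(3) tE(1) trace_fun_norm[OF D(1)] tE(2)] by (simp add: mult_ac)
  have 2: "\<bar>L2_inner \<Omega> (fst d) E\<bar> \<le> ?a * ?e" by (rule L2_inner_le[OF D(1) E order_refl order_refl])
  have "sqrt ?n * (?b * ?e) \<le> ?n * (?b * ?e)" using sqrt_card_le by (rule mult_right_mono) simp
  then have 3: "\<bar>L2_inner \<Omega> (snd d) (trace_fun E)\<bar> \<le> ?n * (?b * ?e)"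
    using L2_inner_le[OF D(4) tE(1) order_refl tE(2)] by (simp add: mult_ac)
  have "a0 d (E, 0) = lam * L2_inner \<Omega> (trace_fun (fst d)) (trace_fun E) + 2 * \<mu> * L2_inner \<Omega> (fst d) E
      - \<alpha> * L2_inner \<Omega> (snd d) (trace_fun E)" by (simp add: a0_def z)
  also have "\<dots> \<le> \<bar>lam * L2_inner \<Omega> (trace_fun (fst d)) (trace_fun E)\<bar> + \<bar>2 * \<mu> * L2_inner \<Omega> (fst d) E\<bar>
      + \<bar>\<alpha> * L2_inner \<Omega> (snd d) (trace_fun E)\<bar>" by linarith
  also have "\<dots> \<le> lam * (?n * (?a * ?e)) + 2 * \<mu> * (?a * ?e) + \<alpha> * (?n * (?b * ?e))"
    unfolding abs_mult using 1 2 3 params by (intro add_mono mult_mono) auto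
  also have "\<dots> = ((2 * \<mu> + ?n * lam) * ?a + (?n * \<alpha>) * ?b) * ?e" by (simp add: algebra_simps)
  also have "\<dots> \<le> (Ca * ?a + Ca * ?b) * ?e"
    using Ca_ge by (intro mult_right_mono add_mono) auto
  also have "\<dots> = Ca * (?a + ?b) * ?e" by (simp add: algebra_simps)
  also have "\<dots> \<le> Ca * (3 / 2 * X_norm \<Omega> d) * ?e"
  proof (intro mult_right_mono mult_left_mono)
    show "?a + ?b \<le> 3 / 2 * X_norm \<Omega> d"
    proof (rule power2_le_imp_le)
      have A: "?a\<^sup>2 + ?b\<^sup>2 \<le> (X_norm \<Omega> d)\<^sup>2" by (simp add: X_norm_sq[OF d])
      have "(?a + ?b)\<^sup>2 \<le> 2 * (?a\<^sup>2 + ?b\<^sup>2)" using zero_le_power2[of "?a - ?b"] by (simp add: power2_eq_square algebra_simps)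
      also have "\<dots> \<le> 9 / 4 * (X_norm \<Omega> d)\<^sup>2" using A by (intro mult_mono) auto
      also have "\<dots> = (3 / 2 * X_norm \<Omega> d)\<^sup>2" by (simp add: power_mult_distrib power2_eq_square)
      finally show "(?a + ?b)\<^sup>2 \<le> (3 / 2 * X_norm \<Omega> d)\<^sup>2" .
    qed simp
  qed (use Ca_ge in auto)
  finally show ?thesis by (simp add: mult_ac)
qed

lemma a0_flux_coercive:
  assumes w: "w \<in> X_space \<Omega>" and d: "d \<in> X_space \<Omega>"
  shows "ca * (X_norm \<Omega> d)\<^sup>2 \<le> a0 d d + flux_form \<Omega> (\<kappa> w) (snd d) (snd d)"
proof -
  note D = X_parts[OF d]
  let ?G = "weak_grad \<Omega> (snd d)"
  have GL: "?G \<in> L2 \<Omega>" by (rule weak_grad_L2[OF D(2)])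
  obtain B where B: "bounded_field \<Omega> (\<kappa> w) B" using bounded_field_Linf[OF kappa_Linf[OF w]] by blast
  have "\<kappa>1 * (L2_norm \<Omega> ?G)\<^sup>2 = (LINT x|lebesgue_on \<Omega>. \<kappa>1 * (norm (?G x))\<^sup>2)" by (simp add: L2_norm_def)
  also have "\<dots> \<le> (LINT x|lebesgue_on \<Omega>. (\<kappa> w x *v ?G x) \<bullet> ?G x)"
  proof (rule integral_mono_AE)
    show "integrable (lebesgue_on \<Omega>) (\<lambda>x. \<kappa>1 * (norm (?G x))\<^sup>2)" using L2_integrable_sq[OF GL] by simp
    show "integrable (lebesgue_on \<Omega>) (\<lambda>x. (\<kappa> w x *v ?G x) \<bullet> ?G x)" by (rule L2_inner_integrable[OF flux_L2[OF B D(2)] GL])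
    have "AE x in lebesgue_on \<Omega>. \<forall>v. v \<noteq> 0 \<longrightarrow> \<kappa>1 * (norm v)\<^sup>2 \<le> v \<bullet> (\<kappa> w x *v v)"
      using perm w by (auto simp: permeability_def)
    then show "AE x in lebesgue_on \<Omega>. \<kappa>1 * (norm (?G x))\<^sup>2 \<le> (\<kappa> w x *v ?G x) \<bullet> ?G x"
    proof eventually_elim
      case (elim x)
      then show ?case by (cases "?G x = 0") (auto simp: inner_commute)
    qed
  qed
  finally have fl: "\<kappa>1 * (L2_norm \<Omega> ?G)\<^sup>2 \<le> flux_form \<Omega> (\<kappa> w) (snd d) (snd d)" by (simp add: flux_form_def L2_inner_def)
  have "a0 d d = lam * (L2_norm \<Omega> (trace_fun (fst d)))\<^sup>2 + 2 * \<mu> * (L2_norm \<Omega> (fst d))\<^sup>2 + c0 * (L2_norm \<Omega> (snd d))\<^sup>2"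
    using L2.ip_sym[OF D(3) D(4)] by (simp add: a0_def L2_norm_sq_inner)
  then have a: "2 * \<mu> * (L2_norm \<Omega> (fst d))\<^sup>2 + c0 * (L2_norm \<Omega> (snd d))\<^sup>2 \<le> a0 d d" using params by simp
  have "ca * (X_norm \<Omega> d)\<^sup>2 = ca * (L2_norm \<Omega> (fst d))\<^sup>2 + ca * (L2_norm \<Omega> (snd d))\<^sup>2 + ca * (L2_norm \<Omega> ?G)\<^sup>2"
    by (simp add: X_norm_sq[OF d] algebra_simps)
  also have "\<dots> \<le> 2 * \<mu> * (L2_norm \<Omega> (fst d))\<^sup>2 + c0 * (L2_norm \<Omega> (snd d))\<^sup>2 + \<kappa>1 * (L2_norm \<Omega> ?G)\<^sup>2"
    using ca_le by (intro add_mono mult_right_mono) auto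
  finally show ?thesis using a fl by linarith
qed

lemma functional_G_strain: "R \<in> Hmhalf \<Omega> \<Longrightarrow> functional_G \<Omega> g R (E, 0) = 0"
proof -
  assume R: "R \<in> Hmhalf \<Omega>"
  have "R (bdry_trace \<Omega> 0) = 0" using Hmhalf_bound[OF R subspace_0[OF H1_subspace]] H1_norm_0 by simp
  then show ?thesis by (simp add: functional_G_def)
qed

lemma flux_form_strain: "bounded_field \<Omega> M B \<Longrightarrow> p \<in> H1 \<Omega> \<Longrightarrow> flux_form \<Omega> M p 0 = 0"
  using flux_form_bound[of M B p 0] subspace_0[OF H1_subspace] H1_norm_0 by simp

text \<open>Testing with the solution itself bounds the strain and the pressure by the stress and the
  displacement, which are in turn bounded by them: the stress is determined by the constitutive law,
  its divergence by the load, and the displacement by the inf-sup condition. The permeability enters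
  only through its coercivity.\<close>

lemma a_priori_bound:
  assumes data: "f \<in> L2 \<Omega>" "g \<in> L2 \<Omega>" "u\<Gamma> \<in> Hhalf_vec \<Omega>" "r\<Gamma> \<in> Hmhalf \<Omega>"
    and \<beta>: "\<beta> > 0" and infsup: "inf_sup_b2 \<Omega> (X_space \<Omega>) (Y_space \<Omega>) (Z_space \<Omega>) \<beta>"
    and sol: "solves_problem \<Omega> lam \<mu> \<alpha> c0 \<kappa> f g u\<Gamma> r\<Gamma> (X_space \<Omega>) (Y_space \<Omega>) (Z_space \<Omega>) ((d, \<sigma>), u)"
  shows "X_norm \<Omega> d \<le> const_gamma1 Ca ca \<beta> * data_size \<Omega> f g u\<Gamma> r\<Gamma>"
proof -
  note S = solves_problemD[OF sol X.zero_in Y.zero_in Z.zero_in]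
  note d = S(1) and \<sigma> = S(2) and u = S(3)
  have m1: "((\<lambda>x. mat 1), 0) \<in> X_space \<Omega>" by (rule strain_test[OF L2_const_bounded[OF bounded_dom dom_sets]])
  have v1: "((\<lambda>x. vec 1), 0) \<in> Z_space \<Omega>"
    using L2_const_bounded[OF bounded_dom dom_sets] subspace_0[OF L2_skew_subspace] by (simp add: Z_space_def)
  have \<beta>1: "\<beta> \<le> 1" by (rule inf_sup_le_1[OF infsup order_refl order_refl m1 Y.zero_in nonempty v1])
  obtain B where B: "bounded_field \<Omega> (\<kappa> d) B" using bounded_field_Linf[OF kappa_Linf[OF d]] by blast
  have \<sigma>L: "\<sigma> \<in> L2 \<Omega>" "tensor_div \<Omega> \<sigma> \<in> L2 \<Omega>" using \<sigma> by (auto simp: Y_space_def Hdiv_L2 tensor_div_L2)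
  have stress: "L2_norm \<Omega> \<sigma> \<le> 3 / 2 * Ca * X_norm \<Omega> d"
  proof -
    have "(L2_norm \<Omega> \<sigma>)\<^sup>2 = a0 d (\<sigma>, 0)"
      using S(4)[OF strain_test[OF \<sigma>L(1)]] form_a_split[OF d strain_test[OF \<sigma>L(1)]]
        flux_form_strain[OF B X_parts(2)[OF d]] functional_G_strain[OF data(4)]
      by (simp add: form_b1_inner L2_norm_sq_inner)
    also have "\<dots> \<le> 3 / 2 * Ca * X_norm \<Omega> d * L2_norm \<Omega> \<sigma>" by (rule a0_strain_bound[OF d \<sigma>L(1)])
    finally have "L2_norm \<Omega> \<sigma> * L2_norm \<Omega> \<sigma> \<le> (3 / 2 * Ca * X_norm \<Omega> d) * L2_norm \<Omega> \<sigma>" by (simp only: power2_eq_square)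
    then show ?thesis using Ca_ge(3) L2_norm_nonneg[of \<Omega> \<sigma>]
      by (cases "L2_norm \<Omega> \<sigma> = 0") (simp_all add: mult_le_cancel_right)
  qed
  have div: "L2_norm \<Omega> (tensor_div \<Omega> \<sigma>) \<le> L2_norm \<Omega> f"
  proof -
    have v: "(tensor_div \<Omega> \<sigma>, 0) \<in> Z_space \<Omega>" using \<sigma>L(2) subspace_0[OF L2_skew_subspace] by (simp add: Z_space_def)
    have "- (L2_norm \<Omega> (tensor_div \<Omega> \<sigma>))\<^sup>2 = L2_inner \<Omega> f (tensor_div \<Omega> \<sigma>)"
      using S(6)[OF v] by (simp add: form_b2_def functional_F_def L2_norm_sq_inner L2_inner_def)
    then have "L2_norm \<Omega> (tensor_div \<Omega> \<sigma>) * L2_norm \<Omega> (tensor_div \<Omega> \<sigma>) \<le> L2_norm \<Omega> f * L2_norm \<Omega> (tensor_div \<Omega> \<sigma>)"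
      using L2_Cauchy_Schwarz[OF data(1) \<sigma>L(2)] by (simp add: power2_eq_square)
    then show ?thesis using L2_norm_nonneg[of \<Omega> "tensor_div \<Omega> \<sigma>"]
      by (cases "L2_norm \<Omega> (tensor_div \<Omega> \<sigma>) = 0") (simp_all add: mult_le_cancel_right)
  qed
  have s: "Y_norm \<Omega> \<sigma> \<le> 3 / 2 * Ca * X_norm \<Omega> d + L2_norm \<Omega> f"
  proof -
    have "Y_norm \<Omega> \<sigma> \<le> L2_norm \<Omega> \<sigma> + L2_norm \<Omega> (tensor_div \<Omega> \<sigma>)" unfolding Y_norm_def by (rule sqrt_sum_squares_le_sum) simp_all
    then show ?thesis using stress div by linarith
  qed
  note dn = data_nonneg(1)[OF data(4), of g] data_nonneg(2)[OF data(4), of u\<Gamma>]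
  have disp: "\<beta> * Z_norm \<Omega> u \<le> X_norm \<Omega> d + Hhalf_vec_norm \<Omega> u\<Gamma>"
  proof (rule inf_supD[OF infsup order_refl order_refl m1 Y.zero_in nonempty u])
    show "0 \<le> X_norm \<Omega> d + Hhalf_vec_norm \<Omega> u\<Gamma>" using dn by simp
    fix \<tau> assume \<tau>: "\<tau> \<in> Y_space \<Omega>"
    have "b2 \<tau> u = functional_H \<Omega> u\<Gamma> \<tau> - form_b1 \<Omega> d \<tau>"
      using S(5)[OF \<tau>] form_b2_b2[OF \<tau> u] by simp
    then show "b2 \<tau> u \<le> (X_norm \<Omega> d + Hhalf_vec_norm \<Omega> u\<Gamma>) * Y_norm \<Omega> \<tau>"
      using functional_H_bound[OF \<tau> data(3)] form_b1_bound[OF d \<tau>] by (simp add: distrib_right)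
  qed
  have "form_a \<Omega> lam \<mu> \<alpha> c0 \<kappa> d d = functional_G \<Omega> g r\<Gamma> d - functional_H \<Omega> u\<Gamma> \<sigma> + functional_F \<Omega> f u"
    using S(4)[OF d] S(5)[OF \<sigma>] S(6)[OF u] by linarith
  then have "ca * (X_norm \<Omega> d)\<^sup>2 \<le> (L2_norm \<Omega> g + Hmhalf_norm \<Omega> r\<Gamma>) * X_norm \<Omega> d
      + Hhalf_vec_norm \<Omega> u\<Gamma> * Y_norm \<Omega> \<sigma> + L2_norm \<Omega> f * Z_norm \<Omega> u"
    using a0_flux_coercive[OF d d] form_a_split[OF d d] functional_G_bound[OF data(2,4) d]
      functional_H_bound[OF \<sigma> data(3)] functional_F_bound[OF data(1) u] by linarith
  from energy_bound_gamma1[OF Ca_ge(3) ca_le(4) \<beta> \<beta>1 dn L2_norm_nonneg XYZ_nonneg(1) this s disp]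
  show ?thesis by (simp add: data_size_def)
qed

end

section \<open>The error estimate\<close>

text \<open>\<open>c\<close> is the share of the approximation error in the bound for the stress, and \<open>e\<close> the factor in the bound
  for strain and pressure that results from the energy estimate after absorption.\<close>

definition cea_const :: "real \<Rightarrow> real \<Rightarrow> real \<Rightarrow> real \<Rightarrow> real" where
  "cea_const ca \<beta> K M =
    (let c = K + 1 + 2 / \<beta>; e = 2 * ((M + ca / 4 + 1 + 2 * K + 1 / \<beta>) + (2 * c + 2 / \<beta>)) / ca + 1
     in 1 + e * (1 + K + 1 / \<beta>) + c + 2 / \<beta>)"

text \<open>\<open>x\<close>, \<open>y\<close>, \<open>z\<close> are the differences between the discrete solution and the competitor in strain and pressure,
  stress and displacement, and \<open>\<epsilon>\<close> is the approximation error. The term \<open>ca / 4 * x\<^sup>2\<close> on the right of the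
  energy estimate is absorbed on the left. If \<open>x > \<epsilon>\<close>, all other terms on the right are at most a multiple
  of \<open>\<epsilon> * x\<close>, and one factor \<open>x\<close> cancels.\<close>

lemma cea_arithmetic:
  assumes pos: "ca > 0" "\<beta> > 0" "K \<ge> 0" "M \<ge> 0" and nn: "x \<ge> 0" "\<epsilon> \<ge> 0"
    and en: "ca * x\<^sup>2 \<le> (M * \<epsilon> + ca / 4 * (\<epsilon> + x) + \<epsilon>) * x + 2 * \<epsilon> * y + \<epsilon> * z"
    and y: "y \<le> K * x + (K + 1 + 2 / \<beta>) * \<epsilon>" and z: "\<beta> * z \<le> x + 2 * \<epsilon>"
  shows "\<epsilon> + x + y + z \<le> cea_const ca \<beta> K M * \<epsilon>"
proof -
  define c where "c = K + 1 + 2 / \<beta>"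
  define b where "b = (M + ca / 4 + 1 + 2 * K + 1 / \<beta>) + (2 * c + 2 / \<beta>)"
  have c0: "c \<ge> 0" and b0: "b \<ge> 0" using pos by (auto simp: c_def b_def)
  have z': "z \<le> 1 / \<beta> * x + 2 / \<beta> * \<epsilon>" using z pos by (simp add: field_simps)
  have y': "y \<le> K * x + c * \<epsilon>" using y by (simp add: c_def)
  have expand: "(M * \<epsilon> + q * (\<epsilon> + x) + \<epsilon>) * x + 2 * \<epsilon> * (K * x + c * \<epsilon>) + \<epsilon> * (i * x + j * \<epsilon>)
      = q * x\<^sup>2 + (M + q + 1 + 2 * K + i) * (\<epsilon> * x) + (2 * c + j) * (\<epsilon> * \<epsilon>)" for i j q
    by (simp add: algebra_simps power2_eq_square)
  have "ca * x\<^sup>2 \<le> (M * \<epsilon> + ca / 4 * (\<epsilon> + x) + \<epsilon>) * x + 2 * \<epsilon> * (K * x + c * \<epsilon>) + \<epsilon> * (1 / \<beta> * x + 2 / \<beta> * \<epsilon>)"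
    using en mult_left_mono[OF y', of "2 * \<epsilon>"] mult_left_mono[OF z', of \<epsilon>] nn by linarith
  then have q: "3 / 4 * ca * x\<^sup>2 \<le> (M + ca / 4 + 1 + 2 * K + 1 / \<beta>) * (\<epsilon> * x) + (2 * c + 2 / \<beta>) * (\<epsilon> * \<epsilon>)"
    unfolding expand by linarith
  have x: "x \<le> (2 * b / ca + 1) * \<epsilon>"
  proof (cases "x \<le> \<epsilon>")
    case True
    have "0 \<le> 2 * b / ca * \<epsilon>" using b0 pos nn by simp
    then show ?thesis using True by (simp add: distrib_right)
  next
    case False
    then have "\<epsilon> * \<epsilon> \<le> \<epsilon> * x" using nn by (intro mult_left_mono) auto
    then have "(2 * c + 2 / \<beta>) * (\<epsilon> * \<epsilon>) \<le> (2 * c + 2 / \<beta>) * (\<epsilon> * x)" by (rule mult_left_mono) (use c0 pos in simp)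
    then have "3 / 4 * ca * x\<^sup>2 \<le> b * (\<epsilon> * x)" using q unfolding b_def distrib_right by linarith
    moreover have "1 / 2 * ca * x\<^sup>2 \<le> 3 / 4 * ca * x\<^sup>2" using pos by (intro mult_right_mono) auto
    ultimately have "(ca * x) * x \<le> (2 * b * \<epsilon>) * x" by (simp add: power2_eq_square)
    moreover have "x > 0" using False nn by linarith
    ultimately have "ca * x \<le> 2 * b * \<epsilon>" by (rule mult_right_le_imp_le)
    then have "x \<le> 2 * b / ca * \<epsilon>" using pos by (simp add: field_simps)
    then show ?thesis using nn by (simp add: distrib_right)
  qed
  have "\<epsilon> + x + y + z \<le> (1 + K + 1 / \<beta>) * x + (1 + c + 2 / \<beta>) * \<epsilon>"
    using y' z' by (simp add: algebra_simps)
  also have "\<dots> \<le> (1 + K + 1 / \<beta>) * ((2 * b / ca + 1) * \<epsilon>) + (1 + c + 2 / \<beta>) * \<epsilon>"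
    using x pos by (intro add_right_mono mult_left_mono) auto
  also have "\<dots> = (1 + (2 * b / ca + 1) * (1 + K + 1 / \<beta>) + c + 2 / \<beta>) * \<epsilon>" by (simp add: algebra_simps)
  also have "\<dots> = cea_const ca \<beta> K M * \<epsilon>" by (simp only: cea_const_def Let_def c_def b_def)
  finally show ?thesis .
qed

lemma cea_const_ge: "\<lbrakk>ca > 0; \<beta> > 0; K \<ge> 0; M \<ge> 0\<rbrakk> \<Longrightarrow> 1 \<le> cea_const ca \<beta> K M"
  unfolding cea_const_def Let_def by simp

locale galerkin = peers \<Omega> T k \<theta> + poroelastic \<Omega> lam \<mu> \<alpha> c0 \<kappa>1 \<kappa>2 r \<kappa>
  for \<Omega> :: "(real^'n) set" and T k \<theta> lam \<mu> \<alpha> c0 \<kappa>1 \<kappa>2 r and \<kappa> :: "'n xsp \<Rightarrow> real^'n \<Rightarrow> real^'n^'n"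
begin

lemma discrete_test: "((\<lambda>x. mat 1), 0) \<in> Xh \<Omega> T k" "((\<lambda>x. vec 1), 0) \<in> Zh \<Omega> T k"
  using const_X1h const_Z1h subspace_0[OF X2h_subspace] subspace_0[OF Z2h_subspace] by (auto simp: Xh_def Zh_def)

lemma Yh_in: "\<tau> \<in> Yh \<Omega> T k \<Longrightarrow> \<tau> \<in> Y_space \<Omega>" and Xh_in: "e \<in> Xh \<Omega> T k \<Longrightarrow> e \<in> X_space \<Omega>"
  and Zh_in: "v \<in> Zh \<Omega> T k \<Longrightarrow> v \<in> Z_space \<Omega>"
  using Yh_Y Xh_X Zh_Z by blast+

text \<open>By \<open>Yh_orthonormal_bound\<close> the discrete stresses are finite-dimensional, as \<open>inf_sup_kernel_split\<close>
  requires. The remainder \<open>\<zeta> - \<zeta>0\<close> lies in the discrete kernel, where \<open>discrete_kernel\<close> applies.\<close>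

lemma discrete_split:
  assumes infsup: "inf_sup_b2 \<Omega> (Xh \<Omega> T k) (Yh \<Omega> T k) (Zh \<Omega> T k) \<beta>" and \<beta>: "\<beta> > 0"
    and \<zeta>: "\<zeta> \<in> Yh \<Omega> T k" and R: "0 \<le> R" "\<And>v. v \<in> Zh \<Omega> T k \<Longrightarrow> b2 \<zeta> v \<le> R * Z_norm \<Omega> v"
  obtains \<zeta>0 where "\<zeta>0 \<in> Yh \<Omega> T k" "\<And>v. v \<in> Zh \<Omega> T k \<Longrightarrow> b2 (\<zeta> - \<zeta>0) v = 0" "Y_norm \<Omega> \<zeta>0 \<le> R / \<beta>"
proof -
  obtain N where N: "\<And>B. Yh.orthonormal B \<Longrightarrow> card B \<le> N" using Yh_orthonormal_bound by blast
  show ?thesis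
  proof (rule Yh.inf_sup_kernel_split[where b = b2 and Z = "Zh \<Omega> T k" and nZ = "Z_norm \<Omega>" and \<beta> = \<beta> and R = R and x = \<zeta>, OF N Zh_subspace])
    fix \<tau> \<rho> :: "'n ysp" and v w :: "'n zsp" and c :: real
    assume \<tau>: "\<tau> \<in> Yh \<Omega> T k" and v: "v \<in> Zh \<Omega> T k"
    have z: "b2 0 v = 0" using b2_lincomb_left[OF Y.zero_in Y.zero_in Zh_in[OF v], of 1] by simp
    show "b2 (c *\<^sub>R \<tau>) v = c * b2 \<tau> v"
      using b2_lincomb_left[OF Yh_in[OF \<tau>] Y.zero_in Zh_in[OF v], of c] z by simp
    have "b2 \<tau> 0 = 0" using b2_lincomb_right[OF Yh_in[OF \<tau>] Z.zero_in Z.zero_in, of 1] by simp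
    then show "b2 \<tau> (c *\<^sub>R v) = c * b2 \<tau> v"
      using b2_lincomb_right[OF Yh_in[OF \<tau>] Zh_in[OF v] Z.zero_in, of c] by simp
    show "\<bar>b2 \<tau> v\<bar> \<le> Yh.nrm \<tau> * Z_norm \<Omega> v"
      using b2_bound[OF Yh_in[OF \<tau>] Zh_in[OF v]] Yh_nrm[OF \<tau>] by simp
    show "b2 (\<tau> + \<rho>) v = b2 \<tau> v + b2 \<rho> v" if \<rho>: "\<rho> \<in> Yh \<Omega> T k"
      using b2_lincomb_left[OF Yh_in[OF \<tau>] Yh_in[OF \<rho>] Zh_in[OF v], of 1] by simp
    show "b2 \<tau> (v + w) = b2 \<tau> v + b2 \<tau> w" if w: "w \<in> Zh \<Omega> T k"
      using b2_lincomb_right[OF Yh_in[OF \<tau>] Zh_in[OF v] Zh_in[OF w], of 1] by simp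
  next
    fix v S assume v: "v \<in> Zh \<Omega> T k" and S: "0 \<le> S" "\<And>\<tau>. \<tau> \<in> Yh \<Omega> T k \<Longrightarrow> b2 \<tau> v \<le> S * Yh.nrm \<tau>"
    show "\<beta> * Z_norm \<Omega> v \<le> S"
      by (rule inf_supD[OF infsup Yh_Y Zh_Z discrete_test(1) Yh.zero_in nonempty v S(1)])
        (use S(2) Yh_nrm in simp)
  next
    fix x0 assume x0: "x0 \<in> Yh \<Omega> T k" "\<And>v. v \<in> Zh \<Omega> T k \<Longrightarrow> b2 (\<zeta> - x0) v = 0" "Yh.nrm x0 \<le> R / \<beta>"
    have "Y_norm \<Omega> x0 = Yh.nrm x0" using Yh_nrm[OF x0(1)] by (rule sym)
    also have "\<dots> \<le> R / \<beta>" by (rule x0(3))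
    finally have n: "Y_norm \<Omega> x0 \<le> R / \<beta>" .
    show ?thesis
    proof (rule that)
      show "x0 \<in> Yh \<Omega> T k" "Y_norm \<Omega> x0 \<le> R / \<beta>" by fact+
      show "b2 (\<zeta> - x0) v = 0" if "v \<in> Zh \<Omega> T k" for v by (rule x0(2)[OF that])
    qed
  qed (use \<beta> \<zeta> R in auto)
qed

text \<open>Galerkin orthogonality turns the difference between the discrete solution and a discrete
  competitor into the solution of a linear discrete problem whose data are the approximation error
  and the change of the permeability. The latter is at most \<open>ca / 4\<close> times the pressure error, by the
  smallness of the exact pressure.\<close>

lemma galerkin_error:
  assumes infsup: "inf_sup_b2 \<Omega> (Xh \<Omega> T k) (Yh \<Omega> T k) (Zh \<Omega> T k) \<beta>" and \<beta>: "\<beta> > 0"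
    and sol: "solves_problem \<Omega> lam \<mu> \<alpha> c0 \<kappa> f g u\<Gamma> r\<Gamma> (X_space \<Omega>) (Y_space \<Omega>) (Z_space \<Omega>) ((d, \<sigma>), u)"
    and solh: "solves_problem \<Omega> lam \<mu> \<alpha> c0 \<kappa> f g u\<Gamma> r\<Gamma> (Xh \<Omega> T k) (Yh \<Omega> T k) (Zh \<Omega> T k) ((dh, \<sigma>h), uh)"
    and small: "\<kappa>2 * X_norm \<Omega> d \<le> ca / 4" and M: "bounded_field \<Omega> (\<kappa> dh) M"
    and w: "e \<in> Xh \<Omega> T k" "\<tau> \<in> Yh \<Omega> T k" "v \<in> Zh \<Omega> T k"
  shows "X_norm \<Omega> (d - dh) + Y_norm \<Omega> (\<sigma> - \<sigma>h) + Z_norm \<Omega> (u - uh)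
    \<le> cea_const ca \<beta> C0 (C0 + M) * (X_norm \<Omega> (d - e) + Y_norm \<Omega> (\<sigma> - \<tau>) + Z_norm \<Omega> (u - v))"
proof -
  have z: "0 \<in> Xh \<Omega> T k" "0 \<in> Yh \<Omega> T k" "0 \<in> Zh \<Omega> T k"
    using subspace_0[OF Xh_subspace] subspace_0[OF Yh_subspace] subspace_0[OF Zh_subspace] by auto
  note S = solves_problemD[OF sol X.zero_in Y.zero_in Z.zero_in]
  note Sh = solves_problemD[OF solh z]
  note d = S(1) and \<sigma> = S(2) and u = S(3)
  note dh = Xh_in[OF Sh(1)] and \<sigma>h = Yh_in[OF Sh(2)] and uh = Zh_in[OF Sh(3)]
  note we = Xh_in[OF w(1)] and w\<tau> = Yh_in[OF w(2)] and wv = Zh_in[OF w(3)]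
  define \<delta> where "\<delta> = d - e"
  define \<rho> where "\<rho> = \<sigma> - \<tau>"
  define \<nu> where "\<nu> = u - v"
  define \<xi> where "\<xi> = dh - e"
  define \<zeta> where "\<zeta> = \<sigma>h - \<tau>"
  define \<omega> where "\<omega> = uh - v"
  have \<delta>: "\<delta> \<in> X_space \<Omega>" and \<rho>: "\<rho> \<in> Y_space \<Omega>" and \<nu>: "\<nu> \<in> Z_space \<Omega>"
    unfolding \<delta>_def \<rho>_def \<nu>_def by (auto intro: X.diff_in Y.diff_in Z.diff_in d \<sigma> u we w\<tau> wv)
  have \<xi>h: "\<xi> \<in> Xh \<Omega> T k" and \<zeta>h: "\<zeta> \<in> Yh \<Omega> T k" and \<omega>h: "\<omega> \<in> Zh \<Omega> T k"
    unfolding \<xi>_def \<zeta>_def \<omega>_def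
    by (auto intro: subspace_diff[OF Xh_subspace] subspace_diff[OF Yh_subspace] subspace_diff[OF Zh_subspace] Sh(1-3) w)
  note \<xi> = Xh_in[OF \<xi>h] and \<zeta> = Yh_in[OF \<zeta>h] and \<omega> = Zh_in[OF \<omega>h]
  let ?x = "X_norm \<Omega> \<xi>" and ?y = "Y_norm \<Omega> \<zeta>" and ?z = "Z_norm \<Omega> \<omega>"
  define \<epsilon> where "\<epsilon> = X_norm \<Omega> \<delta> + Y_norm \<Omega> \<rho> + Z_norm \<Omega> \<nu>"
  have \<epsilon>: "X_norm \<Omega> \<delta> \<le> \<epsilon>" "Y_norm \<Omega> \<rho> \<le> \<epsilon>" "Z_norm \<Omega> \<nu> \<le> \<epsilon>" "0 \<le> \<epsilon>" by (auto simp: \<epsilon>_def)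
  have H: "snd d \<in> H1 \<Omega>" "snd dh \<in> H1 \<Omega>" "snd e \<in> H1 \<Omega>" using d dh we by (auto simp: X_parts)
  obtain B where B: "bounded_field \<Omega> (\<kappa> d) B" using bounded_field_Linf[OF kappa_Linf[OF d]] by blast
  have M0: "M \<ge> 0" using M by (simp add: bounded_field_def)
  let ?p = "snd d" and ?ph = "snd dh"
  have \<Delta>: "bounded_field \<Omega> (\<kappa> d - \<kappa> dh) (\<kappa>2 * H1_norm \<Omega> (?p - ?ph))" by (rule kappa_diff_bounded[OF d dh])
  \<comment> \<open>both sides use the permeability at \<open>dh\<close>, so its change meets only the exact pressure\<close>
  have eq1: "a0 \<xi> t + flux_form \<Omega> (\<kappa> dh) (snd \<xi>) (snd t) + form_b1 \<Omega> t \<zeta>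
    = a0 \<delta> t + flux_form \<Omega> (\<kappa> dh) (snd \<delta>) (snd t) + flux_form \<Omega> (\<kappa> d - \<kappa> dh) ?p (snd t) + form_b1 \<Omega> t \<rho>"
    if t: "t \<in> Xh \<Omega> T k" for t
  proof -
    note t' = Xh_in[OF t]
    have t2: "snd t \<in> H1 \<Omega>" by (rule X_parts(2)[OF t'])
    have "form_a \<Omega> lam \<mu> \<alpha> c0 \<kappa> d t + form_b1 \<Omega> t \<sigma> = form_a \<Omega> lam \<mu> \<alpha> c0 \<kappa> dh t + form_b1 \<Omega> t \<sigma>h"
      using S(4)[OF t'] Sh(4)[OF t] by simp
    then have "a0 d t + flux_form \<Omega> (\<kappa> d) ?p (snd t) + form_b1 \<Omega> t \<sigma>
        = a0 dh t + flux_form \<Omega> (\<kappa> dh) ?ph (snd t) + form_b1 \<Omega> t \<sigma>h"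
      by (simp only: form_a_split[OF d t'] form_a_split[OF dh t'])
    moreover have "a0 \<xi> t = a0 dh t - a0 e t" "a0 \<delta> t = a0 d t - a0 e t"
      unfolding \<xi>_def \<delta>_def by (rule a0_diff[OF dh we t'], rule a0_diff[OF d we t'])
    moreover have "flux_form \<Omega> (\<kappa> dh) (snd \<xi>) (snd t) = flux_form \<Omega> (\<kappa> dh) ?ph (snd t) - flux_form \<Omega> (\<kappa> dh) (snd e) (snd t)"
      "flux_form \<Omega> (\<kappa> dh) (snd \<delta>) (snd t) = flux_form \<Omega> (\<kappa> dh) ?p (snd t) - flux_form \<Omega> (\<kappa> dh) (snd e) (snd t)"
      unfolding \<xi>_def \<delta>_def snd_diff by (rule flux_form_diff[OF M H(2) H(3) t2], rule flux_form_diff[OF M H(1) H(3) t2])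
    moreover have "flux_form \<Omega> (\<kappa> d - \<kappa> dh) ?p (snd t) = flux_form \<Omega> (\<kappa> d) ?p (snd t) - flux_form \<Omega> (\<kappa> dh) ?p (snd t)"
      by (rule flux_form_diff_field[OF B M H(1) t2])
    moreover have "form_b1 \<Omega> t \<zeta> = form_b1 \<Omega> t \<sigma>h - form_b1 \<Omega> t \<tau>" "form_b1 \<Omega> t \<rho> = form_b1 \<Omega> t \<sigma> - form_b1 \<Omega> t \<tau>"
      unfolding \<zeta>_def \<rho>_def by (rule form_b1_diff(2)[OF t' \<sigma>h w\<tau>], rule form_b1_diff(2)[OF t' \<sigma> w\<tau>])
    ultimately show ?thesis by linarith
  qed
  have eq2: "form_b1 \<Omega> \<xi> t + b2 t \<omega> = form_b1 \<Omega> \<delta> t + b2 t \<nu>" if t: "t \<in> Yh \<Omega> T k" for t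
  proof -
    note t' = Yh_in[OF t]
    have "form_b1 \<Omega> d t + b2 t u = form_b1 \<Omega> dh t + b2 t uh"
      using S(5)[OF t'] Sh(5)[OF t] form_b2_b2[OF t' u] form_b2_b2[OF t' uh] by simp
    then show ?thesis
      unfolding \<xi>_def \<delta>_def \<omega>_def \<nu>_def form_b1_diff(1)[OF dh we t'] form_b1_diff(1)[OF d we t']
        b2_diff(2)[OF t' uh wv] b2_diff(2)[OF t' u wv] by linarith
  qed
  have eq3: "b2 \<zeta> t = b2 \<rho> t" if t: "t \<in> Zh \<Omega> T k" for t
  proof -
    note t' = Zh_in[OF t]
    have "b2 \<sigma> t = b2 \<sigma>h t"
      using S(6)[OF t'] Sh(6)[OF t] form_b2_b2[OF \<sigma> t'] form_b2_b2[OF \<sigma>h t'] by simp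
    then show ?thesis unfolding \<zeta>_def \<rho>_def b2_diff(1)[OF \<sigma>h w\<tau> t'] b2_diff(1)[OF \<sigma> w\<tau> t'] by linarith
  qed
  have b1\<delta>: "\<bar>form_b1 \<Omega> \<delta> t\<bar> \<le> \<epsilon> * Y_norm \<Omega> t" if "t \<in> Y_space \<Omega>" for t
    using form_b1_bound[OF \<delta> that] mult_right_mono[OF \<epsilon>(1), of "Y_norm \<Omega> t"] by simp
  have b2\<nu>: "\<bar>b2 t \<nu>\<bar> \<le> \<epsilon> * Y_norm \<Omega> t" if "t \<in> Y_space \<Omega>" for t
    using b2_bound[OF that \<nu>] mult_left_mono[OF \<epsilon>(3), of "Y_norm \<Omega> t"] by (simp add: mult.commute)
  have b2\<rho>: "\<bar>b2 \<rho> t\<bar> \<le> \<epsilon> * Z_norm \<Omega> t" if "t \<in> Z_space \<Omega>" for t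
    using b2_bound[OF \<rho> that] mult_right_mono[OF \<epsilon>(2), of "Z_norm \<Omega> t"] by simp
  have b1\<rho>: "\<bar>form_b1 \<Omega> t \<rho>\<bar> \<le> \<epsilon> * X_norm \<Omega> t" if "t \<in> X_space \<Omega>" for t
    using form_b1_bound[OF that \<rho>] mult_left_mono[OF \<epsilon>(2), of "X_norm \<Omega> t"] by (simp add: mult.commute)
  have a0\<delta>: "\<bar>a0 \<delta> t\<bar> \<le> C0 * \<epsilon> * X_norm \<Omega> t" if "t \<in> X_space \<Omega>" for t
  proof -
    have "C0 * X_norm \<Omega> \<delta> * X_norm \<Omega> t \<le> C0 * \<epsilon> * X_norm \<Omega> t"
      using \<epsilon>(1) C0_nonneg by (intro mult_right_mono mult_left_mono) auto
    then show ?thesis using a0_bound[OF \<delta> that] by linarith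
  qed
  \<comment> \<open>\<open>eq2\<close> bounds \<open>b2 t \<omega>\<close> for every discrete stress \<open>t\<close>, so the inf-sup condition applies\<close>
  have disp: "\<beta> * ?z \<le> ?x + 2 * \<epsilon>"
  proof (rule inf_supD[OF infsup Yh_Y Zh_Z discrete_test(1) z(2) nonempty \<omega>h])
    show "0 \<le> ?x + 2 * \<epsilon>" using \<epsilon>(4) by simp
    fix t assume t: "t \<in> Yh \<Omega> T k"
    show "b2 t \<omega> \<le> (?x + 2 * \<epsilon>) * Y_norm \<Omega> t"
      using eq2[OF t] b1\<delta>[OF Yh_in[OF t]] b2\<nu>[OF Yh_in[OF t]] form_b1_bound[OF \<xi> Yh_in[OF t]]
      by (simp add: algebra_simps)
  qed
  \<comment> \<open>\<open>\<zeta>0\<close> carries the residual of \<open>eq3\<close>; the remainder is a strain and can be inserted in \<open>eq1\<close>\<close>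
  have stress: "?y \<le> C0 * ?x + (C0 + 1 + 2 / \<beta>) * \<epsilon>"
  proof -
    have res: "b2 \<zeta> v \<le> \<epsilon> * Z_norm \<Omega> v" if "v \<in> Zh \<Omega> T k" for v
      using eq3[OF that] b2\<rho>[OF Zh_in[OF that]] by linarith
    obtain \<zeta>0 where \<zeta>0: "\<zeta>0 \<in> Yh \<Omega> T k" "\<And>v. v \<in> Zh \<Omega> T k \<Longrightarrow> b2 (\<zeta> - \<zeta>0) v = 0" "Y_norm \<Omega> \<zeta>0 \<le> \<epsilon> / \<beta>"
      by (rule discrete_split[OF infsup \<beta> \<zeta>h \<epsilon>(4) res]) (assumption, rule that)
    define \<zeta>1 where "\<zeta>1 = \<zeta> - \<zeta>0"
    have \<zeta>1h: "\<zeta>1 \<in> Yh \<Omega> T k" unfolding \<zeta>1_def by (rule subspace_diff[OF Yh_subspace \<zeta>h \<zeta>0(1)])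
    note \<zeta>1 = Yh_in[OF \<zeta>1h]
    have ker: "form_b2 \<Omega> (0, \<zeta>1) v = 0" if "v \<in> Zh \<Omega> T k" for v
      using \<zeta>0(2)[OF that] form_b2_b2[OF \<zeta>1 Zh_in[OF that]] by (simp add: \<zeta>1_def)
    note K = discrete_kernel[OF \<zeta>1h ker]
    have L: "\<zeta>1 \<in> L2 \<Omega>" "\<zeta> \<in> L2 \<Omega>" "\<zeta>0 \<in> L2 \<Omega>" using \<zeta>1h \<zeta>h \<zeta>0(1) by (auto simp: Yh_def Hdiv_L2)
    have Y1: "Y_norm \<Omega> \<zeta>1 = L2_norm \<Omega> \<zeta>1" by (simp add: Y_norm_def K(1))
    let ?t = "(\<zeta>1, 0) :: 'n xsp" and ?n = "L2_norm \<Omega> \<zeta>1"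
    have t: "?t \<in> Xh \<Omega> T k" using K(2) subspace_0[OF X2h_subspace] by (simp add: Xh_def)
    note t' = Xh_in[OF t] and nt = X_norm_strain[of \<zeta>1]
    have "a0 \<xi> ?t - L2_inner \<Omega> \<zeta> \<zeta>1 = a0 \<delta> ?t + form_b1 \<Omega> ?t \<rho>"
      using eq1[OF t] flux_form_strain[OF M X_parts(2)[OF \<xi>]] flux_form_strain[OF M X_parts(2)[OF \<delta>]]
        flux_form_strain[OF \<Delta> H(1)] by (simp add: form_b1_inner)
    moreover have "L2_inner \<Omega> \<zeta> \<zeta>1 = ?n\<^sup>2 + L2_inner \<Omega> \<zeta>0 \<zeta>1"
      using L2.ip_diff[OF L(2) L(3) L(1)] by (simp add: \<zeta>1_def[symmetric] L2_norm_sq_inner)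
    moreover have "\<bar>L2_inner \<Omega> \<zeta>0 \<zeta>1\<bar> \<le> \<epsilon> / \<beta> * ?n"
      using L2_norm_le_norms(5)[of \<zeta>0] \<zeta>0(3) by (intro L2_inner_le L) auto
    moreover have "\<bar>a0 \<xi> ?t\<bar> \<le> C0 * ?x * ?n" using a0_bound[OF \<xi> t'] by (simp only: nt)
    moreover have "\<bar>a0 \<delta> ?t\<bar> \<le> C0 * \<epsilon> * ?n" using a0\<delta>[OF t'] by (simp only: nt)
    moreover have "\<bar>form_b1 \<Omega> ?t \<rho>\<bar> \<le> \<epsilon> * ?n" using b1\<rho>[OF t'] by (simp only: nt)
    ultimately have "?n\<^sup>2 \<le> C0 * ?x * ?n + C0 * \<epsilon> * ?n + \<epsilon> * ?n + \<epsilon> / \<beta> * ?n" by linarith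
    then have "?n * ?n \<le> (C0 * ?x + C0 * \<epsilon> + \<epsilon> + \<epsilon> / \<beta>) * ?n" by (simp only: power2_eq_square distrib_right)
    note nsq = this
    have n: "?n \<le> C0 * ?x + C0 * \<epsilon> + \<epsilon> + \<epsilon> / \<beta>"
    proof (cases "?n = 0")
      case True
      have "0 \<le> C0 * ?x + C0 * \<epsilon> + \<epsilon> + \<epsilon> / \<beta>" using C0_nonneg \<epsilon>(4) \<beta> by simp
      then show ?thesis unfolding True .
    next
      case False
      then have "?n > 0" using L2_norm_nonneg[of \<Omega> \<zeta>1] by linarith
      with nsq show ?thesis by (rule mult_right_le_imp_le)
    qed
    have "?y \<le> Y_norm \<Omega> \<zeta>1 + Y_norm \<Omega> \<zeta>0"
      using Y.nrm_triangle[OF \<zeta>1 Yh_in[OF \<zeta>0(1)]] Y_nrm[OF \<zeta>] Y_nrm[OF \<zeta>1] Y_nrm[OF Yh_in[OF \<zeta>0(1)]]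
      by (simp add: \<zeta>1_def)
    moreover have "(C0 + 1 + 2 / \<beta>) * \<epsilon> = C0 * \<epsilon> + \<epsilon> + 2 * (\<epsilon> / \<beta>)" by (simp add: algebra_simps)
    ultimately show ?thesis using n \<zeta>0(3) Y1 by linarith
  qed
  \<comment> \<open>\<open>eq1\<close> with \<open>t = \<xi>\<close>; \<open>eq2\<close> and \<open>eq3\<close> replace \<open>form_b1 \<Omega> \<xi> \<zeta>\<close> by approximation errors\<close>
  have energy: "ca * ?x\<^sup>2 \<le> ((C0 + M) * \<epsilon> + ca / 4 * (\<epsilon> + ?x) + \<epsilon>) * ?x + 2 * \<epsilon> * ?y + \<epsilon> * ?z"
  proof -
    have "ca * ?x\<^sup>2 \<le> a0 \<xi> \<xi> + flux_form \<Omega> (\<kappa> dh) (snd \<xi>) (snd \<xi>)" by (rule a0_flux_coercive[OF dh \<xi>])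
    moreover have "flux_form \<Omega> (\<kappa> dh) (snd \<delta>) (snd \<xi>) \<le> M * \<epsilon> * ?x"
    proof -
      have "M * H1_norm \<Omega> (snd \<delta>) * H1_norm \<Omega> (snd \<xi>) \<le> M * \<epsilon> * ?x"
        using X_parts(6)[OF \<delta>] X_parts(6)[OF \<xi>] \<epsilon>(1,4) M0 by (intro mult_mono) auto
      then show ?thesis using flux_form_bound[OF M X_parts(2)[OF \<delta>] X_parts(2)[OF \<xi>]] by linarith
    qed
    moreover have "flux_form \<Omega> (\<kappa> d - \<kappa> dh) ?p (snd \<xi>) \<le> ca / 4 * (\<epsilon> + ?x) * ?x"
    proof -
      have "d - dh = \<delta> - \<xi>" by (simp add: \<delta>_def \<xi>_def)
      then have "X_norm \<Omega> (d - dh) \<le> X_norm \<Omega> \<delta> + ?x"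
        using X.nrm_diff[OF \<delta> \<xi>] X_nrm[OF \<delta>] X_nrm[OF \<xi>] X_nrm[OF X.diff_in[OF \<delta> \<xi>]] by simp
      then have "H1_norm \<Omega> (?p - ?ph) \<le> \<epsilon> + ?x"
        using X_parts(6)[OF X.diff_in[OF d dh]] \<epsilon>(1) by simp
      moreover have "\<kappa>2 * H1_norm \<Omega> ?p \<le> ca / 4"
        using X_parts(6)[OF d] small kappa_pos mult_left_mono[of "H1_norm \<Omega> ?p" "X_norm \<Omega> d" \<kappa>2] by linarith
      ultimately have "(\<kappa>2 * H1_norm \<Omega> ?p) * H1_norm \<Omega> (?p - ?ph) * H1_norm \<Omega> (snd \<xi>) \<le> ca / 4 * (\<epsilon> + ?x) * ?x"
        using X_parts(6)[OF \<xi>] \<epsilon>(4) ca_le(4) by (intro mult_mono) auto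
      then show ?thesis using flux_form_bound[OF \<Delta> H(1) X_parts(2)[OF \<xi>]] by (simp add: mult_ac)
    qed
    moreover have "form_b1 \<Omega> \<xi> \<zeta> + b2 \<rho> \<omega> = form_b1 \<Omega> \<delta> \<zeta> + b2 \<zeta> \<nu>" using eq2[OF \<zeta>h] eq3[OF \<omega>h] by simp
    ultimately have "ca * ?x\<^sup>2 \<le> C0 * \<epsilon> * ?x + M * \<epsilon> * ?x + ca / 4 * (\<epsilon> + ?x) * ?x + \<epsilon> * ?x + 2 * (\<epsilon> * ?y) + \<epsilon> * ?z"
      using eq1[OF \<xi>h] a0\<delta>[OF \<xi>] b1\<rho>[OF \<xi>] b1\<delta>[OF \<zeta>] b2\<nu>[OF \<zeta>] b2\<rho>[OF \<omega>] by linarith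
    then show ?thesis by (simp add: distrib_right mult.assoc)
  qed
  have "\<epsilon> + ?x + ?y + ?z \<le> cea_const ca \<beta> C0 (C0 + M) * \<epsilon>"
    by (rule cea_arithmetic[OF ca_le(4) \<beta> C0_nonneg _ _ \<epsilon>(4) energy stress disp]) (use C0_nonneg M0 in auto)
  moreover have "X_norm \<Omega> (d - dh) \<le> X_norm \<Omega> \<delta> + ?x"
  proof -
    have "d - dh = \<delta> - \<xi>" by (simp add: \<delta>_def \<xi>_def)
    then show ?thesis using X.nrm_diff[OF \<delta> \<xi>] X_nrm[OF \<delta>] X_nrm[OF \<xi>] X_nrm[OF X.diff_in[OF \<delta> \<xi>]] by simp
  qed
  moreover have "Y_norm \<Omega> (\<sigma> - \<sigma>h) \<le> Y_norm \<Omega> \<rho> + ?y"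
  proof -
    have "\<sigma> - \<sigma>h = \<rho> - \<zeta>" by (simp add: \<rho>_def \<zeta>_def)
    then show ?thesis using Y.nrm_diff[OF \<rho> \<zeta>] Y_nrm[OF \<rho>] Y_nrm[OF \<zeta>] Y_nrm[OF Y.diff_in[OF \<rho> \<zeta>]] by simp
  qed
  moreover have "Z_norm \<Omega> (u - uh) \<le> Z_norm \<Omega> \<nu> + ?z"
  proof -
    have "u - uh = \<nu> - \<omega>" by (simp add: \<nu>_def \<omega>_def)
    then show ?thesis using Z.nrm_diff[OF \<nu> \<omega>] Z_nrm[OF \<nu>] Z_nrm[OF \<omega>] Z_nrm[OF Z.diff_in[OF \<nu> \<omega>]] by simp
  qed
  ultimately show ?thesis unfolding \<epsilon>_def[symmetric] \<delta>_def[symmetric] \<rho>_def[symmetric] \<nu>_def[symmetric]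
    unfolding \<epsilon>_def by linarith
qed

end

lemma XYZ_norm_le_sum: "XYZ_norm \<Omega> ((d, \<sigma>), u) \<le> X_norm \<Omega> d + Y_norm \<Omega> \<sigma> + Z_norm \<Omega> u"
  and sum_le_XYZ_norm: "X_norm \<Omega> d + Y_norm \<Omega> \<sigma> + Z_norm \<Omega> u \<le> 3 * XYZ_norm \<Omega> ((d, \<sigma>), u)"
proof -
  have nn: "0 \<le> X_norm \<Omega> d" "0 \<le> Y_norm \<Omega> \<sigma>" "0 \<le> Z_norm \<Omega> u"
    by (auto simp: X_norm_def Y_norm_def Z_norm_def split: prod.split)
  let ?N = "XYZ_norm \<Omega> ((d, \<sigma>), u)"
  have N: "?N\<^sup>2 = (X_norm \<Omega> d)\<^sup>2 + (Y_norm \<Omega> \<sigma>)\<^sup>2 + (Z_norm \<Omega> u)\<^sup>2" and N0: "?N \<ge> 0" by (simp_all add: XYZ_norm_def)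
  show "?N \<le> X_norm \<Omega> d + Y_norm \<Omega> \<sigma> + Z_norm \<Omega> u"
  proof (rule power2_le_imp_le)
    show "?N\<^sup>2 \<le> (X_norm \<Omega> d + Y_norm \<Omega> \<sigma> + Z_norm \<Omega> u)\<^sup>2"
      unfolding N using nn by (simp add: power2_eq_square algebra_simps)
  qed (use nn in simp)
  have "X_norm \<Omega> d \<le> ?N" "Y_norm \<Omega> \<sigma> \<le> ?N" "Z_norm \<Omega> u \<le> ?N"
    using N N0 by (auto intro!: power2_le_imp_le[of _ ?N])
  then show "X_norm \<Omega> d + Y_norm \<Omega> \<sigma> + Z_norm \<Omega> u \<le> 3 * ?N" by linarith
qed

theorem theorem5p2:
  fixes \<Omega> :: "(real^'n) set"
    and lam \<mu> \<alpha> c0 \<kappa>1 \<kappa>2 r \<beta>2 \<beta>2h \<theta> Ca ca \<gamma>1 \<gamma>1h D :: real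
    and \<kappa> :: "'n xsp \<Rightarrow> real^'n \<Rightarrow> real^'n^'n"
    and f :: "real^'n \<Rightarrow> real^'n" and g :: "real^'n \<Rightarrow> real"
    and u\<Gamma> :: "(real^'n \<Rightarrow> real) set ^ 'n"
    and r\<Gamma> :: "(real^'n \<Rightarrow> real) set \<Rightarrow> real"
    and k :: nat
  assumes dim: "CARD('n) \<in> {2, 3}"
    and domain: "lipschitz_domain \<Omega>"
    and params: "lam > 0" "\<mu> > 0" "0 \<le> \<alpha>" "\<alpha> \<le> 1" "c0 > 0"
    and perm: "permeability \<Omega> \<kappa>1 \<kappa>2 \<kappa>"
    and r: "r > 0"
    and data: "f \<in> L2 \<Omega>" "g \<in> L2 \<Omega>" "u\<Gamma> \<in> Hhalf_vec \<Omega>" "r\<Gamma> \<in> Hmhalf \<Omega>"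
    and beta: "\<beta>2 > 0" "inf_sup_b2 \<Omega> (X_space \<Omega>) (Y_space \<Omega>) (Z_space \<Omega>) \<beta>2"
    and betah: "\<beta>2h > 0"
    and Ca: "Ca = const_Ca CARD('n) lam \<mu> \<alpha> c0 \<kappa>2 r"
    and ca: "ca = const_ca \<mu> c0 \<kappa>1"
    and gamma1: "\<gamma>1 = const_gamma1 Ca ca \<beta>2"
    and gamma1h: "\<gamma>1h = const_gamma1 Ca ca \<beta>2h"
    and D: "D = data_size \<Omega> f g u\<Gamma> r\<Gamma>"
    and small: "\<kappa>2 * \<gamma>1h * \<gamma>1 * D \<le> 1 / 2"
    and exist: "\<gamma>1 / r * max (\<gamma>1 * \<kappa>2 * r) 1 * D < 1"
    and exist_h: "\<gamma>1h / r * max (\<gamma>1h * \<kappa>2 * r) 1 * D < 1"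
  shows "\<exists>C>0. \<forall>T d \<sigma> u dh \<sigma>h uh.
    regular_partition \<Omega> \<theta> T \<longrightarrow>
    inf_sup_b2 \<Omega> (Xh \<Omega> T k) (Yh \<Omega> T k) (Zh \<Omega> T k) \<beta>2h \<longrightarrow>
    solves_problem \<Omega> lam \<mu> \<alpha> c0 \<kappa> f g u\<Gamma> r\<Gamma> (X_space \<Omega>) (Y_space \<Omega>) (Z_space \<Omega>) ((d, \<sigma>), u) \<longrightarrow>
    X_norm \<Omega> d \<le> r \<longrightarrow>
    solves_problem \<Omega> lam \<mu> \<alpha> c0 \<kappa> f g u\<Gamma> r\<Gamma> (Xh \<Omega> T k) (Yh \<Omega> T k) (Zh \<Omega> T k) ((dh, \<sigma>h), uh) \<longrightarrow>
    X_norm \<Omega> dh \<le> r \<longrightarrow>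
    XYZ_norm \<Omega> (((d, \<sigma>), u) - ((dh, \<sigma>h), uh))
      \<le> C * (INF w\<in>(Xh \<Omega> T k \<times> Yh \<Omega> T k) \<times> Zh \<Omega> T k. XYZ_norm \<Omega> (((d, \<sigma>), u) - w))"
proof -
  have dom: "open \<Omega>" "bounded \<Omega>" "\<Omega> \<noteq> {}" "lipschitz_boundary \<Omega>" using domain by (auto simp: lipschitz_domain_def)
  interpret P: poroelastic \<Omega> lam \<mu> \<alpha> c0 \<kappa>1 \<kappa>2 r \<kappa>
    by unfold_locales (use dom params perm r in auto)
  have PC: "P.Ca = Ca" "P.ca = ca" by (simp_all add: P.Ca_def P.ca_def Ca ca)
  obtain M0 where M0: "\<And>d. d \<in> X_space \<Omega> \<Longrightarrow> X_norm \<Omega> d \<le> r \<Longrightarrow> bounded_field \<Omega> (\<kappa> d) M0"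
    using P.kappa_bounded by blast
  define M where "M = \<bar>M0\<bar>"
  have M: "bounded_field \<Omega> (\<kappa> d) M" if "d \<in> X_space \<Omega>" "X_norm \<Omega> d \<le> r" for d
    using M0[OF that] by (simp add: bounded_field_def M_def)
  define C where "C = cea_const ca \<beta>2h P.C0 (P.C0 + M)"
  have C: "C \<ge> 1" unfolding C_def
    using P.ca_le(4) betah P.C0_nonneg by (intro cea_const_ge) (auto simp: PC M_def)
  show ?thesis
  proof (intro exI[of _ "3 * C"] conjI allI impI)
    show "3 * C > 0" using C by simp
    fix T d \<sigma> u dh \<sigma>h uh
    assume T: "regular_partition \<Omega> \<theta> T"
      and infsup: "inf_sup_b2 \<Omega> (Xh \<Omega> T k) (Yh \<Omega> T k) (Zh \<Omega> T k) \<beta>2h"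
      and sol: "solves_problem \<Omega> lam \<mu> \<alpha> c0 \<kappa> f g u\<Gamma> r\<Gamma> (X_space \<Omega>) (Y_space \<Omega>) (Z_space \<Omega>) ((d, \<sigma>), u)"
      and dr: "X_norm \<Omega> d \<le> r"
      and solh: "solves_problem \<Omega> lam \<mu> \<alpha> c0 \<kappa> f g u\<Gamma> r\<Gamma> (Xh \<Omega> T k) (Yh \<Omega> T k) (Zh \<Omega> T k) ((dh, \<sigma>h), uh)"
      and dhr: "X_norm \<Omega> dh \<le> r"
    interpret G: galerkin \<Omega> T k \<theta> lam \<mu> \<alpha> c0 \<kappa>1 \<kappa>2 r \<kappa>
      by unfold_locales (use dim dom T in auto)
    have b1: "\<beta>2h \<le> 1"
      by (rule P.inf_sup_le_1[OF infsup G.Yh_Y G.Zh_Z G.discrete_test(1) subspace_0[OF G.Yh_subspace] dom(3) G.discrete_test(2)])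
    have ap: "X_norm \<Omega> d \<le> \<gamma>1 * D"
      using P.a_priori_bound[OF data beta sol] by (simp add: PC gamma1 D)
    \<comment> \<open>\<open>\<gamma>1h\<close> is at least \<open>2 / ca\<close>, so the smallness of the data turns into smallness of \<open>d\<close>\<close>
    have sm: "\<kappa>2 * X_norm \<Omega> d \<le> ca / 4"
    proof -
      have g: "2 \<le> ca * \<gamma>1h" unfolding gamma1h
        using gamma1_bounds(3)[OF P.Ca_ge(3) P.ca_le(4) betah b1] by (simp only: PC)
      have "2 * (\<kappa>2 * X_norm \<Omega> d) \<le> (ca * \<gamma>1h) * (\<kappa>2 * X_norm \<Omega> d)"
        using g P.kappa_pos by (intro mult_right_mono) auto
      also have "\<dots> \<le> (ca * \<gamma>1h) * (\<kappa>2 * (\<gamma>1 * D))"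
        using ap g P.kappa_pos by (intro mult_left_mono) auto
      also have "\<dots> = ca * (\<kappa>2 * \<gamma>1h * \<gamma>1 * D)" by (simp add: mult_ac)
      also have "\<dots> \<le> ca * (1 / 2)" using small P.ca_le(4) by (intro mult_left_mono) (auto simp: PC)
      finally show ?thesis by simp
    qed
    have dhX: "dh \<in> X_space \<Omega>" using solh G.Xh_X by (auto simp: solves_problem_def)
    let ?E = "XYZ_norm \<Omega> (((d, \<sigma>), u) - ((dh, \<sigma>h), uh))"
    have le: "?E \<le> 3 * C * XYZ_norm \<Omega> (((d, \<sigma>), u) - w)" if "w \<in> (Xh \<Omega> T k \<times> Yh \<Omega> T k) \<times> Zh \<Omega> T k" for w
    proof -
      obtain e\<tau> v where "w = (e\<tau>, v)" by (cases w) blast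
      moreover obtain e \<tau> where "e\<tau> = (e, \<tau>)" by (cases e\<tau>) blast
      ultimately have w: "w = ((e, \<tau>), v)" "e \<in> Xh \<Omega> T k" "\<tau> \<in> Yh \<Omega> T k" "v \<in> Zh \<Omega> T k" using that by auto
      have "?E \<le> X_norm \<Omega> (d - dh) + Y_norm \<Omega> (\<sigma> - \<sigma>h) + Z_norm \<Omega> (u - uh)"
        using XYZ_norm_le_sum[of \<Omega> "d - dh" "\<sigma> - \<sigma>h" "u - uh"] by simp
      also have "\<dots> \<le> C * (X_norm \<Omega> (d - e) + Y_norm \<Omega> (\<sigma> - \<tau>) + Z_norm \<Omega> (u - v))"
        using G.galerkin_error[OF infsup betah sol solh _ M[OF dhX dhr] w(2-4)] sm by (simp add: PC C_def)
      also have "\<dots> \<le> C * (3 * XYZ_norm \<Omega> ((d - e, \<sigma> - \<tau>), u - v))"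
        using C by (intro mult_left_mono sum_le_XYZ_norm) auto
      finally show ?thesis by (simp add: w(1) mult_ac)
    qed
    have ne: "(Xh \<Omega> T k \<times> Yh \<Omega> T k) \<times> Zh \<Omega> T k \<noteq> {}"
      using G.discrete_test subspace_0[OF G.Yh_subspace] by blast
    have "?E / (3 * C) \<le> (INF w\<in>(Xh \<Omega> T k \<times> Yh \<Omega> T k) \<times> Zh \<Omega> T k. XYZ_norm \<Omega> (((d, \<sigma>), u) - w))"
    proof (rule cINF_greatest[OF ne])
      fix w assume "w \<in> (Xh \<Omega> T k \<times> Yh \<Omega> T k) \<times> Zh \<Omega> T k"
      from le[OF this] show "?E / (3 * C) \<le> XYZ_norm \<Omega> (((d, \<sigma>), u) - w)"
        using C by (simp add: pos_divide_le_eq mult.commute)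
    qed
    then show "?E \<le> 3 * C * (INF w\<in>(Xh \<Omega> T k \<times> Yh \<Omega> T k) \<times> Zh \<Omega> T k. XYZ_norm \<Omega> (((d, \<sigma>), u) - w))"
      using C by (simp add: pos_divide_le_eq mult.commute)
  qed
qed

end
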